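(* Let $(M,g)$ be a complete Riemannian manifold whose sectional curvatures are not greater than $\delta$, where $\delta\in\mathbb R$, and let $\Sigma^n$ be an $n$-dimensional properly immersed minimal submanifold in $M$. Then for any point $p\in M$ the following holds: (i) if $\delta\leqslant 0$, the function $$ r\longmapsto \frac{1}{V^n_\delta(r)}\mathrm{Vol}_g(B(p,r)\cap\Sigma^n),\qquad 0<r<\mathrm{inj}_p(g), $$ is non-decreasing; (ii) if $\delta> 0$, the function $$ r\longmapsto \frac{1}{A^n_\delta(r)}\mathrm{Vol}_g(B(p,r)\cap\Sigma^n),\qquad 0<r<\min\left\{\mathrm{inj}_p(g),\frac{\pi}{\sqrt{\delta}}\right\}, $$ is non-decreasing.
   Context: $\mathrm{inj}_p(g)$ is the injectivity radius of $(M,g)$ at $p$, and $B(p,r)$ is the geodesic ball in $M$ of radius $r$ centred at $p$. $B(p,r)\cap\Sigma^n$ denotes the pre-image of $B(p,r)$ in $\Sigma^n$ under the immersion, and $\mathrm{Vol}_g$ of it is its $n$-dimensional volume with respect to the induced metric. The function $\mathrm{sn}_\delta$ is defined by $\mathrm{sn}_\delta(t)=\frac{1}{\sqrt\delta}\sin(\sqrt\delta t)$ if $\delta>0$, $\mathrm{sn}_\delta(t)=t$ if $\delta=0$, and $\mathrm{sn}_\delta(t)=\frac{1}{\sqrt{|\delta|}}\sinh(\sqrt{|\delta|}t)$ if $\delta<0$. With $\omega_n$ the volume of the unit ball in $\mathbb R^n$, one sets $$ V^n_\delta(r)=n\omega_n\int_0^r\mathrm{sn}_\delta^{n-1}(t)\,dt,\qquad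 A^{n}_\delta(r)=(n+1)\omega_{n+1}\mathrm{sn}_\delta^{n}(r). $$ *)

theory Defs
  imports "HOL-Analysis.Analysis"
begin

section \<open>Smooth functions and smooth manifolds\<close>

primrec times_differentiable_on ::
  "nat \<Rightarrow> 'e::real_normed_vector set \<Rightarrow> ('e \<Rightarrow> 'f::real_normed_vector) \<Rightarrow> bool" where
  "times_differentiable_on 0 U F \<longleftrightarrow> continuous_on U F"
| "times_differentiable_on (Suc k) U F \<longleftrightarrow>
     (\<forall>x\<in>U. F differentiable (at x)) \<and>
     (\<forall>v. times_differentiable_on k U (\<lambda>x. frechet_derivative F (at x) v))"

text \<open>Meant for open \<open>U\<close>: derivatives are two-sided.\<close>

definition smooth_on :: "'e::real_normed_vector set \<Rightarrow> ('e \<Rightarrow> 'f::real_normed_vector) \<Rightarrow> bool" where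
  "smooth_on U F \<longleftrightarrow> (\<forall>k. times_differentiable_on k U F)"

text \<open>A chart is a coordinate map together with its domain; outside the domain the values of the
  coordinate map are irrelevant.\<close>

datatype ('a, 'e) chart = Chart (cdom: "'a set") (cmap: "'a \<Rightarrow> 'e")

definition cinv :: "('a, 'e) chart \<Rightarrow> 'e \<Rightarrow> 'a" where
  "cinv c = inv_into (cdom c) (cmap c)"

definition cimage :: "('a, 'e) chart \<Rightarrow> 'e set" where
  "cimage c = cmap c ` cdom c"

record ('a, 'e) manifold =
  carrier :: "'a set"
  atlas :: "('a, 'e) chart set"

text \<open>The topology of the manifold is the subspace topology of \<open>carrier M\<close>, hence Hausdorff and
  second countable by the type class constraint. The atlas need not be maximal. Manifolds have no
  boundary and are not required to be connected; the dimension is that of the model space.\<close>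

definition smooth_manifold ::
  "('a::{t2_space, second_countable_topology}, 'e::euclidean_space) manifold \<Rightarrow> bool" where
  "smooth_manifold M \<longleftrightarrow>
     (\<Union>c\<in>atlas M. cdom c) = carrier M \<and>
     (\<forall>c\<in>atlas M. openin (top_of_set (carrier M)) (cdom c) \<and> open (cimage c) \<and>
        homeomorphism (cdom c) (cimage c) (cmap c) (cinv c)) \<and>
     (\<forall>c\<in>atlas M. \<forall>d\<in>atlas M.
        smooth_on (cmap c ` (cdom c \<inter> cdom d)) (cmap d \<circ> cinv c))"

definition euclidean_manifold :: "'e::euclidean_space set \<Rightarrow> ('e, 'e) manifold" where
  "euclidean_manifold U = \<lparr>carrier = U, atlas = {Chart U id}\<rparr>"

definition open_submanifold :: "('a, 'e) manifold \<Rightarrow> 'a set \<Rightarrow> ('a, 'e) manifold" where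
  "open_submanifold M W =
     \<lparr>carrier = carrier M \<inter> W, atlas = (\<lambda>c. Chart (cdom c \<inter> W) (cmap c)) ` atlas M\<rparr>"

definition smooth_map ::
  "('a::topological_space, 'e::euclidean_space) manifold \<Rightarrow>
   ('b::topological_space, 'f::euclidean_space) manifold \<Rightarrow> ('a \<Rightarrow> 'b) \<Rightarrow> bool" where
  "smooth_map X Y f \<longleftrightarrow>
     continuous_on (carrier X) f \<and> f ` carrier X \<subseteq> carrier Y \<and>
     (\<forall>c\<in>atlas X. \<forall>d\<in>atlas Y.
        smooth_on (cmap c ` (cdom c \<inter> f -` cdom d)) (cmap d \<circ> f \<circ> cinv c))"

definition diffeomorphism ::
  "('a::topological_space, 'e::euclidean_space) manifold \<Rightarrow>
   ('b::topological_space, 'f::euclidean_space) manifold \<Rightarrow> ('a \<Rightarrow> 'b) \<Rightarrow> bool" where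
  "diffeomorphism X Y f \<longleftrightarrow>
     bij_betw f (carrier X) (carrier Y) \<and> smooth_map X Y f \<and>
     smooth_map Y X (inv_into (carrier X) f)"


section \<open>Tangent vectors\<close>

text \<open>Every point \<open>p\<close> is assigned one preferred chart around it, and the tangent space \<open>T\<^sub>pM\<close> is
  identified with the model space through that chart.\<close>

definition chart_at :: "('a, 'e) manifold \<Rightarrow> 'a \<Rightarrow> ('a, 'e) chart" where
  "chart_at M p = (SOME c. c \<in> atlas M \<and> p \<in> cdom c)"

definition coords :: "('a, 'e) manifold \<Rightarrow> 'a \<Rightarrow> 'e" where
  "coords M p = cmap (chart_at M p) p"

text \<open>\<open>local_rep\<close> is the map \<open>f\<close> near \<open>q\<close> in the preferred charts at \<open>q\<close> and \<open>f q\<close>; its derivative at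
  the coordinates of \<open>q\<close> is the differential \<open>df\<^sub>q : T\<^sub>qX \<rightarrow> T\<^bsub>f(q)\<^esub>Y\<close>.\<close>

definition local_rep ::
  "('a, 'e) manifold \<Rightarrow> ('b, 'f) manifold \<Rightarrow> ('a \<Rightarrow> 'b) \<Rightarrow> 'a \<Rightarrow> 'e \<Rightarrow> 'f" where
  "local_rep X Y f q = cmap (chart_at Y (f q)) \<circ> f \<circ> cinv (chart_at X q)"

definition differential ::
  "('a, 'e::euclidean_space) manifold \<Rightarrow> ('b, 'f::euclidean_space) manifold \<Rightarrow>
   ('a \<Rightarrow> 'b) \<Rightarrow> 'a \<Rightarrow> 'e \<Rightarrow> 'f" where
  "differential X Y f q = frechet_derivative (local_rep X Y f q) (at (coords X q))"

definition velocity ::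
  "('a, 'e::euclidean_space) manifold \<Rightarrow> (real \<Rightarrow> 'a) \<Rightarrow> real \<Rightarrow> 'e" where
  "velocity M \<gamma> t = vector_derivative (cmap (chart_at M (\<gamma> t)) \<circ> \<gamma>) (at t)"


section \<open>Riemannian metrics\<close>

text \<open>For a field \<open>g\<close> of bilinear forms \<open>g p\<close> on \<open>T\<^sub>pM\<close>, \<open>local_metric M g c x\<close> is its expression in the
  coordinates of the chart \<open>c\<close> at the coordinate point \<open>x\<close>: the vectors \<open>u\<close> and \<open>v\<close> are carried from
  the chart \<open>c\<close> to the preferred chart at \<open>p\<close> by the derivative of the transition map.\<close>

definition local_metric ::
  "('a, 'e::euclidean_space) manifold \<Rightarrow> ('a \<Rightarrow> 'e \<Rightarrow> 'e \<Rightarrow> real) \<Rightarrow> ('a, 'e) chart \<Rightarrow>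
   'e \<Rightarrow> 'e \<Rightarrow> 'e \<Rightarrow> real" where
  "local_metric M g c x u v =
     (let p = cinv c x; D = frechet_derivative (cmap (chart_at M p) \<circ> cinv c) (at x)
      in g p (D u) (D v))"

definition riemannian_metric ::
  "('a, 'e::euclidean_space) manifold \<Rightarrow> ('a \<Rightarrow> 'e \<Rightarrow> 'e \<Rightarrow> real) \<Rightarrow> bool" where
  "riemannian_metric M g \<longleftrightarrow>
     (\<forall>p\<in>carrier M. bilinear (g p) \<and> (\<forall>u v. g p u v = g p v u) \<and> (\<forall>u. u \<noteq> 0 \<longrightarrow> 0 < g p u u)) \<and>
     (\<forall>c\<in>atlas M. \<forall>u v. smooth_on (cimage c) (\<lambda>x. local_metric M g c x u v))"

text \<open>The Christoffel symbols of the Levi-Civita connection as a bilinear form, i.e.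
  \<open>\<Gamma> (u, v) = \<nabla>\<^sub>u v\<close> for vector fields \<open>u\<close> and \<open>v\<close> that are constant in the chart; the defining identity
  is the Koszul formula.\<close>

definition christoffel ::
  "('a, 'e::euclidean_space) manifold \<Rightarrow> ('a \<Rightarrow> 'e \<Rightarrow> 'e \<Rightarrow> real) \<Rightarrow> ('a, 'e) chart \<Rightarrow>
   'e \<Rightarrow> 'e \<Rightarrow> 'e \<Rightarrow> 'e" where
  "christoffel M g c x u v =
     (let dG = (\<lambda>a b w. frechet_derivative (\<lambda>y. local_metric M g c y a b) (at x) w)
      in THE w. \<forall>z. local_metric M g c x w z = (dG v z u + dG u z v - dG u v z) / 2)"

text \<open>\<open>R(u, v)w = \<nabla>\<^sub>u\<nabla>\<^sub>v w - \<nabla>\<^sub>v\<nabla>\<^sub>u w\<close> for vector fields \<open>u\<close>, \<open>v\<close>, \<open>w\<close> that are constant in the chart.\<close>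

definition curvature ::
  "('a, 'e::euclidean_space) manifold \<Rightarrow> ('a \<Rightarrow> 'e \<Rightarrow> 'e \<Rightarrow> real) \<Rightarrow> ('a, 'e) chart \<Rightarrow>
   'e \<Rightarrow> 'e \<Rightarrow> 'e \<Rightarrow> 'e \<Rightarrow> 'e" where
  "curvature M g c x u v w =
     (let \<Gamma> = christoffel M g c
      in frechet_derivative (\<lambda>y. \<Gamma> y v w) (at x) u - frechet_derivative (\<lambda>y. \<Gamma> y u w) (at x) v
         + \<Gamma> x u (\<Gamma> x v w) - \<Gamma> x v (\<Gamma> x u w))"

text \<open>Sectional curvature of the plane in \<open>T\<^sub>pM\<close> spanned by linearly independent \<open>u\<close> and \<open>v\<close>.\<close>

definition sectional_curvature ::
  "('a, 'e::euclidean_space) manifold \<Rightarrow> ('a \<Rightarrow> 'e \<Rightarrow> 'e \<Rightarrow> real) \<Rightarrow> 'a \<Rightarrow> 'e \<Rightarrow> 'e \<Rightarrow> real" where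
  "sectional_curvature M g p u v =
     g p (curvature M g (chart_at M p) (coords M p) u v v) u
     / (g p u u * g p v v - (g p u v)\<^sup>2)"

definition sectional_curvature_le ::
  "('a, 'e::euclidean_space) manifold \<Rightarrow> ('a \<Rightarrow> 'e \<Rightarrow> 'e \<Rightarrow> real) \<Rightarrow> real \<Rightarrow> bool" where
  "sectional_curvature_le M g \<delta> \<longleftrightarrow>
     (\<forall>p\<in>carrier M. \<forall>u v. u \<noteq> v \<and> independent {u, v} \<longrightarrow> sectional_curvature M g p u v \<le> \<delta>)"


section \<open>Geodesics, exponential map, distance\<close>

definition geodesic ::
  "('a::topological_space, 'e::euclidean_space) manifold \<Rightarrow> ('a \<Rightarrow> 'e \<Rightarrow> 'e \<Rightarrow> real) \<Rightarrow>
   (real \<Rightarrow> 'a) \<Rightarrow> bool" where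
  "geodesic M g \<gamma> \<longleftrightarrow>
     smooth_map (euclidean_manifold UNIV) M \<gamma> \<and>
     (\<forall>t. let c = chart_at M (\<gamma> t); x = cmap c \<circ> \<gamma>; x' = (\<lambda>s. vector_derivative x (at s))
          in vector_derivative x' (at t) + christoffel M g c (x t) (x' t) (x' t) = 0)"

text \<open>Geodesic completeness: every tangent vector is the initial velocity of a geodesic defined for
  all times.\<close>

definition complete_metric ::
  "('a::topological_space, 'e::euclidean_space) manifold \<Rightarrow> ('a \<Rightarrow> 'e \<Rightarrow> 'e \<Rightarrow> real) \<Rightarrow> bool" where
  "complete_metric M g \<longleftrightarrow>
     (\<forall>p\<in>carrier M. \<forall>v. \<exists>\<gamma>. geodesic M g \<gamma> \<and> \<gamma> 0 = p \<and> velocity M \<gamma> 0 = v)"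

text \<open>Meant for complete metrics, where it is defined on all of \<open>T\<^sub>pM\<close>.\<close>

definition exp_map ::
  "('a::topological_space, 'e::euclidean_space) manifold \<Rightarrow> ('a \<Rightarrow> 'e \<Rightarrow> 'e \<Rightarrow> real) \<Rightarrow>
   'a \<Rightarrow> 'e \<Rightarrow> 'a" where
  "exp_map M g p v =
     (THE q. \<exists>\<gamma>. geodesic M g \<gamma> \<and> \<gamma> 0 = p \<and> velocity M \<gamma> 0 = v \<and> \<gamma> 1 = q)"

text \<open>The injectivity radius may be infinite.\<close>

definition injectivity_radius ::
  "('a::topological_space, 'e::euclidean_space) manifold \<Rightarrow> ('a \<Rightarrow> 'e \<Rightarrow> 'e \<Rightarrow> real) \<Rightarrow>
   'a \<Rightarrow> ereal" where
  "injectivity_radius M g p =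
     Sup {ereal r | r. 0 < r \<and>
       (let B = {v. sqrt (g p v v) < r}; W = exp_map M g p ` B
        in openin (top_of_set (carrier M)) W \<and>
           diffeomorphism (euclidean_manifold B) (open_submanifold M W) (exp_map M g p))}"

definition piecewise_C1_curve ::
  "('a::topological_space, 'e::euclidean_space) manifold \<Rightarrow> (real \<Rightarrow> 'a) \<Rightarrow> bool" where
  "piecewise_C1_curve M \<gamma> \<longleftrightarrow>
     continuous_on {0..1} \<gamma> \<and> \<gamma> ` {0..1} \<subseteq> carrier M \<and>
     (\<exists>T. finite T \<and>
        (\<forall>c\<in>atlas M. (cmap c \<circ> \<gamma>) C1_differentiable_on ({t\<in>{0<..<1}. \<gamma> t \<in> cdom c} - T)))"

definition curve_length ::
  "('a, 'e::euclidean_space) manifold \<Rightarrow> ('a \<Rightarrow> 'e \<Rightarrow> 'e \<Rightarrow> real) \<Rightarrow> (real \<Rightarrow> 'a) \<Rightarrow> ennreal" where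
  "curve_length M g \<gamma> =
     (\<integral>\<^sup>+t\<in>{0<..<1}. ennreal (sqrt (g (\<gamma> t) (velocity M \<gamma> t) (velocity M \<gamma> t))) \<partial>lborel)"

text \<open>The distance is infinite between points in different components.\<close>

definition riemannian_dist ::
  "('a::topological_space, 'e::euclidean_space) manifold \<Rightarrow> ('a \<Rightarrow> 'e \<Rightarrow> 'e \<Rightarrow> real) \<Rightarrow>
   'a \<Rightarrow> 'a \<Rightarrow> ennreal" where
  "riemannian_dist M g p q =
     (INF \<gamma>\<in>{\<gamma>. piecewise_C1_curve M \<gamma> \<and> \<gamma> 0 = p \<and> \<gamma> 1 = q}. curve_length M g \<gamma>)"

definition geodesic_ball ::
  "('a::topological_space, 'e::euclidean_space) manifold \<Rightarrow> ('a \<Rightarrow> 'e \<Rightarrow> 'e \<Rightarrow> real) \<Rightarrow>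
   'a \<Rightarrow> real \<Rightarrow> 'a set" where
  "geodesic_ball M g p r = {q \<in> carrier M. riemannian_dist M g p q < ennreal r}"


section \<open>Riemannian volume\<close>

definition gram_matrix :: "(real^'n \<Rightarrow> real^'n \<Rightarrow> real) \<Rightarrow> real^'n^'n" where
  "gram_matrix G = (\<chi> i j. G (axis i 1) (axis j 1))"

text \<open>The unique Borel measure on the manifold that has density \<open>\<surd>(det G)\<close> in every chart.\<close>

definition riemannian_measure ::
  "('a::topological_space, real^'n) manifold \<Rightarrow> ('a \<Rightarrow> real^'n \<Rightarrow> real^'n \<Rightarrow> real) \<Rightarrow> 'a measure" where
  "riemannian_measure X h =
     (THE \<mu>. sets \<mu> = sets (restrict_space borel (carrier X)) \<and>
        (\<forall>c\<in>atlas X. \<forall>A\<in>sets \<mu>. A \<subseteq> cdom c \<longrightarrow>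
           emeasure \<mu> A =
             (\<integral>\<^sup>+x\<in>cmap c ` A. ennreal (sqrt (det (gram_matrix (local_metric X h c x)))) \<partial>lborel)))"


section \<open>Immersed submanifolds\<close>

definition immersion ::
  "('b::topological_space, 'f::euclidean_space) manifold \<Rightarrow>
   ('a::topological_space, 'e::euclidean_space) manifold \<Rightarrow> ('b \<Rightarrow> 'a) \<Rightarrow> bool" where
  "immersion S M f \<longleftrightarrow> smooth_map S M f \<and> (\<forall>q\<in>carrier S. inj (differential S M f q))"

definition proper_immersion ::
  "('b::topological_space, 'f::euclidean_space) manifold \<Rightarrow>
   ('a::topological_space, 'e::euclidean_space) manifold \<Rightarrow> ('b \<Rightarrow> 'a) \<Rightarrow> bool" where
  "proper_immersion S M f \<longleftrightarrow>
     immersion S M f \<and> (\<forall>K. compact K \<and> K \<subseteq> carrier M \<longrightarrow> compact {q \<in> carrier S. f q \<in> K})"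

definition induced_metric ::
  "('b, 'f::euclidean_space) manifold \<Rightarrow> ('a, 'e::euclidean_space) manifold \<Rightarrow>
   ('a \<Rightarrow> 'e \<Rightarrow> 'e \<Rightarrow> real) \<Rightarrow> ('b \<Rightarrow> 'a) \<Rightarrow> 'b \<Rightarrow> 'f \<Rightarrow> 'f \<Rightarrow> real" where
  "induced_metric S M g f q u v = g (f q) (differential S M f q u) (differential S M f q v)"

definition normal_part ::
  "('e::euclidean_space \<Rightarrow> 'e \<Rightarrow> real) \<Rightarrow> 'e set \<Rightarrow> 'e \<Rightarrow> 'e" where
  "normal_part G T w = (THE z. w - z \<in> T \<and> (\<forall>t\<in>T. G z t = 0))"

text \<open>The normal part of \<open>\<nabla>\<^sub>u (df v)\<close>, for \<open>v\<close> constant in the chart of \<open>S\<close>; it takes values in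
  \<open>T\<^bsub>f(q)\<^esub>M\<close>.\<close>

definition second_fundamental_form ::
  "('b, 'f::euclidean_space) manifold \<Rightarrow> ('a, 'e::euclidean_space) manifold \<Rightarrow>
   ('a \<Rightarrow> 'e \<Rightarrow> 'e \<Rightarrow> real) \<Rightarrow> ('b \<Rightarrow> 'a) \<Rightarrow> 'b \<Rightarrow> 'f \<Rightarrow> 'f \<Rightarrow> 'e" where
  "second_fundamental_form S M g f q u v =
     (let F = local_rep S M f q; df = differential S M f q
      in normal_part (g (f q)) (range df)
           (frechet_derivative (\<lambda>y. frechet_derivative F (at y) v) (at (coords S q)) u
            + christoffel M g (chart_at M (f q)) (coords M (f q)) (df u) (df v)))"

definition orthonormal_basis :: "('f::euclidean_space \<Rightarrow> 'f \<Rightarrow> real) \<Rightarrow> 'f set \<Rightarrow> bool" where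
  "orthonormal_basis G E \<longleftrightarrow>
     finite E \<and> card E = DIM('f) \<and> (\<forall>u\<in>E. \<forall>v\<in>E. G u v = (if u = v then 1 else 0))"

text \<open>The trace of the second fundamental form with respect to the induced metric, which is
  independent of the chosen orthonormal basis.\<close>

definition mean_curvature ::
  "('b, 'f::euclidean_space) manifold \<Rightarrow> ('a, 'e::euclidean_space) manifold \<Rightarrow>
   ('a \<Rightarrow> 'e \<Rightarrow> 'e \<Rightarrow> real) \<Rightarrow> ('b \<Rightarrow> 'a) \<Rightarrow> 'b \<Rightarrow> 'e" where
  "mean_curvature S M g f q =
     (\<Sum>e\<in>(SOME E. orthonormal_basis (induced_metric S M g f q) E).
        second_fundamental_form S M g f q e e)"

definition minimal_immersion ::
  "('b::topological_space, 'f::euclidean_space) manifold \<Rightarrow>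
   ('a::topological_space, 'e::euclidean_space) manifold \<Rightarrow>
   ('a \<Rightarrow> 'e \<Rightarrow> 'e \<Rightarrow> real) \<Rightarrow> ('b \<Rightarrow> 'a) \<Rightarrow> bool" where
  "minimal_immersion S M g f \<longleftrightarrow>
     immersion S M f \<and> (\<forall>q\<in>carrier S. mean_curvature S M g f q = 0)"


section \<open>Model functions\<close>

definition sn :: "real \<Rightarrow> real \<Rightarrow> real" where
  "sn \<delta> t =
     (if \<delta> > 0 then sin (sqrt \<delta> * t) / sqrt \<delta>
      else if \<delta> = 0 then t
      else sinh (sqrt \<bar>\<delta>\<bar> * t) / sqrt \<bar>\<delta>\<bar>)"

definition V_model :: "nat \<Rightarrow> real \<Rightarrow> real \<Rightarrow> real" where
  "V_model n \<delta> r = real n * unit_ball_vol (real n) * integral {0..r} (\<lambda>t. sn \<delta> t ^ (n - 1))"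

definition A_model :: "nat \<Rightarrow> real \<Rightarrow> real \<Rightarrow> real" where
  "A_model n \<delta> r = real (n + 1) * unit_ball_vol (real (n + 1)) * sn \<delta> r ^ n"

end

(* Normal coordinates at p turn the ball of radius R below the injectivity radius into a Euclidean
   ball on which the Gauss lemma holds, so geodesic balls are sublevel sets of the radial function
   rho. Sturm comparison along radial geodesics bounds the Hessian of rho^2/2 from below by the model
   value kf = rho sn'(rho)/sn(rho) in spherical directions. On a minimal submanifold the Laplacian of
   u = rho^2/2 is the trace of this Hessian, hence at least kf (n - sigma) + sigma, where sigma is the
   squared length of the gradient of rho along the submanifold, 0 <= sigma <= 1.

   The divergence theorem for phi(rho) grad u, with phi Lipschitz, nonnegative, constant near 0 and
   zero beyond s, gives
     int phi(rho) (kf (n - sigma) + sigma) + phi'(rho) rho sigma <= 0.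
   Writing phi = kappa sn/t with kappa decreasing, the integrand is n kappa sn' + kappa' sn sigma, at
   least (kappa sn^n)'/sn^(n-1). For delta <= 0 take kappa sn^n = V (1/V(r) - 1/V(s)) below r and
   1 - V/V(s) above it; for delta > 0 take kappa constant below r and (V(s) - V)/sn^n above it. Both
   integrands are then bounded below by constants on rho < r and on r <= rho < s, which is the
   monotonicity. *)
theory Submission
  imports Defs
begin

text \<open>Tangent vectors are read in a preferred chart that varies discontinuously with the
  point, so nothing can be differentiated as it is defined: derivatives are taken in one fixed chart
  or in normal coordinates and then shown to transform correctly. Jacobi fields are not solved for;
  the differential of the exponential map supplies them, and the comparison concerns the positive
  function n in |J|^2 = t^2 n.

  About \<sigma> only 0 \<le> \<sigma> \<le> 1 is known, so \<sigma> can be replaced by 1 only if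
  \<kappa>' \<le> 0. This forces the split by the sign of \<delta>: n V sn' - sn^n starts at 0 and
  has derivative - \<delta> n V sn, hence V/sn^n does not increase for \<delta> \<le> 0 but does
  increase for \<delta> > 0. There a constant \<kappa> below r is the substitute, and sn^n takes the
  place of V in the result.

  In general \<kappa> sn/t is not constant near 0, as differentiability of \<phi>(\<rho>) at the
  centre demands. So \<phi> is frozen below a small \<epsilon>; the loss is a factor 1/cs \<epsilon>
  or sn \<epsilon>/\<epsilon>, which tends to 1.\<close>

abbreviation Ck where "Ck \<equiv> times_differentiable_on"

abbreviation dd :: "('e::real_normed_vector \<Rightarrow> 'f::real_normed_vector) \<Rightarrow> 'e \<Rightarrow> 'e \<Rightarrow> 'f" where
  "dd F x \<equiv> frechet_derivative F (at x)"

abbreviation d2 :: "('e::real_normed_vector \<Rightarrow> 'f::real_normed_vector) \<Rightarrow> 'e \<Rightarrow> 'e \<Rightarrow> 'e \<Rightarrow> 'f" where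
  "d2 F x a b \<equiv> dd (\<lambda>y. dd F y b) x a"

subsection \<open>Functions of class \<open>C\<^sup>k\<close>\<close>

text \<open>Derivatives are two-sided, so agreement on an open set determines them at each of its
  points. This lets a function with irrelevant values elsewhere be replaced by a formula.\<close>

lemma Ck_cong:
  assumes "open U" "\<And>x. x \<in> U \<Longrightarrow> F x = G x" "Ck k U F"
  shows "Ck k U G"
  using assms(2,3)
proof (induction k arbitrary: F G)
  case 0 then show ?case by (simp cong: continuous_on_cong)
next
  case (Suc k)
  have "G differentiable at x" "\<And>v. dd F x v = dd G x v" if "x \<in> U" for x
  proof -
    have d: "F differentiable at x" using Suc.prems that by simp
    show "\<And>v. dd F x v = dd G x v"
      using frechet_derivative_transform_within_open[OF d assms(1) that, of G] Suc.prems(1) by simp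
    show "G differentiable at x"
      using d has_derivative_transform_within_open[OF _ assms(1) that, of F _ UNIV G] Suc.prems(1)
      unfolding differentiable_def by blast
  qed
  moreover have "Ck k U (\<lambda>x. dd F x v)" for v using Suc.prems by simp
  ultimately show ?case using Suc.IH by (metis (no_types, lifting) times_differentiable_on.simps(2))
qed

lemma Ck_subset: "Ck k U F \<Longrightarrow> V \<subseteq> U \<Longrightarrow> Ck k V F"
  by (induction k arbitrary: F) (auto intro: continuous_on_subset)

lemma Ck_Suc_imp: "Ck (Suc k) U F \<Longrightarrow> Ck k U F"
proof (induction k arbitrary: F)
  case 0 then show ?case
    by (auto intro!: continuous_at_imp_continuous_on differentiable_imp_continuous_within)
next
  case (Suc k) show ?case using Suc.prems Suc.IH by (simp del: times_differentiable_on.simps add: times_differentiable_on.simps(2)[of "Suc k"] times_differentiable_on.simps(2)[of k])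
qed

lemma Ck_imp_continuous_on: "Ck k U F \<Longrightarrow> continuous_on U F"
  by (induction k) (auto dest: Ck_Suc_imp simp del: times_differentiable_on.simps(2))

lemma Ck_local:
  assumes "\<And>x. x \<in> U \<Longrightarrow> \<exists>V. open V \<and> x \<in> V \<and> Ck k V F" "open U"
  shows "Ck k U F"
  using assms(1)
proof (induction k arbitrary: F)
  case 0
  then show ?case
    by (auto intro!: continuous_at_imp_continuous_on) (metis continuous_on_eq_continuous_at)
next
  case (Suc k)
  then have "\<exists>V. open V \<and> x \<in> V \<and> Ck k V (\<lambda>x. dd F x v)" if "x \<in> U" for x v
    using that by (metis times_differentiable_on.simps(2))
  moreover have "F differentiable at x" if "x \<in> U" for x
    using Suc.prems[OF that] by auto
  ultimately show ?case using Suc.IH by simp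
qed

lemma Ck_const [simp]: "Ck k U (\<lambda>x. c)"
  by (induction k arbitrary: c) (auto simp: frechet_derivative_const)

lemma dd_eqI: "(F has_derivative F') (at x) \<Longrightarrow> dd F x = F'"
  by (metis frechet_derivative_at)

lemma dd_works: "F differentiable (at x) \<Longrightarrow> (F has_derivative dd F x) (at x)"
  by (simp add: frechet_derivative_works)

text \<open>Trades the choice inside \<open>frechet_derivative\<close> for an explicit derivative,
  so that inductions on the order can use the ordinary differentiation rules.\<close>

lemma Ck_SucI:
  assumes "open U" "\<And>x. x \<in> U \<Longrightarrow> (F has_derivative F' x) (at x)" "\<And>v. Ck k U (\<lambda>x. F' x v)"
  shows "Ck (Suc k) U F"
proof -
  have "dd F x = F' x" if "x \<in> U" for x using assms(2) that dd_eqI by blast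
  then have "Ck k U (\<lambda>x. dd F x v)" for v
    by (intro Ck_cong[OF assms(1) _ assms(3)]) simp
  with assms(2) show ?thesis by (auto simp: differentiable_def)
qed

lemma Ck_Suc_D:
  assumes "Ck (Suc k) U F" "x \<in> U"
  shows "(F has_derivative dd F x) (at x)"
  using assms by (auto intro: dd_works)

lemma Ck_Suc_dd: "Ck (Suc k) U F \<Longrightarrow> Ck k U (\<lambda>x. dd F x v)"
  by simp

lemma Ck_add:
  assumes "open U" "Ck k U F" "Ck k U G" shows "Ck k U (\<lambda>x. F x + G x)"
  using assms(2,3)
proof (induction k arbitrary: F G)
  case 0 then show ?case by (auto intro: continuous_intros)
next
  case (Suc k)
  show ?case
    by (rule Ck_SucI[OF assms(1) has_derivative_add[OF Ck_Suc_D[OF Suc.prems(1)] Ck_Suc_D[OF Suc.prems(2)]]])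
       (use Suc in auto)
qed

lemma Ck_sum:
  assumes "open U" "\<And>i. i \<in> I \<Longrightarrow> Ck k U (F i)" shows "Ck k U (\<lambda>x. \<Sum>i\<in>I. F i x)"
  using assms(2) by (induction I rule: infinite_finite_induct) (auto intro: Ck_add[OF assms(1)])

lemma Ck_linear_comp:
  assumes "open U" "bounded_linear L" "Ck k U F" shows "Ck k U (\<lambda>x. L (F x))"
  using assms(3)
proof (induction k arbitrary: F)
  case 0 then show ?case using assms(2) by (auto intro: bounded_linear.continuous_on)
next
  case (Suc k)
  show ?case
    by (rule Ck_SucI[OF assms(1) bounded_linear.has_derivative[OF assms(2) Ck_Suc_D[OF Suc.prems]]])
       (use Suc in auto)
qed

lemma Ck_bilinear:
  assumes "open U" "bounded_bilinear pr" "Ck k U F" "Ck k U G"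
  shows "Ck k U (\<lambda>x. pr (F x) (G x))"
  using assms(3,4)
proof (induction k arbitrary: F G)
  case 0 then show ?case using assms(2) by (auto intro: bounded_bilinear.continuous_on)
next
  case (Suc k)
  show ?case
    by (rule Ck_SucI[OF assms(1) bounded_bilinear.FDERIV[OF assms(2) Ck_Suc_D[OF Suc.prems(1)] Ck_Suc_D[OF Suc.prems(2)]]])
      (use Suc Ck_Suc_imp[OF Suc.prems(1)] Ck_Suc_imp[OF Suc.prems(2)] in \<open>auto intro!: Ck_add[OF assms(1)]\<close>)
qed

lemmas Ck_mult = Ck_bilinear[OF _ bounded_bilinear_mult]
lemmas Ck_scaleR = Ck_bilinear[OF _ bounded_bilinear_scaleR]
lemmas Ck_inner = Ck_bilinear[OF _ bounded_bilinear_inner]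

lemma Ck_diff:
  assumes "open U" "Ck k U F" "Ck k U G" shows "Ck k U (\<lambda>x. F x - G x)"
  using Ck_add[OF assms(1,2) Ck_linear_comp[OF assms(1) bounded_linear_minus[OF bounded_linear_ident] assms(3)]] by simp

lemma Ck_prod:
  fixes F :: "'i \<Rightarrow> 'e::real_normed_vector \<Rightarrow> real"
  assumes "open U" "\<And>i. i \<in> I \<Longrightarrow> Ck k U (F i)" shows "Ck k U (\<lambda>x. \<Prod>i\<in>I. F i x)"
  using assms(2) by (induction I rule: infinite_finite_induct) (auto intro: Ck_mult[OF assms(1)])

lemma Ck_inverse:
  fixes F :: "'e::real_normed_vector \<Rightarrow> real"
  assumes "open U" "Ck k U F" "\<And>x. x \<in> U \<Longrightarrow> F x \<noteq> 0" shows "Ck k U (\<lambda>x. inverse (F x))"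
  using assms(2)
proof (induction k)
  case 0 then show ?case using assms(3) by (auto intro: continuous_intros)
next
  case (Suc k)
  have "((\<lambda>x. inverse (F x)) has_derivative (\<lambda>h. - (inverse (F x) * dd F x h * inverse (F x)))) (at x)" if "x \<in> U" for x
    using Deriv.has_derivative_inverse[OF assms(3)[OF that] Ck_Suc_D[OF Suc.prems that]] .
  then show ?case
    by (rule Ck_SucI[OF assms(1)])
       (assumption | intro Ck_linear_comp[OF assms(1) bounded_linear_minus[OF bounded_linear_ident]] Ck_mult[OF assms(1)]
          Suc.IH Ck_Suc_imp[OF Suc.prems] Ck_Suc_dd[OF Suc.prems])+
qed

lemma Ck_divide:
  fixes F :: "'e::real_normed_vector \<Rightarrow> real"
  assumes "open U" "Ck k U F" "Ck k U G" "\<And>x. x \<in> U \<Longrightarrow> G x \<noteq> 0" shows "Ck k U (\<lambda>x. F x / G x)"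
  unfolding divide_inverse by (intro Ck_mult Ck_inverse assms)

lemma linear_expand:
  fixes L :: "'e::euclidean_space \<Rightarrow> 'f::real_vector"
  assumes "linear L" shows "L v = (\<Sum>b\<in>Basis. (v \<bullet> b) *\<^sub>R L b)"
  by (subst euclidean_representation[of v, symmetric])
     (simp add: linear_sum[OF assms] linear_cmul[OF assms] del: euclidean_representation)

text \<open>The chain rule evaluates \<open>dd F\<close> in the moving direction
  \<open>dd G x h\<close>, while \<open>Ck\<close> speaks of fixed directions. Expanding over a
  basis leaves fixed directions with coefficients of class C^k.\<close>

lemma Ck_compose:
  fixes F :: "'f::euclidean_space \<Rightarrow> 'g::real_normed_vector"
  assumes "open U" "Ck k V F" "Ck k U G" "\<And>x. x \<in> U \<Longrightarrow> G x \<in> V"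
  shows "Ck k U (\<lambda>x. F (G x))"
  using assms(2,3)
proof (induction k arbitrary: F)
  case 0
  then show ?case using assms(4) by (auto intro!: continuous_on_compose2[of V F])
next
  case (Suc k)
  have "((\<lambda>x. F (G x)) has_derivative (\<lambda>h. dd F (G x) (dd G x h))) (at x)" if "x \<in> U" for x
    using diff_chain_at[OF Ck_Suc_D[OF Suc.prems(2) that] Ck_Suc_D[OF Suc.prems(1) assms(4)[OF that]]]
    by (simp add: o_def)
  moreover have "dd F (G x) (dd G x h) = (\<Sum>b\<in>Basis. (dd G x h \<bullet> b) *\<^sub>R dd F (G x) b)" if "x \<in> U" for x h
    using linear_frechet_derivative Suc.prems(1) assms(4)[OF that]
    by (intro linear_expand) auto
  ultimately have "((\<lambda>x. F (G x)) has_derivative (\<lambda>h. (\<Sum>b\<in>Basis. (dd G x h \<bullet> b) *\<^sub>R dd F (G x) b))) (at x)" if "x \<in> U" for x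
    using that by simp
  moreover have "Ck k U (\<lambda>x. \<Sum>b\<in>Basis. (dd G x h \<bullet> b) *\<^sub>R dd F (G x) b)" for h
    by (intro Ck_sum[OF assms(1)] Ck_scaleR[OF assms(1)] Ck_inner[OF assms(1)] Ck_const Ck_Suc_dd[OF Suc.prems(2)])
       (rule Suc.IH[OF Ck_Suc_dd[OF Suc.prems(1)] Ck_Suc_imp[OF Suc.prems(2)]])
  ultimately show ?case by (rule Ck_SucI[OF assms(1)])
qed

lemma Ck_bounded_linear:
  assumes "bounded_linear L" shows "Ck k U L"
proof -
  have "Ck k UNIV L"
    by (cases k) (auto intro!: Ck_SucI[OF _ bounded_linear.has_derivative[OF assms has_derivative_ident]]
     linear_continuous_on assms simp del: times_differentiable_on.simps(2))
  then show ?thesis using Ck_subset by blast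
qed

lemma Ck_ident [simp]: "Ck k U (\<lambda>x. x)"
  by (rule Ck_bounded_linear) auto

lemma Ck_linear:
  fixes L :: "'e::euclidean_space \<Rightarrow> 'f::real_normed_vector"
  shows "linear L \<Longrightarrow> Ck k U L"
  using Ck_bounded_linear linear_conv_bounded_linear by blast

subsection \<open>Smooth functions\<close>

lemma smooth_on_Ck: "smooth_on U F \<Longrightarrow> Ck k U F"
  by (simp add: smooth_on_def)

lemma smooth_on_D: "smooth_on U F \<Longrightarrow> x \<in> U \<Longrightarrow> (F has_derivative dd F x) (at x)"
  using Ck_Suc_D smooth_on_def by blast

lemma smooth_on_differentiable: "smooth_on U F \<Longrightarrow> x \<in> U \<Longrightarrow> F differentiable at x"
  using smooth_on_D differentiable_def by blast

lemma smooth_on_linear_dd: "smooth_on U F \<Longrightarrow> x \<in> U \<Longrightarrow> linear (dd F x)"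
  using smooth_on_differentiable linear_frechet_derivative by blast

lemma smooth_on_dd: "smooth_on U F \<Longrightarrow> smooth_on U (\<lambda>x. dd F x v)"
  unfolding smooth_on_def using Ck_Suc_dd by blast

lemma smooth_on_continuous: "smooth_on U F \<Longrightarrow> continuous_on U F"
  using Ck_imp_continuous_on smooth_on_def by blast

lemma smooth_on_cong:
  "open U \<Longrightarrow> (\<And>x. x \<in> U \<Longrightarrow> F x = G x) \<Longrightarrow> smooth_on U F \<Longrightarrow> smooth_on U G"
  unfolding smooth_on_def using Ck_cong by blast

lemma smooth_on_subset: "smooth_on U F \<Longrightarrow> V \<subseteq> U \<Longrightarrow> smooth_on V F"
  unfolding smooth_on_def using Ck_subset by blast

lemma smooth_on_local:
  assumes "\<And>x. x \<in> U \<Longrightarrow> \<exists>V. open V \<and> x \<in> V \<and> smooth_on V F" "open U"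
  shows "smooth_on U F"
  unfolding smooth_on_def
proof
  fix k show "Ck k U F" using assms by (intro Ck_local) (auto simp: smooth_on_def)
qed

lemma smooth_on_const [simp]: "smooth_on U (\<lambda>x. c)"
  by (simp add: smooth_on_def)

lemma smooth_on_ident [simp]: "smooth_on U (\<lambda>x. x)"
  by (simp add: smooth_on_def)

lemma smooth_on_linear:
  fixes L :: "'e::euclidean_space \<Rightarrow> 'f::real_normed_vector"
  shows "linear L \<Longrightarrow> smooth_on U L"
  by (simp add: smooth_on_def Ck_linear)

lemma smooth_on_add: "open U \<Longrightarrow> smooth_on U F \<Longrightarrow> smooth_on U G \<Longrightarrow> smooth_on U (\<lambda>x. F x + G x)"
  by (simp add: smooth_on_def Ck_add)

lemma smooth_on_diff: "open U \<Longrightarrow> smooth_on U F \<Longrightarrow> smooth_on U G \<Longrightarrow> smooth_on U (\<lambda>x. F x - G x)"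
  by (simp add: smooth_on_def Ck_diff)

lemma smooth_on_sum: "open U \<Longrightarrow> (\<And>i. i \<in> I \<Longrightarrow> smooth_on U (F i)) \<Longrightarrow> smooth_on U (\<lambda>x. \<Sum>i\<in>I. F i x)"
  by (simp add: smooth_on_def Ck_sum)

lemma smooth_on_prod:
  fixes F :: "'i \<Rightarrow> 'e::real_normed_vector \<Rightarrow> real"
  shows "open U \<Longrightarrow> (\<And>i. i \<in> I \<Longrightarrow> smooth_on U (F i)) \<Longrightarrow> smooth_on U (\<lambda>x. \<Prod>i\<in>I. F i x)"
  by (simp add: smooth_on_def Ck_prod)

lemma smooth_on_mult:
  fixes F :: "'e::real_normed_vector \<Rightarrow> real"
  shows "open U \<Longrightarrow> smooth_on U F \<Longrightarrow> smooth_on U G \<Longrightarrow> smooth_on U (\<lambda>x. F x * G x)"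
  by (simp add: smooth_on_def Ck_mult)

lemma smooth_on_scaleR: "open U \<Longrightarrow> smooth_on U F \<Longrightarrow> smooth_on U G \<Longrightarrow> smooth_on U (\<lambda>x. F x *\<^sub>R G x)"
  by (simp add: smooth_on_def Ck_scaleR)

lemma smooth_on_inner: "open U \<Longrightarrow> smooth_on U F \<Longrightarrow> smooth_on U G \<Longrightarrow> smooth_on U (\<lambda>x. F x \<bullet> G x)"
  by (simp add: smooth_on_def Ck_inner)

lemma smooth_on_divide:
  fixes F :: "'e::real_normed_vector \<Rightarrow> real"
  shows "open U \<Longrightarrow> smooth_on U F \<Longrightarrow> smooth_on U G \<Longrightarrow> (\<And>x. x \<in> U \<Longrightarrow> G x \<noteq> 0) \<Longrightarrow>
    smooth_on U (\<lambda>x. F x / G x)"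
  by (simp add: smooth_on_def Ck_divide)

lemma smooth_on_compose:
  fixes F :: "'f::euclidean_space \<Rightarrow> 'g::real_normed_vector"
  shows "open U \<Longrightarrow> smooth_on V F \<Longrightarrow> smooth_on U G \<Longrightarrow> (\<And>x. x \<in> U \<Longrightarrow> G x \<in> V) \<Longrightarrow>
    smooth_on U (\<lambda>x. F (G x))"
  unfolding smooth_on_def by (blast intro: Ck_compose)

lemma smooth_on_linear_comp:
  "open U \<Longrightarrow> bounded_linear L \<Longrightarrow> smooth_on U F \<Longrightarrow> smooth_on U (\<lambda>x. L (F x))"
  by (simp add: smooth_on_def Ck_linear_comp)

lemma dd_cong:
  assumes "open U" "x \<in> U" "\<And>y. y \<in> U \<Longrightarrow> F y = G y" "F differentiable at x"
  shows "dd F x = dd G x"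
  using frechet_derivative_transform_within_open assms by blast

lemma dd_compose:
  assumes "smooth_on V F" "G differentiable at x" "G x \<in> V"
  shows "dd (\<lambda>x. F (G x)) x a = dd F (G x) (dd G x a)"
  using frechet_derivative_compose[OF assms(2) smooth_on_differentiable[OF assms(1,3)]]
  by (simp add: o_def)

subsection \<open>Symmetry of second derivatives\<close>

lemma line_deriv:
  assumes "F differentiable at (y + t *\<^sub>R b)"
  shows "((\<lambda>s. F (y + s *\<^sub>R b)) has_vector_derivative dd F (y + t *\<^sub>R b) b) (at t)"
proof -
  have "((\<lambda>s. F (y + s *\<^sub>R b)) has_derivative (\<lambda>h. dd F (y + t *\<^sub>R b) (h *\<^sub>R b))) (at t)"
    by (rule has_derivative_compose[of "\<lambda>s. y + s *\<^sub>R b" "\<lambda>h. h *\<^sub>R b", OF _ dd_works[OF assms]])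
      (auto intro!: derivative_eq_intros)
  then show ?thesis
    using linear_frechet_derivative[OF assms]
    by (simp add: has_vector_derivative_def linear_cmul)
qed

text \<open>The mean value theorem is applied once in each direction. The mixed difference is
  symmetric in \<open>a\<close> and \<open>b\<close> while the second derivative has a prescribed
  order; comparing the two orders gives the symmetry of second derivatives.\<close>

lemma mixed_difference:
  fixes F :: "'e::real_normed_vector \<Rightarrow> real"
  assumes "h > 0" and in_U: "\<And>s t. \<lbrakk>0 \<le> s; s \<le> h; 0 \<le> t; t \<le> h\<rbrakk> \<Longrightarrow> x + s *\<^sub>R a + t *\<^sub>R b \<in> U"
    and "Ck 2 U F"
  shows "\<exists>s t. 0 < s \<and> s < h \<and> 0 < t \<and> t < h \<and>
    F (x + h *\<^sub>R a + h *\<^sub>R b) - F (x + h *\<^sub>R a) - F (x + h *\<^sub>R b) + F x = h * h * d2 F (x + s *\<^sub>R a + t *\<^sub>R b) a b"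
proof -
  have C1: "Ck 1 U (\<lambda>y. dd F y b)" and dF: "\<And>y. y \<in> U \<Longrightarrow> F differentiable at y"
    using assms(3) by (simp_all add: numeral_2_eq_2)
  define \<phi> where "\<phi> t = F (x + h *\<^sub>R a + t *\<^sub>R b) - F (x + t *\<^sub>R b)" for t
  have d\<phi>: "DERIV \<phi> t :> dd F (x + h *\<^sub>R a + t *\<^sub>R b) b - dd F (x + t *\<^sub>R b) b" if "0 \<le> t" "t \<le> h" for t
    unfolding \<phi>_def has_real_derivative_iff_has_vector_derivative
    using in_U[of h t] in_U[of 0 t] that assms(1)
    by (intro has_vector_derivative_diff line_deriv dF) auto
  obtain t where t: "0 < t" "t < h"
    "\<phi> h - \<phi> 0 = (h - 0) * (dd F (x + h *\<^sub>R a + t *\<^sub>R b) b - dd F (x + t *\<^sub>R b) b)"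
    using MVT2[OF assms(1), of \<phi> "\<lambda>t. dd F (x + h *\<^sub>R a + t *\<^sub>R b) b - dd F (x + t *\<^sub>R b) b"] d\<phi> by blast
  define \<psi> where "\<psi> s = dd F (x + t *\<^sub>R b + s *\<^sub>R a) b" for s
  have d\<psi>: "DERIV \<psi> s :> d2 F (x + t *\<^sub>R b + s *\<^sub>R a) a b" if "0 \<le> s" "s \<le> h" for s
    unfolding \<psi>_def has_real_derivative_iff_has_vector_derivative
    using line_deriv[of "\<lambda>y. dd F y b" "x + t *\<^sub>R b" s a] C1 in_U[of s t] that t
    by (simp add: algebra_simps)
  obtain s where s: "0 < s" "s < h" "\<psi> h - \<psi> 0 = (h - 0) * d2 F (x + t *\<^sub>R b + s *\<^sub>R a) a b"
    using MVT2[OF assms(1), of \<psi> "\<lambda>s. d2 F (x + t *\<^sub>R b + s *\<^sub>R a) a b"] d\<psi> by blast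
  have "F (x + h *\<^sub>R a + h *\<^sub>R b) - F (x + h *\<^sub>R a) - F (x + h *\<^sub>R b) + F x = \<phi> h - \<phi> 0"
    by (simp add: \<phi>_def)
  also have "\<dots> = h * (\<psi> h - \<psi> 0)"
    by (simp add: t(3) \<psi>_def algebra_simps)
  finally show ?thesis using s t by (intro exI[of _ s] exI[of _ t]) (simp add: algebra_simps)
qed

lemma d2_sym_real:
  fixes F :: "'e::real_normed_vector \<Rightarrow> real"
  assumes "open U" "x \<in> U" "Ck 2 U F"
  shows "d2 F x a b = d2 F x b a"
proof -
  have cont: "continuous_on U (\<lambda>y. d2 F y u v)" for u v :: 'e
    using assms(3) by (simp add: numeral_2_eq_2)
  have "\<bar>d2 F x a b - d2 F x b a\<bar> < e" if "e > 0" for e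
  proof -
    have nbhd: "\<exists>d>0. \<forall>y. dist y x < d \<longrightarrow> y \<in> U \<and> \<bar>d2 F y u v - d2 F x u v\<bar> < e/2" for u v
    proof -
      obtain e1 where "e1 > 0" "ball x e1 \<subseteq> U" using assms(1,2) openE by blast
      moreover have "\<exists>e2>0. \<forall>y\<in>U. dist y x < e2 \<longrightarrow> dist (d2 F y u v) (d2 F x u v) < e/2"
      proof -
        have "\<forall>x\<in>U. \<forall>e>0. \<exists>d>0. \<forall>x'\<in>U. dist x' x < d \<longrightarrow> dist (d2 F x' u v) (d2 F x u v) < e"
          using cont unfolding continuous_on_iff by blast
        from bspec[OF this assms(2)] show ?thesis using half_gt_zero[OF \<open>e > 0\<close>] by blast
      qed
      then obtain e2 where "e2 > 0" and e2: "\<And>y. y\<in>U \<Longrightarrow> dist y x < e2 \<Longrightarrow> dist (d2 F y u v) (d2 F x u v) < e/2"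
        by (elim exE conjE) (erule that, simp)
      ultimately show ?thesis
        by (intro exI[of _ "min e1 e2"]) (use e2 in \<open>auto simp: dist_real_def[symmetric] subset_iff dist_commute\<close>)
    qed
    obtain d where d: "d > 0" "\<And>y. dist y x < d \<Longrightarrow> y \<in> U \<and> \<bar>d2 F y a b - d2 F x a b\<bar> < e/2"
      using nbhd[where u=a and v=b] by blast
    obtain d' where d': "d' > 0" "\<And>y. dist y x < d' \<Longrightarrow> y \<in> U \<and> \<bar>d2 F y b a - d2 F x b a\<bar> < e/2"
      using nbhd[where u=b and v=a] by blast
    \<comment> \<open>The summand 1 keeps the denominator positive when \<open>a\<close> and
      \<open>b\<close> vanish, and puts the whole parallelogram strictly inside both
      neighbourhoods.\<close>
    define h where "h = min d d' / (norm a + norm b + 1)"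
    have pos: "norm a + norm b + 1 > 0" using norm_ge_zero[of a] norm_ge_zero[of b] by linarith
    have h: "h > 0" using d(1) d'(1) pos by (simp add: h_def)
    have near: "dist (x + s *\<^sub>R a + t *\<^sub>R b) x < min d d'" if "0 \<le> s" "s \<le> h" "0 \<le> t" "t \<le> h" for s t
    proof -
      have "dist (x + s *\<^sub>R a + t *\<^sub>R b) x \<le> s * norm a + t * norm b"
        using norm_triangle_ineq[of "s *\<^sub>R a" "t *\<^sub>R b"] that by (simp add: dist_norm)
      also have "\<dots> \<le> h * norm a + h * norm b" using that by (intro add_mono mult_right_mono) auto
      also have "\<dots> < h * (norm a + norm b + 1)" using h by (simp add: algebra_simps)
      finally show ?thesis using pos by (simp add: h_def)
    qed
    have inU: "x + s *\<^sub>R a + t *\<^sub>R b \<in> U" if "0 \<le> s" "s \<le> h" "0 \<le> t" "t \<le> h" for s t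
      using d(2) near[OF that] by simp
    obtain s t where 1: "0 < s" "s < h" "0 < t" "t < h"
      "F (x + h *\<^sub>R a + h *\<^sub>R b) - F (x + h *\<^sub>R a) - F (x + h *\<^sub>R b) + F x = h * h * d2 F (x + s *\<^sub>R a + t *\<^sub>R b) a b"
      using mixed_difference[OF h inU assms(3)] by blast
    have nb: "dist (x + s *\<^sub>R b + t *\<^sub>R a) x < min d d'" if "0 \<le> s" "s \<le> h" "0 \<le> t" "t \<le> h" for s t
      using near[of t s] that by (simp add: algebra_simps)
    have inU': "x + s *\<^sub>R b + t *\<^sub>R a \<in> U" if "0 \<le> s" "s \<le> h" "0 \<le> t" "t \<le> h" for s t
      using d(2) nb[OF that] by simp
    obtain s' t' where 2: "0 < s'" "s' < h" "0 < t'" "t' < h"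
      "F (x + h *\<^sub>R b + h *\<^sub>R a) - F (x + h *\<^sub>R b) - F (x + h *\<^sub>R a) + F x = h * h * d2 F (x + s' *\<^sub>R b + t' *\<^sub>R a) b a"
      using mixed_difference[OF h inU' assms(3)] by blast
    have "h * h * d2 F (x + s *\<^sub>R a + t *\<^sub>R b) a b = h * h * d2 F (x + s' *\<^sub>R b + t' *\<^sub>R a) b a"
      unfolding 1(5)[symmetric] 2(5)[symmetric] by (simp add: algebra_simps)
    then have eq: "d2 F (x + s *\<^sub>R a + t *\<^sub>R b) a b = d2 F (x + s' *\<^sub>R b + t' *\<^sub>R a) b a" using h by simp
    have "\<bar>d2 F (x + s *\<^sub>R a + t *\<^sub>R b) a b - d2 F x a b\<bar> < e/2"
      using d(2) near[of s t] 1(1-4) by simp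
    moreover have "\<bar>d2 F (x + s' *\<^sub>R b + t' *\<^sub>R a) b a - d2 F x b a\<bar> < e/2"
      using d'(2) nb[of s' t'] 2(1-4) by simp
    ultimately show ?thesis using eq by linarith
  qed
  from this[of "\<bar>d2 F x a b - d2 F x b a\<bar>"] show ?thesis by auto
qed

lemma d2_sym:
  fixes F :: "'e::real_normed_vector \<Rightarrow> 'f::euclidean_space"
  assumes "open U" "x \<in> U" "smooth_on U F"
  shows "d2 F x a b = d2 F x b a"
proof (rule euclidean_eqI)
  fix i :: 'f assume "i \<in> Basis"
  have bl: "bounded_linear (\<lambda>y. y \<bullet> i)" by (rule bounded_linear_inner_left)
  have s: "smooth_on U (\<lambda>y. F y \<bullet> i)" by (rule smooth_on_linear_comp[OF assms(1) bl assms(3)])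
  have comp: "dd (\<lambda>y. G y \<bullet> i) y v = dd G y v \<bullet> i" if "G differentiable at y" for G :: "'e \<Rightarrow> 'f" and y v
    using dd_eqI[OF bounded_linear.has_derivative[OF bl dd_works[OF that]]] by simp
  have "d2 (\<lambda>y. F y \<bullet> i) x u v = d2 F x u v \<bullet> i" for u v
  proof -
    have "d2 (\<lambda>y. F y \<bullet> i) x u v = dd (\<lambda>y. dd F y v \<bullet> i) x u"
      using smooth_on_differentiable[OF assms(3)]
      by (subst dd_cong[OF assms(1,2), of _ "\<lambda>y. dd F y v \<bullet> i"])
         (auto simp: comp intro!: smooth_on_differentiable[OF smooth_on_dd[OF s] assms(2)])
    also have "\<dots> = d2 F x u v \<bullet> i"
      by (rule comp[OF smooth_on_differentiable[OF smooth_on_dd[OF assms(3)] assms(2)]])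
    finally show ?thesis .
  qed
  then show "d2 F x a b \<bullet> i = d2 F x b a \<bullet> i"
    using d2_sym_real[OF assms(1,2) smooth_on_Ck[OF s]] by metis
qed

subsection \<open>Smooth families of bilinear maps\<close>

lemma bilinear_expand:
  fixes B :: "'e::euclidean_space \<Rightarrow> 'f::euclidean_space \<Rightarrow> 'g::real_vector"
  assumes "bilinear B"
  shows "B u v = (\<Sum>i\<in>Basis. \<Sum>j\<in>Basis. ((u \<bullet> i) * (v \<bullet> j)) *\<^sub>R B i j)"
proof -
  have l: "linear (\<lambda>u. B u v)" for v
    using assms by (auto simp: bilinear_def)
  have l': "linear (B u)" for u
    using assms by (auto simp: bilinear_def)
  show ?thesis
    by (subst linear_expand[OF l], subst linear_expand[OF l']) (simp add: scaleR_sum_right)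
qed

lemma bilinearI:
  assumes "\<And>a a' b. B (a + a') b = B a b + B a' b" "\<And>r a b. B (r *\<^sub>R a) b = r *\<^sub>R B a b"
    "\<And>a b b'. B a (b + b') = B a b + B a b'" "\<And>r a b. B a (r *\<^sub>R b) = r *\<^sub>R B a b"
  shows "bilinear B"
  using assms by (auto simp: bilinear_def intro!: linearI)

lemma bilinear_sumL: "bilinear B \<Longrightarrow> B (\<Sum>i\<in>I. f i) v = (\<Sum>i\<in>I. B (f i) v)"
  using linear_sum[of "\<lambda>u. B u v"] by (simp add: bilinear_def)

lemma bilinear_sumR: "bilinear B \<Longrightarrow> B v (\<Sum>i\<in>I. f i) = (\<Sum>i\<in>I. B v (f i))"
  using linear_sum[of "B v"] by (simp add: bilinear_def)

lemmas bilinear_simps = bilinear_ladd bilinear_radd bilinear_lmul bilinear_rmul bilinear_lneg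
  bilinear_rneg bilinear_lzero bilinear_rzero bilinear_lsub bilinear_rsub

text \<open>Bilinearity reduces moving arguments to finitely many pairs of basis vectors, for which
  smoothness is assumed. Metrics, Christoffel symbols and second derivatives are all handled in this
  form.\<close>

lemma smooth_on_bilinear:
  fixes G :: "'f::euclidean_space \<Rightarrow> 'a::euclidean_space \<Rightarrow> 'b::euclidean_space \<Rightarrow> 'c::real_normed_vector"
  assumes "open U" "\<And>u v. smooth_on V (\<lambda>y. G y u v)" "\<And>y. y \<in> V \<Longrightarrow> bilinear (G y)"
    and "smooth_on U F" "smooth_on U A" "smooth_on U B" "\<And>x. x \<in> U \<Longrightarrow> F x \<in> V"
  shows "smooth_on U (\<lambda>x. G (F x) (A x) (B x))"
proof (rule smooth_on_cong[OF assms(1)])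
  show "smooth_on U (\<lambda>x. \<Sum>i\<in>Basis. \<Sum>j\<in>Basis. ((A x \<bullet> i) * (B x \<bullet> j)) *\<^sub>R G (F x) i j)"
    by (intro smooth_on_sum smooth_on_scaleR smooth_on_mult smooth_on_inner smooth_on_const
        smooth_on_compose[OF assms(1,2)] assms)
qed (rule bilinear_expand[OF assms(3)[OF assms(7)], symmetric])

lemma bilinear_dd:
  fixes G :: "'f::euclidean_space \<Rightarrow> 'a::euclidean_space \<Rightarrow> 'b::euclidean_space \<Rightarrow> 'c::real_normed_vector"
  assumes "open V" "\<And>u v. smooth_on V (\<lambda>y. G y u v)" "\<And>y. y \<in> V \<Longrightarrow> bilinear (G y)" "p \<in> V"
  shows "bilinear (\<lambda>a b. dd (\<lambda>y. G y a b) p w)"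
proof -
  have d: "((\<lambda>y. G y a b) has_derivative dd (\<lambda>y. G y a b) p) (at p)" for a b
    by (rule smooth_on_D[OF assms(2,4)])
  have eq: "dd (\<lambda>y. G y a b) p = D"
    if "\<And>y. y \<in> V \<Longrightarrow> G y a b = H y" "(H has_derivative D) (at p)" for a b H D
  proof -
    have "(\<lambda>y. G y a b) differentiable (at p)" using d differentiable_def by blast
    with dd_cong[OF assms(1,4), of "\<lambda>y. G y a b" H] that show ?thesis by (simp add: dd_eqI)
  qed
  show ?thesis
  proof (rule bilinearI)
    show "dd (\<lambda>y. G y (a + a') b) p w = dd (\<lambda>y. G y a b) p w + dd (\<lambda>y. G y a' b) p w" for a a' b
      by (subst eq[where a = "a + a'" and b = b, OF _ has_derivative_add[OF d[of a b] d[of a' b]]]) (simp_all add: assms(3) bilinear_ladd)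
    show "dd (\<lambda>y. G y a (b + b')) p w = dd (\<lambda>y. G y a b) p w + dd (\<lambda>y. G y a b') p w" for a b b'
      by (subst eq[where a = a and b = "b + b'", OF _ has_derivative_add[OF d[of a b] d[of a b']]]) (simp_all add: assms(3) bilinear_radd)
    show "dd (\<lambda>y. G y (r *\<^sub>R a) b) p w = r *\<^sub>R dd (\<lambda>y. G y a b) p w" for r a b
      by (subst eq[where a = "r *\<^sub>R a" and b = b, OF _ has_derivative_scaleR_right[OF d[of a b], of r]]) (simp_all add: assms(3) bilinear_lmul)
    show "dd (\<lambda>y. G y a (r *\<^sub>R b)) p w = r *\<^sub>R dd (\<lambda>y. G y a b) p w" for r a b
      by (subst eq[where a = a and b = "r *\<^sub>R b", OF _ has_derivative_scaleR_right[OF d[of a b], of r]]) (simp_all add: assms(3) bilinear_rmul)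
  qed
qed

text \<open>A bilinear family is a finite sum of coordinate products times functions with fixed
  arguments, so the product rule yields one term for the base point and one for each slot.\<close>

lemma has_derivative_bilinear:
  fixes G :: "'f::euclidean_space \<Rightarrow> 'a::euclidean_space \<Rightarrow> 'b::euclidean_space \<Rightarrow> 'c::real_normed_vector"
  assumes "open V" "\<And>u v. smooth_on V (\<lambda>y. G y u v)" "\<And>y. y \<in> V \<Longrightarrow> bilinear (G y)" "F x \<in> V"
    and F: "(F has_derivative F') (at x)" and A: "(A has_derivative A') (at x)" and B: "(B has_derivative B') (at x)"
  shows "((\<lambda>x. G (F x) (A x) (B x)) has_derivative
     (\<lambda>v. dd (\<lambda>y. G y (A x) (B x)) (F x) (F' v) + G (F x) (A' v) (B x) + G (F x) (A x) (B' v))) (at x)"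
proof -
  let ?H = "\<lambda>x. \<Sum>i\<in>Basis. \<Sum>j\<in>Basis. ((A x \<bullet> i) * (B x \<bullet> j)) *\<^sub>R G (F x) i j"
  have "((\<lambda>x. G (F x) i j) has_derivative (\<lambda>v. dd (\<lambda>y. G y i j) (F x) (F' v))) (at x)" for i j
    by (rule has_derivative_compose[OF F smooth_on_D[OF assms(2,4)]])
  then have 1: "(?H has_derivative (\<lambda>v. \<Sum>i\<in>Basis. \<Sum>j\<in>Basis.
      ((A x \<bullet> i) * (B x \<bullet> j)) *\<^sub>R dd (\<lambda>y. G y i j) (F x) (F' v)
       + ((A x \<bullet> i) * (B' v \<bullet> j) + (A' v \<bullet> i) * (B x \<bullet> j)) *\<^sub>R G (F x) i j)) (at x)"
    using A B by (intro has_derivative_sum has_derivative_scaleR has_derivative_mult has_derivative_inner_left)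
  have 2: "(\<Sum>i\<in>Basis. \<Sum>j\<in>Basis.
      ((A x \<bullet> i) * (B x \<bullet> j)) *\<^sub>R dd (\<lambda>y. G y i j) (F x) w
       + ((A x \<bullet> i) * (b \<bullet> j) + (a \<bullet> i) * (B x \<bullet> j)) *\<^sub>R G (F x) i j)
     = dd (\<lambda>y. G y (A x) (B x)) (F x) w + G (F x) a (B x) + G (F x) (A x) b" for w a b
  proof -
    note e = bilinear_expand[OF assms(3)[OF assms(4)]]
    have e1: "dd (\<lambda>y. G y (A x) (B x)) (F x) w = (\<Sum>i\<in>Basis. \<Sum>j\<in>Basis. ((A x \<bullet> i) * (B x \<bullet> j)) *\<^sub>R dd (\<lambda>y. G y i j) (F x) w)"
      by (rule bilinear_expand[OF bilinear_dd[OF assms(1-4)]])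
    have e2: "G (F x) a (B x) = (\<Sum>i\<in>Basis. \<Sum>j\<in>Basis. ((a \<bullet> i) * (B x \<bullet> j)) *\<^sub>R G (F x) i j)"
      by (rule e)
    have e3: "G (F x) (A x) b = (\<Sum>i\<in>Basis. \<Sum>j\<in>Basis. ((A x \<bullet> i) * (b \<bullet> j)) *\<^sub>R G (F x) i j)"
      by (rule e)
    show ?thesis
      unfolding e1 e2 e3 by (simp add: sum.distrib scaleR_add_left)
  qed
  \<comment> \<open>The basis expansion holds only while \<open>F y\<close> stays in
    \<open>V\<close>; continuity of \<open>F\<close> at \<open>x\<close> provides a neighbourhood
    where it does.\<close>
  obtain W where W: "open W" "x \<in> W" "\<And>y. y \<in> W \<Longrightarrow> F y \<in> V"
    using has_derivative_continuous[OF F, unfolded continuous_at_open, rule_format, of V] assms(1,4) by blast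
  show ?thesis
    by (rule has_derivative_transform_within_open[OF 1[unfolded 2] W(1,2)])
       (rule bilinear_expand[OF assms(3)[OF W(3)], symmetric])
qed

subsection \<open>Inner products\<close>

definition inner_form :: "('e::euclidean_space \<Rightarrow> 'e \<Rightarrow> real) \<Rightarrow> bool" where
  "inner_form B \<longleftrightarrow> bilinear B \<and> (\<forall>u v. B u v = B v u) \<and> (\<forall>u. u \<noteq> 0 \<longrightarrow> 0 < B u u)"

lemma inner_formD:
  assumes "inner_form B"
  shows "bilinear B" "B u v = B v u" "u \<noteq> 0 \<Longrightarrow> 0 < B u u" "0 \<le> B u u" "B u u = 0 \<longleftrightarrow> u = 0"
proof -
  show b: "bilinear B" and "B u v = B v u" and p: "u \<noteq> 0 \<Longrightarrow> 0 < B u u"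
    using assms by (auto simp: inner_form_def)
  show "0 \<le> B u u" "B u u = 0 \<longleftrightarrow> u = 0" using p bilinear_lzero[OF b, of 0] by (cases "u = 0"; force)+
qed

lemma inner_form_pullback:
  assumes "inner_form B" "linear L" "inj L"
  shows "inner_form (\<lambda>u v. B (L u) (L v))"
proof -
  note [simp] = bilinear_simps[OF inner_formD(1)[OF assms(1)]] linear_add[OF assms(2)] linear_cmul[OF assms(2)]
  have "L u \<noteq> 0" if "u \<noteq> 0" for u
    using assms(2,3) that by (metis linear_injective_0)
  then show ?thesis
    using inner_formD(2,3)[OF assms(1)] by (auto simp: inner_form_def intro!: bilinearI)
qed

text \<open>An injective linear endomorphism of a finite-dimensional space is onto. This gives the
  definite descriptions for Christoffel symbols and gradients a value.\<close>

lemma riesz_form: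
  fixes B :: "'e::euclidean_space \<Rightarrow> 'e \<Rightarrow> real"
  assumes "inner_form B" "linear \<phi>"
  shows "\<exists>!w. \<forall>z. B w z = \<phi> z"
proof -
  define L where "L w = (\<Sum>b\<in>Basis. B w b *\<^sub>R b)" for w
  note b = inner_formD(1)[OF assms(1)]
  have Lb: "L w \<bullet> b = B w b" if "b \<in> Basis" for w b
    using that by (simp add: L_def inner_sum_left inner_Basis if_distrib cong: if_cong)
  have lin: "linear L"
    by (auto simp: L_def bilinear_simps[OF b] scaleR_add_left sum.distrib scaleR_sum_right intro!: linearI)
  have ext: "(\<forall>z. B w z = \<psi> z) \<longleftrightarrow> (\<forall>b\<in>Basis. B w b = \<psi> b)" if "linear \<psi>" for w \<psi>
    using linear_eq_stdbasis[of "B w" \<psi>] that b by (auto simp: bilinear_def)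
  have "inj L"
  proof (subst linear_injective_0[OF lin], intro allI impI)
    fix w assume "L w = 0"
    then have "\<forall>b\<in>Basis. B w b = 0" using Lb[of _ w] by auto
    then have "B w w = 0" using ext[of "\<lambda>_. 0" w] by (simp add: linear_zero)
    then show "w = 0" using inner_formD(3)[OF assms(1), of w] by fastforce
  qed
  then have "bij L" using linear_injective_imp_surjective[OF lin] by (simp add: bij_def)
  have "(\<forall>z. B w z = \<phi> z) \<longleftrightarrow> L w = (\<Sum>b\<in>Basis. \<phi> b *\<^sub>R b)" for w
    unfolding ext[OF assms(2)] euclidean_eq_iff[of "L w"]
    by (auto simp: Lb inner_sum_left inner_Basis if_distrib cong: if_cong)
  then show ?thesis using \<open>bij L\<close> by (simp add: bij_iff)
qed

lemma inner_form_eqI: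
  assumes "inner_form B" "\<And>z. B u z = B v z" shows "u = v"
proof -
  have "B (u - v) (u - v) = 0"
    using assms(2) by (simp add: bilinear_lsub[OF inner_formD(1)[OF assms(1)]])
  then show ?thesis using inner_formD(5)[OF assms(1)] by simp
qed

lemma inner_form_cauchy_schwarz:
  assumes "inner_form B" shows "(B u v)\<^sup>2 \<le> B u u * B v v"
proof (cases "v = 0")
  case True then show ?thesis by (simp add: bilinear_simps[OF inner_formD(1)[OF assms]])
next
  case False
  then have p: "B v v > 0" using inner_formD(3)[OF assms] by blast
  have "0 \<le> B (u - (B u v / B v v) *\<^sub>R v) (u - (B u v / B v v) *\<^sub>R v)" using inner_formD(4)[OF assms] .
  also have "\<dots> = B u u - (B u v)\<^sup>2 / B v v"
    using p inner_formD(2)[OF assms, of v u]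
    by (simp add: bilinear_simps[OF inner_formD(1)[OF assms]] field_simps power2_eq_square)
  finally show ?thesis using p by (simp add: field_simps)
qed

subsection \<open>Orthonormal bases\<close>

lemma orthonormal_independent:
  assumes "bilinear B" "finite E" "\<forall>u\<in>E. \<forall>v\<in>E. B u v = (if u = v then 1 else (0::real))"
  shows "independent E"
  unfolding independent_explicit_module
proof (intro allI impI)
  fix T c v assume T: "finite T" "T \<subseteq> E" "(\<Sum>v\<in>T. c v *\<^sub>R v) = 0" "v \<in> T"
  have uB: "B u v = (if u = v then 1 else 0)" if "u \<in> T" for u
    using that T(2,4) assms(3) by blast
  have "0 = B (\<Sum>v\<in>T. c v *\<^sub>R v) v" by (simp only: T(3) bilinear_lzero[OF assms(1)])
  also have "\<dots> = (\<Sum>u\<in>T. c u * B u v)" by (simp add: bilinear_sumL[OF assms(1)] bilinear_lmul[OF assms(1)])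
  also have "\<dots> = (\<Sum>u\<in>T. if u = v then c u else 0)" by (intro sum.cong refl) (simp add: uB)
  also have "\<dots> = c v" using T(1,4) by simp
  finally show "c v = 0" by simp
qed

text \<open>Gram-Schmidt, one vector at a time: a family with fewer elements than the dimension does
  not span, and the component of a missing vector orthogonal to the family is normalised.\<close>

lemma orthonormal_basis_ex:
  fixes B :: "'e::euclidean_space \<Rightarrow> 'e \<Rightarrow> real"
  assumes "inner_form B" shows "\<exists>E. orthonormal_basis B E"
proof -
  note b = inner_formD(1)[OF assms]
  have "\<exists>E. finite E \<and> card E = k \<and> (\<forall>u\<in>E. \<forall>v\<in>E. B u v = (if u = v then 1 else 0))" if "k \<le> DIM('e)" for k
    using that
  proof (induction k)
    case 0 then show ?case by (intro exI[of _ "{}"]) auto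
  next
    case (Suc k)
    then obtain E where E: "finite E" "card E = k" "\<forall>u\<in>E. \<forall>v\<in>E. B u v = (if u = v then 1 else 0)" by auto
    have "span E \<noteq> UNIV"
      using dim_le_card[of UNIV E] E Suc.prems by auto
    then obtain x where x: "x \<notin> span E" by auto
    define y where "y = x - (\<Sum>e\<in>E. B x e *\<^sub>R e)"
    have "y \<notin> span E"
      using x span_add[of y E "\<Sum>e\<in>E. B x e *\<^sub>R e"] by (auto simp: y_def span_sum span_scale span_base)
    then have "y \<noteq> 0" using span_zero by metis
    have orth: "B y e = 0" if "e \<in> E" for e
    proof -
      have "B d e = (if d = e then 1 else 0)" if "d \<in> E" for d using E(3) that \<open>e \<in> E\<close> by blast
      then have "(\<Sum>d\<in>E. B x d * B d e) = (\<Sum>d\<in>E. if d = e then B x d else 0)" by (intro sum.cong refl) simp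
      then show ?thesis using E(1) that
        by (simp add: y_def bilinear_simps[OF b] bilinear_sumL[OF b])
    qed
    define z where "z = y /\<^sub>R sqrt (B y y)"
    have p: "B y y > 0" using inner_formD(3)[OF assms \<open>y \<noteq> 0\<close>] .
    have zz: "B z z = 1" using p by (simp add: z_def bilinear_simps[OF b] field_simps)
    have ze: "B z e = 0" "B e z = 0" if "e \<in> E" for e
      using orth[OF that] inner_formD(2)[OF assms, of e z] by (auto simp: z_def bilinear_simps[OF b])
    have "z \<notin> E" using ze zz by force
    then show ?case using E zz ze
      by (intro exI[of _ "insert z E"]) auto
  qed
  then show ?thesis unfolding orthonormal_basis_def by blast
qed

lemma orthonormal_basis_pullback:
  fixes B :: "'e::euclidean_space \<Rightarrow> 'e \<Rightarrow> real" and L :: "'e \<Rightarrow> 'e"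
  assumes "linear L" "bij L" "orthonormal_basis B E"
  shows "orthonormal_basis (\<lambda>u v. B (L u) (L v)) (inv L ` E)"
proof -
  have i: "inj (inv L)" using bij_imp_bij_inv[OF assms(2)] by (simp add: bij_def)
  have c: "card (inv L ` E) = card E" using card_image[OF inj_on_subset[OF i subset_UNIV]] .
  have s: "L (inv L u) = u" for u using assms(2) by (simp add: bij_def surj_f_inv_f)
  have E: "finite E" "card E = DIM('e)" and Buv: "\<And>u v. u \<in> E \<Longrightarrow> v \<in> E \<Longrightarrow> B u v = (if u = v then 1 else 0)"
    using assms(3) unfolding orthonormal_basis_def by blast+
  have "B (L (inv L u)) (L (inv L v)) = (if inv L u = inv L v then 1 else 0)" if "u \<in> E" "v \<in> E" for u v
    unfolding s inj_eq[OF i] by (rule Buv[OF that])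
  then have "\<forall>x\<in>inv L ` E. \<forall>y\<in>inv L ` E. B (L x) (L y) = (if x = y then 1 else 0)"
    by (simp only: ball_simps) blast
  with E show ?thesis unfolding orthonormal_basis_def c by (intro conjI finite_imageI)
qed

lemma orthonormal_expand:
  fixes B :: "'e::euclidean_space \<Rightarrow> 'e \<Rightarrow> real"
  assumes "inner_form B" "orthonormal_basis B E"
  shows "u = (\<Sum>e\<in>E. B u e *\<^sub>R e)"
proof -
  note b = inner_formD(1)[OF assms(1)]
  have E: "finite E" "card E = DIM('e)" "\<forall>u\<in>E. \<forall>v\<in>E. B u v = (if u = v then 1 else 0)"
    using assms(2) by (auto simp: orthonormal_basis_def)
  have "u \<in> span E"
    using card_ge_dim_independent[of E UNIV] orthonormal_independent[OF b E(1,3)] E(2) by auto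
  then obtain c where c: "u = (\<Sum>e\<in>E. c e *\<^sub>R e)" using span_finite[OF E(1)] by auto
  have "B u e = c e" if "e \<in> E" for e
  proof -
    have "B d e = (if d = e then 1 else 0)" if "d \<in> E" for d using E(3) that \<open>e \<in> E\<close> by blast
    then have "(\<Sum>d\<in>E. c d * B d e) = (\<Sum>d\<in>E. if d = e then c d else 0)" by (intro sum.cong refl) simp
    then show ?thesis using that E(1) unfolding c by (simp add: bilinear_simps[OF b] bilinear_sumL[OF b])
  qed
  then show ?thesis using c by simp
qed

lemma orthonormal_parseval:
  fixes B :: "'e::euclidean_space \<Rightarrow> 'e \<Rightarrow> real"
  assumes "inner_form B" "orthonormal_basis B E"
  shows "B u v = (\<Sum>e\<in>E. B u e * B v e)"
proof -
  note b = inner_formD(1)[OF assms(1)]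
  show ?thesis
    by (subst orthonormal_expand[OF assms, of u])
       (simp add: bilinear_sumL[OF b] bilinear_lmul[OF b] inner_formD(2)[OF assms(1), of v])
qed

text \<open>The system is indexed by \<open>E\<close> through \<open>f\<close> because it will be
  the image of an orthonormal basis of the submanifold under a differential. The inequality is the
  nonnegativity of the squared distance from \<open>x\<close> to its projection.\<close>

lemma orthonormal_bessel:
  fixes B :: "'e::euclidean_space \<Rightarrow> 'e \<Rightarrow> real"
  assumes "inner_form B" "finite E" "\<forall>u\<in>E. \<forall>v\<in>E. B (f u) (f v) = (if u = v then 1 else 0)"
  shows "(\<Sum>e\<in>E. (B x (f e))\<^sup>2) \<le> B x x"
proof -
  note b = inner_formD(1)[OF assms(1)]
  let ?p = "\<Sum>e\<in>E. B x (f e) *\<^sub>R f e"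
  have xp: "B x ?p = (\<Sum>e\<in>E. (B x (f e))\<^sup>2)"
    by (simp add: bilinear_sumR[OF b] bilinear_rmul[OF b] power2_eq_square)
  have "B (f d) ?p = B x (f d)" if "d \<in> E" for d
  proof -
    have "B (f d) (f e) = (if e = d then 1 else 0)" if "e \<in> E" for e using assms(3) that \<open>d \<in> E\<close> by metis
    then have "(\<Sum>e\<in>E. B x (f e) * B (f d) (f e)) = (\<Sum>e\<in>E. if e = d then B x (f e) else 0)"
      by (intro sum.cong refl) simp
    then show ?thesis using that assms(2) by (simp add: bilinear_sumR[OF b] bilinear_rmul[OF b])
  qed
  then have pp: "B ?p ?p = (\<Sum>e\<in>E. (B x (f e))\<^sup>2)"
    by (subst bilinear_sumL[OF b]) (simp add: bilinear_lmul[OF b] power2_eq_square)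
  have "0 \<le> B (x - ?p) (x - ?p)" using inner_formD(4)[OF assms(1)] .
  then show ?thesis
    using xp pp inner_formD(2)[OF assms(1), of ?p x] by (simp add: bilinear_simps[OF b])
qed

text \<open>Expanding the coordinate vectors in the orthonormal basis and exchanging the two sums
  reassembles \<open>L e\<close>. It turns coordinate divergences into sums over an orthonormal
  basis.\<close>

lemma orthonormal_trace:
  fixes B :: "real^'n \<Rightarrow> real^'n \<Rightarrow> real"
  assumes "inner_form B" "orthonormal_basis B E" "linear L"
  shows "(\<Sum>i\<in>UNIV. L (axis i 1) $ i) = (\<Sum>e\<in>E. B (L e) e)"
proof -
  note b = inner_formD(1)[OF assms(1)]
  have "L (axis i 1) $ i = (\<Sum>e\<in>E. B (axis i 1) e * L e $ i)" for i
  proof -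
    have "L (axis i 1) = L (\<Sum>e\<in>E. B (axis i 1) e *\<^sub>R e)"
      using orthonormal_expand[OF assms(1,2), of "axis i 1"] by simp
    then show ?thesis by (simp add: linear_sum[OF assms(3)] linear_cmul[OF assms(3)])
  qed
  then have "(\<Sum>i\<in>UNIV. L (axis i 1) $ i) = (\<Sum>i\<in>UNIV. \<Sum>e\<in>E. B (axis i 1) e * L e $ i)" by simp
  also have "\<dots> = (\<Sum>e\<in>E. \<Sum>i\<in>UNIV. B (axis i 1) e * L e $ i)" by (rule sum.swap)
  also have "\<dots> = (\<Sum>e\<in>E. B (\<Sum>i\<in>UNIV. (L e $ i) *\<^sub>R axis i 1) e)"
    by (simp add: bilinear_sumL[OF b] bilinear_lmul[OF b] mult.commute)
  also have "\<dots> = (\<Sum>e\<in>E. B (L e) e)"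
    using basis_expansion[of "L _"] by (simp add: scalar_mult_eq_scaleR)
  finally show ?thesis .
qed

subsection \<open>Determinants depending on parameters\<close>

lemma smooth_on_det:
  fixes A :: "'e::real_normed_vector \<Rightarrow> real^'n^'n"
  assumes "open U" "\<And>i j. smooth_on U (\<lambda>x. A x $ i $ j)"
  shows "smooth_on U (\<lambda>x. det (A x))"
  unfolding det_def
  by (intro smooth_on_sum smooth_on_mult smooth_on_prod smooth_on_const assms)

lemma smooth_on_vec:
  fixes w :: "'e::real_normed_vector \<Rightarrow> real^'n"
  assumes "open U" "\<And>k. smooth_on U (\<lambda>x. w x $ k)"
  shows "smooth_on U w"
proof -
  have "w = (\<lambda>x. \<Sum>k\<in>UNIV. (w x $ k) *\<^sub>R axis k 1)"
    using basis_expansion[of "w _"] by (simp add: scalar_mult_eq_scaleR)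
  moreover have "smooth_on U (\<lambda>x. \<Sum>k\<in>UNIV. (w x $ k) *\<^sub>R (axis k 1 :: real^'n))"
    by (intro smooth_on_sum smooth_on_scaleR smooth_on_const assms)
  ultimately show ?thesis by metis
qed

text \<open>Cramer's rule writes every component of the solution as a quotient of determinants with
  smooth entries.\<close>

lemma smooth_on_solve:
  fixes A :: "'e::real_normed_vector \<Rightarrow> real^'n^'n"
  assumes "open U" "\<And>i j. smooth_on U (\<lambda>x. A x $ i $ j)" "\<And>k. smooth_on U (\<lambda>x. b x $ k)"
    "\<And>x. x \<in> U \<Longrightarrow> det (A x) \<noteq> 0" "\<And>x. x \<in> U \<Longrightarrow> A x *v w x = b x"
  shows "smooth_on U w"
proof (rule smooth_on_vec[OF assms(1)])
  fix k
  have "w x $ k = det (\<chi> i j. if j = k then b x $ i else A x $ i $ j) / det (A x)" if "x \<in> U" for x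
    using cramer[OF assms(4)[OF that], of "w x" "b x"] assms(5)[OF that] by simp
  moreover have "smooth_on U (\<lambda>x. det (\<chi> i j. if j = k then b x $ i else A x $ i $ j) / det (A x))"
  proof (intro smooth_on_divide smooth_on_det assms)
    fix i j show "smooth_on U (\<lambda>x. (\<chi> i j. if j = k then b x $ i else A x $ i $ j) $ i $ j)"
      using assms(2,3) by (cases "j = k") auto
  qed
  ultimately show "smooth_on U (\<lambda>x. w x $ k)"
    using smooth_on_cong[OF assms(1), of "\<lambda>x. det (\<chi> i j. if j = k then b x $ i else A x $ i $ j) / det (A x)"]
    by simp
qed

text \<open>By Parseval the Gram matrix is a matrix times its transpose, so its determinant is a
  square; positivity of \<open>B\<close> makes the kernel trivial and excludes zero.\<close>

lemma det_gram_pos: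
  fixes B :: "real^'n \<Rightarrow> real^'n \<Rightarrow> real"
  assumes "inner_form B"
  shows "det (gram_matrix B) > 0"
proof -
  note b = inner_formD(1)[OF assms]
  obtain E where E: "orthonormal_basis B E" using orthonormal_basis_ex[OF assms] by blast
  then obtain e :: "'n \<Rightarrow> real^'n" where e: "bij_betw e UNIV E"
    using finite_same_card_bij[of "UNIV :: 'n set" E] by (auto simp: orthonormal_basis_def)
  have "gram_matrix B = (\<chi> i j. B (axis i 1) (e j)) ** transpose (\<chi> i j. B (axis i 1) (e j))"
  proof -
    have pars: "(\<Sum>j\<in>UNIV. B u (e j) * B v (e j)) = B u v" for u v
      using orthonormal_parseval[OF assms E, of u v] sum.reindex_bij_betw[OF e, of "\<lambda>d. B u d * B v d"]
      by (simp only:)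
    then show ?thesis by (simp add: gram_matrix_def matrix_matrix_mult_def transpose_def vec_eq_iff)
  qed
  then have sq: "det (gram_matrix B) = (det (\<chi> i j. B (axis i 1) (e j)))\<^sup>2"
    by (simp add: det_mul power2_eq_square)
  have "det (gram_matrix B) \<noteq> 0"
  proof -
    have "v = 0" if "gram_matrix B *v v = 0" for v
    proof -
      have "(gram_matrix B *v v) $ i = B (axis i 1) v" for i
      proof -
        have "B (axis i 1) v = B (axis i 1) (\<Sum>j\<in>UNIV. (v $ j) *\<^sub>R axis j 1)"
          using basis_expansion[of v] by (simp add: scalar_mult_eq_scaleR)
        then show ?thesis
          by (simp add: bilinear_sumR[OF b] bilinear_rmul[OF b] gram_matrix_def matrix_vector_mult_def mult.commute)
      qed
      then have "B (axis i 1) v = 0" for i using that by simp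
      moreover have "B v v = B (\<Sum>j\<in>UNIV. (v $ j) *\<^sub>R axis j 1) v"
        using basis_expansion[of v] by (simp add: scalar_mult_eq_scaleR)
      ultimately have "B v v = 0" by (simp add: bilinear_sumL[OF b] bilinear_lmul[OF b])
      then show ?thesis using inner_formD(5)[OF assms] by blast
    qed
    then have "invertible (gram_matrix B)"
      using matrix_left_invertible_ker[of "gram_matrix B"] by (simp add: invertible_left_inverse)
    then show ?thesis by (simp add: invertible_det_nz)
  qed
  then show ?thesis unfolding sq by simp
qed

lemma gram_matrix_mult:
  fixes B :: "real^'n \<Rightarrow> real^'n \<Rightarrow> real"
  assumes "bilinear B"
  shows "(gram_matrix B *v v) $ i = B (axis i 1) v"
proof -
  have "B (axis i 1) v = B (axis i 1) (\<Sum>j\<in>UNIV. (v $ j) *\<^sub>R axis j 1)"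
    using basis_expansion[of v] by (simp add: scalar_mult_eq_scaleR)
  then show ?thesis
    by (simp add: bilinear_sumR[OF assms] bilinear_rmul[OF assms] gram_matrix_def matrix_vector_mult_def mult.commute)
qed

text \<open>Expressing \<open>L\<close> by its matrix gives transpose times Gram matrix times
  matrix. After taking roots the squared determinant becomes the Jacobian factor of a change of
  chart.\<close>

lemma gram_matrix_pullback:
  fixes B :: "real^'n \<Rightarrow> real^'n \<Rightarrow> real"
  assumes "bilinear B" "linear L"
  shows "det (gram_matrix (\<lambda>u v. B (L u) (L v))) = (det (matrix L))\<^sup>2 * det (gram_matrix B)"
proof -
  have L: "L (axis j 1) = (\<Sum>k\<in>UNIV. (matrix L $ k $ j) *\<^sub>R axis k 1)" for j
    using basis_expansion[of "L (axis j 1)"] by (simp add: scalar_mult_eq_scaleR matrix_def)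
  have "gram_matrix (\<lambda>u v. B (L u) (L v)) = transpose (matrix L) ** (gram_matrix B ** matrix L)"
  proof -
    have "B (L (axis i 1)) (L (axis j 1)) = (transpose (matrix L) ** (gram_matrix B ** matrix L)) $ i $ j" for i j
      unfolding L[of i] L[of j] bilinear_sumL[OF assms(1)]
      by (simp add: bilinear_sumR[OF assms(1)] bilinear_lmul[OF assms(1)] bilinear_rmul[OF assms(1)]
         matrix_matrix_mult_def transpose_def gram_matrix_def sum_distrib_left algebra_simps)
    then show ?thesis by (simp add: gram_matrix_def[of "\<lambda>u v. B (L u) (L v)"] vec_eq_iff)
  qed
  then show ?thesis by (simp add: det_mul power2_eq_square)
qed

text \<open>At the identity only the identity permutation contributes to the first variation of \<open>det\<close>.\<close>

lemma has_derivative_det_at_id: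
  fixes A :: "'e::real_normed_vector \<Rightarrow> real^'n^'n"
  assumes "\<And>i j. ((\<lambda>x. A x $ i $ j) has_derivative A' i j) (at x)" "A x = mat 1"
  shows "((\<lambda>x. det (A x)) has_derivative (\<lambda>v. \<Sum>i\<in>UNIV. A' i i v)) (at x)"
proof -
  let ?P = "{p. p permutes (UNIV :: 'n set)}"
  have "((\<lambda>x. det (A x)) has_derivative (\<lambda>v. \<Sum>p\<in>?P. of_int (sign p) *
       (\<Sum>i\<in>UNIV. A' i (p i) v * (\<Prod>j\<in>UNIV - {i}. A x $ j $ p j)))) (at x)"
    unfolding det_def
    by (intro has_derivative_sum has_derivative_mult_right has_derivative_prod assms)
  moreover have "(\<Sum>p\<in>?P. of_int (sign p) * (\<Sum>i\<in>UNIV. A' i (p i) v * (\<Prod>j\<in>UNIV - {i}. A x $ j $ p j)))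
      = (\<Sum>i\<in>UNIV. A' i i v)" for v
  proof -
    have z: "(\<Prod>j\<in>UNIV - {i}. A x $ j $ p j) = 0"
      if p: "p permutes (UNIV :: 'n set)" and nid: "p \<noteq> id" for p and i :: 'n
    proof -
      \<comment> \<open>A permutation other than the identity moves at least the two points
        \<open>k\<close> and \<open>p k\<close>; one of them differs from the omitted index
        \<open>i\<close> and contributes an off-diagonal zero.\<close>
      obtain k where k: "p k \<noteq> k" using nid by (auto simp: fun_eq_iff)
      have "p (p k) \<noteq> p k" using k permutes_inj[OF p] by (auto dest: injD)
      define j where "j = (if k = i then p k else k)"
      have j: "j \<in> UNIV - {i}" "p j \<noteq> j"
        using k \<open>p (p k) \<noteq> p k\<close> by (auto simp: j_def)
      have "A x $ j $ p j = 0" using j(2) by (simp add: assms(2) mat_def)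
      with j(1) show ?thesis by (intro prod_zero bexI[of _ j]) simp_all
    qed
    have "(\<Sum>p\<in>?P. of_int (sign p) * (\<Sum>i\<in>UNIV. A' i (p i) v * (\<Prod>j\<in>UNIV - {i}. A x $ j $ p j)))
      = (\<Sum>p\<in>{id}. of_int (sign p) * (\<Sum>i\<in>UNIV. A' i (p i) v * (\<Prod>j\<in>UNIV - {i}. A x $ j $ p j)))"
      by (rule sum.mono_neutral_right) (auto simp: permutes_id z finite_permutations)
    also have "\<dots> = (\<Sum>i\<in>UNIV. A' i i v)"
      by (simp add: assms(2) mat_def sign_id)
    finally show ?thesis .
  qed
  ultimately show ?thesis by simp
qed

subsection \<open>Riemannian metrics in coordinates\<close>

text \<open>The functional is kept apart from the vector \<open>chr\<close> that represents it,
  because a functional can be pulled back along maps that are not invertible, such as an immersion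
  read in charts.\<close>

definition koszul :: "('e::real_normed_vector \<Rightarrow> 'e \<Rightarrow> 'e \<Rightarrow> real) \<Rightarrow> 'e \<Rightarrow> 'e \<Rightarrow> 'e \<Rightarrow> 'e \<Rightarrow> real" where
  "koszul G x u v z =
     (dd (\<lambda>y. G y v z) x u + dd (\<lambda>y. G y u z) x v - dd (\<lambda>y. G y u v) x z) / 2"

definition chr :: "('e::real_normed_vector \<Rightarrow> 'e \<Rightarrow> 'e \<Rightarrow> real) \<Rightarrow> 'e \<Rightarrow> 'e \<Rightarrow> 'e \<Rightarrow> 'e" where
  "chr G x u v = (THE w. \<forall>z. G x w z = koszul G x u v z)"

lemma christoffel_eq_chr: "christoffel M g c = chr (local_metric M g c)"
  by (simp add: christoffel_def chr_def koszul_def Let_def fun_eq_iff)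

text \<open>A metric on an open coordinate domain, detached from manifold and chart, so that the
  same lemmas serve local metrics, the metric in normal coordinates and the induced metric.\<close>

locale metric_on =
  fixes U :: "(real^'m) set" and G :: "real^'m \<Rightarrow> real^'m \<Rightarrow> real^'m \<Rightarrow> real"
  assumes open_dom: "open U"
    and inner: "x \<in> U \<Longrightarrow> inner_form (G x)"
    and smooth: "smooth_on U (\<lambda>x. G x u v)"
begin

lemma bil: "x \<in> U \<Longrightarrow> bilinear (G x)" and sym: "x \<in> U \<Longrightarrow> G x u v = G x v u"
  using inner inner_formD by blast+

lemma dG_sym: assumes "x \<in> U" shows "dd (\<lambda>y. G y u v) x = dd (\<lambda>y. G y v u) x"
  by (rule dd_cong[OF open_dom assms sym smooth_on_differentiable[OF smooth assms]])

lemma dG_bilinear: "x \<in> U \<Longrightarrow> bilinear (\<lambda>a b. dd (\<lambda>y. G y a b) x w)"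
  using bilinear_dd[OF open_dom smooth bil] .

lemma dG_linear: "x \<in> U \<Longrightarrow> linear (dd (\<lambda>y. G y a b) x)"
  using smooth_on_linear_dd[OF smooth] .

lemmas dG_simps = bilinear_simps[OF dG_bilinear] linear_add[OF dG_linear] linear_cmul[OF dG_linear]

lemma koszul_linear: "x \<in> U \<Longrightarrow> linear (koszul G x u v)"
  by (rule linearI) (simp_all add: koszul_def dG_simps field_simps)

lemma koszul_bilinear: "x \<in> U \<Longrightarrow> bilinear (\<lambda>u v. koszul G x u v z)"
  by (rule bilinearI) (simp_all add: koszul_def dG_simps field_simps)

lemma koszul_sym: "x \<in> U \<Longrightarrow> koszul G x u v z = koszul G x v u z"
  using dG_sym[of x u v] by (simp add: koszul_def)

lemma chr_works: assumes "x \<in> U" shows "G x (chr G x u v) z = koszul G x u v z"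
  unfolding chr_def
  using theI'[OF riesz_form[OF inner[OF assms] koszul_linear[OF assms]], of u v] by blast

lemma chr_eqI: assumes "x \<in> U" "\<And>z. G x w z = koszul G x u v z" shows "chr G x u v = w"
  by (rule inner_form_eqI[OF inner[OF assms(1)]]) (simp add: assms chr_works)

lemma chr_bilinear: assumes "x \<in> U" shows "bilinear (chr G x)"
  by (rule bilinearI; rule chr_eqI[OF assms])
     (simp_all add: bilinear_simps[OF bil[OF assms]] chr_works[OF assms] bilinear_simps[OF koszul_bilinear[OF assms]])

lemma chr_sym: assumes "x \<in> U" shows "chr G x u v = chr G x v u"
  by (rule chr_eqI[OF assms]) (simp add: chr_works[OF assms] koszul_sym[OF assms, of u])

lemma smooth_koszul: "smooth_on U (\<lambda>x. koszul G x u v z)"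
  unfolding koszul_def
  by (intro smooth_on_divide smooth_on_add smooth_on_diff smooth_on_dd smooth smooth_on_const open_dom) simp

text \<open>Testing against the coordinate vectors gives a linear system whose matrix is the Gram
  matrix. Christoffel symbols and gradients are obtained as such solutions.\<close>

lemma smooth_riesz:
  assumes "\<And>z. smooth_on U (\<lambda>x. \<phi> x z)" "\<And>x z. x \<in> U \<Longrightarrow> G x (w x) z = \<phi> x z"
  shows "smooth_on U w"
proof (rule smooth_on_solve[OF open_dom])
  show "smooth_on U (\<lambda>x. gram_matrix (G x) $ i $ j)" for i j
    using smooth[of "axis i 1" "axis j 1"] by (simp add: gram_matrix_def)
  show "smooth_on U (\<lambda>x. (\<chi> i. \<phi> x (axis i 1)) $ k)" for k
    using assms(1)[of "axis k 1"] by simp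
  show "det (gram_matrix (G x)) \<noteq> 0" if "x \<in> U" for x
    using det_gram_pos[OF inner[OF that]] by simp
  show "gram_matrix (G x) *v w x = (\<chi> i. \<phi> x (axis i 1))" if "x \<in> U" for x
    by (simp add: vec_eq_iff gram_matrix_mult[OF bil[OF that]] sym[OF that, of _ "w x"] assms(2)[OF that])
qed

lemma smooth_chr: "smooth_on U (\<lambda>x. chr G x u v)"
  by (rule smooth_riesz[OF smooth_koszul chr_works])

text \<open>Differentiating \<open>G (F y) (dd F y a) (dd F y b)\<close> gives the Koszul terms of
  \<open>G\<close> and six terms with second derivatives of \<open>F\<close>. Symmetry cancels four
  of these, and what remains pairs the covariant second derivative of \<open>F\<close> with
  \<open>dd F x z\<close>. For a change of coordinates this is the transformation law of the
  Christoffel symbols, for an immersion the tangential part of the Gauss formula.\<close>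

lemma koszul_pullback:
  fixes F :: "'f::euclidean_space \<Rightarrow> real^'m"
  assumes "open V" "x \<in> V" "smooth_on V F" "\<And>y. y \<in> V \<Longrightarrow> F y \<in> U"
    and h: "\<And>y a b. y \<in> V \<Longrightarrow> h y a b = G (F y) (dd F y a) (dd F y b)"
  shows "koszul h x a b z = G (F x) (d2 F x a b + chr G (F x) (dd F x a) (dd F x b)) (dd F x z)"
proof -
  have Fx: "F x \<in> U" using assms by blast
  note [simp] = bilinear_simps[OF bil[OF Fx]]
  have d: "((\<lambda>y. dd F y a) has_derivative dd (\<lambda>y. dd F y a) x) (at x)" for a
    using smooth_on_D[OF smooth_on_dd[OF assms(3)] assms(2)] .
  have dh: "dd (\<lambda>y. h y a b) x w = dd (\<lambda>y. G y (dd F x a) (dd F x b)) (F x) (dd F x w)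
      + G (F x) (d2 F x w a) (dd F x b) + G (F x) (dd F x a) (d2 F x w b)" for a b w
  proof -
    have D: "((\<lambda>y. G (F y) (dd F y a) (dd F y b)) has_derivative
      (\<lambda>w. dd (\<lambda>y. G y (dd F x a) (dd F x b)) (F x) (dd F x w)
      + G (F x) (d2 F x w a) (dd F x b) + G (F x) (dd F x a) (d2 F x w b))) (at x)"
      by (rule has_derivative_bilinear[OF open_dom smooth bil Fx smooth_on_D[OF assms(3,2)] d d])
    have "dd (\<lambda>y. G (F y) (dd F y a) (dd F y b)) x = dd (\<lambda>y. h y a b) x"
      by (rule dd_cong[OF assms(1,2)]) (use D h in \<open>auto simp: differentiable_def\<close>)
    then show ?thesis using dd_eqI[OF D] by metis
  qed
  note s = d2_sym[OF assms(1-3)]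
  show ?thesis
    unfolding bilinear_ladd[OF bil[OF Fx]] chr_works[OF Fx] koszul_def dh
    using s[of z a] s[of z b] s[of b a] sym[OF Fx, of "d2 F x a z" "dd F x b"] sym[OF Fx, of "dd F x a" "d2 F x b z"] sym[OF Fx, of "dd F x b" "d2 F x a z"]
      sym[OF Fx, of "d2 F x a b" "dd F x z"] dG_sym[OF Fx]
    by (simp add: field_simps)
qed

end

lemma d2_linear:
  fixes F :: "'e::real_normed_vector \<Rightarrow> 'f::euclidean_space"
  assumes "open U" "x \<in> U" "smooth_on U F"
  shows "linear (\<lambda>a. d2 F x a b)" "linear (d2 F x a)"
proof -
  show l: "linear (\<lambda>a. d2 F x a b)" for b
    using smooth_on_linear_dd[OF smooth_on_dd[OF assms(3)] assms(2)] .
  have "d2 F x a = (\<lambda>b. d2 F x b a)" using d2_sym[OF assms] by blast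
  then show "linear (d2 F x a)" using l by simp
qed

lemma d2_bilinear:
  fixes F :: "'e::real_normed_vector \<Rightarrow> 'f::euclidean_space"
  assumes "open U" "x \<in> U" "smooth_on U F"
  shows "bilinear (d2 F x)"
  using d2_linear[OF assms] by (simp add: bilinear_def)

text \<open>\<open>dd F y u\<close> is linear in \<open>u\<close> alone; the dummy scalar argument
  \<open>v\<close> makes the family bilinear, so that the rule for bilinear families
  applies.\<close>

lemma has_derivative_dd_along:
  fixes F :: "'e::euclidean_space \<Rightarrow> 'f::euclidean_space"
  assumes "open V" "smooth_on V F" "A x \<in> V" "(A has_derivative A') (at x)" "(B has_derivative B') (at x)"
  shows "((\<lambda>x. dd F (A x) (B x)) has_derivative (\<lambda>v. d2 F (A x) (A' v) (B x) + dd F (A x) (B' v))) (at x)"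
proof -
  define G where "G y u v = v *\<^sub>R dd F y u" for y u and v :: real
  have s: "smooth_on V (\<lambda>y. G y u v)" for u v
    unfolding G_def by (intro smooth_on_scaleR smooth_on_dd assms smooth_on_const)
  have b: "bilinear (G y)" if "y \<in> V" for y
    using smooth_on_linear_dd[OF assms(2) that]
    by (auto simp: G_def linear_add linear_cmul algebra_simps intro!: bilinearI)
  have "((\<lambda>x. G (A x) (B x) 1) has_derivative
     (\<lambda>v. dd (\<lambda>y. G y (B x) 1) (A x) (A' v) + G (A x) (B' v) 1 + G (A x) (B x) 0)) (at x)"
    by (rule has_derivative_bilinear[OF assms(1) s b assms(3,4,5) has_derivative_const])
  then show ?thesis by (simp add: G_def)
qed

lemma d2_compose:
  fixes S :: "'f::euclidean_space \<Rightarrow> 'g::euclidean_space" and F :: "'e::euclidean_space \<Rightarrow> 'f"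
  assumes "open V" "smooth_on V S" "open U" "smooth_on U F" "x \<in> U" "\<And>y. y \<in> U \<Longrightarrow> F y \<in> V"
  shows "d2 (\<lambda>x. S (F x)) x a b = d2 S (F x) (dd F x a) (dd F x b) + dd S (F x) (d2 F x a b)"
proof -
  have D: "((\<lambda>y. dd S (F y) (dd F y b)) has_derivative
     (\<lambda>v. d2 S (F x) (dd F x v) (dd F x b) + dd S (F x) (d2 F x v b))) (at x)"
    by (rule has_derivative_dd_along[OF assms(1,2) assms(6)[OF assms(5)] smooth_on_D[OF assms(4,5)]
        smooth_on_D[OF smooth_on_dd[OF assms(4)] assms(5)]])
  have "dd (\<lambda>y. dd S (F y) (dd F y b)) x = dd (\<lambda>y. dd (\<lambda>x. S (F x)) y b) x"
    by (rule dd_cong[OF assms(3,5)])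
       (use D dd_compose[OF assms(2) smooth_on_differentiable[OF assms(4)] assms(6)] in \<open>auto simp: differentiable_def\<close>)
  then show ?thesis using dd_eqI[OF D] by metis
qed

lemma dd_cong_on:
  assumes "open U" "x \<in> U" "\<And>y. y \<in> U \<Longrightarrow> F y = G y" "smooth_on U F"
  shows "dd F x = dd G x"
  using dd_cong[OF assms(1,2,3) smooth_on_differentiable[OF assms(4,2)]] .

lemma d2_cong_on:
  assumes "open U" "x \<in> U" "\<And>y. y \<in> U \<Longrightarrow> F y = G y" "smooth_on U F"
  shows "d2 F x a b = d2 G x a b"
  using dd_cong_on[OF assms(1,2) _ smooth_on_dd[OF assms(4), of b], where G = "\<lambda>y. dd G y b"]
    dd_cong_on[OF assms(1) _ assms(3,4)] by simp

subsection \<open>Charts and smooth parametrizations\<close>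

locale mfd =
  fixes M :: "('a::{t2_space, second_countable_topology}, 'e::euclidean_space) manifold"
  assumes M: "smooth_manifold M"
begin

lemma chart_homeo: "c \<in> atlas M \<Longrightarrow> homeomorphism (cdom c) (cimage c) (cmap c) (cinv c)"
  using M unfolding smooth_manifold_def by blast

lemma open_cimage: "c \<in> atlas M \<Longrightarrow> open (cimage c)"
  using M unfolding smooth_manifold_def by blast

lemma openin_cdom: "c \<in> atlas M \<Longrightarrow> openin (top_of_set (carrier M)) (cdom c)"
  using M unfolding smooth_manifold_def by blast

lemma cdom_sub: "c \<in> atlas M \<Longrightarrow> cdom c \<subseteq> carrier M"
  using M unfolding smooth_manifold_def by blast

lemma cmap_cimage: "q \<in> cdom c \<Longrightarrow> cmap c q \<in> cimage c"
  by (simp add: cimage_def)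

lemma cinv_cdom: "x \<in> cimage c \<Longrightarrow> cinv c x \<in> cdom c"
  by (simp add: cimage_def cinv_def inv_into_into)

lemma cmap_cinv: "x \<in> cimage c \<Longrightarrow> cmap c (cinv c x) = x"
  by (simp add: cimage_def cinv_def f_inv_into_f)

lemma cinv_cmap: "c \<in> atlas M \<Longrightarrow> q \<in> cdom c \<Longrightarrow> cinv c (cmap c q) = q"
  using chart_homeo unfolding homeomorphism_def by blast

lemma continuous_cinv: "c \<in> atlas M \<Longrightarrow> continuous_on (cimage c) (cinv c)"
  using chart_homeo unfolding homeomorphism_def by blast

lemma continuous_cmap: "c \<in> atlas M \<Longrightarrow> continuous_on (cdom c) (cmap c)"
  using chart_homeo unfolding homeomorphism_def by blast

lemma chart_at: assumes "q \<in> carrier M" shows "chart_at M q \<in> atlas M" "q \<in> cdom (chart_at M q)"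
proof -
  have "\<exists>c. c \<in> atlas M \<and> q \<in> cdom c" using M assms unfolding smooth_manifold_def by blast
  then show "chart_at M q \<in> atlas M" "q \<in> cdom (chart_at M q)"
    unfolding chart_at_def using someI_ex[of "\<lambda>c. c \<in> atlas M \<and> q \<in> cdom c"] by auto
qed

lemma transition_smooth:
  "c \<in> atlas M \<Longrightarrow> d \<in> atlas M \<Longrightarrow> smooth_on (cmap c ` (cdom c \<inter> cdom d)) (cmap d \<circ> cinv c)"
  using M unfolding smooth_manifold_def by blast

end

text \<open>Inverse charts, geodesics, the exponential map and an immersion read in a chart are all
  smooth maps from an open Euclidean set into the manifold; this notion gives them one
  calculus.\<close>

definition smooth_param ::
  "('a::topological_space, 'e::euclidean_space) manifold \<Rightarrow> 'f::euclidean_space set \<Rightarrow> ('f \<Rightarrow> 'a) \<Rightarrow> bool" where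
  "smooth_param M V X \<longleftrightarrow> open V \<and> continuous_on V X \<and> X ` V \<subseteq> carrier M \<and>
     (\<forall>d\<in>atlas M. smooth_on (V \<inter> X -` cdom d) (cmap d \<circ> X))"

definition param_metric ::
  "('a, 'e::euclidean_space) manifold \<Rightarrow> ('a \<Rightarrow> 'e \<Rightarrow> 'e \<Rightarrow> real) \<Rightarrow>
    ('f::euclidean_space \<Rightarrow> 'a) \<Rightarrow> 'f \<Rightarrow> 'f \<Rightarrow> 'f \<Rightarrow> real" where
  "param_metric M g X x a b =
     g (X x) (dd (cmap (chart_at M (X x)) \<circ> X) x a) (dd (cmap (chart_at M (X x)) \<circ> X) x b)"

text \<open>The covariant second derivative of the map \<open>X\<close>, read in the chart
  \<open>d\<close>. For a curve its vanishing is the geodesic equation; for an immersion its normal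
  part is the second fundamental form.\<close>

definition hess ::
  "('a, 'e::euclidean_space) manifold \<Rightarrow> ('a \<Rightarrow> 'e \<Rightarrow> 'e \<Rightarrow> real) \<Rightarrow> ('a, 'e) chart \<Rightarrow>
    ('f::euclidean_space \<Rightarrow> 'a) \<Rightarrow> 'f \<Rightarrow> 'f \<Rightarrow> 'f \<Rightarrow> 'e" where
  "hess M g d X x a b = d2 (cmap d \<circ> X) x a b
     + chr (local_metric M g d) (cmap d (X x)) (dd (cmap d \<circ> X) x a) (dd (cmap d \<circ> X) x b)"

lemma local_metric_eq_param: "local_metric M g c = param_metric M g (cinv c)"
  by (simp add: local_metric_def param_metric_def Let_def fun_eq_iff)

context mfd begin

lemma param_open: "smooth_param M V X \<Longrightarrow> open V"
  by (simp add: smooth_param_def)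

lemma param_carrier: "smooth_param M V X \<Longrightarrow> x \<in> V \<Longrightarrow> X x \<in> carrier M"
  by (auto simp: smooth_param_def)

lemma param_chart_open:
  assumes "smooth_param M V X" "d \<in> atlas M" shows "open (V \<inter> X -` cdom d)"
proof -
  have "openin (top_of_set V) (V \<inter> X -` cdom d)"
    using assms(1) openin_cdom[OF assms(2)] unfolding smooth_param_def
    by (intro continuous_openin_preimage[of V X "carrier M"]) auto
  then show ?thesis using param_open[OF assms(1)] openin_open_trans by blast
qed

lemma param_chart_smooth:
  "smooth_param M V X \<Longrightarrow> d \<in> atlas M \<Longrightarrow> smooth_on (V \<inter> X -` cdom d) (cmap d \<circ> X)"
  by (simp add: smooth_param_def)

lemma smooth_param_cinv: assumes "c \<in> atlas M" shows "smooth_param M (cimage c) (cinv c)"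
  unfolding smooth_param_def
proof (intro conjI ballI)
  show "cinv c ` cimage c \<subseteq> carrier M" using cinv_cdom[of _ c] cdom_sub[OF assms] by blast
  fix d assume d: "d \<in> atlas M"
  have "cimage c \<inter> cinv c -` cdom d \<subseteq> cmap c ` (cdom c \<inter> cdom d)"
    using cmap_cinv[of _ c] cinv_cdom[of _ c] by (force simp: image_iff)
  then show "smooth_on (cimage c \<inter> cinv c -` cdom d) (cmap d \<circ> cinv c)"
    using transition_smooth[OF assms d] smooth_on_subset by blast
qed (use open_cimage continuous_cinv assms in auto)

lemma smooth_param_subset:
  assumes "smooth_param M V X" "open W" "W \<subseteq> V" shows "smooth_param M W X"
proof -
  have V: "continuous_on V X" "X ` V \<subseteq> carrier M" "\<And>d. d \<in> atlas M \<Longrightarrow> smooth_on (V \<inter> X -` cdom d) (cmap d \<circ> X)"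
    using assms(1) by (simp_all add: smooth_param_def)
  have "smooth_on (W \<inter> X -` cdom d) (cmap d \<circ> X)" if "d \<in> atlas M" for d
    by (rule smooth_on_subset[OF V(3)[OF that]]) (use assms(3) in blast)
  moreover have "continuous_on W X" "X ` W \<subseteq> carrier M"
    using continuous_on_subset[OF V(1) assms(3)] V(2) assms(3) by auto
  ultimately show ?thesis using assms(2) unfolding smooth_param_def by blast
qed

lemma smooth_param_compose:
  assumes "smooth_param M V X" "open W" "smooth_on W F" "\<And>y. y \<in> W \<Longrightarrow> F y \<in> V"
  shows "smooth_param M W (\<lambda>y. X (F y))"
  unfolding smooth_param_def
proof (intro conjI ballI)
  show c: "continuous_on W (\<lambda>y. X (F y))"
    using assms smooth_on_continuous[OF assms(3)] unfolding smooth_param_def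
    by (intro continuous_on_compose2[of V X W F]) auto
  show "(\<lambda>y. X (F y)) ` W \<subseteq> carrier M" using assms param_carrier by blast
  fix d assume d: "d \<in> atlas M"
  have "openin (top_of_set W) (W \<inter> F -` (V \<inter> X -` cdom d))"
    using smooth_on_continuous[OF assms(3)] param_chart_open[OF assms(1) d]
    by (intro continuous_openin_preimage_gen)
  moreover have "W \<inter> F -` (V \<inter> X -` cdom d) = W \<inter> (\<lambda>y. X (F y)) -` cdom d" using assms(4) by auto
  ultimately have o: "open (W \<inter> (\<lambda>y. X (F y)) -` cdom d)" using assms(2) openin_open_trans by metis
  have "smooth_on (W \<inter> (\<lambda>y. X (F y)) -` cdom d) (\<lambda>y. (cmap d \<circ> X) (F y))"
    by (rule smooth_on_compose[OF o param_chart_smooth[OF assms(1) d] smooth_on_subset[OF assms(3)]])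
       (use assms(4) in auto)
  then show "smooth_on (W \<inter> (\<lambda>y. X (F y)) -` cdom d) (cmap d \<circ> (\<lambda>y. X (F y)))"
    by (simp add: o_def)
qed (use assms in auto)

lemma param_change:
  assumes X: "smooth_param M V X" "x \<in> V" and c: "c \<in> atlas M" "X x \<in> cdom c" and d: "d \<in> atlas M" "X x \<in> cdom d"
  shows "dd (cmap d \<circ> X) x a = dd (cmap d \<circ> cinv c) (cmap c (X x)) (dd (cmap c \<circ> X) x a)"
    and "d2 (cmap d \<circ> X) x a b = d2 (cmap d \<circ> cinv c) (cmap c (X x)) (dd (cmap c \<circ> X) x a) (dd (cmap c \<circ> X) x b)
       + dd (cmap d \<circ> cinv c) (cmap c (X x)) (d2 (cmap c \<circ> X) x a b)"
proof -
  let ?W = "(V \<inter> X -` cdom c) \<inter> (V \<inter> X -` cdom d)"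
  let ?T = "cimage c \<inter> cinv c -` cdom d"
  have W: "open ?W" "x \<in> ?W"
    using X c d by (auto intro!: open_Int[OF param_chart_open param_chart_open])
  have T: "open ?T" "smooth_on ?T (cmap d \<circ> cinv c)"
    using param_chart_open[OF smooth_param_cinv[OF c(1)] d(1)] param_chart_smooth[OF smooth_param_cinv[OF c(1)] d(1)] by auto
  have sc: "smooth_on ?W (cmap c \<circ> X)" by (rule smooth_on_subset[OF param_chart_smooth[OF X(1) c(1)]]) auto
  have sd: "smooth_on ?W (cmap d \<circ> X)" by (rule smooth_on_subset[OF param_chart_smooth[OF X(1) d(1)]]) auto
  have in_T: "(cmap c \<circ> X) y \<in> ?T" if "y \<in> ?W" for y
    using that cmap_cimage cinv_cmap[OF c(1)] by auto
  have eq: "(cmap d \<circ> X) y = (\<lambda>x. (cmap d \<circ> cinv c) ((cmap c \<circ> X) x)) y" if "y \<in> ?W" for y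
    using that cinv_cmap[OF c(1)] by auto
  show "dd (cmap d \<circ> X) x a = dd (cmap d \<circ> cinv c) (cmap c (X x)) (dd (cmap c \<circ> X) x a)"
  proof -
    have "dd (cmap d \<circ> X) x = dd (\<lambda>x. (cmap d \<circ> cinv c) ((cmap c \<circ> X) x)) x"
      by (rule dd_cong_on[where G = "\<lambda>x. (cmap d \<circ> cinv c) ((cmap c \<circ> X) x)", OF W eq sd])
    then have "dd (cmap d \<circ> X) x a = dd (\<lambda>x. (cmap d \<circ> cinv c) ((cmap c \<circ> X) x)) x a" by (rule fun_cong)
    also have "\<dots> = dd (cmap d \<circ> cinv c) ((cmap c \<circ> X) x) (dd (cmap c \<circ> X) x a)"
      using dd_compose[OF T(2) smooth_on_differentiable[OF sc W(2)] in_T[OF W(2)]] .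
    finally show ?thesis by (simp only: comp_apply)
  qed
  show "d2 (cmap d \<circ> X) x a b = d2 (cmap d \<circ> cinv c) (cmap c (X x)) (dd (cmap c \<circ> X) x a) (dd (cmap c \<circ> X) x b)
       + dd (cmap d \<circ> cinv c) (cmap c (X x)) (d2 (cmap c \<circ> X) x a b)"
  proof -
    have "d2 (cmap d \<circ> X) x a b = d2 (\<lambda>x. (cmap d \<circ> cinv c) ((cmap c \<circ> X) x)) x a b"
      by (rule d2_cong_on[where G = "\<lambda>x. (cmap d \<circ> cinv c) ((cmap c \<circ> X) x)", OF W eq sd])
    also have "\<dots> = d2 (cmap d \<circ> cinv c) ((cmap c \<circ> X) x) (dd (cmap c \<circ> X) x a) (dd (cmap c \<circ> X) x b)
       + dd (cmap d \<circ> cinv c) ((cmap c \<circ> X) x) (d2 (cmap c \<circ> X) x a b)"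
      using d2_compose[OF T W(1) sc W(2) in_T] .
    finally show ?thesis by (simp only: comp_apply)
  qed
qed

lemma transition_inverse:
  assumes "c \<in> atlas M" "d \<in> atlas M" "q \<in> cdom c" "q \<in> cdom d"
  shows "dd (cmap c \<circ> cinv d) (cmap d q) (dd (cmap d \<circ> cinv c) (cmap c q) a) = a"
proof -
  have x: "cmap c q \<in> cimage c" "cinv c (cmap c q) = q" using assms cmap_cimage cinv_cmap by auto
  have "dd (cmap c \<circ> cinv c) (cmap c q) a = dd (cmap c \<circ> cinv d) (cmap d (cinv c (cmap c q))) (dd (cmap d \<circ> cinv c) (cmap c q) a)"
    using x assms by (intro param_change(1)[OF smooth_param_cinv]) auto
  moreover have "dd (\<lambda>x. x) (cmap c q) = dd (cmap c \<circ> cinv c) (cmap c q)"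
    by (rule dd_cong_on[OF open_cimage[OF assms(1)] x(1)]) (auto simp: cmap_cinv)
  ultimately show ?thesis using x(2) by (metis frechet_derivative_ident)
qed

lemma transition_linear:
  assumes "c \<in> atlas M" "d \<in> atlas M" "q \<in> cdom c" "q \<in> cdom d"
  shows "linear (dd (cmap d \<circ> cinv c) (cmap c q))" "inj (dd (cmap d \<circ> cinv c) (cmap c q))"
    "surj (dd (cmap d \<circ> cinv c) (cmap c q))"
proof -
  have x: "cmap c q \<in> cimage c \<inter> cinv c -` cdom d" using assms cmap_cimage cinv_cmap by auto
  show "linear (dd (cmap d \<circ> cinv c) (cmap c q))"
    using smooth_on_linear_dd[OF param_chart_smooth[OF smooth_param_cinv[OF assms(1)] assms(2)] x] .
  show "inj (dd (cmap d \<circ> cinv c) (cmap c q))"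
    using transition_inverse[OF assms] by (rule inj_on_inverseI)
  show "surj (dd (cmap d \<circ> cinv c) (cmap c q))"
    using transition_inverse[OF assms(2,1,4,3)] by (rule surjI)
qed

end

locale riem = mfd M for M :: "('a::{t2_space, second_countable_topology}, real^'m) manifold" +
  fixes g :: "'a \<Rightarrow> real^'m \<Rightarrow> real^'m \<Rightarrow> real"
  assumes g: "riemannian_metric M g"
begin

lemma g_inner: "q \<in> carrier M \<Longrightarrow> inner_form (g q)"
  using g unfolding riemannian_metric_def inner_form_def by blast

lemma param_metric_chart:
  assumes "smooth_param M V X" "x \<in> V" "d \<in> atlas M" "X x \<in> cdom d"
  shows "param_metric M g X x a b =
    local_metric M g d (cmap d (X x)) (dd (cmap d \<circ> X) x a) (dd (cmap d \<circ> X) x b)"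
  using param_change(1)[OF assms(1,2,3,4) chart_at[OF param_carrier[OF assms(1,2)]]] cinv_cmap[OF assms(3,4)]
  by (simp add: param_metric_def local_metric_def Let_def)

lemma metric_on_chart: assumes "c \<in> atlas M" shows "metric_on (cimage c) (local_metric M g c)"
proof
  show "open (cimage c)" using open_cimage[OF assms] .
  show "smooth_on (cimage c) (\<lambda>x. local_metric M g c x u v)" for u v
    using g assms unfolding riemannian_metric_def by blast
  fix x assume x: "x \<in> cimage c"
  let ?q = "cinv c x" and ?d = "chart_at M (cinv c x)"
  have q: "?q \<in> cdom c" "cmap c ?q = x" "?q \<in> carrier M"
    using cinv_cdom[OF x] cmap_cinv[OF x] cdom_sub[OF assms] by auto
  note t = transition_linear[OF assms chart_at(1)[OF q(3)] q(1) chart_at(2)[OF q(3)], unfolded q(2)]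
  show "inner_form (local_metric M g c x)"
    using inner_form_pullback[OF g_inner[OF q(3)] t(1,2)]
    by (simp add: local_metric_def[abs_def] Let_def)
qed

lemma local_metric_preferred:
  assumes "q \<in> carrier M" shows "local_metric M g (chart_at M q) (cmap (chart_at M q) q) = g q"
proof -
  let ?c = "chart_at M q"
  note c = chart_at[OF assms]
  have x: "cmap ?c q \<in> cimage ?c" "cinv ?c (cmap ?c q) = q" using c cmap_cimage cinv_cmap by auto
  have "dd (\<lambda>x. x) (cmap ?c q) = dd (cmap ?c \<circ> cinv ?c) (cmap ?c q)"
    by (rule dd_cong_on[OF open_cimage[OF c(1)] x(1)]) (auto simp: cmap_cinv)
  then show ?thesis using x by (simp add: local_metric_def Let_def fun_eq_iff)
qed

text \<open>\<open>param_metric\<close> refers to the preferred chart at \<open>X x\<close>, which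
  may jump as \<open>x\<close> moves. Near each point it is therefore rewritten in the single chart
  preferred at that point.\<close>

lemma smooth_param_metric:
  assumes "smooth_param M V X" shows "smooth_on V (\<lambda>x. param_metric M g X x a b)"
proof (rule smooth_on_local[OF _ param_open[OF assms]])
  fix x assume x: "x \<in> V"
  let ?d = "chart_at M (X x)"
  note d = chart_at[OF param_carrier[OF assms x]]
  interpret m: metric_on "cimage ?d" "local_metric M g ?d" by (rule metric_on_chart[OF d(1)])
  let ?W = "V \<inter> X -` cdom ?d"
  note W = param_chart_open[OF assms d(1)] and s = param_chart_smooth[OF assms d(1)]
  have "smooth_on ?W (\<lambda>x. local_metric M g ?d ((cmap ?d \<circ> X) x) (dd (cmap ?d \<circ> X) x a) (dd (cmap ?d \<circ> X) x b))"
    by (rule smooth_on_bilinear[OF W m.smooth m.bil s smooth_on_dd[OF s] smooth_on_dd[OF s]])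
       (auto simp: cmap_cimage)
  then have "smooth_on ?W (\<lambda>x. param_metric M g X x a b)"
    by (rule smooth_on_cong[OF W, rotated]) (use param_metric_chart[OF assms _ d(1)] in auto)
  then show "\<exists>W. open W \<and> x \<in> W \<and> smooth_on W (\<lambda>x. param_metric M g X x a b)"
    using W x d by blast
qed

lemma param_koszul:
  assumes "smooth_param M V X" "x \<in> V" "d \<in> atlas M" "X x \<in> cdom d"
  shows "koszul (param_metric M g X) x a b z =
    local_metric M g d (cmap d (X x)) (hess M g d X x a b) (dd (cmap d \<circ> X) x z)"
proof -
  interpret m: metric_on "cimage d" "local_metric M g d" by (rule metric_on_chart[OF assms(3)])
  show ?thesis
    using m.koszul_pullback[OF param_chart_open[OF assms(1,3)] _ param_chart_smooth[OF assms(1,3)], of x "param_metric M g X" a b z]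
      param_metric_chart[OF assms(1) _ assms(3)] assms(2,4)
    by (auto simp: hess_def cmap_cimage)
qed

text \<open>Second derivatives pick up a term from the transition map, which the Christoffel symbols
  absorb. For an inverse chart this is seen by pairing both sides with all tangent vectors; the
  chain rule then gives the general case.\<close>

lemma hess_change:
  assumes X: "smooth_param M V X" "x \<in> V" and c: "c \<in> atlas M" "X x \<in> cdom c" and d: "d \<in> atlas M" "X x \<in> cdom d"
  shows "hess M g d X x a b = dd (cmap d \<circ> cinv c) (cmap c (X x)) (hess M g c X x a b)"
proof -
  let ?q = "X x" and ?y = "cmap c (X x)"
  let ?L = "dd (cmap d \<circ> cinv c) ?y"
  interpret m: metric_on "cimage d" "local_metric M g d" by (rule metric_on_chart[OF d(1)])
  interpret mc: metric_on "cimage c" "local_metric M g c" by (rule metric_on_chart[OF c(1)])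
  have y: "?y \<in> cimage c" "cinv c ?y = ?q" and yd: "cmap d ?q \<in> cimage d"
    using c d cmap_cimage cinv_cmap by auto
  note L = transition_linear[OF c(1) d(1) c(2) d(2)]
  note P = smooth_param_cinv[OF c(1)]
  have *: "hess M g d (cinv c) ?y u v = ?L (chr (local_metric M g c) ?y u v)" for u v
  proof (rule inner_form_eqI[OF m.inner[OF yd]])
    fix z
    obtain z' where z': "z = ?L z'" using L(3) by (metis surjD)
    have "local_metric M g d (cmap d ?q) (hess M g d (cinv c) ?y u v) (?L z') = koszul (param_metric M g (cinv c)) ?y u v z'"
      using param_koszul[OF P y(1) d(1)] y d by simp
    also have "\<dots> = local_metric M g c ?y (chr (local_metric M g c) ?y u v) z'"
      by (simp only: mc.chr_works[OF y(1)] local_metric_eq_param[symmetric])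
    also have "\<dots> = local_metric M g d (cmap d ?q) (?L (chr (local_metric M g c) ?y u v)) (?L z')"
      using param_metric_chart[OF P y(1) d(1)] y d by (simp add: local_metric_eq_param)
    finally show "local_metric M g d (cmap d ?q) (hess M g d (cinv c) ?y u v) z =
      local_metric M g d (cmap d ?q) (?L (chr (local_metric M g c) ?y u v)) z" by (simp add: z')
  qed
  show ?thesis
    unfolding hess_def[of _ _ d X] param_change[OF X c d] hess_def[of _ _ c X] linear_add[OF L(1)]
      *[symmetric] unfolding hess_def using y by simp
qed

end

subsection \<open>Uniqueness for second order equations\<close>

text \<open>The partial derivatives are bounded on a closed ball around \<open>p\<close>; their sum
  over the basis bounds the operator norm, and the ball is convex.\<close>

lemma smooth_on_lipschitz:
  fixes F :: "'e::euclidean_space \<Rightarrow> 'f::real_normed_vector"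
  assumes "open N" "smooth_on N F" "p \<in> N"
  obtains L \<delta> where "L \<ge> 0" "\<delta> > 0" "\<And>q q'. \<lbrakk>q \<in> ball p \<delta>; q' \<in> ball p \<delta>\<rbrakk> \<Longrightarrow> norm (F q - F q') \<le> L * norm (q - q')"
proof -
  obtain \<delta> where \<delta>: "\<delta> > 0" "cball p \<delta> \<subseteq> N" using assms(1,3) open_contains_cball by blast
  have "\<exists>K. \<forall>y\<in>cball p \<delta>. norm (dd F y b) \<le> K" for b
  proof -
    have "continuous_on (cball p \<delta>) (\<lambda>y. dd F y b)"
      by (rule continuous_on_subset[OF smooth_on_continuous[OF smooth_on_dd[OF assms(2)]] \<delta>(2)])
    then have "bounded ((\<lambda>y. dd F y b) ` cball p \<delta>)"
      by (intro compact_imp_bounded compact_continuous_image compact_cball)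
    then show ?thesis unfolding bounded_iff by blast
  qed
  then obtain K where K: "\<And>b y. y \<in> cball p \<delta> \<Longrightarrow> norm (dd F y b) \<le> K b" by metis
  define L where "L = (\<Sum>b\<in>Basis. K b)"
  have K0: "K b \<ge> 0" for b using K[of p b] \<delta>(1) norm_ge_zero order_trans by (metis centre_in_cball less_imp_le)
  have on: "onorm (dd F y) \<le> L" if "y \<in> cball p \<delta>" for y
  proof (rule onorm_le)
    fix v
    have "norm (dd F y v) = norm (\<Sum>b\<in>Basis. (v \<bullet> b) *\<^sub>R dd F y b)"
      using linear_expand[OF smooth_on_linear_dd[OF assms(2)], of y v] that \<delta>(2) by auto
    also have "\<dots> \<le> (\<Sum>b\<in>Basis. norm v * K b)"
      by (intro sum_norm_le) (auto intro!: mult_mono Basis_le_norm K that)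
    also have "\<dots> = L * norm v" by (simp add: L_def sum_distrib_left mult.commute)
    finally show "norm (dd F y v) \<le> L * norm v" .
  qed
  show ?thesis
  proof (rule that)
    show "L \<ge> 0" unfolding L_def by (intro sum_nonneg K0)
    fix q q' assume q: "q \<in> ball p \<delta>" "q' \<in> ball p \<delta>"
    show "norm (F q - F q') \<le> L * norm (q - q')"
    proof (rule differentiable_bound[of "ball p \<delta>" F "dd F"])
      fix x assume x: "x \<in> ball p \<delta>"
      then have "x \<in> N" using \<delta>(2) by auto
      then show "(F has_derivative dd F x) (at x within ball p \<delta>)"
        using smooth_on_D[OF assms(2)] has_derivative_at_withinI by blast
      show "onorm (dd F x) \<le> L" using on x by simp
    qed (use q in auto)
  qed (rule \<delta>(1))
qed

text \<open>On an interval so short that \<open>L * \<eta>\<close> is at most 1/2, the maximum of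
  \<open>norm (w t)\<close> is at most half of itself, hence zero.\<close>

lemma lipschitz_ode_unique:
  fixes w :: "real \<Rightarrow> 'e::euclidean_space"
  assumes "\<epsilon> > 0" "L \<ge> 0" "w t0 = 0"
    and w: "\<And>t. dist t t0 < \<epsilon> \<Longrightarrow> (w has_vector_derivative w' t) (at t)"
    and bound: "\<And>t. dist t t0 < \<epsilon> \<Longrightarrow> norm (w' t) \<le> L * norm (w t)"
  shows "\<exists>\<eta>>0. \<forall>t. dist t t0 < \<eta> \<longrightarrow> w t = 0"
proof -
  define \<eta> where "\<eta> = min (\<epsilon>/2) (1 / (2 * (L + 1)))"
  have \<eta>: "\<eta> > 0" "\<eta> < \<epsilon>" "L * \<eta> \<le> 1/2"
  proof -
    show "\<eta> > 0" "\<eta> < \<epsilon>" using assms(1,2) by (auto simp: \<eta>_def)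
    have "L * \<eta> \<le> L * (1 / (2 * (L + 1)))" using assms(2) by (intro mult_left_mono) (auto simp: \<eta>_def)
    also have "\<dots> \<le> 1/2" using assms(2) by (simp add: field_simps)
    finally show "L * \<eta> \<le> 1/2" .
  qed
  have "continuous_on (cball t0 \<eta>) w"
  proof (rule continuous_at_imp_continuous_on, intro ballI)
    fix t assume "t \<in> cball t0 \<eta>"
    then have "dist t t0 < \<epsilon>" using \<eta>(2) by (simp add: dist_commute)
    from has_vector_derivative_continuous[OF w[OF this]] show "isCont w t" .
  qed
  then have "continuous_on (cball t0 \<eta>) (\<lambda>t. norm (w t))" by (rule continuous_on_norm)
  then obtain t1 where t1: "t1 \<in> cball t0 \<eta>" "\<And>t. t \<in> cball t0 \<eta> \<Longrightarrow> norm (w t) \<le> norm (w t1)"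
    using continuous_attains_sup[of "cball t0 \<eta>" "\<lambda>t. norm (w t)"] \<eta>(1) by (auto simp: compact_cball)
  have "norm (w t1 - w t0) \<le> (L * norm (w t1)) * norm (t1 - t0)"
  proof (rule differentiable_bound[of "cball t0 \<eta>" w "\<lambda>t h. h *\<^sub>R w' t"])
    fix t assume t: "t \<in> cball t0 \<eta>"
    then have t': "dist t t0 < \<epsilon>" using \<eta>(2) by (simp add: dist_commute)
    show "(w has_derivative (\<lambda>h. h *\<^sub>R w' t)) (at t within cball t0 \<eta>)"
      using w[OF t'] unfolding has_vector_derivative_def by (rule has_derivative_at_withinI)
    have "norm (w' t) \<le> L * norm (w t1)"
      using bound[OF t'] mult_left_mono[OF t1(2)[OF t] assms(2)] by simp
    then show "onorm (\<lambda>h. h *\<^sub>R w' t) \<le> L * norm (w t1)"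
      by (intro onorm_le) (simp add: mult.commute[of _ "\<bar>_\<bar>"] mult_left_mono)
  qed (use t1 \<eta> in auto)
  also have "\<dots> \<le> (L * norm (w t1)) * \<eta>"
    using t1(1) assms(2) by (intro mult_left_mono) (auto simp: dist_norm norm_minus_commute)
  also have "\<dots> = (L * \<eta>) * norm (w t1)" by simp
  also have "\<dots> \<le> 1/2 * norm (w t1)" by (rule mult_right_mono[OF \<eta>(3)]) simp
  finally have "norm (w t1) \<le> 0" using assms(3) by simp
  then have "w t = 0" if "t \<in> cball t0 \<eta>" for t using t1(2)[OF that] by simp
  then show ?thesis using \<eta>(1) by (intro exI[of _ \<eta>]) (auto simp: dist_commute)
qed

text \<open>The pair of position and velocity solves a first-order system with the smooth, hence
  locally Lipschitz, field \<open>F\<close>; the difference of two solutions is then controlled by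
  its own size.\<close>

lemma ode2_unique:
  fixes \<Gamma> :: "'e::euclidean_space \<Rightarrow> 'e \<Rightarrow> 'e \<Rightarrow> 'e"
  assumes U: "open U" and s: "\<And>u v. smooth_on U (\<lambda>x. \<Gamma> x u v)" and b: "\<And>x. x \<in> U \<Longrightarrow> bilinear (\<Gamma> x)"
    and "\<epsilon> > 0"
    and x: "\<And>t. dist t t0 < \<epsilon> \<Longrightarrow> x t \<in> U" "\<And>t. dist t t0 < \<epsilon> \<Longrightarrow> (x has_vector_derivative x' t) (at t)"
      "\<And>t. dist t t0 < \<epsilon> \<Longrightarrow> (x' has_vector_derivative - \<Gamma> (x t) (x' t) (x' t)) (at t)"
    and y: "\<And>t. dist t t0 < \<epsilon> \<Longrightarrow> y t \<in> U" "\<And>t. dist t t0 < \<epsilon> \<Longrightarrow> (y has_vector_derivative y' t) (at t)"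
      "\<And>t. dist t t0 < \<epsilon> \<Longrightarrow> (y' has_vector_derivative - \<Gamma> (y t) (y' t) (y' t)) (at t)"
    and init: "x t0 = y t0" "x' t0 = y' t0"
  shows "\<exists>\<eta>>0. \<forall>t. dist t t0 < \<eta> \<longrightarrow> x t = y t \<and> x' t = y' t"
proof -
  define F where "F p = (snd p, - \<Gamma> (fst p) (snd p) (snd p))" for p :: "'e \<times> 'e"
  let ?N = "U \<times> (UNIV :: 'e set)"
  have N: "open ?N" using U by (intro open_Times) auto
  have sG: "smooth_on ?N (\<lambda>p. \<Gamma> (fst p) (snd p) (snd p))"
    by (rule smooth_on_bilinear[OF N s b]) (auto intro: smooth_on_linear linear_fst linear_snd)
  have "F = (\<lambda>p. (\<lambda>u. (u, 0)) (snd p) + (\<lambda>u. (0, - u)) (\<Gamma> (fst p) (snd p) (snd p)))"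
    by (simp add: F_def fun_eq_iff)
  moreover have "smooth_on ?N (\<lambda>p. (\<lambda>u. (u, 0)) (snd p) + (\<lambda>u. (0, - u)) (\<Gamma> (fst p) (snd p) (snd p)))"
    by (intro smooth_on_add[OF N] smooth_on_linear_comp[OF N _ sG] smooth_on_linear linearI)
       (auto intro!: bounded_linear_Pair bounded_linear_minus bounded_linear_ident bounded_linear_zero)
  ultimately have F: "smooth_on ?N F" by simp
  have p: "(x t0, x' t0) \<in> ?N" using x(1)[of t0] assms(4) by simp
  obtain L \<delta> where L: "L \<ge> 0" "\<delta> > 0"
    "\<And>q q'. \<lbrakk>q \<in> ball (x t0, x' t0) \<delta>; q' \<in> ball (x t0, x' t0) \<delta>\<rbrakk> \<Longrightarrow> norm (F q - F q') \<le> L * norm (q - q')"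
    by (rule smooth_on_lipschitz[OF N F p]) blast
  have dX: "((\<lambda>t. (x t, x' t)) has_vector_derivative F (x t, x' t)) (at t)" if "dist t t0 < \<epsilon>" for t
    unfolding F_def using has_vector_derivative_Pair[OF x(2)[OF that] x(3)[OF that]] by simp
  have dY: "((\<lambda>t. (y t, y' t)) has_vector_derivative F (y t, y' t)) (at t)" if "dist t t0 < \<epsilon>" for t
    unfolding F_def using has_vector_derivative_Pair[OF y(2)[OF that] y(3)[OF that]] by simp
  have near: "\<exists>e>0. \<forall>t. dist t t0 < e \<longrightarrow> z t \<in> ball (x t0, x' t0) \<delta>"
    if "(z has_vector_derivative zd) (at t0)" "z t0 = (x t0, x' t0)" for z :: "real \<Rightarrow> 'e \<times> 'e" and zd
  proof -
    have "isCont z t0" using has_vector_derivative_continuous[OF that(1)] .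
    then have "\<exists>e>0. \<forall>t. dist t t0 < e \<longrightarrow> dist (z t) (z t0) < \<delta>"
      using L(2) unfolding continuous_at_eps_delta by blast
    then show ?thesis using that(2) by (simp add: dist_commute)
  qed
  obtain e1 where e1: "e1 > 0" "\<And>t. dist t t0 < e1 \<Longrightarrow> (x t, x' t) \<in> ball (x t0, x' t0) \<delta>"
    using near[OF dX[of t0]] assms(4) by auto
  obtain e2 where e2: "e2 > 0" "\<And>t. dist t t0 < e2 \<Longrightarrow> (y t, y' t) \<in> ball (x t0, x' t0) \<delta>"
    using near[OF dY[of t0]] assms(4) init by auto
  define w where "w t = (x t, x' t) - (y t, y' t)" for t
  have "\<exists>\<eta>>0. \<forall>t. dist t t0 < \<eta> \<longrightarrow> w t = 0"
  proof (rule lipschitz_ode_unique[where \<epsilon> = "min \<epsilon> (min e1 e2)" and w' = "\<lambda>t. F (x t, x' t) - F (y t, y' t)"])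
    show "min \<epsilon> (min e1 e2) > 0" using e1(1) e2(1) assms(4) by simp
    show "w t0 = 0" using init by (simp add: w_def)
    fix t assume t: "dist t t0 < min \<epsilon> (min e1 e2)"
    show "(w has_vector_derivative F (x t, x' t) - F (y t, y' t)) (at t)"
      unfolding w_def using t by (intro has_vector_derivative_diff dX dY) auto
    show "norm (F (x t, x' t) - F (y t, y' t)) \<le> L * norm (w t)"
      unfolding w_def by (rule L(3)) (use e1(2) e2(2) t in auto)
  qed (rule L(1))
  then show ?thesis by (simp add: w_def zero_prod_def)
qed

subsection \<open>Geodesics\<close>

lemma real_dd:
  fixes F :: "real \<Rightarrow> 'e::real_normed_vector"
  assumes "F differentiable at t"
  shows "(F has_vector_derivative dd F t 1) (at t)" "vector_derivative F (at t) = dd F t 1"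
proof -
  show "(F has_vector_derivative dd F t 1) (at t)"
    using line_deriv[of F 0 t 1] assms by simp
  then show "vector_derivative F (at t) = dd F t 1" by (rule vector_derivative_at)
qed

context mfd begin

lemma smooth_param_euclidean:
  assumes "smooth_map (euclidean_manifold B) M E" "open B" shows "smooth_param M B E"
proof -
  have c: "continuous_on B E" "E ` B \<subseteq> carrier M"
    and s: "\<And>d. d \<in> atlas M \<Longrightarrow> smooth_on (id ` (B \<inter> E -` cdom d)) (cmap d \<circ> E \<circ> cinv (Chart B id))"
    using assms(1) by (auto simp: smooth_map_def euclidean_manifold_def)
  have "smooth_on (B \<inter> E -` cdom d) (cmap d \<circ> E)" if d: "d \<in> atlas M" for d
  proof -
    have "openin (top_of_set B) (B \<inter> E -` cdom d)"
      using c openin_cdom[OF d] by (intro continuous_openin_preimage[of B E "carrier M"]) auto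
    then have o: "open (B \<inter> E -` cdom d)" using assms(2) openin_open_trans by blast
    \<comment> \<open>The inverse of the chart \<open>Chart B id\<close> is the identity only on
      \<open>B\<close>, so the equality is claimed for the relevant points alone.\<close>
    have "(cmap d \<circ> E \<circ> cinv (Chart B id)) x = (cmap d \<circ> E) x" if "x \<in> B \<inter> E -` cdom d" for x
      using that f_inv_into_f[of x id B] by (simp add: cinv_def)
    note eq = this
    have "id ` (B \<inter> E -` cdom d) = B \<inter> E -` cdom d" by simp
    from smooth_on_cong[OF o eq s[OF d, unfolded this]] show ?thesis .
  qed
  then show ?thesis using c assms(2) by (simp add: smooth_param_def)
qed

lemma smooth_param_imp_smooth_map:
  assumes "smooth_param M B E" shows "smooth_map (euclidean_manifold B) M E"
proof -
  have eq: "(cmap d \<circ> E) x = (cmap d \<circ> E \<circ> cinv (Chart B id)) x" if "x \<in> B \<inter> E -` cdom d" for x d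
    using that f_inv_into_f[of x id B] by (simp add: cinv_def)
  have "smooth_on (B \<inter> E -` cdom d) (cmap d \<circ> E \<circ> cinv (Chart B id))" if "d \<in> atlas M" for d
    using smooth_on_cong[OF param_chart_open[OF assms that] eq param_chart_smooth[OF assms that]] .
  then show ?thesis using assms by (auto simp: smooth_map_def euclidean_manifold_def smooth_param_def)
qed

lemma velocity_eq:
  assumes "smooth_param M V \<gamma>" "t \<in> V"
  shows "velocity M \<gamma> t = dd (cmap (chart_at M (\<gamma> t)) \<circ> \<gamma>) t 1"
  unfolding velocity_def
  by (rule real_dd(2)[OF smooth_on_differentiable[OF param_chart_smooth[OF assms(1)]]])
     (use chart_at[OF param_carrier[OF assms]] assms(2) in auto)

end

context riem begin

text \<open>For linear \<open>F\<close> the term with \<open>d2 F\<close> vanishes; this is how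
  geodesics are rescaled and how the exponential map is restricted to rays.\<close>

lemma hess_compose:
  fixes F :: "'f::euclidean_space \<Rightarrow> 'g::euclidean_space"
  assumes X: "smooth_param M V X" and F: "open W" "smooth_on W F" "\<And>y. y \<in> W \<Longrightarrow> F y \<in> V"
    and y: "y \<in> W" and d: "d \<in> atlas M" "X (F y) \<in> cdom d"
  shows "dd (cmap d \<circ> (\<lambda>y. X (F y))) y a = dd (cmap d \<circ> X) (F y) (dd F y a)" (is ?A)
    and "hess M g d (\<lambda>y. X (F y)) y a b = hess M g d X (F y) (dd F y a) (dd F y b)
      + dd (cmap d \<circ> X) (F y) (d2 F y a b)" (is ?B)
proof -
  let ?W = "W \<inter> (\<lambda>y. X (F y)) -` cdom d"
  note P = smooth_param_compose[OF X F]
  have W: "open ?W" "y \<in> ?W" using param_chart_open[OF P d(1)] y d by auto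
  note sX = param_chart_smooth[OF X d(1)] and oX = param_chart_open[OF X d(1)]
  have sF: "smooth_on ?W F" by (rule smooth_on_subset[OF F(2)]) auto
  have inV: "F z \<in> V \<inter> X -` cdom d" if "z \<in> ?W" for z using that F(3) by auto
  have c: "cmap d \<circ> (\<lambda>y. X (F y)) = (\<lambda>y. (cmap d \<circ> X) (F y))" by (simp add: fun_eq_iff)
  have 1: "dd (cmap d \<circ> (\<lambda>y. X (F y))) y a = dd (cmap d \<circ> X) (F y) (dd F y a)" for a
    unfolding c by (rule dd_compose[OF sX smooth_on_differentiable[OF sF W(2)] inV[OF W(2)]])
  then show ?A .
  have 2: "d2 (cmap d \<circ> (\<lambda>y. X (F y))) y a b = d2 (cmap d \<circ> X) (F y) (dd F y a) (dd F y b)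
      + dd (cmap d \<circ> X) (F y) (d2 F y a b)"
    unfolding c by (rule d2_compose[OF oX sX W(1) sF W(2) inV])
  show ?B unfolding hess_def 1 2 by simp
qed

text \<open>The definition fixes the preferred chart at each time \<open>t\<close>; near that time
  its nested vector derivatives are ordinary derivatives of one coordinate curve.\<close>

lemma geodesic_iff:
  "geodesic M g \<gamma> \<longleftrightarrow> smooth_param M UNIV \<gamma> \<and> (\<forall>t. hess M g (chart_at M (\<gamma> t)) \<gamma> t 1 1 = 0)"
proof -
  have sm: "smooth_map (euclidean_manifold UNIV) M \<gamma> \<longleftrightarrow> smooth_param M UNIV \<gamma>"
    using smooth_param_euclidean smooth_param_imp_smooth_map by blast
  have "(let c = chart_at M (\<gamma> t); x = cmap c \<circ> \<gamma>; x' = (\<lambda>s. vector_derivative x (at s))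
          in vector_derivative x' (at t) + christoffel M g c (x t) (x' t) (x' t) = 0)
     \<longleftrightarrow> hess M g (chart_at M (\<gamma> t)) \<gamma> t 1 1 = 0" if P: "smooth_param M UNIV \<gamma>" for t
  proof -
    let ?c = "chart_at M (\<gamma> t)"
    let ?x = "cmap ?c \<circ> \<gamma>" and ?W = "UNIV \<inter> \<gamma> -` cdom ?c"
    note c = chart_at[OF param_carrier[OF P UNIV_I]]
    have W: "open ?W" "t \<in> ?W" and s: "smooth_on ?W ?x"
      using param_chart_open[OF P c(1)] c(2) param_chart_smooth[OF P c(1)] by auto
    have x': "vector_derivative ?x (at s) = dd ?x s 1" if "s \<in> ?W" for s
      by (rule real_dd(2)[OF smooth_on_differentiable[OF s that]])
    have "((\<lambda>s. dd ?x s 1) has_vector_derivative d2 ?x t 1 1) (at t)"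
      by (rule real_dd(1)[OF smooth_on_differentiable[OF smooth_on_dd[OF s] W(2)]])
    then have "((\<lambda>s. vector_derivative ?x (at s)) has_vector_derivative d2 ?x t 1 1) (at t)"
      by (rule has_vector_derivative_transform_within_open[OF _ W]) (simp only: x')
    then have "vector_derivative (\<lambda>s. vector_derivative ?x (at s)) (at t) = d2 ?x t 1 1"
      by (rule vector_derivative_at)
    then show ?thesis
      unfolding Let_def hess_def christoffel_eq_chr by (simp only: x'[OF W(2)] comp_apply)
  qed
  then show ?thesis unfolding geodesic_def sm by blast
qed

lemma geodesic_hess:
  assumes "geodesic M g \<gamma>" "d \<in> atlas M" "\<gamma> t \<in> cdom d"
  shows "hess M g d \<gamma> t 1 1 = 0"
proof -
  have P: "smooth_param M UNIV \<gamma>" and h: "hess M g (chart_at M (\<gamma> t)) \<gamma> t 1 1 = 0"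
    using assms(1) by (auto simp: geodesic_iff)
  note c = chart_at[OF param_carrier[OF P UNIV_I]]
  show ?thesis
    using hess_change[OF P UNIV_I c assms(2,3)] h linear_0[OF transition_linear(1)[OF c(1) assms(2) c(2) assms(3)]] by simp
qed

lemma geodesic_scale:
  assumes "geodesic M g \<gamma>" shows "geodesic M g (\<lambda>t. \<gamma> (c * t))"
    "velocity M (\<lambda>t. \<gamma> (c * t)) 0 = c *\<^sub>R velocity M \<gamma> 0"
proof -
  let ?F = "\<lambda>t. c * t :: real"
  have P: "smooth_param M UNIV \<gamma>" using assms by (simp add: geodesic_iff)
  have sF: "smooth_on UNIV ?F" by (intro smooth_on_mult) auto
  have dF: "dd ?F t a = c * a" for t a
  proof -
    have "(?F has_derivative (\<lambda>h. c * h)) (at t)" by (auto intro!: derivative_eq_intros)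
    then show ?thesis by (simp add: dd_eqI)
  qed
  have d2F: "d2 ?F t a b = 0" for t a b by (simp add: dF)
  have P': "smooth_param M UNIV (\<lambda>t. \<gamma> (c * t))" by (rule smooth_param_compose[OF P open_UNIV sF UNIV_I])
  have "hess M g (chart_at M (\<gamma> (c * t))) (\<lambda>t. \<gamma> (c * t)) t 1 1 = 0" for t
  proof -
    let ?d = "chart_at M (\<gamma> (c * t))"
    note d = chart_at[OF param_carrier[OF P UNIV_I, of "c * t"]]
    have s: "smooth_on (UNIV \<inter> \<gamma> -` cdom ?d) (cmap ?d \<circ> \<gamma>)" by (rule param_chart_smooth[OF P d(1)])
    have l: "c * t \<in> UNIV \<inter> \<gamma> -` cdom ?d" using d by simp
    interpret m: metric_on "cimage ?d" "local_metric M g ?d" by (rule metric_on_chart[OF d(1)])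
    have "d2 (cmap ?d \<circ> \<gamma>) (c * t) (c *\<^sub>R 1) (c *\<^sub>R 1) = c *\<^sub>R c *\<^sub>R d2 (cmap ?d \<circ> \<gamma>) (c * t) 1 1"
      by (simp only: bilinear_lmul[OF d2_bilinear[OF param_chart_open[OF P d(1)] l s]]
         bilinear_rmul[OF d2_bilinear[OF param_chart_open[OF P d(1)] l s]])
    moreover have "dd (cmap ?d \<circ> \<gamma>) (c * t) (c *\<^sub>R 1) = c *\<^sub>R dd (cmap ?d \<circ> \<gamma>) (c * t) 1"
      by (rule linear_cmul[OF smooth_on_linear_dd[OF s l]])
    ultimately have "hess M g ?d \<gamma> (c * t) (c *\<^sub>R 1) (c *\<^sub>R 1) = c *\<^sub>R c *\<^sub>R hess M g ?d \<gamma> (c * t) 1 1"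
      unfolding hess_def by (simp add: bilinear_simps[OF m.chr_bilinear[OF cmap_cimage[OF d(2)]]] scaleR_add_right)
    moreover have "hess M g ?d \<gamma> (c * t) 1 1 = 0" using geodesic_hess[OF assms d] .
    moreover have "linear (dd (cmap ?d \<circ> \<gamma>) (c * t))" using smooth_on_linear_dd[OF s l] .
    ultimately show ?thesis
      using hess_compose(2)[OF P open_UNIV sF UNIV_I UNIV_I d, of 1 1] by (simp add: dF d2F linear_0)
  qed
  then show "geodesic M g (\<lambda>t. \<gamma> (c * t))" using P' by (simp add: geodesic_iff)
  let ?d = "chart_at M (\<gamma> 0)"
  note d = chart_at[OF param_carrier[OF P UNIV_I, of 0]]
  have "dd (cmap ?d \<circ> (\<lambda>t. \<gamma> (c * t))) 0 1 = dd (cmap ?d \<circ> \<gamma>) (c * 0) (dd ?F 0 1)"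
    by (rule hess_compose(1)[OF P open_UNIV sF UNIV_I UNIV_I]) (use d in auto)
  moreover have "linear (dd (cmap ?d \<circ> \<gamma>) 0)"
    using smooth_on_linear_dd[OF param_chart_smooth[OF P d(1)], of 0] d by auto
  ultimately show "velocity M (\<lambda>t. \<gamma> (c * t)) 0 = c *\<^sub>R velocity M \<gamma> 0"
    using velocity_eq[OF P UNIV_I, of 0] velocity_eq[OF P' UNIV_I, of 0] linear_cmul[of "dd (cmap ?d \<circ> \<gamma>) 0" c 1]
    by (simp add: dF)
qed

text \<open>The times at which position and velocity agree form a nonempty set, closed by continuity
  and open by local uniqueness for the geodesic equation. Both arguments run in a fixed chart;
  \<open>vel\<close> translates between agreement of velocities there and in the preferred
  charts.\<close>

lemma geodesic_unique:
  assumes g1: "geodesic M g \<gamma>1" and g2: "geodesic M g \<gamma>2"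
    and init: "\<gamma>1 0 = \<gamma>2 0" "velocity M \<gamma>1 0 = velocity M \<gamma>2 0"
  shows "\<gamma>1 = \<gamma>2"
proof -
  have P1: "smooth_param M UNIV \<gamma>1" and P2: "smooth_param M UNIV \<gamma>2"
    using g1 g2 by (auto simp: geodesic_iff)
  have vel: "velocity M \<gamma>1 t = velocity M \<gamma>2 t \<longleftrightarrow> dd (cmap d \<circ> \<gamma>1) t 1 = dd (cmap d \<circ> \<gamma>2) t 1"
    if "\<gamma>1 t = \<gamma>2 t" "d \<in> atlas M" "\<gamma>1 t \<in> cdom d" for t d
  proof -
    let ?c = "chart_at M (\<gamma>1 t)"
    note c = chart_at[OF param_carrier[OF P1 UNIV_I, of t]]
    have "dd (cmap d \<circ> \<gamma>1) t 1 = dd (cmap d \<circ> cinv ?c) (cmap ?c (\<gamma>1 t)) (velocity M \<gamma>1 t)"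
      using param_change(1)[OF P1 UNIV_I c that(2,3)] velocity_eq[OF P1 UNIV_I] by simp
    moreover have c2: "\<gamma>2 t \<in> cdom ?c" "\<gamma>2 t \<in> cdom d" using c(2) that(1,3) by simp_all
    have "dd (cmap d \<circ> \<gamma>2) t 1 = dd (cmap d \<circ> cinv ?c) (cmap ?c (\<gamma>1 t)) (velocity M \<gamma>2 t)"
      using param_change(1)[OF P2 UNIV_I c(1) c2(1) that(2) c2(2)]
        velocity_eq[OF P2 UNIV_I, of t] by (simp add: that(1))
    ultimately show ?thesis
      using inj_eq[OF transition_linear(2)[OF c(1) that(2) c(2) that(3)]] by simp
  qed
  define A where "A = {t. \<gamma>1 t = \<gamma>2 t \<and> velocity M \<gamma>1 t = velocity M \<gamma>2 t}"
  have cont: "continuous_on UNIV \<gamma>1" "continuous_on UNIV \<gamma>2" using P1 P2 by (auto simp: smooth_param_def)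
  have cl: "closed {t. \<gamma>1 t = \<gamma>2 t}" using closed_Collect_eq[OF cont] .
  have chart: "\<exists>d W. d \<in> atlas M \<and> open W \<and> t0 \<in> W \<and> (\<forall>t\<in>W. \<gamma>1 t \<in> cdom d \<and> \<gamma>2 t \<in> cdom d)
      \<and> smooth_on W (cmap d \<circ> \<gamma>1) \<and> smooth_on W (cmap d \<circ> \<gamma>2)" if "\<gamma>1 t0 = \<gamma>2 t0" for t0
  proof -
    let ?d = "chart_at M (\<gamma>1 t0)"
    let ?W = "(UNIV \<inter> \<gamma>1 -` cdom ?d) \<inter> (UNIV \<inter> \<gamma>2 -` cdom ?d)"
    note d = chart_at[OF param_carrier[OF P1 UNIV_I, of t0]]
    have "open ?W" by (intro open_Int param_chart_open[OF P1 d(1)] param_chart_open[OF P2 d(1)])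
    moreover have "smooth_on ?W (cmap ?d \<circ> \<gamma>1)" "smooth_on ?W (cmap ?d \<circ> \<gamma>2)"
      using smooth_on_subset[OF param_chart_smooth[OF P1 d(1)]] smooth_on_subset[OF param_chart_smooth[OF P2 d(1)]] by auto
    ultimately show ?thesis using d that by (intro exI[of _ ?d] exI[of _ ?W]) auto
  qed
  have "closed A"
    unfolding closed_limpt
  proof (intro allI impI)
    fix t0 assume t0: "t0 islimpt A"
    have "A \<subseteq> {t. \<gamma>1 t = \<gamma>2 t}" by (auto simp: A_def)
    then have eq: "\<gamma>1 t0 = \<gamma>2 t0" using cl t0 islimpt_subset closed_limpt by blast
    obtain d W where W: "d \<in> atlas M" "open W" "t0 \<in> W" "\<forall>t\<in>W. \<gamma>1 t \<in> cdom d \<and> \<gamma>2 t \<in> cdom d"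
      "smooth_on W (cmap d \<circ> \<gamma>1)" "smooth_on W (cmap d \<circ> \<gamma>2)" using chart[OF eq] by blast
    let ?D = "\<lambda>t. dd (cmap d \<circ> \<gamma>1) t 1 - dd (cmap d \<circ> \<gamma>2) t 1"
    have "continuous_on W ?D"
      by (intro continuous_on_diff smooth_on_continuous smooth_on_dd W)
    then have c: "isCont ?D t0" using W(2,3) continuous_on_eq_continuous_at by blast
    have zero: "?D t = 0" if t: "t \<in> A" "t \<in> W" for t
    proof -
      have e: "\<gamma>1 t = \<gamma>2 t" "velocity M \<gamma>1 t = velocity M \<gamma>2 t" using t by (auto simp: A_def)
      show ?thesis using vel[OF e(1) W(1)] e(2) W(4) t(2) by simp
    qed
    have "?D t0 = 0"
    proof (rule ccontr)
      assume "?D t0 \<noteq> 0"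
      then have "\<forall>\<^sub>F t in at t0. ?D t \<noteq> 0" using c unfolding isCont_def by (rule tendsto_imp_eventually_ne[rotated])
      then have "\<forall>\<^sub>F t in at t0. ?D t \<noteq> 0 \<and> t \<in> W"
        using eventually_at_in_open'[OF W(2,3)] eventually_conj by blast
      moreover have "\<exists>\<^sub>F t in at t0. t \<in> A" using t0 by (simp add: islimpt_conv_frequently_at)
      ultimately have "\<exists>\<^sub>F t in at t0. t \<in> A \<and> ?D t \<noteq> 0 \<and> t \<in> W" by (rule frequently_eventually_frequently[rotated])
      then show False using zero frequently_ex by blast
    qed
    then show "t0 \<in> A" using eq vel[OF eq W(1)] W(3,4) by (simp add: A_def)
  qed
  moreover have "open A"
    unfolding open_dist
  proof
    fix t0 assume t0: "t0 \<in> A"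
    then have eq: "\<gamma>1 t0 = \<gamma>2 t0" by (simp add: A_def)
    obtain d W where W: "d \<in> atlas M" "open W" "t0 \<in> W" "\<forall>t\<in>W. \<gamma>1 t \<in> cdom d \<and> \<gamma>2 t \<in> cdom d"
      "smooth_on W (cmap d \<circ> \<gamma>1)" "smooth_on W (cmap d \<circ> \<gamma>2)" using chart[OF eq] by blast
    interpret m: metric_on "cimage d" "local_metric M g d" by (rule metric_on_chart[OF W(1)])
    obtain \<epsilon> where \<epsilon>: "\<epsilon> > 0" "\<And>t. dist t t0 < \<epsilon> \<Longrightarrow> t \<in> W" using W(2,3) unfolding open_dist by blast
    have ode: "(cmap d \<circ> \<gamma>) t \<in> cimage d"
       "((cmap d \<circ> \<gamma>) has_vector_derivative dd (cmap d \<circ> \<gamma>) t 1) (at t)"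
       "((\<lambda>t. dd (cmap d \<circ> \<gamma>) t 1) has_vector_derivative
          - chr (local_metric M g d) ((cmap d \<circ> \<gamma>) t) (dd (cmap d \<circ> \<gamma>) t 1) (dd (cmap d \<circ> \<gamma>) t 1)) (at t)"
      if "geodesic M g \<gamma>" "smooth_on W (cmap d \<circ> \<gamma>)" "\<forall>t\<in>W. \<gamma> t \<in> cdom d" "dist t t0 < \<epsilon>" for \<gamma> t
    proof -
      have t: "t \<in> W" using \<epsilon>(2) that(4) by blast
      show "(cmap d \<circ> \<gamma>) t \<in> cimage d" using cmap_cimage[OF bspec[OF that(3) t]] by simp
      show "((cmap d \<circ> \<gamma>) has_vector_derivative dd (cmap d \<circ> \<gamma>) t 1) (at t)"
        by (rule real_dd(1)[OF smooth_on_differentiable[OF that(2) t]])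
      have "((\<lambda>t. dd (cmap d \<circ> \<gamma>) t 1) has_vector_derivative d2 (cmap d \<circ> \<gamma>) t 1 1) (at t)"
        by (rule real_dd(1)[OF smooth_on_differentiable[OF smooth_on_dd[OF that(2)] t]])
      moreover have "hess M g d \<gamma> t 1 1 = 0" using geodesic_hess[OF that(1) W(1)] that(3) t by blast
      ultimately show "((\<lambda>t. dd (cmap d \<circ> \<gamma>) t 1) has_vector_derivative
          - chr (local_metric M g d) ((cmap d \<circ> \<gamma>) t) (dd (cmap d \<circ> \<gamma>) t 1) (dd (cmap d \<circ> \<gamma>) t 1)) (at t)"
        by (simp add: hess_def add_eq_0_iff2)
    qed
    have w1: "\<forall>t\<in>W. \<gamma>1 t \<in> cdom d" and w2: "\<forall>t\<in>W. \<gamma>2 t \<in> cdom d" using W(4) by auto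
    note o1 = ode[OF g1 W(5) w1] and o2 = ode[OF g2 W(6) w2]
    have "\<exists>\<eta>>0. \<forall>t. dist t t0 < \<eta> \<longrightarrow> (cmap d \<circ> \<gamma>1) t = (cmap d \<circ> \<gamma>2) t \<and>
        dd (cmap d \<circ> \<gamma>1) t 1 = dd (cmap d \<circ> \<gamma>2) t 1"
      by (rule ode2_unique[OF m.open_dom m.smooth_chr m.chr_bilinear \<epsilon>(1) o1 o2])
         (use eq t0 vel[OF eq W(1)] W(3,4) in \<open>auto simp: A_def\<close>)
    then obtain \<eta> where \<eta>: "\<eta> > 0" "\<And>t. dist t t0 < \<eta> \<Longrightarrow> (cmap d \<circ> \<gamma>1) t = (cmap d \<circ> \<gamma>2) t \<and>
        dd (cmap d \<circ> \<gamma>1) t 1 = dd (cmap d \<circ> \<gamma>2) t 1" by blast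
    have "t \<in> A" if "dist t t0 < min \<epsilon> \<eta>" for t
    proof -
      have t: "\<gamma>1 t \<in> cdom d" "\<gamma>2 t \<in> cdom d" using W(4) \<epsilon>(2)[of t] that by simp_all
      have e: "cmap d (\<gamma>1 t) = cmap d (\<gamma>2 t)" "dd (cmap d \<circ> \<gamma>1) t 1 = dd (cmap d \<circ> \<gamma>2) t 1"
        using \<eta>(2)[of t] that by simp_all
      have eq: "\<gamma>1 t = \<gamma>2 t"
        using cinv_cmap[OF W(1) t(1)] unfolding e(1) cinv_cmap[OF W(1) t(2)] by simp
      show ?thesis using vel[OF eq W(1) t(1)] e(2) eq by (simp add: A_def)
    qed
    then show "\<exists>e>0. \<forall>t. dist t t0 < e \<longrightarrow> t \<in> A" using \<epsilon>(1) \<eta>(1) by (intro exI[of _ "min \<epsilon> \<eta>"]) auto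
  qed
  moreover have "0 \<in> A" using init by (simp add: A_def)
  ultimately have "A = UNIV" using clopen[of A] by auto
  then show ?thesis by (auto simp: A_def)
qed

text \<open>Rescaling the geodesic by \<open>t\<close> gives a witness for the definite description
  in \<open>exp_map\<close>, and uniqueness of geodesics makes its endpoint the only
  candidate.\<close>

lemma exp_map_geodesic:
  assumes "geodesic M g \<gamma>" "\<gamma> 0 = p" "velocity M \<gamma> 0 = v"
  shows "exp_map M g p (t *\<^sub>R v) = \<gamma> t"
proof -
  have "geodesic M g (\<lambda>s. \<gamma> (t * s)) \<and> (\<lambda>s. \<gamma> (t * s)) 0 = p \<and> velocity M (\<lambda>s. \<gamma> (t * s)) 0 = t *\<^sub>R v \<and> (\<lambda>s. \<gamma> (t * s)) 1 = \<gamma> t"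
    using geodesic_scale[OF assms(1), of t] assms by simp
  moreover have "\<gamma>' 1 = \<gamma> t" if "geodesic M g \<gamma>'" "\<gamma>' 0 = p" "velocity M \<gamma>' 0 = t *\<^sub>R v" for \<gamma>'
    using geodesic_unique[OF that(1) geodesic_scale(1)[OF assms(1), of t]] that geodesic_scale(2)[OF assms(1), of t] assms by simp
  ultimately show ?thesis unfolding exp_map_def by (intro the_equality) blast+
qed

end

subsection \<open>Normal coordinates\<close>

text \<open>\<open>R\<close> is some radius at which the exponential map is a diffeomorphism onto an
  open set. Working with it avoids the question whether the supremum defining the injectivity radius
  is attained.\<close>

locale normal_ball = riem M g
  for M :: "('a::{t2_space, second_countable_topology}, real^'m) manifold" and g +
  fixes p :: 'a and R :: real
  assumes p: "p \<in> carrier M" and complete: "complete_metric M g" and R: "0 < R"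
    and openin_W: "openin (top_of_set (carrier M)) (exp_map M g p ` {v. sqrt (g p v v) < R})"
    and diffeo: "diffeomorphism (euclidean_manifold {v. sqrt (g p v v) < R})
       (open_submanifold M (exp_map M g p ` {v. sqrt (g p v v) < R})) (exp_map M g p)"
begin

definition B where "B = {v. sqrt (g p v v) < R}"
definition E where "E = exp_map M g p"
definition W where "W = E ` B"
definition \<Phi> where "\<Phi> = inv_into B E"
text \<open>The metric in normal coordinates, in which the geodesics from \<open>p\<close> are
  straight rays.\<close>

definition N where "N = param_metric M g E"
definition rad where "rad v = sqrt (g p v v)"

lemma gp: "inner_form (g p)" using g_inner[OF p] .

lemmas gp_simps = bilinear_simps[OF inner_formD(1)[OF gp]]

lemma smooth_gp: "smooth_on UNIV (\<lambda>v. g p v v)"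
  using smooth_on_bilinear[of UNIV UNIV "\<lambda>_. g p" "\<lambda>v. v" "\<lambda>v. v" "\<lambda>v. v"] inner_formD(1)[OF gp] by simp

lemma continuous_rad: "continuous_on UNIV rad"
  unfolding rad_def using smooth_on_continuous[OF smooth_gp] by (intro continuous_intros)

lemma rad_scale: "rad (t *\<^sub>R v) = \<bar>t\<bar> * rad v"
  by (simp add: rad_def gp_simps real_sqrt_mult flip: power2_eq_square mult.assoc)

lemma rad_nonneg: "rad v \<ge> 0" and rad_eq_0: "rad v = 0 \<longleftrightarrow> v = 0" and rad_sq: "(rad v)\<^sup>2 = g p v v"
  using inner_formD(4,5)[OF gp] by (auto simp: rad_def)

lemma B_iff: "v \<in> B \<longleftrightarrow> rad v < R" by (simp add: B_def rad_def)

lemma open_B: "open B"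
proof -
  have "B = rad -` {..<R}" by (auto simp: B_iff)
  then show ?thesis using continuous_rad by (simp add: continuous_on_open_vimage open_lessThan)
qed

lemma zero_B: "0 \<in> B" using R by (simp add: B_iff rad_eq_0[THEN iffD2])

lemma scale_B: "v \<in> B \<Longrightarrow> \<bar>t\<bar> \<le> 1 \<Longrightarrow> t *\<^sub>R v \<in> B"
  using mult_right_mono[OF _ rad_nonneg, of "\<bar>t\<bar>" 1 v] by (simp add: B_iff rad_scale)

lemma W_sub: "W \<subseteq> carrier M" and openin_W': "openin (top_of_set (carrier M)) W"
  using openin_W openin_imp_subset unfolding W_def B_def E_def by blast+

lemma diffeo': "diffeomorphism (euclidean_manifold B) (open_submanifold M W) E"
  using diffeo by (simp add: B_def W_def E_def)

lemma E_param: "smooth_param M B E"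
proof (rule smooth_param_euclidean[OF _ open_B])
  have sm: "smooth_map (euclidean_manifold B) (open_submanifold M W) E"
    using diffeo' by (simp add: diffeomorphism_def)
  have "smooth_on (cmap c ` (cdom c \<inter> E -` cdom d)) (cmap d \<circ> E \<circ> cinv c)"
    if "c \<in> atlas (euclidean_manifold B)" "d \<in> atlas M" for c d
  proof -
    have "c = Chart B id" using that(1) by (simp add: euclidean_manifold_def)
    then have "cdom c \<inter> E -` cdom d = cdom c \<inter> E -` (cdom d \<inter> W)" by (auto simp: W_def)
    moreover have "Chart (cdom d \<inter> W) (cmap d) \<in> atlas (open_submanifold M W)"
      using that(2) by (simp add: open_submanifold_def)
    then have "smooth_on (cmap c ` (cdom c \<inter> E -` (cdom d \<inter> W))) (cmap d \<circ> E \<circ> cinv c)"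
      using sm that(1) unfolding smooth_map_def by fastforce
    ultimately show ?thesis by simp
  qed
  then show "smooth_map (euclidean_manifold B) M E"
    using sm by (auto simp: smooth_map_def open_submanifold_def)
qed

lemma E_inj: "inj_on E B"
  using diffeo' by (simp add: diffeomorphism_def bij_betw_def euclidean_manifold_def)

lemma \<Phi>_E: "v \<in> B \<Longrightarrow> \<Phi> (E v) = v" unfolding \<Phi>_def by (rule inv_into_f_f[OF E_inj])

lemma E_\<Phi>: "q \<in> W \<Longrightarrow> E (\<Phi> q) = q" unfolding \<Phi>_def W_def by (rule f_inv_into_f)

lemma \<Phi>_B: "q \<in> W \<Longrightarrow> \<Phi> q \<in> B" unfolding \<Phi>_def W_def by (rule inv_into_into)

lemma E_W: "v \<in> B \<Longrightarrow> E v \<in> W" by (simp add: W_def)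

lemma \<Phi>_smooth_map: "smooth_map (open_submanifold M W) (euclidean_manifold B) \<Phi>"
  using diffeo' by (simp add: diffeomorphism_def \<Phi>_def euclidean_manifold_def)

lemma \<Phi>_continuous: "continuous_on W \<Phi>"
  using \<Phi>_smooth_map W_sub by (simp add: smooth_map_def open_submanifold_def Int_absorb1)

text \<open>Smoothness of \<Phi> is given for the charts of \<open>open_submanifold M W\<close>,
  whose domains are smaller; their inverses are shown to agree with \<open>cinv d\<close> on the
  image of the smaller domain.\<close>

lemma \<Phi>_chart_smooth:
  assumes d: "d \<in> atlas M"
  shows "smooth_on (cmap d ` (cdom d \<inter> W)) (\<Phi> \<circ> cinv d)"
proof -
  let ?c = "Chart (cdom d \<inter> W) (cmap d)"
  have "?c \<in> atlas (open_submanifold M W)" using d by (simp add: open_submanifold_def)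
  then have s: "smooth_on (cmap ?c ` (cdom ?c \<inter> \<Phi> -` cdom (Chart B id))) (cmap (Chart B id) \<circ> \<Phi> \<circ> cinv ?c)"
    using \<Phi>_smooth_map unfolding smooth_map_def euclidean_manifold_def by fastforce
  have set: "cmap ?c ` (cdom ?c \<inter> \<Phi> -` cdom (Chart B id)) = cmap d ` (cdom d \<inter> W)"
    using \<Phi>_B by auto
  have "cmap d ` (cdom d \<inter> W) = cimage d \<inter> cinv d -` W"
    using cinv_cmap[OF d] cmap_cimage cinv_cdom[of _ d] cmap_cinv[of _ d] by (force simp: image_iff)
  moreover have "openin (top_of_set (cimage d)) (cimage d \<inter> cinv d -` W)"
    using continuous_cinv[OF d] openin_W' cinv_cdom[of _ d] cdom_sub[OF d]
    by (intro continuous_openin_preimage[of _ _ "carrier M"]) auto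
  ultimately have o: "open (cmap d ` (cdom d \<inter> W))"
    using openin_open_trans open_cimage[OF d] by metis
  have inj: "inj_on (cmap d) (cdom d)" using cinv_cmap[OF d] by (rule inj_on_inverseI)
  have "cinv ?c y = cinv d y" if "y \<in> cmap d ` (cdom d \<inter> W)" for y
  proof -
    obtain q where q: "q \<in> cdom d \<inter> W" "y = cmap d q" using \<open>y \<in> _\<close> by blast
    have "inv_into (cdom d \<inter> W) (cmap d) (cmap d q) = q"
      using inv_into_f_f[OF inj_on_subset[OF inj] q(1)] by auto
    then show ?thesis using q cinv_cmap[OF d, of q] by (simp add: cinv_def)
  qed
  then show ?thesis
    by (intro smooth_on_cong[OF o _ s[unfolded set]]) simp
qed

lemma \<Phi>_smooth:
  assumes X: "smooth_param M V X" and XW: "\<And>x. x \<in> V \<Longrightarrow> X x \<in> W"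
  shows "smooth_on V (\<lambda>x. \<Phi> (X x))"
proof (rule smooth_on_local[OF _ param_open[OF X]])
  fix x assume x: "x \<in> V"
  let ?d = "chart_at M (X x)"
  note d = chart_at[OF param_carrier[OF X x]]
  let ?O = "V \<inter> X -` cdom ?d"
  have "smooth_on ?O (\<lambda>x. (\<Phi> \<circ> cinv ?d) ((cmap ?d \<circ> X) x))"
    by (rule smooth_on_compose[OF param_chart_open[OF X d(1)] \<Phi>_chart_smooth[OF d(1)] param_chart_smooth[OF X d(1)]])
       (use XW in auto)
  then have "smooth_on ?O (\<lambda>x. \<Phi> (X x))"
    by (rule smooth_on_cong[OF param_chart_open[OF X d(1)], rotated]) (simp add: cinv_cmap[OF d(1)])
  then show "\<exists>O'. open O' \<and> x \<in> O' \<and> smooth_on O' (\<lambda>x. \<Phi> (X x))"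
    using param_chart_open[OF X d(1)] x d(2) by blast
qed

text \<open>Differentiating \<open>\<Phi> (E v) = v\<close> yields a left inverse, and equal
  dimensions give surjectivity.\<close>

lemma dE_bij:
  assumes v: "v \<in> B" and d: "d \<in> atlas M" "E v \<in> cdom d"
  shows "linear (dd (cmap d \<circ> E) v)" "inj (dd (cmap d \<circ> E) v)" "surj (dd (cmap d \<circ> E) v)"
proof -
  let ?O = "B \<inter> E -` cdom d"
  note o = param_chart_open[OF E_param d(1)] and s = param_chart_smooth[OF E_param d(1)]
  have vO: "v \<in> ?O" using v d by simp
  have "dd (\<lambda>y. (\<Phi> \<circ> cinv d) ((cmap d \<circ> E) y)) v a = dd (\<Phi> \<circ> cinv d) ((cmap d \<circ> E) v) (dd (cmap d \<circ> E) v a)" for a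
    by (rule dd_compose[OF \<Phi>_chart_smooth[OF d(1)] smooth_on_differentiable[OF s vO]])
       (use v d E_W in auto)
  moreover have "dd (\<lambda>y. y) v = dd (\<lambda>y. (\<Phi> \<circ> cinv d) ((cmap d \<circ> E) y)) v"
    by (rule dd_cong_on[OF o vO]) (auto simp: cinv_cmap[OF d(1)] \<Phi>_E)
  ultimately have inv: "dd (\<Phi> \<circ> cinv d) ((cmap d \<circ> E) v) (dd (cmap d \<circ> E) v a) = a" for a
    by (metis frechet_derivative_ident)
  show l: "linear (dd (cmap d \<circ> E) v)" using smooth_on_linear_dd[OF s vO] .
  show i: "inj (dd (cmap d \<circ> E) v)" using inv by (rule inj_on_inverseI)
  show "surj (dd (cmap d \<circ> E) v)" using linear_injective_imp_surjective[OF l] i by simp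
qed

lemma N_chart:
  assumes "v \<in> B" "d \<in> atlas M" "E v \<in> cdom d"
  shows "N v a b = local_metric M g d (cmap d (E v)) (dd (cmap d \<circ> E) v a) (dd (cmap d \<circ> E) v b)"
  unfolding N_def using param_metric_chart[OF E_param assms] .

sublocale N: metric_on B N
proof
  show "open B" by (rule open_B)
  show "smooth_on B (\<lambda>x. N x u v)" for u v unfolding N_def by (rule smooth_param_metric[OF E_param])
  fix v assume v: "v \<in> B"
  note d = chart_at[OF param_carrier[OF E_param v]]
  interpret m: metric_on "cimage (chart_at M (E v))" "local_metric M g (chart_at M (E v))"
    by (rule metric_on_chart[OF d(1)])
  have "N v = (\<lambda>a b. local_metric M g (chart_at M (E v)) (cmap (chart_at M (E v)) (E v))
       (dd (cmap (chart_at M (E v)) \<circ> E) v a) (dd (cmap (chart_at M (E v)) \<circ> E) v b))"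
    using N_chart[OF v d] by (simp add: fun_eq_iff)
  then show "inner_form (N v)"
    using inner_form_pullback[OF m.inner[OF cmap_cimage[OF d(2)]] dE_bij(1,2)[OF v d]] by simp
qed

lemma ray:
  obtains \<gamma> where "geodesic M g \<gamma>" "\<gamma> 0 = p" "velocity M \<gamma> 0 = v" "\<And>t. E (t *\<^sub>R v) = \<gamma> t"
proof -
  obtain \<gamma> where "geodesic M g \<gamma>" "\<gamma> 0 = p" "velocity M \<gamma> 0 = v"
    using complete p unfolding complete_metric_def by blast
  then show ?thesis using that exp_map_geodesic unfolding E_def by metis
qed

lemma E_0: "E 0 = p"
proof -
  obtain \<gamma> where "\<gamma> 0 = p" "\<And>t. E (t *\<^sub>R 0) = \<gamma> t" using ray[where v = 0] by blast
  then show ?thesis by (metis scale_zero_right)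
qed

lemma dd_line: "dd (\<lambda>t. t *\<^sub>R z) t a = a *\<^sub>R z" and d2_line: "d2 (\<lambda>t. t *\<^sub>R z) t a b = 0"
  for z :: "real^'m"
proof -
  have 1: "dd (\<lambda>t. t *\<^sub>R z) t = (\<lambda>a. a *\<^sub>R z)" for t
    by (rule dd_eqI) (auto intro!: derivative_eq_intros)
  then show "dd (\<lambda>t. t *\<^sub>R z) t a = a *\<^sub>R z" by simp
  show "d2 (\<lambda>t. t *\<^sub>R z) t a b = 0" unfolding 1 by simp
qed

text \<open>The line through \<open>z\<close> has zero second derivative, so composing
  \<open>E\<close> with it identifies the covariant second derivative of \<open>E\<close> along the
  ray with the acceleration of a geodesic.\<close>

lemma ray_derivatives:
  assumes z: "t *\<^sub>R z \<in> B" and d: "d \<in> atlas M" "E (t *\<^sub>R z) \<in> cdom d"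
    and \<gamma>: "geodesic M g \<gamma>" "\<And>t. E (t *\<^sub>R z) = \<gamma> t"
  shows "dd (cmap d \<circ> \<gamma>) t 1 = dd (cmap d \<circ> E) (t *\<^sub>R z) z" "hess M g d E (t *\<^sub>R z) z z = 0"
proof -
  let ?L = "\<lambda>t. t *\<^sub>R z"
  have o: "open (?L -` B)" by (intro continuous_open_vimage open_B continuous_intros)
  have s: "smooth_on (?L -` B) ?L" by (rule smooth_on_scaleR[OF o]) auto
  have L: "(\<lambda>t. E (?L t)) = \<gamma>" using \<gamma>(2) by blast
  have t: "t \<in> ?L -` B" using z by simp
  have dE0: "dd (cmap d \<circ> E) (t *\<^sub>R z) 0 = 0"
    using linear_0[OF dE_bij(1)[OF z d]] .
  have a: "dd (cmap d \<circ> (\<lambda>t. E (?L t))) t 1 = dd (cmap d \<circ> E) (?L t) (dd ?L t 1)"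
    by (rule hess_compose(1)[OF E_param o s _ t d]) simp
  show "dd (cmap d \<circ> \<gamma>) t 1 = dd (cmap d \<circ> E) (t *\<^sub>R z) z"
    using a unfolding L dd_line by simp
  have b: "hess M g d (\<lambda>t. E (?L t)) t 1 1 = hess M g d E (?L t) (dd ?L t 1) (dd ?L t 1) + dd (cmap d \<circ> E) (?L t) (d2 ?L t 1 1)"
    by (rule hess_compose(2)[OF E_param o s _ t d]) simp
  have "hess M g d \<gamma> t 1 1 = 0" using geodesic_hess[OF \<gamma>(1) d(1)] d(2) \<gamma>(2) by simp
  then show "hess M g d E (t *\<^sub>R z) z z = 0"
    using b unfolding L d2_line dd_line by (simp add: dE0)
qed

lemma hess_ray:
  assumes "z \<in> B" "d \<in> atlas M" "E z \<in> cdom d" shows "hess M g d E z z z = 0"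
proof -
  obtain \<gamma> where \<gamma>: "geodesic M g \<gamma>" "\<And>t. E (t *\<^sub>R z) = \<gamma> t" using ray[where v = z] by blast
  show ?thesis using ray_derivatives(2)[OF _ assms(2) _ \<gamma>, of 1] assms(1,3) by simp
qed

text \<open>The geodesic with initial velocity \<open>v\<close> is the image of the ray through
  \<open>v\<close>, so the differential of the exponential map at the origin is the
  identity.\<close>

lemma N_0: "N 0 a b = g p a b"
proof -
  note d = chart_at[OF p]
  have "dd (cmap (chart_at M p) \<circ> E) 0 v = v" for v
  proof -
    obtain \<gamma> where \<gamma>: "geodesic M g \<gamma>" "\<gamma> 0 = p" "velocity M \<gamma> 0 = v" "\<And>t. E (t *\<^sub>R v) = \<gamma> t" using ray[where v = v] by blast
    have "smooth_param M UNIV \<gamma>" using \<gamma>(1) by (simp add: geodesic_iff)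
    then have "dd (cmap (chart_at M p) \<circ> \<gamma>) 0 1 = v" using velocity_eq[of UNIV \<gamma> 0] \<gamma>(2,3) by simp
    then show ?thesis using ray_derivatives(1)[of 0 v "chart_at M p" \<gamma>] \<gamma> zero_B d by (simp add: E_0)
  qed
  then show ?thesis by (simp add: N_def param_metric_def E_0)
qed

text \<open>This is the geodesic equation of the rays, in the form from which the Gauss lemma is
  derived.\<close>

lemma koszul_ray: assumes "z \<in> B" shows "koszul N z z z w = 0"
proof -
  note d = chart_at[OF param_carrier[OF E_param assms]]
  interpret m: metric_on "cimage (chart_at M (E z))" "local_metric M g (chart_at M (E z))"
    by (rule metric_on_chart[OF d(1)])
  show ?thesis
    unfolding N_def param_koszul[OF E_param assms d] hess_ray[OF assms d]
    by (rule bilinear_lzero[OF m.bil[OF cmap_cimage[OF d(2)]]])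
qed

subsection \<open>The Gauss lemma\<close>

lemma N_along:
  assumes "t *\<^sub>R x \<in> B"
  shows "((\<lambda>t. N (t *\<^sub>R x) a b) has_real_derivative dd (\<lambda>y. N y a b) (t *\<^sub>R x) x) (at t)"
  unfolding has_real_derivative_iff_has_vector_derivative
  using line_deriv[OF smooth_on_differentiable[OF N.smooth, of "0 + t *\<^sub>R x" ]] assms by simp

lemma koszul_ray': assumes "t *\<^sub>R z \<in> B" "t \<noteq> 0" shows "koszul N (t *\<^sub>R z) z z w = 0"
  using koszul_ray[OF assms(1), of w] assms(2)
    bilinear_lmul[OF N.koszul_bilinear[OF assms(1)]] bilinear_rmul[OF N.koszul_bilinear[OF assms(1)]] by simp

text \<open>Geodesics have constant speed; its value along the ray is found at the origin, where the
  metric is \<open>g p\<close>.\<close>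

lemma N_radial: assumes x: "x \<in> B" shows "N x x x = g p x x"
proof -
  let ?f = "\<lambda>t. N (t *\<^sub>R x) x x"
  have d: "(?f has_real_derivative dd (\<lambda>y. N y x x) (t *\<^sub>R x) x) (at t)" if "0 \<le> t" "t \<le> 1" for t
    by (rule N_along) (use scale_B[OF x, of t] that in simp)
  have z: "dd (\<lambda>y. N y x x) (t *\<^sub>R x) x = 0" if "0 < t" "t \<le> 1" for t
    using koszul_ray'[of t x x] scale_B[OF x, of t] that by (simp add: koszul_def)
  have "?f 1 = ?f 0"
  proof (rule DERIV_isconst_end[where f = ?f])
    show "continuous_on {0..1} ?f"
    proof (rule continuous_at_imp_continuous_on, intro ballI)
      fix t :: real assume "t \<in> {0..1}"
      then show "isCont ?f t" using DERIV_isCont[OF d] by simp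
    qed
    show "(?f has_real_derivative 0) (at t)" if "0 < t" "t < 1" for t
      using d[of t] z[of t] that by simp
  qed simp
  then show ?thesis by (simp add: N_0)
qed

text \<open>\<open>N_radial\<close> is differentiated in the direction \<open>w\<close>, and the
  geodesic equation trades the derivative in that direction for a radial one. What results is a
  differential equation along a single ray.\<close>

lemma N_radial_deriv:
  assumes y: "y \<in> B" shows "dd (\<lambda>z. N z y w) y y + N y y w = g p y w"
proof -
  have D: "((\<lambda>z. N z z z) has_derivative (\<lambda>w. dd (\<lambda>z. N z y y) y w + N y w y + N y y w)) (at y)"
    by (rule has_derivative_bilinear[where F = "\<lambda>z. z" and A = "\<lambda>z. z" and B = "\<lambda>z. z", OF open_B N.smooth N.bil y]) auto
  have D2: "((\<lambda>z. g p z z) has_derivative (\<lambda>w. dd (\<lambda>z. g p y y) y w + g p w y + g p y w)) (at y)"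
    by (rule has_derivative_bilinear[where V = UNIV and G = "\<lambda>_. g p" and F = "\<lambda>z. z" and A = "\<lambda>z. z" and B = "\<lambda>z. z"])
      (auto intro: inner_formD(1)[OF gp])
  have "dd (\<lambda>z. N z z z) y = dd (\<lambda>z. g p z z) y"
    by (rule dd_cong[OF open_B y N_radial]) (use D in \<open>auto simp: differentiable_def\<close>)
  from fun_cong[OF this, of w] have "dd (\<lambda>z. N z y y) y w + 2 * N y y w = 2 * g p y w"
    unfolding dd_eqI[OF D] dd_eqI[OF D2] using N.sym[OF y, of w y] inner_formD(2)[OF gp, of w y] by simp
  moreover have "dd (\<lambda>z. N z y y) y w = 2 * dd (\<lambda>z. N z y w) y y"
    using koszul_ray[OF y, of w] by (simp add: koszul_def)
  ultimately show ?thesis by simp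
qed

text \<open>By \<open>N_radial_deriv\<close> the function t N(t x)(x, w) has the constant derivative
  \<open>g p x w\<close>. The factor t makes it vanish at 0 and thereby fixes the constant of
  integration.\<close>

lemma gauss: assumes x: "x \<in> B" shows "N x x w = g p x w"
proof -
  let ?f = "\<lambda>t. t * N (t *\<^sub>R x) x w - t * g p x w"
  have d: "(?f has_real_derivative (N (t *\<^sub>R x) x w + t * dd (\<lambda>y. N y x w) (t *\<^sub>R x) x - g p x w)) (at t)"
    if "0 \<le> t" "t \<le> 1" for t
    using N_along[of t x x w] scale_B[OF x, of t] that by (auto intro!: derivative_eq_intros)
  have z: "N (t *\<^sub>R x) x w + t * dd (\<lambda>y. N y x w) (t *\<^sub>R x) x - g p x w = 0" if "0 < t" "t \<le> 1" for t
  proof -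
    have B: "t *\<^sub>R x \<in> B" using scale_B[OF x, of t] that by simp
    have "t * (N (t *\<^sub>R x) x w + t * dd (\<lambda>y. N y x w) (t *\<^sub>R x) x - g p x w) = 0"
      using N_radial_deriv[OF B, of w]
      by (simp add: bilinear_lmul[OF N.dG_bilinear[OF B]] linear_cmul[OF N.dG_linear[OF B]]
          bilinear_lmul[OF N.bil[OF B]] gp_simps algebra_simps)
    then show ?thesis using that by simp
  qed
  have "?f 1 = ?f 0"
  proof (rule DERIV_isconst_end[where f = ?f])
    show "continuous_on {0..1} ?f"
    proof (rule continuous_at_imp_continuous_on, intro ballI)
      fix t :: real assume "t \<in> {0..1}"
      then show "isCont ?f t" using DERIV_isCont[OF d] by simp
    qed
    show "(?f has_real_derivative 0) (at t)" if "0 < t" "t < 1" for t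
      using d[of t] z[of t] that by simp
  qed simp
  then show ?thesis by simp
qed

lemma dN_radial: assumes "x \<in> B" shows "dd (\<lambda>z. N z x w) x x = 0"
  using N_radial_deriv[OF assms, of w] gauss[OF assms, of w] by simp

end

subsection \<open>Derivatives along curves\<close>

lemma curve_bilinear:
  fixes G :: "'f::euclidean_space \<Rightarrow> 'a::euclidean_space \<Rightarrow> 'b::euclidean_space \<Rightarrow> 'c::real_normed_vector"
  assumes G: "open V" "\<And>u v. smooth_on V (\<lambda>y. G y u v)" "\<And>y. y \<in> V \<Longrightarrow> bilinear (G y)" "F t \<in> V"
    and F: "(F has_vector_derivative F') (at t)" and A: "(A has_vector_derivative A') (at t)"
    and B: "(B has_vector_derivative B') (at t)"
  shows "((\<lambda>s. G (F s) (A s) (B s)) has_vector_derivative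
     dd (\<lambda>y. G y (A t) (B t)) (F t) F' + G (F t) A' (B t) + G (F t) (A t) B') (at t)"
  using has_derivative_bilinear[OF G F[unfolded has_vector_derivative_def] A[unfolded has_vector_derivative_def]
      B[unfolded has_vector_derivative_def]]
  unfolding has_vector_derivative_def
  by (simp add: bilinear_lmul[OF G(3)[OF G(4)]] bilinear_rmul[OF G(3)[OF G(4)]]
      linear_cmul[OF smooth_on_linear_dd[OF G(2) G(4)]] scaleR_add_right)

lemma curve_dd:
  fixes F :: "'e::euclidean_space \<Rightarrow> 'f::euclidean_space"
  assumes F: "open V" "smooth_on V F" "A t \<in> V" and A: "(A has_vector_derivative A') (at t)"
    and B: "(B has_vector_derivative B') (at t)"
  shows "((\<lambda>s. dd F (A s) (B s)) has_vector_derivative d2 F (A t) A' (B t) + dd F (A t) B') (at t)"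
  using has_derivative_dd_along[OF F A[unfolded has_vector_derivative_def] B[unfolded has_vector_derivative_def]]
  unfolding has_vector_derivative_def
  by (simp add: linear_cmul[OF smooth_on_linear_dd[OF F(2,3)]] linear_cmul[OF d2_linear(1)[OF F(1,3,2)]] scaleR_add_right)

lemma curve_compose:
  fixes F :: "'e::euclidean_space \<Rightarrow> 'f::real_normed_vector"
  assumes F: "smooth_on V F" "A t \<in> V" and A: "(A has_vector_derivative A') (at t)"
  shows "((\<lambda>s. F (A s)) has_vector_derivative dd F (A t) A') (at t)"
  using has_derivative_compose[OF A[unfolded has_vector_derivative_def] smooth_on_D[OF F]]
  unfolding has_vector_derivative_def
  by (simp add: linear_cmul[OF smooth_on_linear_dd[OF F]])

subsection \<open>The Jacobi equation in coordinates\<close>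

definition crv :: "('e::real_normed_vector \<Rightarrow> 'e \<Rightarrow> 'e \<Rightarrow> real) \<Rightarrow> 'e \<Rightarrow> 'e \<Rightarrow> 'e \<Rightarrow> 'e \<Rightarrow> 'e" where
  "crv G x u v w = dd (\<lambda>y. chr G y v w) x u - dd (\<lambda>y. chr G y u w) x v
     + chr G x u (chr G x v w) - chr G x v (chr G x u w)"

lemma curvature_eq_crv: "curvature M g c = crv (local_metric M g c)"
  by (simp add: curvature_def crv_def christoffel_eq_chr Let_def fun_eq_iff)

context metric_on begin

lemma compat:
  assumes "x \<in> U"
  shows "dd (\<lambda>y. G y a b) x w = G x (chr G x w a) b + G x a (chr G x w b)"
  unfolding sym[OF assms, of a "chr G x w b"] chr_works[OF assms] koszul_def dG_sym[OF assms, of b a]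
    dG_sym[OF assms, of w a] dG_sym[OF assms, of w b]
  by (simp add: field_simps)

text \<open>\<open>Y\<close> is the covariant derivative of \<open>J\<close> along the curve
  \<open>x\<close>. Metric compatibility gives the first formula; in the second the Jacobi equation
  replaces the covariant derivative of \<open>Y\<close> by minus the curvature term.\<close>

lemma jacobi_energy:
  assumes x: "x t \<in> U" "(x has_vector_derivative T t) (at t)"
    and T: "(T has_vector_derivative - chr G (x t) (T t) (T t)) (at t)"
    and J: "(J has_vector_derivative J1 t) (at t)" and J1: "(J1 has_vector_derivative J2) (at t)"
    and jacobi: "J2 + dd (\<lambda>y. chr G y (T t) (T t)) (x t) (J t) + 2 *\<^sub>R chr G (x t) (J1 t) (T t) = 0"
  defines "Y \<equiv> \<lambda>s. J1 s + chr G (x s) (T s) (J s)"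
  shows "((\<lambda>s. G (x s) (J s) (J s)) has_vector_derivative 2 * G (x t) (Y t) (J t)) (at t)"
    and "((\<lambda>s. G (x s) (Y s) (J s)) has_vector_derivative
       G (x t) (Y t) (Y t) - G (x t) (crv G (x t) (J t) (T t) (T t)) (J t)) (at t)"
proof -
  note b = bilinear_simps[OF bil[OF x(1)]] and c = bilinear_simps[OF chr_bilinear[OF x(1)]]
  show "((\<lambda>s. G (x s) (J s) (J s)) has_vector_derivative 2 * G (x t) (Y t) (J t)) (at t)"
    using curve_bilinear[OF open_dom smooth bil x J J] sym[OF x(1), of "J t"]
    by (simp add: compat[OF x(1)] Y_def b algebra_simps)
  have Y: "(Y has_vector_derivative J2 + (dd (\<lambda>y. chr G y (T t) (J t)) (x t) (T t)
      + chr G (x t) (- chr G (x t) (T t) (T t)) (J t) + chr G (x t) (T t) (J1 t))) (at t)"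
    unfolding Y_def
    by (intro has_vector_derivative_add J1 curve_bilinear[OF open_dom smooth_chr chr_bilinear x T J])
  have 1: "((\<lambda>s. G (x s) (Y s) (J s)) has_vector_derivative
     G (x t) (chr G (x t) (T t) (Y t)) (J t) + G (x t) (Y t) (chr G (x t) (T t) (J t))
     + G (x t) (J2 + (dd (\<lambda>y. chr G y (T t) (J t)) (x t) (T t)
      + chr G (x t) (- chr G (x t) (T t) (T t)) (J t) + chr G (x t) (T t) (J1 t))) (J t)
     + G (x t) (Y t) (J1 t)) (at t)"
    using curve_bilinear[OF open_dom smooth bil x Y J] by (simp only: compat[OF x(1)])
  have J2: "J2 = - dd (\<lambda>y. chr G y (T t) (T t)) (x t) (J t) - 2 *\<^sub>R chr G (x t) (J1 t) (T t)"
    using eq_neg_iff_add_eq_0[THEN iffD2, OF jacobi[unfolded add.assoc]] by simp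
  have ds: "dd (\<lambda>y. chr G y (T t) (J t)) (x t) = dd (\<lambda>y. chr G y (J t) (T t)) (x t)"
    by (rule dd_cong[OF open_dom x(1) chr_sym smooth_on_differentiable[OF smooth_chr x(1)]])
  \<comment> \<open>The left side is the covariant derivative of \<open>Y\<close>. After inserting
    \<open>J2\<close>, the derivatives and the quadratic terms of the Christoffel symbols assemble
    to the curvature.\<close>
  have 2: "chr G (x t) (T t) (Y t) + (J2 + (dd (\<lambda>y. chr G y (T t) (J t)) (x t) (T t)
      + chr G (x t) (- chr G (x t) (T t) (T t)) (J t) + chr G (x t) (T t) (J1 t)))
     = - crv G (x t) (J t) (T t) (T t)"
    unfolding J2 Y_def crv_def ds
    using chr_sym[OF x(1), of "J t" "chr G (x t) (T t) (T t)"] chr_sym[OF x(1), of "T t" "J t"] chr_sym[OF x(1), of "J1 t" "T t"]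
    by (simp add: c algebra_simps scaleR_2)
  have "G (x t) (chr G (x t) (T t) (Y t)) (J t) + G (x t) (Y t) (chr G (x t) (T t) (J t))
     + G (x t) (J2 + (dd (\<lambda>y. chr G y (T t) (J t)) (x t) (T t)
      + chr G (x t) (- chr G (x t) (T t) (T t)) (J t) + chr G (x t) (T t) (J1 t))) (J t)
     + G (x t) (Y t) (J1 t)
    = G (x t) (chr G (x t) (T t) (Y t) + (J2 + (dd (\<lambda>y. chr G y (T t) (J t)) (x t) (T t)
      + chr G (x t) (- chr G (x t) (T t) (T t)) (J t) + chr G (x t) (T t) (J1 t)))) (J t)
     + G (x t) (Y t) (J1 t + chr G (x t) (T t) (J t))"
    by (simp only: b)
  also have "\<dots> = G (x t) (Y t) (Y t) - G (x t) (crv G (x t) (J t) (T t) (T t)) (J t)"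
    unfolding 2 by (simp add: b Y_def)
  finally show "((\<lambda>s. G (x s) (Y s) (J s)) has_vector_derivative
       G (x t) (Y t) (Y t) - G (x t) (crv G (x t) (J t) (T t) (T t)) (J t)) (at t)"
    using 1 by simp
qed

end

lemma third_derivative_sym:
  fixes F :: "'e::euclidean_space \<Rightarrow> 'f::euclidean_space"
  assumes "open U" "x \<in> U" "smooth_on U F"
  shows "dd (\<lambda>y. d2 F y a b) x c = dd (\<lambda>y. d2 F y c b) x a"
  using d2_sym[OF assms(1,2) smooth_on_dd[OF assms(3), of b], where a = c and b = a] .

context normal_ball begin

lemma line_curve: "((\<lambda>s. s *\<^sub>R v) has_vector_derivative v) (at t)" for v :: "real^'m"
  by (auto intro!: derivative_eq_intros)

text \<open>\<open>J\<close> is the variation field of the rays s (v + \<epsilon> w), read in the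
  chart \<open>d\<close>. Each ray satisfies the geodesic equation, and the derivative of that
  equation at \<epsilon> = 0 is the Jacobi equation once symmetry of third derivatives brings it
  into the form of \<open>J1\<close> and \<open>J2\<close>.\<close>

lemma jacobi_field:
  fixes v w :: "real^'m"
  assumes d: "d \<in> atlas M" and t: "t *\<^sub>R v \<in> B \<inter> E -` cdom d" "t \<noteq> 0"
  defines "\<tau> \<equiv> cmap d \<circ> E"
  defines "\<Gamma> \<equiv> chr (local_metric M g d)"
  defines "T \<equiv> \<lambda>s. dd \<tau> (s *\<^sub>R v) v" and "J \<equiv> \<lambda>s. dd \<tau> (s *\<^sub>R v) (s *\<^sub>R w)"
    and "J1 \<equiv> \<lambda>s. d2 \<tau> (s *\<^sub>R v) v (s *\<^sub>R w) + dd \<tau> (s *\<^sub>R v) w"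
    and "J2 \<equiv> dd (\<lambda>y. d2 \<tau> y v (t *\<^sub>R w)) (t *\<^sub>R v) v + 2 *\<^sub>R d2 \<tau> (t *\<^sub>R v) v w"
  shows "((\<lambda>s. \<tau> (s *\<^sub>R v)) has_vector_derivative T t) (at t)"
    and "(T has_vector_derivative - \<Gamma> (\<tau> (t *\<^sub>R v)) (T t) (T t)) (at t)"
    and "(J has_vector_derivative J1 t) (at t)" and "(J1 has_vector_derivative J2) (at t)"
    and "J2 + dd (\<lambda>y. \<Gamma> y (T t) (T t)) (\<tau> (t *\<^sub>R v)) (J t) + 2 *\<^sub>R \<Gamma> (\<tau> (t *\<^sub>R v)) (J1 t) (T t) = 0"
proof -
  let ?O = "B \<inter> E -` cdom d"
  interpret m: metric_on "cimage d" "local_metric M g d" by (rule metric_on_chart[OF d])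
  have O: "open ?O" and s: "smooth_on ?O \<tau>"
    unfolding \<tau>_def by (rule param_chart_open[OF E_param d], rule param_chart_smooth[OF E_param d])
  have \<tau>im: "\<tau> z \<in> cimage d" if "z \<in> ?O" for z using that cmap_cimage by (auto simp: \<tau>_def)
  note lin = smooth_on_linear_dd[OF s]
  note d2b = d2_bilinear[OF O _ s]
  have cst: "((\<lambda>s. v) has_vector_derivative 0) (at t)" for v :: "real^'m" by (rule has_vector_derivative_const)
  show x: "((\<lambda>s. \<tau> (s *\<^sub>R v)) has_vector_derivative T t) (at t)"
    unfolding T_def by (rule curve_compose[OF s t(1) line_curve])
  \<comment> \<open>\<open>hess_ray\<close> is the geodesic equation at \<open>z\<close> in the
    direction \<open>z\<close> itself; bilinearity rescales it to the direction \<open>u\<close>,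
    which requires \<open>r\<close> to be nonzero.\<close>
  have hz: "d2 \<tau> z u u + \<Gamma> (\<tau> z) (dd \<tau> z u) (dd \<tau> z u) = 0" if z: "z \<in> ?O" "z = r *\<^sub>R u" "r \<noteq> 0" for z u r
  proof -
    have "u = (1/r) *\<^sub>R z" using z by simp
    moreover have "d2 \<tau> z z z + \<Gamma> (\<tau> z) (dd \<tau> z z) (dd \<tau> z z) = 0"
      using hess_ray[of z d] z(1) d by (simp add: hess_def \<tau>_def \<Gamma>_def)
    moreover have "d2 \<tau> z ((1/r) *\<^sub>R z) ((1/r) *\<^sub>R z) + \<Gamma> (\<tau> z) (dd \<tau> z ((1/r) *\<^sub>R z)) (dd \<tau> z ((1/r) *\<^sub>R z))
       = (1/r) *\<^sub>R (1/r) *\<^sub>R (d2 \<tau> z z z + \<Gamma> (\<tau> z) (dd \<tau> z z) (dd \<tau> z z))"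
      unfolding linear_cmul[OF lin[OF z(1)]] bilinear_lmul[OF d2b[OF z(1)]] bilinear_rmul[OF d2b[OF z(1)]]
        \<Gamma>_def bilinear_lmul[OF m.chr_bilinear[OF \<tau>im[OF z(1)]]] bilinear_rmul[OF m.chr_bilinear[OF \<tau>im[OF z(1)]]]
      by (simp only: scaleR_add_right)
    ultimately show ?thesis by simp
  qed
  have "(T has_vector_derivative d2 \<tau> (t *\<^sub>R v) v v + dd \<tau> (t *\<^sub>R v) 0) (at t)"
    unfolding T_def by (rule curve_dd[OF O s t(1) line_curve cst])
  moreover have "d2 \<tau> (t *\<^sub>R v) v v = - \<Gamma> (\<tau> (t *\<^sub>R v)) (T t) (T t)"
    using hz[OF t(1) refl t(2)] unfolding T_def by (simp add: eq_neg_iff_add_eq_0)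
  ultimately show "(T has_vector_derivative - \<Gamma> (\<tau> (t *\<^sub>R v)) (T t) (T t)) (at t)"
    using linear_0[OF lin[OF t(1)]] by simp
  show "(J has_vector_derivative J1 t) (at t)"
    unfolding J_def J1_def by (rule curve_dd[OF O s t(1) line_curve line_curve])
  have "((\<lambda>s. d2 \<tau> (s *\<^sub>R v) v (s *\<^sub>R w) + dd \<tau> (s *\<^sub>R v) w) has_vector_derivative
     (dd (\<lambda>y. d2 \<tau> y v (t *\<^sub>R w)) (t *\<^sub>R v) v + d2 \<tau> (t *\<^sub>R v) 0 (t *\<^sub>R w) + d2 \<tau> (t *\<^sub>R v) v w)
     + (d2 \<tau> (t *\<^sub>R v) v w + dd \<tau> (t *\<^sub>R v) 0)) (at t)"
    by (intro has_vector_derivative_add curve_dd[OF O s t(1) line_curve cst]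
        curve_bilinear[OF O smooth_on_dd[OF smooth_on_dd[OF s]] d2b t(1) line_curve cst line_curve])
  then show "(J1 has_vector_derivative J2) (at t)"
    unfolding J1_def J2_def
    using linear_0[OF lin[OF t(1)]] bilinear_lzero[OF d2b[OF t(1)]] by (simp add: scaleR_2 add.assoc)
  \<comment> \<open>\<open>?z \<epsilon>\<close> is t times \<open>?u \<epsilon>\<close>: the point
    at time t on the varied ray, whose direction is \<open>?u \<epsilon>\<close>.\<close>
  let ?u = "\<lambda>\<epsilon>. v + \<epsilon> *\<^sub>R w" and ?z = "\<lambda>\<epsilon>. t *\<^sub>R v + \<epsilon> *\<^sub>R (t *\<^sub>R w)"
  have dz: "(?z has_vector_derivative t *\<^sub>R w) (at 0)" and du: "(?u has_vector_derivative w) (at 0)"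
    by (auto intro!: derivative_eq_intros)
  have z0: "?z 0 \<in> ?O" using t(1) by simp
  have d1: "((\<lambda>\<epsilon>. d2 \<tau> (?z \<epsilon>) (?u \<epsilon>) (?u \<epsilon>)) has_vector_derivative
     dd (\<lambda>y. d2 \<tau> y (?u 0) (?u 0)) (?z 0) (t *\<^sub>R w) + d2 \<tau> (?z 0) w (?u 0) + d2 \<tau> (?z 0) (?u 0) w) (at 0)"
    by (rule curve_bilinear[OF O smooth_on_dd[OF smooth_on_dd[OF s]] d2b z0 dz du du])
  have dx: "((\<lambda>\<epsilon>. \<tau> (?z \<epsilon>)) has_vector_derivative dd \<tau> (?z 0) (t *\<^sub>R w)) (at 0)"
    by (rule curve_compose[OF s z0 dz])
  have dT: "((\<lambda>\<epsilon>. dd \<tau> (?z \<epsilon>) (?u \<epsilon>)) has_vector_derivative d2 \<tau> (?z 0) (t *\<^sub>R w) (?u 0) + dd \<tau> (?z 0) w) (at 0)"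
    by (rule curve_dd[OF O s z0 dz du])
  have d2': "((\<lambda>\<epsilon>. \<Gamma> (\<tau> (?z \<epsilon>)) (dd \<tau> (?z \<epsilon>) (?u \<epsilon>)) (dd \<tau> (?z \<epsilon>) (?u \<epsilon>))) has_vector_derivative
     dd (\<lambda>y. \<Gamma> y (dd \<tau> (?z 0) (?u 0)) (dd \<tau> (?z 0) (?u 0))) (\<tau> (?z 0)) (dd \<tau> (?z 0) (t *\<^sub>R w))
     + \<Gamma> (\<tau> (?z 0)) (d2 \<tau> (?z 0) (t *\<^sub>R w) (?u 0) + dd \<tau> (?z 0) w) (dd \<tau> (?z 0) (?u 0))
     + \<Gamma> (\<tau> (?z 0)) (dd \<tau> (?z 0) (?u 0)) (d2 \<tau> (?z 0) (t *\<^sub>R w) (?u 0) + dd \<tau> (?z 0) w)) (at 0)"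
    unfolding \<Gamma>_def by (rule curve_bilinear[OF m.open_dom m.smooth_chr m.chr_bilinear \<tau>im[OF z0] dx dT dT])
  have oz: "open (?z -` ?O)" by (intro continuous_open_vimage O continuous_intros)
  have "?z \<epsilon> = t *\<^sub>R ?u \<epsilon>" for \<epsilon> by (simp add: scaleR_add_right)
  then have "d2 \<tau> (?z \<epsilon>) (?u \<epsilon>) (?u \<epsilon>) + \<Gamma> (\<tau> (?z \<epsilon>)) (dd \<tau> (?z \<epsilon>) (?u \<epsilon>)) (dd \<tau> (?z \<epsilon>) (?u \<epsilon>)) = 0"
    if "\<epsilon> \<in> ?z -` ?O" for \<epsilon> using hz[of "?z \<epsilon>" t "?u \<epsilon>"] that t(2) by blast
  then have zero: "((\<lambda>\<epsilon>. 0) has_vector_derivative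
      (dd (\<lambda>y. d2 \<tau> y (?u 0) (?u 0)) (?z 0) (t *\<^sub>R w) + d2 \<tau> (?z 0) w (?u 0) + d2 \<tau> (?z 0) (?u 0) w) +
      (dd (\<lambda>y. \<Gamma> y (dd \<tau> (?z 0) (?u 0)) (dd \<tau> (?z 0) (?u 0))) (\<tau> (?z 0)) (dd \<tau> (?z 0) (t *\<^sub>R w))
     + \<Gamma> (\<tau> (?z 0)) (d2 \<tau> (?z 0) (t *\<^sub>R w) (?u 0) + dd \<tau> (?z 0) w) (dd \<tau> (?z 0) (?u 0))
     + \<Gamma> (\<tau> (?z 0)) (dd \<tau> (?z 0) (?u 0)) (d2 \<tau> (?z 0) (t *\<^sub>R w) (?u 0) + dd \<tau> (?z 0) w))) (at 0)"
    using z0 by (intro has_vector_derivative_transform_within_open[OF has_vector_derivative_add[OF d1 d2'] oz]) auto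
  have sym1: "d2 \<tau> (t *\<^sub>R v) (t *\<^sub>R w) v = d2 \<tau> (t *\<^sub>R v) v (t *\<^sub>R w)" "d2 \<tau> (t *\<^sub>R v) w v = d2 \<tau> (t *\<^sub>R v) v w"
    using d2_sym[OF O t(1) s] by blast+
  have "dd (\<lambda>y. d2 \<tau> y v v) (t *\<^sub>R v) (t *\<^sub>R w) = dd (\<lambda>y. d2 \<tau> y (t *\<^sub>R w) v) (t *\<^sub>R v) v"
    by (rule third_derivative_sym[OF O t(1) s])
  also have "dd (\<lambda>y. d2 \<tau> y (t *\<^sub>R w) v) (t *\<^sub>R v) = dd (\<lambda>y. d2 \<tau> y v (t *\<^sub>R w)) (t *\<^sub>R v)"
    by (rule dd_cong[OF O t(1) _ smooth_on_differentiable[OF smooth_on_dd[OF smooth_on_dd[OF s]] t(1)]])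
       (rule d2_sym[OF O _ s])
  finally have sym2: "dd (\<lambda>y. d2 \<tau> y v v) (t *\<^sub>R v) (t *\<^sub>R w) = dd (\<lambda>y. d2 \<tau> y v (t *\<^sub>R w)) (t *\<^sub>R v) v" .
  have gs: "\<Gamma> (\<tau> (t *\<^sub>R v)) a b = \<Gamma> (\<tau> (t *\<^sub>R v)) b a" for a b
    unfolding \<Gamma>_def by (rule m.chr_sym[OF \<tau>im[OF t(1)]])
  have "0 = J2 + dd (\<lambda>y. \<Gamma> y (T t) (T t)) (\<tau> (t *\<^sub>R v)) (J t) + 2 *\<^sub>R \<Gamma> (\<tau> (t *\<^sub>R v)) (J1 t) (T t)"
    using vector_derivative_unique_at[OF has_vector_derivative_const zero] gs[of "T t" "J1 t"]
    unfolding T_def J_def J1_def J2_def by (simp add: sym1 sym2 scaleR_2 add.assoc)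
  then show "J2 + dd (\<lambda>y. \<Gamma> y (T t) (T t)) (\<tau> (t *\<^sub>R v)) (J t) + 2 *\<^sub>R \<Gamma> (\<tau> (t *\<^sub>R v)) (J1 t) (T t) = 0" by simp
qed

end

subsection \<open>Model functions\<close>

definition cs :: "real \<Rightarrow> real \<Rightarrow> real" where
  "cs \<delta> t = (if \<delta> > 0 then cos (sqrt \<delta> * t) else if \<delta> = 0 then 1 else cosh (sqrt \<bar>\<delta>\<bar> * t))"

text \<open>\<open>kf \<delta> t\<close> is \<open>t\<close> times the Hessian of the distance function of the model space in the
  spherical directions, with its limit value at \<open>t = 0\<close>.\<close>

definition kf :: "real \<Rightarrow> real \<Rightarrow> real" where
  "kf \<delta> t = (if t = 0 then 1 else t * cs \<delta> t / sn \<delta> t)"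

lemma sn_deriv: "(sn \<delta> has_real_derivative cs \<delta> t) (at t)"
  and cs_deriv: "(cs \<delta> has_real_derivative - \<delta> * sn \<delta> t) (at t)"
proof -
  define c where "c = sqrt \<bar>\<delta>\<bar>"
  have c: "c * c = \<bar>\<delta>\<bar>" by (simp add: c_def)
  consider "\<delta> > 0" | "\<delta> = 0" | "\<delta> < 0" by linarith
  then have "(sn \<delta> has_real_derivative cs \<delta> t) (at t) \<and> (cs \<delta> has_real_derivative - \<delta> * sn \<delta> t) (at t)"
  proof cases
    case 1
    then have c0: "c \<noteq> 0" by (simp add: c_def)
    have "sn \<delta> = (\<lambda>t. sin (c * t) / c)" "cs \<delta> = (\<lambda>t. cos (c * t))"
      using 1 by (auto simp: sn_def cs_def c_def fun_eq_iff)
    moreover have "((\<lambda>t. sin (c * t) / c) has_real_derivative cos (c * t)) (at t)"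
      using c0 by (auto intro!: derivative_eq_intros)
    moreover have "((\<lambda>t. cos (c * t)) has_real_derivative - \<delta> * (sin (c * t) / c)) (at t)"
      using c0 c 1 by (auto intro!: derivative_eq_intros simp: field_simps)
    ultimately show ?thesis by simp
  next
    case 2
    then have "sn \<delta> = (\<lambda>t. t)" "cs \<delta> = (\<lambda>t. 1)" by (auto simp: sn_def cs_def fun_eq_iff)
    then show ?thesis using 2 by simp
  next
    case 3
    then have c0: "c \<noteq> 0" by (simp add: c_def)
    have "sn \<delta> = (\<lambda>t. sinh (c * t) / c)" "cs \<delta> = (\<lambda>t. cosh (c * t))"
      using 3 by (auto simp: sn_def cs_def c_def fun_eq_iff)
    moreover have "((\<lambda>t. sinh (c * t) / c) has_real_derivative cosh (c * t)) (at t)"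
      using c0 by (auto intro!: derivative_eq_intros)
    moreover have "((\<lambda>t. cosh (c * t)) has_real_derivative c * sinh (c * t)) (at t)"
      by (auto intro!: derivative_eq_intros)
    moreover have "c * sinh (c * t) = - \<delta> * (sinh (c * t) / c)"
      using c0 3 unfolding abs_of_neg[OF 3] c[unfolded abs_of_neg[OF 3], symmetric] by simp
    ultimately show ?thesis by simp
  qed
  then show "(sn \<delta> has_real_derivative cs \<delta> t) (at t)" "(cs \<delta> has_real_derivative - \<delta> * sn \<delta> t) (at t)"
    by auto
qed

lemma sn_0 [simp]: "sn \<delta> 0 = 0" and cs_0 [simp]: "cs \<delta> 0 = 1"
  by (auto simp: sn_def cs_def)

lemma sn_pos:
  assumes "0 < t" "\<delta> > 0 \<Longrightarrow> t < pi / sqrt \<delta>" shows "sn \<delta> t > 0"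
proof (cases "\<delta> > 0")
  case True
  then have "sqrt \<delta> * t < pi" using assms by (simp add: field_simps)
  then show ?thesis using True assms by (simp add: sn_def sin_gt_zero)
qed (use assms in \<open>auto simp: sn_def\<close>)

text \<open>With t^2 n = f^2 the hypothesis \<open>ineq\<close> reads f^3 f'' \<ge> - \<delta> f^4,
  so f'' + \<delta> f \<ge> 0 and the Wronskian f' sn - f sn' does not decrease from its value 0.
  Splitting off t^2 leaves the root of a positive function, which is differentiable up to t =
  0.\<close>

lemma sturm_comparison:
  fixes n :: "real \<Rightarrow> real"
  assumes b: "\<delta> > 0 \<Longrightarrow> b \<le> pi / sqrt \<delta>"
    and n: "\<And>t. 0 \<le> t \<Longrightarrow> t < b \<Longrightarrow> (n has_real_derivative n1 t) (at t)"
    and n1: "\<And>t. 0 \<le> t \<Longrightarrow> t < b \<Longrightarrow> (n1 has_real_derivative n2 t) (at t)"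
    and pos: "\<And>t. 0 \<le> t \<Longrightarrow> t < b \<Longrightarrow> n t > 0"
    and ineq: "\<And>t. 0 < t \<Longrightarrow> t < b \<Longrightarrow>
      t\<^sup>2 * n t * (2 * n t + 4 * t * n1 t + t\<^sup>2 * n2 t) / 2 - (2 * t * n t + t\<^sup>2 * n1 t)\<^sup>2 / 4 \<ge> - \<delta> * (t\<^sup>2 * n t)\<^sup>2"
    and t: "0 < t" "t < b"
  shows "(n t + t * n1 t / 2) * sn \<delta> t \<ge> t * n t * cs \<delta> t"
proof -
  define r where "r s = sqrt (n s)" for s
  \<comment> \<open>The Wronskian of s r(s) and \<open>sn \<delta>\<close>.\<close>
  define \<psi> where "\<psi> s = (r s + s * n1 s / (2 * r s)) * sn \<delta> s - s * r s * cs \<delta> s" for s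
  have r: "r s > 0" "r s * r s = n s" if "0 \<le> s" "s < b" for s
    using pos[OF that] by (auto simp: r_def)
  have dr: "(r has_real_derivative n1 s / (2 * r s)) (at s)" if "0 \<le> s" "s < b" for s
    unfolding r_def[abs_def] using n[OF that] pos[OF that]
    by (auto intro!: derivative_eq_intros simp: field_simps)
  have d\<psi>: "(\<psi> has_real_derivative (n1 s / r s + s * n2 s / (2 * r s) - s * (n1 s)\<^sup>2 / (4 * r s ^ 3) + \<delta> * (s * r s)) * sn \<delta> s) (at s)"
    if "0 \<le> s" "s < b" for s
    unfolding \<psi>_def[abs_def] using r(1)[OF that]
    by (auto intro!: derivative_eq_intros dr[OF that] n1[OF that] sn_deriv cs_deriv simp: field_simps power2_eq_square power3_eq_cube)
  have "\<psi> 0 \<le> \<psi> t"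
  proof (rule DERIV_nonneg_imp_increasing_open[OF less_imp_le[OF t(1)]])
    show "continuous_on {0..t} \<psi>"
    proof (rule continuous_at_imp_continuous_on, intro ballI)
      fix s assume "s \<in> {0..t}" then show "isCont \<psi> s" using DERIV_isCont[OF d\<psi>] t by simp
    qed
    fix s assume s: "0 < s" "s < t"
    then have s': "0 \<le> s" "s < b" "0 < s" using t by auto
    have sn: "sn \<delta> s > 0" using sn_pos[OF s(1)] b s t by fastforce
    let ?D = "n1 s / r s + s * n2 s / (2 * r s) - s * (n1 s)\<^sup>2 / (4 * r s ^ 3) + \<delta> * (s * r s)"
    have "(s * r s) ^ 3 * ?D = s ^ 3 * (r s * r s) * n1 s + s ^ 4 * (r s * r s) * n2 s / 2 - s ^ 4 * (n1 s)\<^sup>2 / 4 + \<delta> * (s\<^sup>2 * (r s * r s))\<^sup>2"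
      using r(1)[OF s'(1,2)] by (simp add: field_simps power2_eq_square power3_eq_cube power4_eq_xxxx)
    also have "\<dots> = s\<^sup>2 * n s * (2 * n s + 4 * s * n1 s + s\<^sup>2 * n2 s) / 2 - (2 * s * n s + s\<^sup>2 * n1 s)\<^sup>2 / 4 + \<delta> * (s\<^sup>2 * n s)\<^sup>2"
      unfolding r(2)[OF s'(1,2)] by (simp add: field_simps power2_eq_square power3_eq_cube power4_eq_xxxx)
    also have "\<dots> \<ge> 0" using ineq[OF s'(3,2)] by simp
    finally have "(s * r s) ^ 3 * ?D \<ge> 0" .
    moreover have pos: "(s * r s) ^ 3 > 0" using r(1)[OF s'(1,2)] s(1) by simp
    ultimately have "?D \<ge> 0" using mult_le_cancel_left_pos[OF pos, of 0 ?D] by simp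
    then show "\<exists>y. (\<psi> has_real_derivative y) (at s) \<and> 0 \<le> y"
      using d\<psi>[OF s'(1,2)] mult_nonneg_nonneg[OF \<open>?D \<ge> 0\<close> less_imp_le[OF sn]] by blast
  qed
  then have "0 \<le> r t * \<psi> t" using r(1)[of t] t by (simp add: \<psi>_def)
  also have "r t * \<psi> t = (r t * r t + t * n1 t / 2) * sn \<delta> t - t * (r t * r t) * cs \<delta> t"
    using r(1)[of t] t by (simp add: \<psi>_def field_simps)
  finally show ?thesis using r(2)[of t] t by simp
qed

subsection \<open>Hessian comparison\<close>

locale normal_ball_le = normal_ball +
  fixes \<delta> :: real
  assumes sec: "sectional_curvature_le M g \<delta>"
begin

text \<open>For nonzero \<open>u\<close> orthogonal to the unit vector \<open>v\<close> the two are
  independent, and the denominator of the sectional curvature reduces to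
  \<open>g q u u\<close>.\<close>

lemma curvature_bound:
  assumes q: "q \<in> carrier M" and orth: "g q u v = 0" and "g q v v = 1"
  shows "g q (crv (local_metric M g (chart_at M q)) (cmap (chart_at M q) q) u v v) u \<le> \<delta> * g q u u"
proof (cases "u = 0")
  case True
  then show ?thesis using bilinear_rzero[OF inner_formD(1)[OF g_inner[OF q]]] by simp
next
  case False
  note ip = g_inner[OF q]
  note b = bilinear_simps[OF inner_formD(1)[OF ip]]
  have uu: "g q u u > 0" using inner_formD(3)[OF ip False] .
  have "v \<noteq> 0" using assms(3) b by auto
  have "u \<notin> span {v}"
  proof
    assume "u \<in> span {v}"
    then obtain k where "u = k *\<^sub>R v" by (auto simp: span_singleton)
    then show False using orth assms(3) False by (auto simp: b)
  qed
  then have "u \<noteq> v \<and> independent {u, v}"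
    using \<open>v \<noteq> 0\<close> span_base[of v "{v}"] by (auto simp: independent_insert)
  then have "sectional_curvature M g q u v \<le> \<delta>"
    using sec q unfolding sectional_curvature_le_def by blast
  then show ?thesis
    using uu orth assms(3) by (simp add: sectional_curvature_def coords_def curvature_eq_crv field_simps)
qed

section \<open>Jacobi fields along unit-speed rays\<close>

definition nn where "nn v w s = N (s *\<^sub>R v) w w"
definition nn1 where "nn1 v w s = dd (\<lambda>z. N z w w) (s *\<^sub>R v) v"
definition nn2 where "nn2 v w s = d2 (\<lambda>z. N z w w) (s *\<^sub>R v) v v"

lemma unit_ray_B: "rad v = 1 \<Longrightarrow> s *\<^sub>R v \<in> B \<longleftrightarrow> \<bar>s\<bar> < R"
  by (simp add: B_iff rad_scale)

lemma nn_deriv: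
  assumes "rad v = 1" "\<bar>s\<bar> < R"
  shows "(nn v w has_real_derivative nn1 v w s) (at s)" "(nn1 v w has_real_derivative nn2 v w s) (at s)"
proof -
  have s: "s *\<^sub>R v \<in> B" using assms unit_ray_B by simp
  show "(nn v w has_real_derivative nn1 v w s) (at s)"
    unfolding nn_def[abs_def] nn1_def by (rule N_along[OF s])
  show "(nn1 v w has_real_derivative nn2 v w s) (at s)"
    unfolding nn1_def[abs_def] nn2_def has_real_derivative_iff_has_vector_derivative
    by (rule curve_compose[OF smooth_on_dd[OF N.smooth] s line_curve])
qed

text \<open>For y = |J|^2 = t^2 n one has y' = 2 <Y, J> and y'' = 2 (|Y|^2 - <R(J, T)T, J>). The
  Gauss lemma makes J orthogonal to the unit vector T, so the curvature bound applies, and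
  Cauchy-Schwarz for Y and J gives the claim.\<close>

lemma jacobi_inequality:
  assumes v: "rad v = 1" and t: "0 < t" "t < R" and orth: "g p v w = 0"
  shows "t\<^sup>2 * nn v w t * (2 * nn v w t + 4 * t * nn1 v w t + t\<^sup>2 * nn2 v w t) / 2
     - (2 * t * nn v w t + t\<^sup>2 * nn1 v w t)\<^sup>2 / 4 \<ge> - \<delta> * (t\<^sup>2 * nn v w t)\<^sup>2"
proof -
  have tB: "t *\<^sub>R v \<in> B" using unit_ray_B[OF v] t by simp
  let ?q = "E (t *\<^sub>R v)" and ?d = "chart_at M (E (t *\<^sub>R v))"
  have q: "?q \<in> carrier M" using param_carrier[OF E_param tB] .
  note d = chart_at[OF q]
  let ?O = "B \<inter> E -` cdom ?d"
  interpret m: metric_on "cimage ?d" "local_metric M g ?d" by (rule metric_on_chart[OF d(1)])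
  let ?G = "local_metric M g ?d"
  let ?\<tau> = "cmap ?d \<circ> E"
  define x where "x s = ?\<tau> (s *\<^sub>R v)" for s
  define T where "T s = dd ?\<tau> (s *\<^sub>R v) v" for s
  define J where "J s = dd ?\<tau> (s *\<^sub>R v) (s *\<^sub>R w)" for s
  define J1 where "J1 s = d2 ?\<tau> (s *\<^sub>R v) v (s *\<^sub>R w) + dd ?\<tau> (s *\<^sub>R v) w" for s
  define Y where "Y s = J1 s + chr ?G (x s) (T s) (J s)" for s
  \<comment> \<open>The chart \<open>?d\<close> covers the ray only near time \<open>t\<close>, and
    \<open>jacobi_field\<close> excludes time 0; derivatives at \<open>t\<close> are computed on
    this open set.\<close>
  define I where "I = (\<lambda>s. s *\<^sub>R v) -` ?O \<inter> {0<..}"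
  have I: "open I" unfolding I_def
    by (intro open_Int continuous_open_vimage param_chart_open[OF E_param d(1)] continuous_intros open_greaterThan)
  have tI: "t \<in> I" using tB d t by (simp add: I_def)
  have energy: "((\<lambda>s. ?G (x s) (J s) (J s)) has_vector_derivative 2 * ?G (x s) (Y s) (J s)) (at s)"
    "((\<lambda>s. ?G (x s) (Y s) (J s)) has_vector_derivative
       ?G (x s) (Y s) (Y s) - ?G (x s) (crv ?G (x s) (J s) (T s) (T s)) (J s)) (at s)" if "s \<in> I" for s
  proof -
    have s: "s *\<^sub>R v \<in> ?O" "s \<noteq> 0" using that by (auto simp: I_def)
    have xs: "x s \<in> cimage ?d" using s cmap_cimage by (auto simp: x_def)
    note jf = jacobi_field(1,2)[OF d(1) s] jacobi_field(3-5)[OF d(1) s, where w = w]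
    show "((\<lambda>s. ?G (x s) (J s) (J s)) has_vector_derivative 2 * ?G (x s) (Y s) (J s)) (at s)"
      unfolding Y_def by (rule m.jacobi_energy(1)[where x = x and t = s and T = T and J = J and ?J1.0 = J1, OF xs])
        (unfold x_def[abs_def] T_def[abs_def] J_def[abs_def] J1_def[abs_def], rule jf(1), rule jf(2), rule jf(3), rule jf(4), rule jf(5))
    show "((\<lambda>s. ?G (x s) (Y s) (J s)) has_vector_derivative
       ?G (x s) (Y s) (Y s) - ?G (x s) (crv ?G (x s) (J s) (T s) (T s)) (J s)) (at s)"
      unfolding Y_def by (rule m.jacobi_energy(2)[where x = x and t = s and T = T and J = J and ?J1.0 = J1, OF xs])
        (unfold x_def[abs_def] T_def[abs_def] J_def[abs_def] J1_def[abs_def], rule jf(1), rule jf(2), rule jf(3), rule jf(4), rule jf(5))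
  qed
  have NG: "N (s *\<^sub>R v) a b = ?G (x s) (dd ?\<tau> (s *\<^sub>R v) a) (dd ?\<tau> (s *\<^sub>R v) b)" if "s \<in> I" for s a b
    using N_chart[OF _ d(1), of "s *\<^sub>R v" a b] that by (simp add: I_def x_def)
  have y: "?G (x s) (J s) (J s) = s\<^sup>2 * nn v w s" if "s \<in> I" for s
  proof -
    have "s *\<^sub>R v \<in> B" using that by (simp add: I_def)
    then show ?thesis
      unfolding J_def NG[OF that, symmetric] nn_def
      by (simp add: bilinear_simps[OF N.bil] power2_eq_square)
  qed
  have absR: "\<bar>s\<bar> < R" if "s \<in> I" for s using that unit_ray_B[OF v] by (auto simp: I_def)
  have yd: "2 * ?G (x s) (Y s) (J s) = 2 * s * nn v w s + s\<^sup>2 * nn1 v w s" if "s \<in> I" for s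
  proof -
    have "((\<lambda>s. s\<^sup>2 * nn v w s) has_real_derivative 2 * s * nn v w s + s\<^sup>2 * nn1 v w s) (at s)"
      using nn_deriv(1)[OF v absR[OF that]] by (auto intro!: derivative_eq_intros)
    moreover have "((\<lambda>s. s\<^sup>2 * nn v w s) has_real_derivative 2 * ?G (x s) (Y s) (J s)) (at s)"
      unfolding has_real_derivative_iff_has_vector_derivative
      by (rule has_vector_derivative_transform_within_open[OF energy(1)[OF that] I that]) (rule y)
    ultimately show ?thesis using DERIV_unique by blast
  qed
  let ?e = "?G (x t) (Y t) (Y t) - ?G (x t) (crv ?G (x t) (J t) (T t) (T t)) (J t)"
  have "((\<lambda>s. s * nn v w s + s\<^sup>2 * nn1 v w s / 2) has_real_derivative
      nn v w t + t * nn1 v w t + t * nn1 v w t + t\<^sup>2 * nn2 v w t / 2) (at t)"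
    using nn_deriv[OF v absR[OF tI]] by (auto intro!: derivative_eq_intros)
  moreover have "((\<lambda>s. s * nn v w s + s\<^sup>2 * nn1 v w s / 2) has_real_derivative ?e) (at t)"
    unfolding has_real_derivative_iff_has_vector_derivative
    by (rule has_vector_derivative_transform_within_open[OF energy(2)[OF tI] I tI]) (use yd in fastforce)
  ultimately have e: "nn v w t + t * nn1 v w t + t * nn1 v w t + t\<^sup>2 * nn2 v w t / 2 = ?e"
    using DERIV_unique by blast
  have xt: "x t = cmap ?d ?q" "x t \<in> cimage ?d" using cmap_cimage[OF d(2)] by (auto simp: x_def)
  have Gg: "?G (x t) = g ?q" unfolding xt(1) by (rule local_metric_preferred[OF q])
  have TT: "g ?q (T t) (T t) = 1"
  proof -
    have "g ?q (T t) (T t) = N (t *\<^sub>R v) v v" unfolding Gg[symmetric] T_def NG[OF tI] ..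
    moreover have "N (t *\<^sub>R v) (t *\<^sub>R v) v = g p (t *\<^sub>R v) v" by (rule gauss[OF tB])
    moreover have "g p v v = 1" using v rad_sq[of v] by simp
    ultimately show ?thesis using t by (simp add: bilinear_simps[OF N.bil[OF tB]] gp_simps)
  qed
  have JT: "g ?q (J t) (T t) = 0"
  proof -
    have "g ?q (J t) (T t) = N (t *\<^sub>R v) (t *\<^sub>R w) v" unfolding Gg[symmetric] T_def J_def NG[OF tI] ..
    also have "\<dots> = N (t *\<^sub>R v) (t *\<^sub>R v) w"
      using N.sym[OF tB, of w v] by (simp add: bilinear_simps[OF N.bil[OF tB]])
    also have "\<dots> = 0" unfolding gauss[OF tB] using orth by (simp add: gp_simps)
    finally show ?thesis .
  qed
  have "?G (x t) (crv ?G (x t) (J t) (T t) (T t)) (J t) \<le> \<delta> * ?G (x t) (J t) (J t)"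
    using curvature_bound[OF q JT TT] unfolding Gg unfolding xt(1) .
  then have e': "?e \<ge> ?G (x t) (Y t) (Y t) - \<delta> * (t\<^sup>2 * nn v w t)" using y[OF tI] by simp
  have yt: "t\<^sup>2 * nn v w t \<ge> 0" using y[OF tI] inner_formD(4)[OF m.inner[OF xt(2)]] by metis
  have "(2 * t * nn v w t + t\<^sup>2 * nn1 v w t)\<^sup>2 / 4 = (?G (x t) (Y t) (J t))\<^sup>2"
    unfolding yd[OF tI, symmetric] by (simp add: power_mult_distrib)
  also have "\<dots> \<le> ?G (x t) (Y t) (Y t) * (t\<^sup>2 * nn v w t)"
    using inner_form_cauchy_schwarz[OF m.inner[OF xt(2)], of "Y t" "J t"] y[OF tI] by simp
  also have "\<dots> \<le> (?e + \<delta> * (t\<^sup>2 * nn v w t)) * (t\<^sup>2 * nn v w t)"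
    using e' yt by (intro mult_right_mono) auto
  finally show ?thesis
    unfolding e[symmetric] by (simp add: field_simps power2_eq_square)
qed

text \<open>The Hessian of half the squared radius for the metric \<open>N\<close>; the Gauss lemma
  lets it be written without Christoffel symbols, as \<open>Hs_chr\<close> confirms.\<close>

definition Hs where "Hs x a b = N x a b + dd (\<lambda>z. N z a b) x x / 2"

text \<open>In the direction \<open>w\<close> the Hessian equals n + t n'/2, where n is the squared
  length of \<open>w\<close> along the ray; this is the quantity that Sturm comparison
  bounds.\<close>

lemma Hs_orth:
  assumes v: "rad v = 1" and t: "0 < t" "t < R" "\<delta> > 0 \<Longrightarrow> t < pi / sqrt \<delta>" and orth: "g p v w = 0" and w: "w \<noteq> 0"
  shows "Hs (t *\<^sub>R v) w w \<ge> kf \<delta> t * N (t *\<^sub>R v) w w"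
proof -
  \<comment> \<open>The comparison starts at the centre and needs an interval on which both the
    normal coordinates and the positivity of \<open>sn \<delta>\<close> are available.\<close>
  define b where "b = (if \<delta> > 0 then min R (pi / sqrt \<delta>) else R)"
  have b: "\<delta> > 0 \<Longrightarrow> b \<le> pi / sqrt \<delta>" "b \<le> R" "t < b" using t by (auto simp: b_def)
  have B: "s *\<^sub>R v \<in> B" if "0 \<le> s" "s < b" for s using unit_ray_B[OF v] that b by simp
  have "(nn v w t + t * nn1 v w t / 2) * sn \<delta> t \<ge> t * nn v w t * cs \<delta> t"
  proof (rule sturm_comparison[OF b(1) _ _ _ _ t(1) b(3)])
    fix s assume s: "0 \<le> s" "s < b"
    show "(nn v w has_real_derivative nn1 v w s) (at s)" "(nn1 v w has_real_derivative nn2 v w s) (at s)"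
      using nn_deriv[OF v] s b by auto
    show "nn v w s > 0" unfolding nn_def by (rule inner_formD(3)[OF N.inner[OF B[OF s]] w])
  next
    fix s assume "0 < s" "s < b"
    then show "s\<^sup>2 * nn v w s * (2 * nn v w s + 4 * s * nn1 v w s + s\<^sup>2 * nn2 v w s) / 2
     - (2 * s * nn v w s + s\<^sup>2 * nn1 v w s)\<^sup>2 / 4 \<ge> - \<delta> * (s\<^sup>2 * nn v w s)\<^sup>2"
      using jacobi_inequality[OF v _ _ orth] b by simp
  qed
  moreover have "sn \<delta> t > 0" using sn_pos[OF t(1,3)] .
  moreover have "Hs (t *\<^sub>R v) w w = nn v w t + t * nn1 v w t / 2"
    using linear_cmul[OF N.dG_linear[OF B[of t]], of w w t v] t b
    by (simp add: Hs_def nn_def nn1_def)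
  moreover have "kf \<delta> t * N (t *\<^sub>R v) w w = (t * nn v w t * cs \<delta> t) / sn \<delta> t"
    using t(1) by (simp add: kf_def nn_def)
  ultimately show ?thesis by (simp only: pos_divide_le_eq)
qed

lemma Hs_bilinear: "x \<in> B \<Longrightarrow> bilinear (Hs x)"
  unfolding Hs_def
  by (rule bilinearI) (simp_all add: bilinear_simps[OF N.bil] bilinear_simps[OF N.dG_bilinear] field_simps)

text \<open>Radially the Hessian coincides with the metric, orthogonally the Sturm bound holds, and
  the cross terms vanish by the Gauss lemma. The quotient is the squared length of the radial part
  of \<open>a\<close>.\<close>

lemma hessian_comparison:
  assumes x: "x \<in> B" and pi: "\<delta> > 0 \<Longrightarrow> rad x < pi / sqrt \<delta>"
  shows "Hs x a a \<ge> kf \<delta> (rad x) * N x a a + (1 - kf \<delta> (rad x)) * ((g p x a)\<^sup>2 / (rad x)\<^sup>2)"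
proof (cases "x = 0")
  \<comment> \<open>At the centre \<open>kf \<delta> 0 = 1\<close>, so the quotient with denominator
    0 is multiplied by 0.\<close>
  case True
  then show ?thesis
    using linear_0[OF N.dG_linear[OF zero_B]] by (simp add: Hs_def kf_def rad_eq_0[THEN iffD2] gp_simps)
next
  case False
  define \<rho> where "\<rho> = rad x"
  define \<alpha> where "\<alpha> = g p x a / \<rho>\<^sup>2"
  define w where "w = a - \<alpha> *\<^sub>R x"
  have \<rho>: "\<rho> > 0" "\<rho> < R" "g p x x = \<rho>\<^sup>2"
    using False rad_nonneg[of x] rad_eq_0[of x] x by (auto simp: \<rho>_def B_iff rad_sq)
  have v: "rad ((1/\<rho>) *\<^sub>R x) = 1" "x = \<rho> *\<^sub>R ((1/\<rho>) *\<^sub>R x)" using \<rho> by (auto simp: rad_scale \<rho>_def)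
  have xw: "g p x w = 0" using \<rho> by (simp add: w_def gp_simps \<alpha>_def)
  have a: "a = \<alpha> *\<^sub>R x + w" by (simp add: w_def)
  note Nb = bilinear_simps[OF N.bil[OF x]] and Hb = bilinear_simps[OF Hs_bilinear[OF x]]
  have N1: "N x x x = \<rho>\<^sup>2" "N x x w = 0" "N x w x = 0"
    using gauss[OF x] xw \<rho>(3) N.sym[OF x, of w x] by auto
  have H1: "Hs x x b = g p x b" "Hs x b x = g p x b" for b
    using dN_radial[OF x, of b] gauss[OF x, of b] N.dG_sym[OF x, of b x] N.sym[OF x, of b x] by (auto simp: Hs_def)
  have Naa: "N x a a = \<alpha>\<^sup>2 * \<rho>\<^sup>2 + N x w w" unfolding a by (simp add: Nb N1 power2_eq_square)
  have Haa: "Hs x a a = \<alpha>\<^sup>2 * \<rho>\<^sup>2 + Hs x w w"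
    unfolding a by (simp add: Hb H1 gp_simps xw \<rho>(3) power2_eq_square)
  have "Hs x w w \<ge> kf \<delta> \<rho> * N x w w"
  proof (cases "w = 0")
    case True then show ?thesis by (simp add: Nb Hb)
  next
    case False
    have "g p ((1/\<rho>) *\<^sub>R x) w = 0" using xw by (simp add: gp_simps)
    from Hs_orth[OF v(1) \<rho>(1,2) _ this False] show ?thesis using pi v(2) by (simp add: \<rho>_def)
  qed
  moreover have "(g p x a)\<^sup>2 / \<rho>\<^sup>2 = \<alpha>\<^sup>2 * \<rho>\<^sup>2"
    using \<rho>(1) by (simp add: \<alpha>_def power_divide power2_eq_square)
  ultimately show ?thesis unfolding Haa Naa \<rho>_def[symmetric] by (simp add: algebra_simps)
qed

end

subsection \<open>Geodesic balls\<close>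

text \<open>The speed \<open>s\<close> enters as a pointwise bound through monotonicity of the
  nonnegative integral. Measurability is supplied by \<open>f'\<close>, which is gauge integrable by
  the fundamental theorem.\<close>

lemma increment_le_nn_integral:
  fixes f :: "real \<Rightarrow> real" and s :: "real \<Rightarrow> real"
  assumes "finite T" "a \<le> b" "continuous_on {a..b} f"
    and d: "\<And>x. x \<in> {a<..<b} - T \<Longrightarrow> (f has_vector_derivative f' x) (at x)"
    and le: "\<And>x. x \<in> {a<..<b} - T \<Longrightarrow> \<bar>f' x\<bar> \<le> s x"
  shows "ennreal (f b - f a) \<le> (\<integral>\<^sup>+x\<in>{a<..<b}. ennreal (s x) \<partial>lborel)" (is "_ \<le> ?I")
proof (cases "?I = \<infinity>")
  case False
  have ftc: "(f' has_integral f b - f a) {a..b}"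
    by (rule fundamental_theorem_of_calculus_interior_strong[OF assms(1,2) d assms(3)])
  have meas: "f' \<in> borel_measurable (lebesgue_on {a..b})"
    using ftc integrable_imp_measurable by blast
  have "finite (insert a (insert b T))" using assms(1) by simp
  then have "AE x in lborel. x \<notin> insert a (insert b T)"
    by (intro AE_not_in finite_imp_null_set_lborel)
  then have "AE x in lebesgue. x \<notin> insert a (insert b T)" by (rule AE_completion)
  then have ae: "AE x in lebesgue. ennreal (norm (f' x)) * indicator {a..b} x \<le> ennreal (s x) * indicator {a<..<b} x"
    by eventually_elim (use le in \<open>auto simp: indicator_def intro!: ennreal_leI\<close>)
  have "(\<integral>\<^sup>+x. ennreal (norm (f' x)) \<partial>lebesgue_on {a..b})
     = (\<integral>\<^sup>+x. ennreal (norm (f' x)) * indicator {a..b} x \<partial>lebesgue)"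
    by (subst nn_integral_restrict_space) auto
  also have "\<dots> \<le> (\<integral>\<^sup>+x. ennreal (s x) * indicator {a<..<b} x \<partial>lebesgue)"
    by (rule nn_integral_mono_AE[OF ae])
  also have "\<dots> = ?I" by (rule nn_integral_completion)
  finally have nn: "(\<integral>\<^sup>+x. ennreal (norm (f' x)) \<partial>lebesgue_on {a..b}) \<le> ?I" .
  then have int: "integrable (lebesgue_on {a..b}) f'"
    using meas False by (auto simp: integrable_iff_bounded less_top intro: le_less_trans)
  have "f b - f a = integral\<^sup>L (lebesgue_on {a..b}) f'"
    using lebesgue_integral_eq_integral[OF int] integral_unique[OF ftc] by simp
  also have "\<dots> \<le> integral\<^sup>L (lebesgue_on {a..b}) (\<lambda>x. norm (f' x))"
    by (intro integral_mono int integrable_norm) auto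
  finally have "ennreal (f b - f a) \<le> ennreal (integral\<^sup>L (lebesgue_on {a..b}) (\<lambda>x. norm (f' x)))"
    by (rule ennreal_leI)
  also have "\<dots> = (\<integral>\<^sup>+x. ennreal (norm (f' x)) \<partial>lebesgue_on {a..b})"
    by (rule nn_integral_eq_integral[symmetric]) (use int in auto)
  finally show ?thesis using nn by (rule order_trans)
qed simp

text \<open>The norm of \<open>G\<close> attains a positive minimum on the unit sphere; homogeneity
  extends the bound. It makes closed balls of \<open>rad\<close> compact.\<close>

lemma inner_form_lower_bound:
  fixes G :: "'e::euclidean_space \<Rightarrow> 'e \<Rightarrow> real"
  assumes "inner_form G" shows "\<exists>c>0. \<forall>v. c * norm v \<le> sqrt (G v v)"
proof -
  have "continuous_on UNIV (\<lambda>v. G v v)"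
    by (rule smooth_on_continuous, rule smooth_on_bilinear[where V = UNIV and G = "\<lambda>_. G" and F = "\<lambda>v. v" and A = "\<lambda>v. v" and B = "\<lambda>v. v"])
       (use inner_formD(1)[OF assms] in auto)
  then have c: "continuous_on (sphere 0 1) (\<lambda>v. sqrt (G v v))"
    using continuous_on_subset by (intro continuous_on_real_sqrt) blast
  obtain b :: 'e where "b \<in> Basis" using nonempty_Basis by blast
  then have "sphere (0::'e) 1 \<noteq> {}" by (metis norm_Basis mem_sphere_0 empty_iff)
  then obtain u where u: "u \<in> sphere 0 1" "\<forall>v\<in>sphere 0 1. sqrt (G u u) \<le> sqrt (G v v)"
    using continuous_attains_inf[OF compact_sphere _ c] by blast
  have "u \<noteq> 0" using u(1) by auto
  have "sqrt (G u u) * norm v \<le> sqrt (G v v)" for v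
  proof (cases "v = 0")
    case False
    have "sqrt (G u u) \<le> sqrt (G (v /\<^sub>R norm v) (v /\<^sub>R norm v))" using u(2) False by simp
    also have "\<dots> = sqrt (G v v) / norm v"
      using False by (simp add: bilinear_simps[OF inner_formD(1)[OF assms]] real_sqrt_mult real_sqrt_divide
          flip: power2_eq_square divide_inverse mult.assoc) (simp add: field_simps)
    finally show ?thesis using False by (simp add: field_simps)
  qed (simp add: bilinear_lzero[OF inner_formD(1)[OF assms]])
  then show ?thesis using inner_formD(3)[OF assms \<open>u \<noteq> 0\<close>] by (intro exI[of _ "sqrt (G u u)"]) auto
qed

context normal_ball begin

lemma compact_rad: "compact {v. rad v \<le> r}"
proof -
  obtain c where c: "c > 0" "\<And>v. c * norm v \<le> rad v" using inner_form_lower_bound[OF gp] by (auto simp: rad_def)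
  have "norm v \<le> r / c" if "rad v \<le> r" for v
    using c(1) order_trans[OF c(2)[of v] that] by (simp add: field_simps)
  then have "bounded {v. rad v \<le> r}" unfolding bounded_iff by blast
  moreover have "closed {v. rad v \<le> r}"
    by (intro closed_Collect_le continuous_rad continuous_on_const)
  ultimately show ?thesis by (simp add: compact_eq_bounded_closed)
qed

lemma compact_E_ball: assumes "r < R" shows "compact (E ` {v. rad v \<le> r})"
proof (rule compact_continuous_image[OF _ compact_rad])
  show "continuous_on {v. rad v \<le> r} E"
    using E_param assms unfolding smooth_param_def by (rule_tac continuous_on_subset[of B]) (auto simp: B_iff)
qed

text \<open>The Gauss lemma gives the ray the constant speed \<open>rad v\<close>; it provides the
  upper bound for the distance.\<close>

lemma radial_curve:
  assumes v: "v \<in> B"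
  shows "piecewise_C1_curve M (\<lambda>t. E (t *\<^sub>R v))" "curve_length M g (\<lambda>t. E (t *\<^sub>R v)) = ennreal (rad v)"
proof -
  obtain \<gamma> where \<gamma>: "geodesic M g \<gamma>" "\<And>t. E (t *\<^sub>R v) = \<gamma> t" using ray[where v = v] by blast
  have eq: "(\<lambda>t. E (t *\<^sub>R v)) = \<gamma>" using \<gamma>(2) by blast
  have P: "smooth_param M UNIV \<gamma>" using \<gamma>(1) by (simp add: geodesic_iff)
  have "(cmap c \<circ> \<gamma>) C1_differentiable_on ({t\<in>{0<..<1}. \<gamma> t \<in> cdom c} - {})" if c: "c \<in> atlas M" for c
  proof -
    let ?O = "UNIV \<inter> \<gamma> -` cdom c"
    note s = param_chart_smooth[OF P c]
    have "continuous_on {t\<in>{0<..<1}. \<gamma> t \<in> cdom c} (\<lambda>t. dd (cmap c \<circ> \<gamma>) t 1)"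
      by (rule continuous_on_subset[OF smooth_on_continuous[OF smooth_on_dd[OF s]]]) auto
    moreover have "((cmap c \<circ> \<gamma>) has_vector_derivative dd (cmap c \<circ> \<gamma>) t 1) (at t)" if "\<gamma> t \<in> cdom c" for t
      by (rule real_dd(1)[OF smooth_on_differentiable[OF s]]) (use that in simp)
    ultimately show ?thesis
      unfolding C1_differentiable_on_def by (intro exI[of _ "\<lambda>t. dd (cmap c \<circ> \<gamma>) t 1"]) auto
  qed
  moreover have "continuous_on {0..1} \<gamma>" "\<gamma> ` {0..1} \<subseteq> carrier M"
    using P continuous_on_subset unfolding smooth_param_def by blast+
  ultimately show "piecewise_C1_curve M (\<lambda>t. E (t *\<^sub>R v))"
    unfolding eq piecewise_C1_curve_def by blast
  have "g (\<gamma> t) (velocity M \<gamma> t) (velocity M \<gamma> t) = g p v v" if t: "0 < t" "t < 1" for t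
  proof -
    have tB: "t *\<^sub>R v \<in> B" using scale_B[OF v, of t] t by simp
    note d = chart_at[OF param_carrier[OF E_param tB]]
    have "velocity M \<gamma> t = dd (cmap (chart_at M (E (t *\<^sub>R v))) \<circ> E) (t *\<^sub>R v) v"
      using velocity_eq[OF P UNIV_I] ray_derivatives(1)[OF tB d \<gamma>] by (simp add: \<gamma>(2))
    then have "g (\<gamma> t) (velocity M \<gamma> t) (velocity M \<gamma> t) = N (t *\<^sub>R v) v v"
      by (simp add: N_def param_metric_def \<gamma>(2))
    moreover have "N (t *\<^sub>R v) (t *\<^sub>R v) v = g p (t *\<^sub>R v) v" by (rule gauss[OF tB])
    ultimately show ?thesis using t by (simp add: bilinear_simps[OF N.bil[OF tB]] gp_simps)
  qed
  then have "curve_length M g \<gamma> = (\<integral>\<^sup>+t. ennreal (rad v) * indicator {0<..<1} (t::real) \<partial>lborel)"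
    unfolding curve_length_def rad_def by (intro nn_integral_cong) (auto simp: indicator_def)
  also have "\<dots> = ennreal (rad v)" by (subst nn_integral_cmult_indicator) auto
  finally show "curve_length M g (\<lambda>t. E (t *\<^sub>R v)) = ennreal (rad v)" unfolding eq .
qed

text \<open>The radius is not differentiable at the centre, hence the smoothing sqrt (\<epsilon>^2 +
  \<rho>^2). Its derivative is, by the Gauss lemma, a product of position and velocity in
  \<open>N\<close>, which Cauchy-Schwarz bounds by the speed.\<close>

lemma radial_derivative_bound:
  assumes cont: "continuous_on {0..1} \<gamma>" and car: "\<gamma> ` {0..1} \<subseteq> carrier M"
    and t: "0 < t" "t < 1" "\<gamma> t \<in> W"
    and d: "((cmap (chart_at M (\<gamma> t)) \<circ> \<gamma>) has_vector_derivative velocity M \<gamma> t) (at t)"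
    and \<epsilon>: "\<epsilon> > 0"
  shows "\<exists>D. ((\<lambda>s. sqrt (\<epsilon>\<^sup>2 + (rad (\<Phi> (\<gamma> s)))\<^sup>2)) has_vector_derivative D) (at t) \<and>
     \<bar>D\<bar> \<le> sqrt (g (\<gamma> t) (velocity M \<gamma> t) (velocity M \<gamma> t))"
proof -
  let ?q = "\<gamma> t" and ?d = "chart_at M (\<gamma> t)" and ?z = "\<Phi> (\<gamma> t)"
  have q: "?q \<in> carrier M" using car t by auto
  note dd = chart_at[OF q]
  define V where "V = velocity M \<gamma> t"
  define P where "P = dd (\<Phi> \<circ> cinv ?d) (cmap ?d ?q) V"
  have zB: "?z \<in> B" and Ez: "E ?z = ?q" using \<Phi>_B[OF t(3)] E_\<Phi>[OF t(3)] by auto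
  have "openin (top_of_set {0..1}) ({0..1} \<inter> \<gamma> -` (cdom ?d \<inter> W))"
    using cont car openin_Int[OF openin_cdom[OF dd(1)] openin_W'] by (intro continuous_openin_preimage[of _ _ "carrier M"]) auto
  then obtain O1 where O1: "open O1" "{0..1} \<inter> \<gamma> -` (cdom ?d \<inter> W) = {0..1} \<inter> O1"
    unfolding openin_open by blast
  define O2 where "O2 = O1 \<inter> {0<..<1}"
  have mem: "s \<in> {0..1} \<inter> \<gamma> -` (cdom ?d \<inter> W) \<longleftrightarrow> s \<in> {0..1} \<inter> O1" for s unfolding O1(2) ..
  have O2: "open O2" "t \<in> O2"
    using O1(1) mem[of t] t dd(2) by (auto simp: O2_def)
  have O2': "\<gamma> s \<in> cdom ?d \<and> \<gamma> s \<in> W" if "s \<in> O2" for s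
    using mem[of s] that by (simp add: O2_def)
  have "((\<lambda>s. (\<Phi> \<circ> cinv ?d) ((cmap ?d \<circ> \<gamma>) s)) has_vector_derivative P) (at t)"
    using curve_compose[OF \<Phi>_chart_smooth[OF dd(1)] _ d] dd(2) t(3) by (simp add: P_def V_def)
  then have dP: "((\<lambda>s. \<Phi> (\<gamma> s)) has_vector_derivative P) (at t)"
    by (rule has_vector_derivative_transform_within_open[OF _ O2(1,2)])
       (use O2' cinv_cmap[OF dd(1)] in auto)
  have "((\<lambda>s. (cmap ?d \<circ> E) (\<Phi> (\<gamma> s))) has_vector_derivative dd (cmap ?d \<circ> E) ?z P) (at t)"
    by (rule curve_compose[OF param_chart_smooth[OF E_param dd(1)] _ dP]) (use zB Ez dd(2) in simp)
  then have "((cmap ?d \<circ> \<gamma>) has_vector_derivative dd (cmap ?d \<circ> E) ?z P) (at t)"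
    by (rule has_vector_derivative_transform_within_open[OF _ O2(1,2)]) (use O2' E_\<Phi> in auto)
  then have V: "V = dd (cmap ?d \<circ> E) ?z P" using vector_derivative_unique_at[OF d] by (simp add: V_def)
  have gV: "g ?q V V = N ?z P P" unfolding V N_def param_metric_def Ez ..
  have "((\<lambda>s. g p (\<Phi> (\<gamma> s)) (\<Phi> (\<gamma> s))) has_vector_derivative
     dd (\<lambda>y. g p ?z ?z) ?z P + g p P ?z + g p ?z P) (at t)"
    by (rule curve_bilinear[where V = UNIV and G = "\<lambda>_. g p" and F = "\<lambda>s. \<Phi> (\<gamma> s)" and A = "\<lambda>s. \<Phi> (\<gamma> s)" and B = "\<lambda>s. \<Phi> (\<gamma> s)"])
       (use inner_formD(1)[OF gp] dP in auto)
  then have du: "((\<lambda>s. (rad (\<Phi> (\<gamma> s)))\<^sup>2) has_real_derivative 2 * g p ?z P) (at t)"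
    unfolding rad_sq has_real_derivative_iff_has_vector_derivative using inner_formD(2)[OF gp, of P ?z] by simp
  define u where "u = rad ?z"
  define D where "D = g p ?z P / sqrt (\<epsilon>\<^sup>2 + u\<^sup>2)"
  have pos: "\<epsilon>\<^sup>2 + u\<^sup>2 > 0" using \<epsilon> by (simp add: add_pos_nonneg)
  have "((\<lambda>s. sqrt (\<epsilon>\<^sup>2 + (rad (\<Phi> (\<gamma> s)))\<^sup>2)) has_real_derivative D) (at t)"
  proof -
    have "((\<lambda>s. \<epsilon>\<^sup>2 + (rad (\<Phi> (\<gamma> s)))\<^sup>2) has_real_derivative 0 + 2 * g p ?z P) (at t)"
      by (rule DERIV_add[OF DERIV_const du])
    from DERIV_chain2[OF DERIV_real_sqrt this] pos show ?thesis by (simp add: D_def u_def field_simps)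
  qed
  moreover have "\<bar>D\<bar> \<le> sqrt (g ?q V V)"
  proof -
    have "(g p ?z P)\<^sup>2 \<le> u\<^sup>2 * g ?q V V"
      using inner_form_cauchy_schwarz[OF N.inner[OF zB], of ?z P]
      unfolding gV gauss[OF zB] u_def rad_sq .
    also have "\<dots> \<le> (\<epsilon>\<^sup>2 + u\<^sup>2) * g ?q V V"
      using inner_formD(4)[OF g_inner[OF q]] by (intro mult_right_mono) auto
    finally have "D\<^sup>2 \<le> g ?q V V" using pos by (simp add: D_def power_divide field_simps)
    then show ?thesis by (metis real_sqrt_abs real_sqrt_le_iff)
  qed
  ultimately show ?thesis
    unfolding V_def has_real_derivative_iff_has_vector_derivative by blast
qed

text \<open>The bound on the derivative of the smoothed radius is integrated from the start, where
  its value is \<epsilon>; then \<epsilon> tends to 0.\<close>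

lemma radial_le_length:
  assumes \<gamma>: "piecewise_C1_curve M \<gamma>" "\<gamma> 0 = p" and t: "0 \<le> t" "t < 1" and inW: "\<And>s. 0 \<le> s \<Longrightarrow> s \<le> t \<Longrightarrow> \<gamma> s \<in> W"
  shows "ennreal (rad (\<Phi> (\<gamma> t))) \<le> curve_length M g \<gamma>"
proof -
  obtain T where cont: "continuous_on {0..1} \<gamma>" and car: "\<gamma> ` {0..1} \<subseteq> carrier M" and T: "finite T"
    "\<And>c. c \<in> atlas M \<Longrightarrow> (cmap c \<circ> \<gamma>) C1_differentiable_on ({t\<in>{0<..<1}. \<gamma> t \<in> cdom c} - T)"
    using \<gamma>(1) unfolding piecewise_C1_curve_def by blast
  define sp where "sp s = sqrt (g (\<gamma> s) (velocity M \<gamma> s) (velocity M \<gamma> s))" for s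
  have vel: "((cmap (chart_at M (\<gamma> s)) \<circ> \<gamma>) has_vector_derivative velocity M \<gamma> s) (at s)" if "0 < s" "s < 1" "s \<notin> T" for s
  proof -
    have "\<gamma> s \<in> carrier M" using car that by auto
    note d = chart_at[OF this]
    from T(2)[OF d(1)] obtain D where "\<forall>t\<in>{t\<in>{0<..<1}. \<gamma> t \<in> cdom (chart_at M (\<gamma> s))} - T.
        ((cmap (chart_at M (\<gamma> s)) \<circ> \<gamma>) has_vector_derivative D t) (at t)"
      unfolding C1_differentiable_on_def by blast
    then have "((cmap (chart_at M (\<gamma> s)) \<circ> \<gamma>) has_vector_derivative D s) (at s)" using that d(2) by simp
    then show ?thesis unfolding velocity_def by (metis vector_derivative_at)
  qed
  have "ennreal (rad (\<Phi> (\<gamma> t))) \<le> curve_length M g \<gamma> + ennreal \<epsilon>" if \<epsilon>: "\<epsilon> > 0" for \<epsilon>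
  proof -
    define f where "f s = sqrt (\<epsilon>\<^sup>2 + (rad (\<Phi> (\<gamma> s)))\<^sup>2)" for s
    have "\<forall>s\<in>{0<..<t} - T. \<exists>D. (f has_vector_derivative D) (at s) \<and> \<bar>D\<bar> \<le> sp s"
      unfolding f_def[abs_def] sp_def using t inW
      by (intro ballI radial_derivative_bound cont car vel \<epsilon>) auto
    then obtain f' where f': "\<And>s. s \<in> {0<..<t} - T \<Longrightarrow> (f has_vector_derivative f' s) (at s)"
      "\<And>s. s \<in> {0<..<t} - T \<Longrightarrow> \<bar>f' s\<bar> \<le> sp s" by metis
    have "continuous_on {0..t} (\<lambda>s. \<Phi> (\<gamma> s))"
      by (rule continuous_on_compose2[OF \<Phi>_continuous continuous_on_subset[OF cont]]) (use t inW in auto)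
    then have "continuous_on {0..t} (\<lambda>s. rad (\<Phi> (\<gamma> s)))"
      by (rule continuous_on_compose2[OF continuous_rad]) auto
    then have "continuous_on {0..t} f" unfolding f_def[abs_def] by (intro continuous_intros)
    from increment_le_nn_integral[OF T(1) t(1) this f']
    have "ennreal (f t - f 0) \<le> (\<integral>\<^sup>+x\<in>{0<..<t}. ennreal (sp x) \<partial>lborel)" .
    also have "\<dots> \<le> curve_length M g \<gamma>"
      unfolding curve_length_def sp_def using t by (intro nn_integral_mono) (auto simp: indicator_def)
    finally have le: "ennreal (f t - f 0) \<le> curve_length M g \<gamma>" .
    have "f 0 = \<epsilon>" using \<epsilon> \<Phi>_E[OF zero_B] by (simp add: f_def \<gamma>(2) E_0 rad_eq_0[THEN iffD2])
    moreover have "rad (\<Phi> (\<gamma> t)) \<le> f t" unfolding f_def by (rule real_le_rsqrt) simp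
    ultimately have "ennreal (rad (\<Phi> (\<gamma> t))) \<le> ennreal ((f t - f 0) + \<epsilon>)" by (intro ennreal_leI) simp
    \<comment> \<open>\<open>ennreal\<close> sends negative reals to 0, so the two signs of the
      increment are treated separately.\<close>
    also have "\<dots> \<le> ennreal (f t - f 0) + ennreal \<epsilon>"
    proof (cases "f t - f 0 \<ge> 0")
      case True
      then show ?thesis using ennreal_plus[OF True less_imp_le[OF \<epsilon>]] by simp
    next
      case False
      then have "ennreal ((f t - f 0) + \<epsilon>) \<le> ennreal \<epsilon>" by (intro ennreal_leI) simp
      then show ?thesis by (rule order_trans) simp
    qed
    also have "\<dots> \<le> curve_length M g \<gamma> + ennreal \<epsilon>" using le by (rule add_right_mono)
    finally show ?thesis .
  qed
  then show ?thesis by (rule ennreal_le_epsilon)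
qed

text \<open>Radial geodesics give one inclusion. Conversely, a curve of length l < r from
  \<open>p\<close> is examined at the first time t0 outside the open set of radius less than
  \<open>r\<close>: before t0 it lies in the compact image of radius at most l, which is closed, so
  it is still inside at t0.\<close>

lemma geodesic_ball_eq:
  assumes r: "0 < r" "r < R"
  shows "geodesic_ball M g p r = {q \<in> W. rad (\<Phi> q) < r}"
proof (rule set_eqI, rule iffI)
  fix q assume "q \<in> {q \<in> W. rad (\<Phi> q) < r}"
  then have q: "q \<in> W" "rad (\<Phi> q) < r" by auto
  note c = radial_curve[OF \<Phi>_B[OF q(1)]]
  have "riemannian_dist M g p q \<le> curve_length M g (\<lambda>t. E (t *\<^sub>R \<Phi> q))"
    unfolding riemannian_dist_def by (rule INF_lower) (use c(1) E_0 E_\<Phi>[OF q(1)] in simp)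
  also have "\<dots> < ennreal r" unfolding c(2) using q(2) rad_nonneg by (simp add: ennreal_lessI r)
  finally show "q \<in> geodesic_ball M g p r" using q(1) W_sub by (auto simp: geodesic_ball_def)
next
  fix q assume q: "q \<in> geodesic_ball M g p r"
  then have "riemannian_dist M g p q < ennreal r" by (simp add: geodesic_ball_def)
  then obtain \<gamma> where \<gamma>: "piecewise_C1_curve M \<gamma>" "\<gamma> 0 = p" "\<gamma> 1 = q" and len: "curve_length M g \<gamma> < ennreal r"
    unfolding riemannian_dist_def INF_less_iff by blast
  have cont: "continuous_on {0..1} \<gamma>" and car: "\<gamma> ` {0..1} \<subseteq> carrier M"
    using \<gamma>(1) unfolding piecewise_C1_curve_def by blast+
  let ?O = "{q \<in> W. rad (\<Phi> q) < r}"
  have "openin (top_of_set W) (W \<inter> (\<lambda>q. rad (\<Phi> q)) -` {..<r})"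
    by (intro continuous_openin_preimage_gen continuous_on_compose2[OF continuous_rad \<Phi>_continuous]) auto
  moreover have "W \<inter> (\<lambda>q. rad (\<Phi> q)) -` {..<r} = ?O" by auto
  ultimately have "openin (top_of_set (carrier M)) ?O" using openin_W' openin_trans by metis
  then have "openin (top_of_set {0..1}) ({0..1} \<inter> \<gamma> -` ?O)"
    using cont car by (intro continuous_openin_preimage[of _ _ "carrier M"]) auto
  then obtain Q where Q: "open Q" "{0..1} \<inter> \<gamma> -` ?O = {0..1} \<inter> Q" unfolding openin_open by blast
  have "{0..1} - \<gamma> -` ?O = {0..1} - {0..1} \<inter> \<gamma> -` ?O" by blast
  also have "\<dots> = {0..1} - Q" unfolding Q(2) by blast
  finally have cl: "closed ({0..1} - \<gamma> -` ?O)" using closed_Diff[OF closed_atLeastAtMost Q(1)] by simp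
  show "q \<in> ?O"
  proof (rule ccontr)
    assume nq: "q \<notin> ?O"
    define t0 where "t0 = Inf ({0..1} - \<gamma> -` ?O)"
    have "1 \<in> {0..1} - \<gamma> -` ?O" using nq \<gamma>(3) by simp
    then have ne: "{0..1} - \<gamma> -` ?O \<noteq> {}" by blast
    have bdd: "bdd_below ({0..1} - \<gamma> -` ?O)" by (rule bdd_below_mono[of "{0..1::real}"]) auto
    have t0: "t0 \<in> {0..1} - \<gamma> -` ?O" unfolding t0_def by (rule closed_contains_Inf[OF ne bdd cl])
    have p: "p \<in> ?O"
    proof -
      have "\<Phi> p = 0" using \<Phi>_E[OF zero_B] by (simp add: E_0)
      moreover have "p \<in> W" using E_W[OF zero_B] by (simp add: E_0)
      ultimately show ?thesis using r rad_eq_0[of 0] by simp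
    qed
    then have "t0 \<noteq> 0" using t0 \<gamma>(2) by auto
    then have t0': "0 < t0" "t0 \<le> 1" using t0 by auto
    have before: "\<gamma> s \<in> ?O" if "0 \<le> s" "s < t0" for s
    proof (rule ccontr)
      assume "\<gamma> s \<notin> ?O"
      then have "s \<in> {0..1} - \<gamma> -` ?O" using that t0' by auto
      then have "t0 \<le> s" unfolding t0_def by (rule cInf_lower[OF _ bdd])
      then show False using that by simp
    qed
    have le: "ennreal (rad (\<Phi> (\<gamma> s))) \<le> curve_length M g \<gamma>" if "0 \<le> s" "s < t0" for s
      by (rule radial_le_length[OF \<gamma>(1,2)]) (use that t0' before in auto)
    obtain l where l: "curve_length M g \<gamma> = ennreal l" "0 \<le> l" "l < r"
      using len by (cases "curve_length M g \<gamma>") (auto simp: ennreal_less_iff)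
    let ?K = "E ` {v. rad v \<le> l}"
    have K: "closed ?K" using compact_E_ball[of l] l r by (intro compact_imp_closed) auto
    have inK: "\<gamma> s \<in> ?K" if "0 \<le> s" "s < t0" for s
    proof -
      have "rad (\<Phi> (\<gamma> s)) \<le> l" using le[OF that] l by simp
      moreover have "\<gamma> s = E (\<Phi> (\<gamma> s))" using before[OF that] E_\<Phi> by simp
      ultimately show ?thesis by blast
    qed
    have "closedin (top_of_set {0..1}) ({0..1} \<inter> \<gamma> -` ?K)" by (rule continuous_closedin_preimage[OF cont K])
    then have clK: "closed ({0..1} \<inter> \<gamma> -` ?K)" using closedin_closed_trans by blast
    have "{0..<t0} \<subseteq> {0..1} \<inter> \<gamma> -` ?K" using inK t0' by auto
    then have "closure {0..<t0} \<subseteq> {0..1} \<inter> \<gamma> -` ?K" by (rule closure_minimal[OF _ clK])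
    moreover have "t0 \<in> closure {0..<t0}" using t0' by (simp add: closure_atLeastLessThan)
    ultimately have "\<gamma> t0 \<in> ?K" by blast
    then obtain v where v: "rad v \<le> l" "\<gamma> t0 = E v" by blast
    then have "v \<in> B" using l r by (simp add: B_iff)
    then have "\<gamma> t0 \<in> ?O" using v l by (simp add: E_W \<Phi>_E)
    then show False using t0 by simp
  qed
qed

end

subsection \<open>Change of variables for arbitrary finite index types\<close>

text \<open>The change of variables theorem of the library is restricted to well-ordered index types; it is
  transported along a well-ordered copy of the index type.\<close>

typedef 'n wo = "UNIV :: 'n set" morphisms of_wo to_wo ..

lemma to_of_wo [simp]: "to_wo (of_wo x) = x" "of_wo (to_wo y) = y"
  by (simp_all add: of_wo_inverse to_wo_inverse)

lemma bij_of_wo: "bij of_wo" "bij to_wo"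
  by (metis bij_iff to_of_wo)+

definition wo_index :: "'n::finite \<Rightarrow> nat" where "wo_index = (SOME f. inj f)"

lemma inj_wo_index: "inj (wo_index :: 'n::finite \<Rightarrow> nat)"
proof -
  have "\<exists>f :: 'n \<Rightarrow> nat. inj f" using finite_imp_inj_to_nat_seg[of "UNIV :: 'n set"] by auto
  then show ?thesis unfolding wo_index_def by (rule someI_ex)
qed

instance wo :: (finite) finite
proof
  have "(UNIV :: 'a wo set) = to_wo ` UNIV" using bij_of_wo(2) by (auto simp: bij_def)
  then show "finite (UNIV :: 'a wo set)" by (metis finite finite_imageI)
qed

instantiation wo :: (finite) wellorder
begin

definition less_eq_wo :: "'a wo \<Rightarrow> 'a wo \<Rightarrow> bool" where
  "x \<le> y \<longleftrightarrow> wo_index (of_wo x) \<le> wo_index (of_wo y)"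

definition less_wo :: "'a wo \<Rightarrow> 'a wo \<Rightarrow> bool" where
  "x < y \<longleftrightarrow> wo_index (of_wo x) < wo_index (of_wo y)"

instance
proof
  fix x y z :: "'a wo"
  show "x < y \<longleftrightarrow> x \<le> y \<and> \<not> y \<le> x" by (auto simp: less_eq_wo_def less_wo_def)
  show "x \<le> x" by (simp add: less_eq_wo_def)
  show "x \<le> y \<Longrightarrow> y \<le> z \<Longrightarrow> x \<le> z" by (simp add: less_eq_wo_def)
  show "x \<le> y \<or> y \<le> x" by (auto simp: less_eq_wo_def)
  show "x = y" if "x \<le> y" "y \<le> x"
  proof -
    have "wo_index (of_wo x) = wo_index (of_wo y)" using that by (simp add: less_eq_wo_def)
    then have "of_wo x = of_wo y" by (rule injD[OF inj_wo_index])
    then show ?thesis by (metis to_of_wo(1))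
  qed
next
  fix P :: "'a wo \<Rightarrow> bool" and a :: "'a wo"
  assume step: "\<And>x. (\<And>y. y < x \<Longrightarrow> P y) \<Longrightarrow> P x"
  show "P a"
    by (induction a rule: measure_induct_rule[of "\<lambda>x. wo_index (of_wo x)"]) (auto intro: step simp: less_wo_def)
qed

end

text \<open>Conjugating a transposition by \<open>f\<close> gives the transposition of the images,
  so a product of \<open>n\<close> transpositions remains one. The two permutations may live on
  different types.\<close>

lemma swapidseq_conj:
  assumes "swapidseq n p" "bij f" shows "swapidseq n (f \<circ> p \<circ> inv f)"
  using assms(1)
proof (induction rule: swapidseq.induct)
  case id
  have "f \<circ> id \<circ> inv f = id" by (rule ext) (use assms(2) in \<open>simp add: bij_def surj_f_inv_f\<close>)
  then show ?case using swapidseq.id by metis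
next
  case (comp_Suc n p a b)
  have "inj f" using assms(2) by (simp add: bij_def)
  then have eq: "f \<circ> (Transposition.transpose a b \<circ> p) \<circ> inv f = Transposition.transpose (f a) (f b) \<circ> (f \<circ> p \<circ> inv f)"
    by (auto simp: fun_eq_iff Transposition.transpose_def inj_eq)
  have "f a \<noteq> f b" using comp_Suc \<open>inj f\<close> by (simp add: inj_eq)
  then show ?case unfolding eq by (rule swapidseq.comp_Suc[OF comp_Suc.IH])
qed

lemma sign_conj:
  assumes "permutation p" "bij f" shows "sign (f \<circ> p \<circ> inv f) = sign p"
proof -
  obtain n where n: "swapidseq n p" using assms(1) by (auto simp: permutation_def)
  show ?thesis
    using evenperm_unique[OF n refl] evenperm_unique[OF swapidseq_conj[OF n assms(2)] refl] by (simp add: sign_def)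
qed

lemma inv_of_wo: "inv of_wo = to_wo" "inv to_wo = of_wo"
  by (rule inv_equality; simp)+

lemma permutes_UNIV_iff_bij: "p permutes (UNIV :: 'x set) \<longleftrightarrow> bij p"
  by (simp add: permutes_def bij_iff)

text \<open>Conjugation with the bijection of index types matches the permutations and preserves
  their signs and products of entries.\<close>

lemma det_wo:
  fixes A :: "real^'n^'n"
  shows "det (\<chi> i j. A $ of_wo i $ of_wo j :: real^'n wo^'n wo) = det A"
proof -
  have "bij_betw (\<lambda>p. of_wo \<circ> p \<circ> to_wo) {p. p permutes (UNIV :: 'n wo set)} {p. p permutes (UNIV :: 'n set)}"
  proof (rule bij_betw_byWitness[where f' = "\<lambda>p. to_wo \<circ> p \<circ> of_wo"])
    show "(\<lambda>p. of_wo \<circ> p \<circ> to_wo) ` {p. p permutes (UNIV :: 'n wo set)} \<subseteq> {p. p permutes (UNIV :: 'n set)}"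
      by (auto simp: permutes_UNIV_iff_bij intro!: bij_comp bij_of_wo)
    show "(\<lambda>p. to_wo \<circ> p \<circ> of_wo) ` {p. p permutes (UNIV :: 'n set)} \<subseteq> {p. p permutes (UNIV :: 'n wo set)}"
      by (auto simp: permutes_UNIV_iff_bij intro!: bij_comp bij_of_wo)
  qed (auto simp: fun_eq_iff)
  then have "det A = (\<Sum>p\<in>{p. p permutes (UNIV :: 'n wo set)}. of_int (sign (of_wo \<circ> p \<circ> to_wo)) * (\<Prod>i\<in>UNIV. A $ i $ (of_wo \<circ> p \<circ> to_wo) i))"
    unfolding det_def by (rule sum.reindex_bij_betw[symmetric])
  also have "\<dots> = (\<Sum>p\<in>{p. p permutes (UNIV :: 'n wo set)}. of_int (sign p) * (\<Prod>i\<in>UNIV. A $ of_wo i $ of_wo (p i)))"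
  proof (rule sum.cong[OF refl])
    fix p :: "'n wo \<Rightarrow> 'n wo" assume "p \<in> {p. p permutes UNIV}"
    then have "permutation p" by (auto simp: permutation_permutes)
    then have "sign (of_wo \<circ> p \<circ> to_wo) = sign p" using sign_conj[OF _ bij_of_wo(1)] inv_of_wo(1) by metis
    moreover have "(\<Prod>i\<in>UNIV. A $ i $ (of_wo \<circ> p \<circ> to_wo) i) = (\<Prod>i\<in>UNIV. A $ of_wo i $ of_wo (p i))"
      using prod.reindex_bij_betw[OF bij_of_wo(1), of "\<lambda>i. A $ i $ (of_wo \<circ> p \<circ> to_wo) i"] by simp
    ultimately show "of_int (sign (of_wo \<circ> p \<circ> to_wo)) * (\<Prod>i\<in>UNIV. A $ i $ (of_wo \<circ> p \<circ> to_wo) i) =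
      of_int (sign p) * (\<Prod>i\<in>UNIV. A $ of_wo i $ of_wo (p i))" by simp
  qed
  finally show ?thesis unfolding det_def by simp
qed

definition of_wo_vec :: "real^'n wo \<Rightarrow> real^'n" where "of_wo_vec x = (\<chi> i. x $ to_wo i)"
definition to_wo_vec :: "real^'n \<Rightarrow> real^'n wo" where "to_wo_vec x = (\<chi> i. x $ of_wo i)"

lemma wo_vec [simp]: "of_wo_vec (to_wo_vec x) = x" "to_wo_vec (of_wo_vec y) = y"
  by (simp_all add: of_wo_vec_def to_wo_vec_def)

lemma linear_wo_vec: "linear of_wo_vec" "linear to_wo_vec"
  by (auto simp: of_wo_vec_def to_wo_vec_def vec_eq_iff intro!: linearI)

lemma bounded_linear_wo_vec: "bounded_linear of_wo_vec" "bounded_linear to_wo_vec"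
  using linear_wo_vec by (simp_all add: linear_conv_bounded_linear)

lemma measurable_wo_vec [measurable]: "of_wo_vec \<in> borel_measurable borel" "to_wo_vec \<in> borel_measurable borel"
  by (rule borel_measurable_continuous_onI[OF linear_continuous_on[OF bounded_linear_wo_vec(1)]],
      rule borel_measurable_continuous_onI[OF linear_continuous_on[OF bounded_linear_wo_vec(2)]])

lemma prod_Basis_vec: "(\<Prod>b\<in>(Basis :: (real^'n) set). F b) = (\<Prod>i\<in>UNIV. F (axis i 1))"
proof -
  have "bij_betw (\<lambda>i. axis i 1) UNIV (Basis :: (real^'n) set)"
    by (auto simp: bij_betw_def inj_on_def axis_eq_axis Basis_vec_def)
  from prod.reindex_bij_betw[OF this, of F] show ?thesis by simp
qed

text \<open>Relabelling coordinates maps boxes to boxes with the same side lengths, and Lebesgue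
  measure is determined by boxes.\<close>

lemma lborel_wo: "(lborel :: (real^'n) measure) = distr lborel borel of_wo_vec"
proof (rule lborel_eqI)
  fix l u :: "real^'n" assume le: "\<And>b. b \<in> Basis \<Longrightarrow> l \<bullet> b \<le> u \<bullet> b"
  have le': "l $ i \<le> u $ i" for i using le[of "axis i 1"] by (simp add: inner_axis)
  have "of_wo_vec -` box l u = box (to_wo_vec l) (to_wo_vec u)"
  proof (rule set_eqI)
    fix x
    have "x \<in> of_wo_vec -` box l u \<longleftrightarrow> (\<forall>i. l $ i < x $ to_wo i \<and> x $ to_wo i < u $ i)"
      by (simp add: mem_box_cart of_wo_vec_def)
    also have "\<dots> \<longleftrightarrow> (\<forall>i. l $ of_wo i < x $ i \<and> x $ i < u $ of_wo i)"
      by (metis to_of_wo)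
    finally show "x \<in> of_wo_vec -` box l u \<longleftrightarrow> x \<in> box (to_wo_vec l) (to_wo_vec u)"
      by (simp add: mem_box_cart to_wo_vec_def)
  qed
  then have "emeasure (distr lborel borel of_wo_vec) (box l u) = emeasure lborel (box (to_wo_vec l) (to_wo_vec u))"
    by (subst emeasure_distr) auto
  also have "\<dots> = (\<Prod>b\<in>Basis. (to_wo_vec u - to_wo_vec l) \<bullet> b)"
    using le' by (subst emeasure_lborel_box) (auto simp: Basis_vec_def inner_axis to_wo_vec_def)
  also have "\<dots> = (\<Prod>i\<in>UNIV. (u - l) $ of_wo i)"
    by (simp add: prod_Basis_vec inner_axis to_wo_vec_def)
  also have "(\<Prod>i\<in>UNIV. (u - l) $ of_wo i) = (\<Prod>i\<in>UNIV. (u - l) $ i)"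
    by (rule prod.reindex_bij_betw[OF bij_of_wo(1)])
  also have "\<dots> = (\<Prod>b\<in>Basis. (u - l) \<bullet> b)" by (simp add: prod_Basis_vec inner_axis)
  finally show "emeasure (distr lborel borel of_wo_vec) (box l u) = ennreal (prod ((\<bullet>) (u - l)) Basis)" .
qed simp

text \<open>Connects the gauge integrals of the change of variables theorem with the nonnegative
  Lebesgue integrals that define the Riemannian measure.\<close>

lemma absolutely_integrable_iff_nn:
  fixes h :: "'e::euclidean_space \<Rightarrow> real"
  assumes m: "(\<lambda>x. indicator X x * h x) \<in> borel_measurable borel" and pos: "\<And>x. x \<in> X \<Longrightarrow> 0 \<le> h x"
  shows "h absolutely_integrable_on X \<longleftrightarrow> (\<integral>\<^sup>+x\<in>X. ennreal (h x) \<partial>lborel) < \<infinity>"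
    and "h absolutely_integrable_on X \<Longrightarrow> (\<integral>\<^sup>+x\<in>X. ennreal (h x) \<partial>lborel) = ennreal (integral X h)"
proof -
  have nn: "(\<integral>\<^sup>+x\<in>X. ennreal (h x) \<partial>lborel) = (\<integral>\<^sup>+x. ennreal (indicator X x * h x) \<partial>lborel)"
    by (intro nn_integral_cong) (auto simp: indicator_def)
  have nm: "norm (indicator X x * h x) = indicator X x * h x" for x
    using pos by (auto simp: indicator_def)
  have "h absolutely_integrable_on X \<longleftrightarrow> integrable lborel (\<lambda>x. indicator X x * h x)"
    unfolding set_integrable_def using m by (simp add: integrable_completion)
  then show iff: "h absolutely_integrable_on X \<longleftrightarrow> (\<integral>\<^sup>+x\<in>X. ennreal (h x) \<partial>lborel) < \<infinity>"
    unfolding integrable_iff_bounded nn nm using m by simp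
  assume a: "h absolutely_integrable_on X"
  have i: "integrable lborel (\<lambda>x. indicator X x * h x)"
    using a m unfolding set_integrable_def by (simp add: integrable_completion)
  have "(\<integral>\<^sup>+x. ennreal (indicator X x * h x) \<partial>lborel) = ennreal (integral\<^sup>L lborel (\<lambda>x. indicator X x * h x))"
    by (rule nn_integral_eq_integral[OF i]) (use pos in \<open>auto simp: indicator_def\<close>)
  also have "integral\<^sup>L lborel (\<lambda>x. indicator X x * h x) = integral\<^sup>L lebesgue (\<lambda>x. indicator X x * h x)"
    using m by (simp add: integral_completion)
  also have "\<dots> = integral X h"
    using set_lebesgue_integral_eq_integral(2)[OF a] by (simp add: set_lebesgue_integral_def)
  finally show "(\<integral>\<^sup>+x\<in>X. ennreal (h x) \<partial>lborel) = ennreal (integral X h)" unfolding nn .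
qed

text \<open>\<open>has_absolute_integral_change_of_variables\<close> concerns vector-valued
  functions, so \<open>f\<close> is viewed with values in \<open>real^1\<close>. The theorem also
  equates integrability, so if one side is infinite, both are.\<close>

lemma nn_change_of_variables_wo:
  fixes \<sigma> :: "real^'m::{finite,wellorder} \<Rightarrow> real^'m::_" and f :: "real^'m::_ \<Rightarrow> real"
  assumes X: "X \<in> sets borel" and der: "\<And>x. x \<in> X \<Longrightarrow> (\<sigma> has_derivative \<sigma>' x) (at x)" and inj: "inj_on \<sigma> X"
    and pos: "\<And>y. y \<in> \<sigma> ` X \<Longrightarrow> 0 \<le> f y"
    and m1: "(\<lambda>x. indicator X x * (\<bar>det (matrix (\<sigma>' x))\<bar> * f (\<sigma> x))) \<in> borel_measurable borel"
    and m2: "(\<lambda>y. indicator (\<sigma> ` X) y * f y) \<in> borel_measurable borel"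
  shows "(\<integral>\<^sup>+x\<in>X. ennreal (\<bar>det (matrix (\<sigma>' x))\<bar> * f (\<sigma> x)) \<partial>lborel) = (\<integral>\<^sup>+y\<in>\<sigma> ` X. ennreal (f y) \<partial>lborel)"
proof -
  let ?L = "\<lambda>x. \<bar>det (matrix (\<sigma>' x))\<bar> * f (\<sigma> x)"
  define F where "F y = (vec (f y) :: real^1)" for y
  have Xl: "X \<in> sets lebesgue" using X by simp
  have cov: "(\<lambda>x. \<bar>det (matrix (\<sigma>' x))\<bar> *\<^sub>R F (\<sigma> x)) absolutely_integrable_on X \<and>
           integral X (\<lambda>x. \<bar>det (matrix (\<sigma>' x))\<bar> *\<^sub>R F (\<sigma> x)) = b
     \<longleftrightarrow> F absolutely_integrable_on (\<sigma> ` X) \<and> integral (\<sigma> ` X) F = b" for b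
    by (rule has_absolute_integral_change_of_variables[OF Xl _ inj]) (use der has_derivative_at_withinI in blast)
  have cov': "?L absolutely_integrable_on X \<and> vec (integral X ?L) = b \<longleftrightarrow>
      f absolutely_integrable_on (\<sigma> ` X) \<and> vec (integral (\<sigma> ` X) f) = b" for b :: "real^1"
    using cov[of b] unfolding absolutely_integrable_on_1_iff integral_on_1_eq by (simp add: F_def)
  have posL: "0 \<le> ?L x" if "x \<in> X" for x using pos that by simp
  note L1 = absolutely_integrable_iff_nn(1)[OF m1 posL] and L2 = absolutely_integrable_iff_nn(2)[OF m1 posL]
    and R1 = absolutely_integrable_iff_nn(1)[OF m2 pos] and R2 = absolutely_integrable_iff_nn(2)[OF m2 pos]
  show ?thesis
  proof (cases "?L absolutely_integrable_on X")
    case True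
    then have "f absolutely_integrable_on (\<sigma> ` X) \<and> (vec (integral (\<sigma> ` X) f) :: real^1) = vec (integral X ?L)"
      using cov'[of "vec (integral X ?L)"] by blast
    then show ?thesis using L2 R2 True by (simp add: vec_eq_iff)
  next
    case False
    then have "\<not> f absolutely_integrable_on (\<sigma> ` X)" using cov'[of "vec (integral (\<sigma> ` X) f)"] by blast
    then show ?thesis using False L1 R1 by (simp add: not_less top_unique)
  qed
qed

lemma nn_change_of_variables:
  fixes \<sigma> :: "real^'n \<Rightarrow> real^'n" and f :: "real^'n \<Rightarrow> real"
  assumes X: "X \<in> sets borel" and der: "\<And>x. x \<in> X \<Longrightarrow> (\<sigma> has_derivative \<sigma>' x) (at x)" and inj: "inj_on \<sigma> X"
    and pos: "\<And>y. y \<in> \<sigma> ` X \<Longrightarrow> 0 \<le> f y"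
    and m1: "(\<lambda>x. indicator X x * (\<bar>det (matrix (\<sigma>' x))\<bar> * f (\<sigma> x))) \<in> borel_measurable borel"
    and m2: "(\<lambda>y. indicator (\<sigma> ` X) y * f y) \<in> borel_measurable borel"
  shows "(\<integral>\<^sup>+x\<in>X. ennreal (\<bar>det (matrix (\<sigma>' x))\<bar> * f (\<sigma> x)) \<partial>lborel) = (\<integral>\<^sup>+y\<in>\<sigma> ` X. ennreal (f y) \<partial>lborel)"
proof -
  let ?P = "of_wo_vec :: real^'n wo \<Rightarrow> real^'n" and ?Q = "to_wo_vec :: real^'n \<Rightarrow> real^'n wo"
  have pull: "(\<integral>\<^sup>+x\<in>Z. ennreal (h x) \<partial>lborel) = (\<integral>\<^sup>+x\<in>?P -` Z. ennreal (h (?P x)) \<partial>lborel)"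
    if "(\<lambda>x. indicator Z x * h x) \<in> borel_measurable borel" for Z and h :: "real^'n \<Rightarrow> real"
  proof -
    have "(\<integral>\<^sup>+x\<in>Z. ennreal (h x) \<partial>lborel) = (\<integral>\<^sup>+x. ennreal (indicator Z x * h x) \<partial>distr lborel borel ?P)"
      unfolding lborel_wo[symmetric] by (intro nn_integral_cong) (auto simp: indicator_def)
    also have "\<dots> = (\<integral>\<^sup>+x. ennreal (indicator Z (?P x) * h (?P x)) \<partial>lborel)"
      using that by (subst nn_integral_distr) auto
    also have "\<dots> = (\<integral>\<^sup>+x\<in>?P -` Z. ennreal (h (?P x)) \<partial>lborel)"
      by (intro nn_integral_cong) (auto simp: indicator_def)
    finally show ?thesis .
  qed
  define \<tau> where "\<tau> x = ?Q (\<sigma> (?P x))" for x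
  define \<tau>' where "\<tau>' x v = ?Q (\<sigma>' (?P x) (?P v))" for x v
  let ?X = "?P -` X"
  have imX: "\<tau> ` ?X = ?P -` (\<sigma> ` X)"
  proof (intro equalityI subsetI)
    fix y assume "y \<in> \<tau> ` ?X" then show "y \<in> ?P -` (\<sigma> ` X)" by (auto simp: \<tau>_def)
  next
    fix y assume "y \<in> ?P -` (\<sigma> ` X)"
    then obtain z where "?P y = \<sigma> z" "z \<in> X" by auto
    then have "?Q z \<in> ?X" "y = \<tau> (?Q z)" using wo_vec(2)[of y] by (simp_all add: \<tau>_def)
    then show "y \<in> \<tau> ` ?X" by blast
  qed
  have det: "det (matrix (\<tau>' x)) = det (matrix (\<sigma>' (?P x)))" for x
  proof -
    have "matrix (\<tau>' x) = (\<chi> i j. matrix (\<sigma>' (?P x)) $ of_wo i $ of_wo j)"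
    proof -
      have "?P (axis j 1) = axis (of_wo j) 1" for j
        by (simp add: of_wo_vec_def axis_def vec_eq_iff) (metis to_of_wo)
      then show ?thesis by (simp add: matrix_def \<tau>'_def to_wo_vec_def)
    qed
    then show ?thesis by (simp add: det_wo)
  qed
  have "(\<integral>\<^sup>+x\<in>X. ennreal (\<bar>det (matrix (\<sigma>' x))\<bar> * f (\<sigma> x)) \<partial>lborel)
     = (\<integral>\<^sup>+x\<in>?X. ennreal (\<bar>det (matrix (\<tau>' x))\<bar> * f (?P (\<tau> x))) \<partial>lborel)"
    unfolding pull[OF m1] det \<tau>_def by simp
  also have "\<dots> = (\<integral>\<^sup>+y\<in>\<tau> ` ?X. ennreal (f (?P y)) \<partial>lborel)"
  proof (rule nn_change_of_variables_wo)
    show "?X \<in> sets borel" using measurable_sets[OF measurable_wo_vec(1) X] by simp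
    show "(\<tau> has_derivative \<tau>' x) (at x)" if "x \<in> ?X" for x
    proof -
      have 1: "(?P has_derivative ?P) (at x)" by (rule bounded_linear_imp_has_derivative[OF bounded_linear_wo_vec(1)])
      have "((\<lambda>x. \<sigma> (?P x)) has_derivative (\<lambda>v. \<sigma>' (?P x) (?P v))) (at x)"
        by (rule has_derivative_compose[OF 1 der]) (use that in simp)
      then show ?thesis unfolding \<tau>_def[abs_def] \<tau>'_def[abs_def]
        by (rule bounded_linear.has_derivative[OF bounded_linear_wo_vec(2)])
    qed
    show "inj_on \<tau> ?X"
    proof (rule inj_onI)
      fix x y assume "x \<in> ?X" "y \<in> ?X" "\<tau> x = \<tau> y"
      then have "?P x \<in> X" "?P y \<in> X" "?P (?Q (\<sigma> (?P x))) = ?P (?Q (\<sigma> (?P y)))" by (simp_all add: \<tau>_def)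
      then have "?P x = ?P y" using inj by (simp add: inj_on_eq_iff)
      then show "x = y" by (metis wo_vec(2))
    qed
    show "0 \<le> f (?P y)" if "y \<in> \<tau> ` ?X" for y using pos that unfolding imX by simp
    have i: "indicator (?P -` Z) x = (indicator Z (?P x) :: real)" for Z x by (simp add: indicator_def)
    show "(\<lambda>x. indicator ?X x * (\<bar>det (matrix (\<tau>' x))\<bar> * f (?P (\<tau> x)))) \<in> borel_measurable borel"
      using measurable_compose[OF measurable_wo_vec(1) m1] unfolding det i \<tau>_def wo_vec .
    show "(\<lambda>y. indicator (\<tau> ` ?X) y * f (?P y)) \<in> borel_measurable borel"
      using measurable_compose[OF measurable_wo_vec(1) m2] unfolding imX i .
  qed
  also have "\<dots> = (\<integral>\<^sup>+y\<in>\<sigma> ` X. ennreal (f y) \<partial>lborel)" unfolding imX pull[OF m2] ..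
  finally show ?thesis .
qed

subsection \<open>The Riemannian measure\<close>

definition dens ::
  "('a, real^'n) manifold \<Rightarrow> ('a \<Rightarrow> real^'n \<Rightarrow> real^'n \<Rightarrow> real) \<Rightarrow> ('a, real^'n) chart \<Rightarrow> real^'n \<Rightarrow> real" where
  "dens X h c x = sqrt (det (gram_matrix (local_metric X h c x)))"

definition chart_measure ::
  "('a::topological_space, real^'n) manifold \<Rightarrow> ('a \<Rightarrow> real^'n \<Rightarrow> real^'n \<Rightarrow> real) \<Rightarrow> ('a, real^'n) chart \<Rightarrow> 'a measure" where
  "chart_measure X h c = distr (density (restrict_space lborel (cimage c)) (\<lambda>x. ennreal (dens X h c x)))
     (restrict_space borel (carrier X)) (cinv c)"

context mfd begin

abbreviation borel_M :: "'a measure" where "borel_M \<equiv> restrict_space borel (carrier M)"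

lemma openin_sets: "openin (top_of_set (carrier M)) A \<Longrightarrow> A \<in> sets borel_M"
proof -
  assume "openin (top_of_set (carrier M)) A"
  then obtain T where "open T" "A = carrier M \<inter> T" unfolding openin_open by blast
  then show ?thesis unfolding sets_restrict_space by (intro image_eqI[of _ _ T]) auto
qed

lemma cdom_sets: "c \<in> atlas M \<Longrightarrow> cdom c \<in> sets borel_M"
  using openin_sets openin_cdom by blast

lemma space_borel_M: "space borel_M = carrier M" by (simp add: space_restrict_space)

lemma borel_M_sub: "A \<in> sets borel_M \<Longrightarrow> A \<subseteq> carrier M"
  using sets.sets_into_space space_borel_M by metis

lemma measurable_cinv:
  assumes "c \<in> atlas M" shows "cinv c \<in> measurable (restrict_space borel (cimage c)) borel_M"
proof (rule measurable_restrict_space2)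
  show "cinv c \<in> space (restrict_space borel (cimage c)) \<rightarrow> carrier M"
    using cinv_cdom[of _ c] cdom_sub[OF assms] by (auto simp: space_restrict_space)
qed (rule borel_measurable_continuous_on_restrict[OF continuous_cinv[OF assms]])

lemma chart_image:
  assumes "c \<in> atlas M" shows "cmap c ` (A \<inter> cdom c) = cimage c \<inter> cinv c -` A"
  using cinv_cmap[OF assms] cmap_cimage cinv_cdom[of _ c] cmap_cinv[of _ c] by (force simp: image_iff)

lemma chart_image_borel:
  assumes c: "c \<in> atlas M" and A: "A \<in> sets borel_M" shows "cmap c ` (A \<inter> cdom c) \<in> sets borel"
proof -
  have "cinv c -` A \<inter> space (restrict_space borel (cimage c)) \<in> sets (restrict_space borel (cimage c))"
    by (rule measurable_sets[OF measurable_cinv[OF c] A])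
  then have "cimage c \<inter> cinv c -` A \<in> sets (restrict_space borel (cimage c))"
    by (simp add: space_restrict_space Int_commute)
  then show ?thesis
    unfolding chart_image[OF c] using open_cimage[OF c] by (auto simp: sets_restrict_space_iff)
qed

text \<open>Lindelof's theorem extracts a countable cover. It is enumerated by all natural numbers
  with repetitions, which requires at least one chart.\<close>

lemma countable_charts:
  assumes "carrier M \<noteq> {}"
  shows "\<exists>c :: nat \<Rightarrow> ('a, 'e) chart. (\<forall>i. c i \<in> atlas M) \<and> (\<Union>i. cdom (c i)) = carrier M"
proof -
  have cov: "\<Union> (cdom ` atlas M) = carrier M" using M unfolding smooth_manifold_def by blast
  obtain F where F: "F \<subseteq> cdom ` atlas M" "countable F" "\<Union> F = \<Union> (cdom ` atlas M)"
    by (rule Lindelof_openin[of "cdom ` atlas M" "carrier M"]) (use openin_cdom in auto)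
  have ne: "F \<noteq> {}" using assms F cov by auto
  have "\<forall>i. \<exists>c\<in>atlas M. cdom c = from_nat_into F i" using from_nat_into[OF ne] F(1) by blast
  then obtain c where c: "\<And>i. c i \<in> atlas M" "\<And>i. cdom (c i) = from_nat_into F i" by metis
  have "(\<Union>i. cdom (c i)) = carrier M" using range_from_nat_into[OF ne F(2)] c(2) F(3) cov by simp
  then show ?thesis using c(1) by blast
qed

end

context riem begin

lemma gram_pos: "c \<in> atlas M \<Longrightarrow> x \<in> cimage c \<Longrightarrow> det (gram_matrix (local_metric M g c x)) > 0"
  using det_gram_pos[OF metric_on.inner[OF metric_on_chart]] by blast

lemma dens_pos: "c \<in> atlas M \<Longrightarrow> x \<in> cimage c \<Longrightarrow> dens M g c x > 0"
  using gram_pos by (simp add: dens_def)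

lemma smooth_gram_det:
  assumes "c \<in> atlas M" shows "smooth_on (cimage c) (\<lambda>x. det (gram_matrix (local_metric M g c x)))"
  by (rule smooth_on_det[OF open_cimage[OF assms]])
     (simp add: gram_matrix_def metric_on.smooth[OF metric_on_chart[OF assms]])

lemma continuous_dens: "c \<in> atlas M \<Longrightarrow> continuous_on (cimage c) (dens M g c)"
  unfolding dens_def[abs_def] using smooth_on_continuous[OF smooth_gram_det] by (rule continuous_on_real_sqrt)

lemma measurable_dens:
  assumes "c \<in> atlas M" "X \<in> sets borel" "X \<subseteq> cimage c"
  shows "(\<lambda>x. indicator X x * dens M g c x) \<in> borel_measurable borel"
  using borel_measurable_continuous_on_indicator[OF assms(2) continuous_on_subset[OF continuous_dens[OF assms(1)] assms(3)]]
  by simp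

lemma dens_transform:
  assumes c: "c \<in> atlas M" "q \<in> cdom c" and d: "d \<in> atlas M" "q \<in> cdom d"
  shows "\<bar>det (matrix (dd (cmap d \<circ> cinv c) (cmap c q)))\<bar> * dens M g d (cmap d q) = dens M g c (cmap c q)"
proof -
  let ?L = "dd (cmap d \<circ> cinv c) (cmap c q)"
  have x: "cmap c q \<in> cimage c" "cinv c (cmap c q) = q" using c cmap_cimage cinv_cmap by auto
  interpret m: metric_on "cimage d" "local_metric M g d" by (rule metric_on_chart[OF d(1)])
  have "local_metric M g c (cmap c q) u v = local_metric M g d (cmap d q) (?L u) (?L v)" for u v
    using param_metric_chart[OF smooth_param_cinv[OF c(1)] x(1) d(1)] x(2) d(2)
    by (simp add: local_metric_eq_param)
  then have "local_metric M g c (cmap c q) = (\<lambda>u v. local_metric M g d (cmap d q) (?L u) (?L v))"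
    by (simp add: fun_eq_iff)
  then have "det (gram_matrix (local_metric M g c (cmap c q))) =
     (det (matrix ?L))\<^sup>2 * det (gram_matrix (local_metric M g d (cmap d q)))"
    using gram_matrix_pullback[OF m.bil[OF cmap_cimage[OF d(2)]] transition_linear(1)[OF c(1) d(1) c(2) d(2)]] by simp
  then show ?thesis by (simp add: dens_def real_sqrt_mult)
qed

text \<open>The Jacobian of the transition map is exactly the ratio of the two densities, so the
  change of variables theorem identifies the integrals.\<close>

lemma chart_integral_compat:
  assumes c: "c \<in> atlas M" and d: "d \<in> atlas M" and A: "A \<in> sets borel_M" "A \<subseteq> cdom c" "A \<subseteq> cdom d"
  shows "(\<integral>\<^sup>+x\<in>cmap c ` A. ennreal (dens M g c x) \<partial>lborel) = (\<integral>\<^sup>+x\<in>cmap d ` A. ennreal (dens M g d x) \<partial>lborel)"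
proof -
  let ?\<sigma> = "cmap d \<circ> cinv c" and ?X = "cmap c ` A"
  have bX: "?X \<in> sets borel" and bY: "cmap d ` A \<in> sets borel"
    using chart_image_borel[OF c A(1)] chart_image_borel[OF d A(1)] A(2,3) by (simp_all add: Int_absorb2)
  have im: "?\<sigma> ` ?X = cmap d ` A"
    using cinv_cmap[OF c] A(2) by (force simp: image_iff)
  have eq: "\<bar>det (matrix (dd ?\<sigma> x))\<bar> * dens M g d (?\<sigma> x) = dens M g c x" if "x \<in> ?X" for x
  proof -
    obtain q where q: "q \<in> A" "x = cmap c q" using \<open>x \<in> ?X\<close> by blast
    then have qc: "q \<in> cdom c" "q \<in> cdom d" using A(2,3) by blast+
    show ?thesis using dens_transform[OF c qc(1) d qc(2)] cinv_cmap[OF c qc(1)] q(2) by simp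
  qed
  have "(\<integral>\<^sup>+x\<in>?X. ennreal (dens M g c x) \<partial>lborel)
     = (\<integral>\<^sup>+x\<in>?X. ennreal (\<bar>det (matrix (dd ?\<sigma> x))\<bar> * dens M g d (?\<sigma> x)) \<partial>lborel)"
  proof (rule nn_integral_cong)
    show "ennreal (dens M g c x) * indicator ?X x
      = ennreal (\<bar>det (matrix (dd ?\<sigma> x))\<bar> * dens M g d (?\<sigma> x)) * indicator ?X x" for x
      using eq[of x] by (cases "x \<in> ?X") simp_all
  qed
  also have "\<dots> = (\<integral>\<^sup>+y\<in>?\<sigma> ` ?X. ennreal (dens M g d y) \<partial>lborel)"
  proof (rule nn_change_of_variables[OF bX])
    fix x assume "x \<in> ?X"
    then obtain q where q: "q \<in> A" "x = cmap c q" by blast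
    then have qc: "q \<in> cdom c" "q \<in> cdom d" using A(2,3) by blast+
    then have "x \<in> cimage c \<inter> cinv c -` cdom d" using q(2) cmap_cimage[OF qc(1)] cinv_cmap[OF c qc(1)] by simp
    from smooth_on_D[OF param_chart_smooth[OF smooth_param_cinv[OF c] d] this]
    show "(?\<sigma> has_derivative dd ?\<sigma> x) (at x)" .
  next
    show "inj_on ?\<sigma> ?X"
    proof (rule inj_onI)
      fix x y assume "x \<in> ?X" "y \<in> ?X" and e: "?\<sigma> x = ?\<sigma> y"
      then obtain q r where q: "q \<in> A" "x = cmap c q" "r \<in> A" "y = cmap c r" by blast
      have qc: "q \<in> cdom c" "r \<in> cdom c" "q \<in> cdom d" "r \<in> cdom d" using q A(2,3) by blast+
      have "cmap d q = cmap d r" using e q cinv_cmap[OF c qc(1)] cinv_cmap[OF c qc(2)] by simp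
      then have "q = r" using cinv_cmap[OF d qc(3)] cinv_cmap[OF d qc(4)] by metis
      then show "x = y" using q by simp
    qed
    fix y assume "y \<in> ?\<sigma> ` ?X"
    then obtain q where "q \<in> A" "y = cmap d q" unfolding im by blast
    then have "y \<in> cimage d" using cmap_cimage[of q d] A(3) by blast
    then show "0 \<le> dens M g d y" using dens_pos[OF d] by (simp add: less_imp_le)
  next
    have "(\<lambda>x. indicator ?X x * dens M g c x) \<in> borel_measurable borel"
      by (rule measurable_dens[OF c bX]) (use A(2) in \<open>auto simp: cimage_def\<close>)
    moreover have "indicator ?X x * (\<bar>det (matrix (dd ?\<sigma> x))\<bar> * dens M g d (?\<sigma> x)) = indicator ?X x * dens M g c x" for x
      using eq[of x] by (cases "x \<in> cmap c ` A") simp_all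
    ultimately show "(\<lambda>x. indicator ?X x * (\<bar>det (matrix (dd ?\<sigma> x))\<bar> * dens M g d (?\<sigma> x))) \<in> borel_measurable borel"
      by (simp only:)
  next
    show "(\<lambda>y. indicator (?\<sigma> ` ?X) y * dens M g d y) \<in> borel_measurable borel"
      unfolding im by (rule measurable_dens[OF d bY]) (use A(3) in \<open>auto simp: cimage_def\<close>)
  qed
  finally show ?thesis unfolding im .
qed

lemma sets_chart_measure [simp]: "sets (chart_measure M g c) = sets borel_M"
  by (simp add: chart_measure_def)

lemma measurable_dens_restrict:
  assumes "c \<in> atlas M"
  shows "(\<lambda>x. ennreal (dens M g c x)) \<in> borel_measurable (restrict_space lborel (cimage c))"
proof -
  have "dens M g c \<in> borel_measurable (restrict_space borel (cimage c))"
    by (rule borel_measurable_continuous_on_restrict[OF continuous_dens[OF assms]])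
  then have "dens M g c \<in> borel_measurable (restrict_space lborel (cimage c))"
    by (simp cong: measurable_cong_sets add: sets_restrict_space)
  then show ?thesis by simp
qed

lemma measurable_cinv_density:
  assumes "c \<in> atlas M"
  shows "cinv c \<in> measurable (density (restrict_space lborel (cimage c)) F) borel_M"
  using measurable_cinv[OF assms] by (simp cong: measurable_cong_sets add: sets_restrict_space)

lemma nn_integral_chart_measure:
  assumes c: "c \<in> atlas M" and F: "F \<in> borel_measurable borel_M"
  shows "(\<integral>\<^sup>+q. F q \<partial>chart_measure M g c) = (\<integral>\<^sup>+x\<in>cimage c. ennreal (dens M g c x) * F (cinv c x) \<partial>lborel)"
proof -
  have m: "(\<lambda>x. F (cinv c x)) \<in> borel_measurable (restrict_space lborel (cimage c))"
    using measurable_compose[OF measurable_cinv[OF c] F]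
    by (simp cong: measurable_cong_sets add: sets_restrict_space)
  have "(\<integral>\<^sup>+q. F q \<partial>chart_measure M g c)
      = (\<integral>\<^sup>+x. F (cinv c x) \<partial>density (restrict_space lborel (cimage c)) (\<lambda>x. ennreal (dens M g c x)))"
    unfolding chart_measure_def by (rule nn_integral_distr[OF measurable_cinv_density[OF c]]) (use F in simp)
  also have "\<dots> = (\<integral>\<^sup>+x. ennreal (dens M g c x) * F (cinv c x) \<partial>restrict_space lborel (cimage c))"
    by (rule nn_integral_density[OF measurable_dens_restrict[OF c] m])
  also have "\<dots> = (\<integral>\<^sup>+x\<in>cimage c. ennreal (dens M g c x) * F (cinv c x) \<partial>lborel)"
    by (rule nn_integral_restrict_space) (use open_cimage[OF c] in simp)
  finally show ?thesis .
qed

lemma emeasure_chart_measure: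
  assumes c: "c \<in> atlas M" and A: "A \<in> sets borel_M"
  shows "emeasure (chart_measure M g c) A = (\<integral>\<^sup>+x\<in>cmap c ` (A \<inter> cdom c). ennreal (dens M g c x) \<partial>lborel)"
proof -
  have "emeasure (chart_measure M g c) A = (\<integral>\<^sup>+q. indicator A q \<partial>chart_measure M g c)" using A by simp
  also have "\<dots> = (\<integral>\<^sup>+x\<in>cimage c. ennreal (dens M g c x) * indicator A (cinv c x) \<partial>lborel)"
    by (rule nn_integral_chart_measure[OF c]) (use A in simp)
  also have "\<dots> = (\<integral>\<^sup>+x\<in>cmap c ` (A \<inter> cdom c). ennreal (dens M g c x) \<partial>lborel)"
    unfolding chart_image[OF c] by (intro nn_integral_cong) (auto simp: indicator_def)
  finally show ?thesis .
qed

text \<open>The property inside the definite description of \<open>riemannian_measure\<close>, named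
  so that existence and uniqueness can be proved for it.\<close>

definition is_vol :: "'a measure \<Rightarrow> bool" where
  "is_vol \<mu> \<longleftrightarrow> sets \<mu> = sets borel_M \<and>
     (\<forall>c\<in>atlas M. \<forall>A\<in>sets \<mu>. A \<subseteq> cdom c \<longrightarrow>
        emeasure \<mu> A = (\<integral>\<^sup>+x\<in>cmap c ` A. ennreal (dens M g c x) \<partial>lborel))"

lemma disjoint_charts:
  assumes c: "\<And>i. c i \<in> atlas M" "(\<Union>i. cdom (c i)) = carrier M"
  defines "D \<equiv> disjointed (\<lambda>i. cdom (c i))"
  shows "\<And>i. D i \<in> sets borel_M" "\<And>i. D i \<subseteq> cdom (c i)" "disjoint_family D" "(\<Union>i. D i) = carrier M"
proof -
  show "D i \<in> sets borel_M" for i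
    unfolding D_def using sets.range_disjointed_sets[of "\<lambda>i. cdom (c i)" borel_M] cdom_sets[OF c(1)] by blast
  show "D i \<subseteq> cdom (c i)" for i unfolding D_def by (rule disjointed_subset)
  show "disjoint_family D" unfolding D_def by (rule disjoint_family_disjointed)
  show "(\<Union>i. D i) = carrier M" unfolding D_def UN_disjointed_eq c(2) ..
qed

text \<open>A measurable set is cut into countably many disjoint pieces, each inside one chart
  domain, where the density prescribes the value.\<close>

lemma is_vol_unique:
  assumes "is_vol \<mu>" "is_vol \<nu>" shows "\<mu> = \<nu>"
proof (rule measure_eqI)
  have s: "sets \<mu> = sets borel_M" "sets \<nu> = sets borel_M" using assms by (auto simp: is_vol_def)
  then show "sets \<mu> = sets \<nu>" by simp
  fix A assume A: "A \<in> sets \<mu>"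
  show "emeasure \<mu> A = emeasure \<nu> A"
  proof (cases "carrier M = {}")
    case True
    then have "A = {}" using A s borel_M_sub by blast
    then show ?thesis by simp
  next
    case False
    obtain c :: "nat \<Rightarrow> ('a, real^'m) chart" where c': "\<forall>i. c i \<in> atlas M" "(\<Union>i. cdom (c i)) = carrier M"
      using countable_charts[OF False] by blast
    then have c: "\<And>i. c i \<in> atlas M" "(\<Union>i. cdom (c i)) = carrier M" by simp_all
    define D where "D = disjointed (\<lambda>i. cdom (c i))"
    note D = disjoint_charts[OF c, folded D_def]
    have AD: "A \<inter> D i \<in> sets borel_M" for i using A D(1) s by auto
    have "A \<subseteq> carrier M" using A s borel_M_sub by simp
    then have U: "A = (\<Union>i. A \<inter> D i)" using D(4) by blast
    have dj: "disjoint_family (\<lambda>i. A \<inter> D i)" using D(3) by (auto simp: disjoint_family_on_def)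
    have eq: "emeasure \<mu> (A \<inter> D i) = emeasure \<nu> (A \<inter> D i)" for i
    proof -
      have sub: "A \<inter> D i \<subseteq> cdom (c i)" using D(2) by blast
      have "emeasure \<mu> (A \<inter> D i) = (\<integral>\<^sup>+x\<in>cmap (c i) ` (A \<inter> D i). ennreal (dens M g (c i) x) \<partial>lborel)"
        using assms(1) c(1) AD sub s unfolding is_vol_def by blast
      moreover have "emeasure \<nu> (A \<inter> D i) = (\<integral>\<^sup>+x\<in>cmap (c i) ` (A \<inter> D i). ennreal (dens M g (c i) x) \<partial>lborel)"
        using assms(2) c(1) AD sub s unfolding is_vol_def by blast
      ultimately show ?thesis by simp
    qed
    have "emeasure \<mu> A = (\<Sum>i. emeasure \<mu> (A \<inter> D i))"
      by (subst U, rule suminf_emeasure[symmetric]) (use AD s dj in auto)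
    also have "\<dots> = (\<Sum>i. emeasure \<nu> (A \<inter> D i))" unfolding eq ..
    also have "\<dots> = emeasure \<nu> A"
      by (subst (2) U, rule suminf_emeasure) (use AD s dj in auto)
    finally show ?thesis .
  qed
qed

text \<open>The same pieces define a measure as a sum of chart measures. Countable additivity is an
  exchange of two sums, one of them written as an integral over counting measure; compatibility on
  overlaps shows that every chart sees its own density.\<close>

lemma is_vol_exists: "\<exists>\<mu>. is_vol \<mu>"
proof (cases "carrier M = {}")
  case True
  have e: "A = {}" if "A \<in> sets borel_M" for A using borel_M_sub[OF that] True by simp
  have "is_vol borel_M" unfolding is_vol_def by (auto dest!: e)
  then show ?thesis by blast
next
  case False
  obtain c :: "nat \<Rightarrow> ('a, real^'m) chart" where c': "\<forall>i. c i \<in> atlas M" "(\<Union>i. cdom (c i)) = carrier M"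
    using countable_charts[OF False] by blast
  then have c: "\<And>i. c i \<in> atlas M" "(\<Union>i. cdom (c i)) = carrier M" by simp_all
  define D where "D = disjointed (\<lambda>i. cdom (c i))"
  note D = disjoint_charts[OF c, folded D_def]
  define m where "m A = (\<Sum>i. emeasure (chart_measure M g (c i)) (A \<inter> D i))" for A
  define \<mu> where "\<mu> = measure_of (carrier M) (sets borel_M) m"
  have sa: "sigma_algebra (carrier M) (sets borel_M)"
    using sets.sigma_algebra_axioms[of borel_M] by (simp add: space_borel_M)
  have ca: "countably_additive (sets borel_M) m"
  proof (rule countably_additiveI)
    fix A :: "nat \<Rightarrow> 'a set" assume A: "range A \<subseteq> sets borel_M" "disjoint_family A" "(\<Union>j. A j) \<in> sets borel_M"
    have 1: "(\<Sum>j. emeasure (chart_measure M g (c i)) (A j \<inter> D i)) = emeasure (chart_measure M g (c i)) ((\<Union>j. A j) \<inter> D i)" for i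
      unfolding Int_UN_distrib2[symmetric] UN_extend_simps(4)
      by (rule suminf_emeasure) (use A D(1) in \<open>auto simp: disjoint_family_on_def\<close>)
    have "(\<Sum>j. m (A j)) = (\<integral>\<^sup>+j. (\<Sum>i. emeasure (chart_measure M g (c i)) (A j \<inter> D i)) \<partial>count_space UNIV)"
      by (simp add: m_def nn_integral_count_space_nat)
    also have "\<dots> = (\<Sum>i. \<integral>\<^sup>+j. emeasure (chart_measure M g (c i)) (A j \<inter> D i) \<partial>count_space UNIV)"
      by (rule nn_integral_suminf) simp
    also have "\<dots> = m (\<Union>j. A j)" unfolding nn_integral_count_space_nat 1 m_def ..
    finally show "(\<Sum>j. m (A j)) = m (\<Union>j. A j)" .
  qed
  have em: "emeasure \<mu> A = m A" if "A \<in> sets borel_M" for A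
    unfolding \<mu>_def by (rule emeasure_measure_of_sigma[OF sa _ ca that]) (simp add: positive_def m_def)
  have sets: "sets \<mu> = sets borel_M"
    unfolding \<mu>_def by (rule sigma_algebra.sets_measure_of_eq[OF sa])
  have "emeasure \<mu> A = (\<integral>\<^sup>+x\<in>cmap d ` A. ennreal (dens M g d x) \<partial>lborel)"
    if d: "d \<in> atlas M" and A: "A \<in> sets borel_M" "A \<subseteq> cdom d" for d A
  proof -
    have AD: "A \<inter> D i \<in> sets borel_M" for i using A D(1) by auto
    have U: "A = (\<Union>i. A \<inter> D i)" using D(4) borel_M_sub[OF A(1)] by blast
    have dj: "disjoint_family (\<lambda>i. A \<inter> D i)" using D(3) by (auto simp: disjoint_family_on_def)
    have i: "emeasure (chart_measure M g (c i)) (A \<inter> D i) = emeasure (chart_measure M g d) (A \<inter> D i)" for i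
    proof -
      have "A \<inter> D i \<subseteq> cdom (c i)" "A \<inter> D i \<subseteq> cdom d" using D(2) A(2) by blast+
      then show ?thesis
        using chart_integral_compat[OF c(1) d AD] emeasure_chart_measure[OF c(1) AD] emeasure_chart_measure[OF d AD]
        by (simp add: Int_absorb2)
    qed
    have "m A = (\<Sum>i. emeasure (chart_measure M g d) (A \<inter> D i))" by (simp add: m_def i)
    also have "\<dots> = emeasure (chart_measure M g d) A"
      by (subst (2) U, rule suminf_emeasure) (use AD dj in auto)
    finally show ?thesis using em[OF A(1)] emeasure_chart_measure[OF d A(1)] A(2) by (simp add: Int_absorb2)
  qed
  then have "is_vol \<mu>" unfolding is_vol_def sets by blast
  then show ?thesis by blast
qed

abbreviation vol :: "'a measure" where "vol \<equiv> riemannian_measure M g"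

lemma is_vol: "is_vol vol"
proof -
  have "riemannian_measure M g = (THE \<mu>. is_vol \<mu>)"
    by (simp add: riemannian_measure_def is_vol_def dens_def)
  then show ?thesis using theI'[of is_vol] is_vol_exists is_vol_unique by metis
qed

lemma sets_vol [simp, measurable_cong]: "sets vol = sets borel_M"
  using is_vol by (simp add: is_vol_def)

lemma space_vol [simp]: "space vol = carrier M"
  using sets_eq_imp_space_eq[OF sets_vol] space_borel_M by simp

lemma vol_chart:
  assumes c: "c \<in> atlas M" shows "density vol (indicator (cdom c)) = chart_measure M g c"
proof (rule measure_eqI)
  show "sets (density vol (indicator (cdom c))) = sets (chart_measure M g c)" by simp
  fix A assume "A \<in> sets (density vol (indicator (cdom c)))"
  then have A: "A \<in> sets borel_M" by simp
  have AC: "A \<inter> cdom c \<in> sets borel_M" using A cdom_sets[OF c] by auto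
  have "emeasure (density vol (indicator (cdom c))) A = (\<integral>\<^sup>+q. indicator (cdom c) q * indicator A q \<partial>vol)"
    using A cdom_sets[OF c] by (subst emeasure_density) auto
  also have "\<dots> = emeasure vol (A \<inter> cdom c)"
  proof -
    have "(\<integral>\<^sup>+q. indicator (cdom c) q * indicator A q \<partial>vol) = (\<integral>\<^sup>+q. indicator (A \<inter> cdom c) q \<partial>vol)"
      by (intro nn_integral_cong) (auto simp: indicator_def)
    then show ?thesis using AC by (simp add: nn_integral_indicator)
  qed
  also have "\<dots> = emeasure (chart_measure M g c) A"
    using is_vol c AC unfolding emeasure_chart_measure[OF c A] is_vol_def by auto
  finally show "emeasure (density vol (indicator (cdom c))) A = emeasure (chart_measure M g c) A" .
qed

lemma integral_chart:
  fixes F :: "'a \<Rightarrow> real"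
  assumes c: "c \<in> atlas M" and F: "F \<in> borel_measurable borel_M" and zero: "\<And>q. q \<in> carrier M - cdom c \<Longrightarrow> F q = 0"
  shows "integrable vol F \<longleftrightarrow> integrable lborel (\<lambda>x. indicator (cimage c) x * (dens M g c x * F (cinv c x)))"
    and "integral\<^sup>L vol F = (\<integral>x. indicator (cimage c) x * (dens M g c x * F (cinv c x)) \<partial>lborel)"
proof -
  have F': "F \<in> borel_measurable vol" using F by (simp cong: measurable_cong_sets)
  have ind: "(\<lambda>q. indicator (cdom c) q *\<^sub>R F q) q = F q" if "q \<in> space vol" for q
    using zero that by (auto simp: indicator_def)
  have Fc: "F \<in> borel_measurable (chart_measure M g c)" using F by (simp cong: measurable_cong_sets)
  have m: "(\<lambda>x. F (cinv c x)) \<in> borel_measurable (restrict_space lborel (cimage c))"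
    using measurable_compose[OF measurable_cinv[OF c] F]
    by (simp cong: measurable_cong_sets add: sets_restrict_space)
  have md: "dens M g c \<in> borel_measurable (restrict_space lborel (cimage c))"
    using borel_measurable_continuous_on_restrict[OF continuous_dens[OF c]]
    by (simp cong: measurable_cong_sets add: sets_restrict_space)
  have ae: "AE x in restrict_space lborel (cimage c). 0 \<le> dens M g c x"
    by (rule AE_I2) (use dens_pos[OF c] in \<open>auto simp: space_restrict_space less_imp_le\<close>)
  have ci: "cimage c \<inter> space lborel \<in> sets lborel" using open_cimage[OF c] by simp
  have indd: "density vol (indicator (cdom c)) = density vol (\<lambda>q. ennreal (indicator (cdom c) q))"
    by (simp add: ennreal_indicator)
  have "integrable vol F \<longleftrightarrow> integrable vol (\<lambda>q. indicator (cdom c) q *\<^sub>R F q)"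
    using ind by (intro Bochner_Integration.integrable_cong) auto
  also have "\<dots> \<longleftrightarrow> integrable (chart_measure M g c) F"
    unfolding vol_chart[OF c, symmetric] indd
    by (rule integrable_density[symmetric]) (use F' cdom_sets[OF c] in auto)
  also have "\<dots> \<longleftrightarrow> integrable (density (restrict_space lborel (cimage c)) (\<lambda>x. ennreal (dens M g c x))) (\<lambda>x. F (cinv c x))"
    unfolding chart_measure_def by (rule integrable_distr_eq[OF measurable_cinv_density[OF c] F])
  also have "\<dots> \<longleftrightarrow> integrable (restrict_space lborel (cimage c)) (\<lambda>x. dens M g c x *\<^sub>R F (cinv c x))"
    by (rule integrable_density[OF m md ae])
  also have "\<dots> \<longleftrightarrow> integrable lborel (\<lambda>x. indicator (cimage c) x * (dens M g c x * F (cinv c x)))"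
    by (subst integrable_restrict_space[OF ci]) simp
  finally show "integrable vol F \<longleftrightarrow> integrable lborel (\<lambda>x. indicator (cimage c) x * (dens M g c x * F (cinv c x)))" .
  have "integral\<^sup>L vol F = integral\<^sup>L vol (\<lambda>q. indicator (cdom c) q *\<^sub>R F q)"
    using ind by (intro Bochner_Integration.integral_cong) auto
  also have "\<dots> = integral\<^sup>L (chart_measure M g c) F"
    unfolding vol_chart[OF c, symmetric] indd
    by (rule integral_density[symmetric]) (use F' cdom_sets[OF c] in auto)
  also have "\<dots> = integral\<^sup>L (density (restrict_space lborel (cimage c)) (\<lambda>x. ennreal (dens M g c x))) (\<lambda>x. F (cinv c x))"
    unfolding chart_measure_def by (rule integral_distr[OF measurable_cinv_density[OF c] F])
  also have "\<dots> = integral\<^sup>L (restrict_space lborel (cimage c)) (\<lambda>x. dens M g c x *\<^sub>R F (cinv c x))"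
    by (rule integral_density[OF m md ae])
  also have "\<dots> = (\<integral>x. indicator (cimage c) x * (dens M g c x * F (cinv c x)) \<partial>lborel)"
    by (subst integral_restrict_space[OF ci]) simp
  finally show "integral\<^sup>L vol F = (\<integral>x. indicator (cimage c) x * (dens M g c x * F (cinv c x)) \<partial>lborel)" .
qed

text \<open>Each point has a coordinate ball whose closure lies in the chart image, so that the
  continuous density is bounded on it; finitely many such balls cover \<open>K\<close>.\<close>

lemma vol_compact_finite:
  assumes K: "compact K" "K \<subseteq> carrier M" shows "emeasure vol K < \<infinity>"
proof -
  have "\<exists>T. open T \<and> q \<in> T \<and> carrier M \<inter> T \<in> sets borel_M \<and> emeasure vol (carrier M \<inter> T) < \<infinity>" if q: "q \<in> K" for q
  proof -
    let ?c = "chart_at M q"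
    note c = chart_at[OF subsetD[OF K(2) q]]
    have x: "cmap ?c q \<in> cimage ?c" using cmap_cimage[OF c(2)] .
    then obtain r where r: "r > 0" "cball (cmap ?c q) r \<subseteq> cimage ?c" using open_cimage[OF c(1)] open_contains_cball by blast
    let ?b = "ball (cmap ?c q) r"
    let ?O = "cdom ?c \<inter> cmap ?c -` ?b"
    have "openin (top_of_set (cdom ?c)) ?O"
      by (rule continuous_openin_preimage_gen[OF continuous_cmap[OF c(1)] open_ball])
    then have o: "openin (top_of_set (carrier M)) ?O" using openin_cdom[OF c(1)] openin_trans by blast
    then obtain T where T: "open T" "?O = carrier M \<inter> T" unfolding openin_open by blast
    have im: "cmap ?c ` ?O \<subseteq> ?b" by auto
    have "compact (dens M g ?c ` cball (cmap ?c q) r)"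
      by (intro compact_continuous_image continuous_on_subset[OF continuous_dens[OF c(1)] r(2)] compact_cball)
    then have "bounded (dens M g ?c ` cball (cmap ?c q) r)" by (rule compact_imp_bounded)
    then obtain k where k0: "\<forall>y\<in>dens M g ?c ` cball (cmap ?c q) r. norm y \<le> k" unfolding bounded_iff by blast
    have k: "\<bar>dens M g ?c x\<bar> \<le> k" if "x \<in> cball (cmap ?c q) r" for x using k0 that by simp
    have "emeasure vol ?O = (\<integral>\<^sup>+x\<in>cmap ?c ` ?O. ennreal (dens M g ?c x) \<partial>lborel)"
      using is_vol c(1) openin_sets[OF o] unfolding is_vol_def by auto
    also have "\<dots> \<le> (\<integral>\<^sup>+x. ennreal k * indicator ?b x \<partial>lborel)"
    proof (rule nn_integral_mono)
      fix x :: "real^'m"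
      show "ennreal (dens M g ?c x) * indicator (cmap ?c ` ?O) x \<le> ennreal k * indicator ?b x"
      proof (cases "x \<in> cmap ?c ` ?O")
        case True
        then have "x \<in> ?b" using im by blast
        then have "dens M g ?c x \<le> k" using k[of x] by (simp add: less_imp_le abs_le_iff)
        then show ?thesis using True \<open>x \<in> ?b\<close> by (simp add: ennreal_leI)
      qed simp
    qed
    also have "\<dots> = ennreal k * emeasure lborel ?b" by (rule nn_integral_cmult_indicator) simp
    also have "\<dots> < \<infinity>" using emeasure_bounded_finite[of ?b] by (simp add: ennreal_mult_less_top)
    finally have "emeasure vol ?O < \<infinity>" .
    moreover have "q \<in> ?O" using c(2) r(1) by simp
    ultimately show ?thesis using T openin_sets[OF o] by (intro exI[of _ T]) auto
  qed
  then obtain T where T: "\<And>q. q \<in> K \<Longrightarrow> open (T q)" "\<And>q. q \<in> K \<Longrightarrow> q \<in> T q"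
     "\<And>q. q \<in> K \<Longrightarrow> carrier M \<inter> T q \<in> sets borel_M" "\<And>q. q \<in> K \<Longrightarrow> emeasure vol (carrier M \<inter> T q) < \<infinity>" by metis
  obtain F where F: "F \<subseteq> K" "finite F" "K \<subseteq> (\<Union>q\<in>F. T q)"
    by (rule compactE_image[OF K(1), of K T]) (use T(1,2) in auto)
  have "emeasure vol K \<le> emeasure vol (\<Union>q\<in>F. carrier M \<inter> T q)"
  proof (rule emeasure_mono)
    show "K \<subseteq> (\<Union>q\<in>F. carrier M \<inter> T q)" using F(3) K(2) by blast
    show "(\<Union>q\<in>F. carrier M \<inter> T q) \<in> sets vol" using F T(3) by (intro sets.finite_UN) auto
  qed
  also have "\<dots> \<le> (\<Sum>q\<in>F. emeasure vol (carrier M \<inter> T q))"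
    by (rule emeasure_subadditive_finite[OF F(2)]) (use F T(3) in auto)
  also have "\<dots> < \<infinity>"
  proof -
    have "\<forall>q\<in>F. emeasure vol (carrier M \<inter> T q) < \<infinity>" using F(1) T(4) by blast
    with F(2) show ?thesis by (induction F rule: finite_induct) (auto simp: less_top)
  qed
  finally show ?thesis .
qed

end

subsection \<open>Divergence in coordinates\<close>

context metric_on begin

text \<open>In the basis \<open>Eb\<close> the matrix of \<open>G x\<close> is the identity, where
  the derivative of the determinant is a trace. Passing to this fixed basis changes the determinant
  only by a constant factor.\<close>

lemma has_derivative_sqrt_det_gram:
  assumes x: "x \<in> U" and Eb: "orthonormal_basis (G x) Eb"
  shows "((\<lambda>y. sqrt (det (gram_matrix (G y)))) has_derivative
     (\<lambda>v. sqrt (det (gram_matrix (G x))) * (\<Sum>e\<in>Eb. dd (\<lambda>y. G y e e) x v) / 2)) (at x)"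
proof -
  obtain e :: "'m \<Rightarrow> real^'m" where e: "bij_betw e UNIV Eb"
    using finite_same_card_bij[of "UNIV :: 'm set" Eb] Eb by (auto simp: orthonormal_basis_def)
  define L where "L v = (\<Sum>i\<in>UNIV. (v $ i) *\<^sub>R e i)" for v :: "real^'m"
  have L: "linear L" by (auto simp: L_def scaleR_add_left sum.distrib scaleR_sum_right intro!: linearI)
  have "(axis i 1 $ j) *\<^sub>R e j = (if j = i then e j else 0)" for i j by (simp add: axis_def)
  then have Le: "L (axis i 1) = e i" for i by (simp add: L_def)
  define A where "A y = gram_matrix (\<lambda>u v. G y (L u) (L v))" for y
  have Aij: "A y $ i $ j = G y (e i) (e j)" for y i j by (simp add: A_def gram_matrix_def Le)
  have detA: "det (A y) = (det (matrix L))\<^sup>2 * det (gram_matrix (G y))" if "y \<in> U" for y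
    unfolding A_def by (rule gram_matrix_pullback[OF bil[OF that] L])
  have "A x = mat 1"
  proof -
    have "G x (e i) (e j) = (if i = j then 1 else 0)" for i j
    proof -
      have "e i \<in> Eb" "e j \<in> Eb" "e i = e j \<longleftrightarrow> i = j" using e by (auto simp: bij_betw_def inj_eq)
      then show ?thesis using Eb by (simp add: orthonormal_basis_def)
    qed
    then show ?thesis by (simp add: vec_eq_iff Aij mat_def)
  qed
  then have D: "((\<lambda>y. det (A y)) has_derivative (\<lambda>v. \<Sum>i\<in>UNIV. dd (\<lambda>y. G y (e i) (e i)) x v)) (at x)"
    by (intro has_derivative_det_at_id) (simp_all add: Aij smooth_on_D[OF smooth x])
  define c where "c = det (gram_matrix (G x))"
  have c: "c > 0" using det_gram_pos[OF inner[OF x]] by (simp add: c_def)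
  have "(det (matrix L))\<^sup>2 * c = 1" using detA[OF x] \<open>A x = mat 1\<close> by (simp add: c_def)
  then have "det (gram_matrix (G y)) = c * det (A y)" if "y \<in> U" for y
    using detA[OF that] by (metis mult.assoc mult.commute mult_1)
  then have "((\<lambda>y. det (gram_matrix (G y))) has_derivative (\<lambda>v. c * (\<Sum>i\<in>UNIV. dd (\<lambda>y. G y (e i) (e i)) x v))) (at x)"
    by (intro has_derivative_transform_within_open[OF has_derivative_mult_right[OF D] open_dom x]) simp
  moreover have "(\<Sum>i\<in>UNIV. dd (\<lambda>y. G y (e i) (e i)) x v) = (\<Sum>e\<in>Eb. dd (\<lambda>y. G y e e) x v)" for v
    by (rule sum.reindex_bij_betw[OF e, of "\<lambda>e. dd (\<lambda>y. G y e e) x v"])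
  ultimately have D2: "((\<lambda>y. det (gram_matrix (G y))) has_derivative (\<lambda>v. c * (\<Sum>e\<in>Eb. dd (\<lambda>y. G y e e) x v))) (at x)"
    by simp
  have "((\<lambda>y. sqrt (det (gram_matrix (G y)))) has_derivative
     (\<lambda>v. (c * (\<Sum>e\<in>Eb. dd (\<lambda>y. G y e e) x v)) * (inverse (sqrt c) / 2))) (at x)"
    using has_derivative_compose[OF D2 DERIV_real_sqrt[unfolded has_field_derivative_def, OF c[unfolded c_def]]]
    by (simp add: c_def mult.commute)
  moreover have "(c * s) * (inverse (sqrt c) / 2) = sqrt c * s / 2" for s
    using c real_sqrt_mult_self[of c] by (simp add: field_simps)
  ultimately show ?thesis unfolding c_def by (simp only:)
qed

lemma divergence:
  assumes x: "x \<in> U" and Eb: "orthonormal_basis (G x) Eb" and Y: "Y differentiable (at x)"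
  shows "(\<lambda>y. sqrt (det (gram_matrix (G y))) *\<^sub>R Y y) differentiable (at x)"
    and "(\<Sum>i\<in>UNIV. dd (\<lambda>y. sqrt (det (gram_matrix (G y))) *\<^sub>R Y y) x (axis i 1) $ i)
      = sqrt (det (gram_matrix (G x))) * ((\<Sum>e\<in>Eb. G x (dd Y x e) e) + (\<Sum>e\<in>Eb. dd (\<lambda>y. G y e e) x (Y x)) / 2)"
proof -
  let ?s = "sqrt (det (gram_matrix (G x)))"
  let ?D = "\<lambda>v. ?s * (\<Sum>e\<in>Eb. dd (\<lambda>y. G y e e) x v) / 2"
  have D: "((\<lambda>y. sqrt (det (gram_matrix (G y))) *\<^sub>R Y y) has_derivative (\<lambda>v. ?s *\<^sub>R dd Y x v + ?D v *\<^sub>R Y x)) (at x)"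
    by (rule has_derivative_scaleR[OF has_derivative_sqrt_det_gram[OF x Eb] dd_works[OF Y]])
  then show "(\<lambda>y. sqrt (det (gram_matrix (G y))) *\<^sub>R Y y) differentiable (at x)" by (auto simp: differentiable_def)
  have lin: "linear ?D"
    by (auto simp: linear_add[OF dG_linear[OF x]] linear_cmul[OF dG_linear[OF x]] sum.distrib sum_distrib_left field_simps intro!: linearI)
  have "?D (Y x) = ?D (\<Sum>i\<in>UNIV. (Y x $ i) *\<^sub>R axis i 1)"
    using basis_expansion[of "Y x"] by (simp add: scalar_mult_eq_scaleR)
  also have "\<dots> = (\<Sum>i\<in>UNIV. Y x $ i * ?D (axis i 1))"
    unfolding linear_sum[OF lin] linear_cmul[OF lin] by simp
  finally have 1: "(\<Sum>i\<in>UNIV. ?D (axis i 1) * Y x $ i) = ?D (Y x)" by (simp add: mult.commute)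
  have 2: "(\<Sum>i\<in>UNIV. dd Y x (axis i 1) $ i) = (\<Sum>e\<in>Eb. G x (dd Y x e) e)"
    by (rule orthonormal_trace[OF inner[OF x] Eb linear_frechet_derivative[OF Y]])
  have "(\<Sum>i\<in>UNIV. dd (\<lambda>y. sqrt (det (gram_matrix (G y))) *\<^sub>R Y y) x (axis i 1) $ i)
     = ?s * (\<Sum>i\<in>UNIV. dd Y x (axis i 1) $ i) + (\<Sum>i\<in>UNIV. ?D (axis i 1) * Y x $ i)"
    unfolding dd_eqI[OF D] by (simp add: sum.distrib sum_distrib_left)
  then show "(\<Sum>i\<in>UNIV. dd (\<lambda>y. sqrt (det (gram_matrix (G y))) *\<^sub>R Y y) x (axis i 1) $ i)
      = ?s * ((\<Sum>e\<in>Eb. G x (dd Y x e) e) + (\<Sum>e\<in>Eb. dd (\<lambda>y. G y e e) x (Y x)) / 2)"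
    unfolding 1 2 by (simp add: algebra_simps)
qed

text \<open>Differentiating \<open>G y (Y y) e = dd u y e\<close> expresses \<open>dd Y\<close> by
  second derivatives of \<open>u\<close> and first derivatives of \<open>G\<close>. Together with
  the derivative of the density the latter form the Koszul terms, and the sum is the Laplacian of
  \<open>u\<close> in coordinates.\<close>

lemma divergence_gradient:
  assumes x: "x \<in> U" and Eb: "orthonormal_basis (G x) Eb" and u: "smooth_on U u"
    and Y: "smooth_on U Y" "\<And>y z. y \<in> U \<Longrightarrow> G y (Y y) z = dd u y z"
  shows "(\<Sum>i\<in>UNIV. dd (\<lambda>y. sqrt (det (gram_matrix (G y))) *\<^sub>R Y y) x (axis i 1) $ i)
      = sqrt (det (gram_matrix (G x))) * (\<Sum>e\<in>Eb. d2 u x e e - koszul G x e e (Y x))"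
proof -
  have Yd: "Y differentiable (at x)" by (rule smooth_on_differentiable[OF Y(1) x])
  have 1: "d2 u x e e = dd (\<lambda>y. G y (Y x) e) x e + G x (dd Y x e) e" for e
  proof -
    have D: "((\<lambda>y. G y (Y y) e) has_derivative (\<lambda>v. dd (\<lambda>y. G y (Y x) e) x v + G x (dd Y x v) e + G x (Y x) 0)) (at x)"
      by (rule has_derivative_bilinear[where F = "\<lambda>y. y" and A = Y and B = "\<lambda>_. e", OF open_dom smooth bil x])
         (use dd_works[OF Yd] in auto)
    have "dd (\<lambda>y. dd u y e) x = dd (\<lambda>y. G y (Y y) e) x"
      by (rule dd_cong_on[OF open_dom x _ smooth_on_dd[OF u]]) (simp add: Y(2))
    then show ?thesis unfolding dd_eqI[OF D] using bilinear_rzero[OF bil[OF x]] by simp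
  qed
  have 2: "koszul G x e e (Y x) = dd (\<lambda>y. G y (Y x) e) x e - dd (\<lambda>y. G y e e) x (Y x) / 2" for e
    using dG_sym[OF x, of e "Y x"] by (simp add: koszul_def field_simps)
  show ?thesis
    unfolding divergence(2)[OF x Eb Yd] 1 2 by (simp add: sum.distrib sum_subtractf sum_divide_distrib)
qed

end

subsection \<open>Normal components\<close>

text \<open>The tangential part comes from the Riesz vector of \<open>G w\<close> for the form
  pulled back by \<open>L\<close>; positivity of \<open>G\<close> makes the decomposition
  unique.\<close>

lemma normal_part_works:
  fixes L :: "'f::euclidean_space \<Rightarrow> 'e::euclidean_space"
  assumes G: "inner_form G" and L: "linear L" "inj L"
  shows "w - normal_part G (range L) w \<in> range L"
proof -
  note b = bilinear_simps[OF inner_formD(1)[OF G]]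
  let ?B = "\<lambda>u v. G (L u) (L v)"
  have iB: "inner_form ?B" by (rule inner_form_pullback[OF G L])
  have "linear (\<lambda>v. G w (L v))"
    by (rule linearI) (simp_all add: linear_add[OF L(1)] linear_cmul[OF L(1)] b)
  then obtain t where t: "\<And>v. G (L t) (L v) = G w (L v)" using riesz_form[OF iB] by blast
  have ex: "w - (w - L t) \<in> range L \<and> (\<forall>s\<in>range L. G (w - L t) s = 0)" by (auto simp: b t)
  have "z = w - L t" if z: "w - z \<in> range L \<and> (\<forall>s\<in>range L. G z s = 0)" for z
  proof -
    obtain v where v: "w - z = L v" using z by blast
    have e: "z - (w - L t) = L (t - v)" using v by (simp add: linear_diff[OF L(1)] algebra_simps)
    have "G (z - (w - L t)) (L (t - v)) = 0" using z ex by (simp add: b)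
    then have "L (t - v) = 0" unfolding e using inner_formD(5)[OF G] by simp
    then show ?thesis using e by simp
  qed
  with ex have "normal_part G (range L) w = w - L t" unfolding normal_part_def by (intro the_equality) blast+
  then show ?thesis by simp
qed

subsection \<open>Immersed submanifolds\<close>

lemma (in riem) hess_cong:
  assumes X: "smooth_param M V X" and V: "x \<in> V" "\<And>y. y \<in> V \<Longrightarrow> X y = Z y" and d: "d \<in> atlas M" "X x \<in> cdom d"
  shows "dd (cmap d \<circ> X) x = dd (cmap d \<circ> Z) x" "hess M g d X x a b = hess M g d Z x a b"
proof -
  let ?V = "V \<inter> X -` cdom d"
  have o: "open ?V" "x \<in> ?V" using param_chart_open[OF X d(1)] V(1) d(2) by auto
  have e: "(cmap d \<circ> X) y = (cmap d \<circ> Z) y" if "y \<in> ?V" for y using V(2) that by simp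
  show 1: "dd (cmap d \<circ> X) x = dd (cmap d \<circ> Z) x"
    by (rule dd_cong_on[OF o e param_chart_smooth[OF X d(1)]])
  have "d2 (cmap d \<circ> X) x a b = d2 (cmap d \<circ> Z) x a b"
    by (rule d2_cong_on[OF o e param_chart_smooth[OF X d(1)]])
  then show "hess M g d X x a b = hess M g d Z x a b" unfolding hess_def 1 V(2)[OF V(1)] by simp
qed

locale submfd = riem M g
  for M :: "('a::{t2_space, second_countable_topology}, real^'m) manifold" and g +
  fixes S :: "('b::{t2_space, second_countable_topology}, real^'n) manifold" and f :: "'b \<Rightarrow> 'a"
  assumes S: "smooth_manifold S" and imm: "immersion S M f"
begin

sublocale S: mfd S using S by unfold_locales

lemma f_map: "smooth_map S M f" and f_inj: "q \<in> carrier S \<Longrightarrow> inj (differential S M f q)"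
  using imm by (auto simp: immersion_def)

lemma f_carrier: "q \<in> carrier S \<Longrightarrow> f q \<in> carrier M"
  using f_map by (auto simp: smooth_map_def)

abbreviation X :: "('b, real^'n) chart \<Rightarrow> real^'n \<Rightarrow> 'a" where "X c \<equiv> \<lambda>x. f (cinv c x)"

abbreviation h where "h \<equiv> induced_metric S M g f"

lemma X_param: assumes c: "c \<in> atlas S" shows "smooth_param M (cimage c) (X c)"
  unfolding smooth_param_def
proof (intro conjI ballI)
  show "open (cimage c)" by (rule S.open_cimage[OF c])
  have im: "cinv c ` cimage c \<subseteq> carrier S" using S.cinv_cdom[of _ c] S.cdom_sub[OF c] by blast
  show "continuous_on (cimage c) (X c)"
    using f_map by (intro continuous_on_compose2[OF _ S.continuous_cinv[OF c] im]) (simp add: smooth_map_def)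
  show "X c ` cimage c \<subseteq> carrier M" using im f_carrier by auto
  fix d assume d: "d \<in> atlas M"
  have "cimage c \<inter> X c -` cdom d \<subseteq> cmap c ` (cdom c \<inter> f -` cdom d)"
    using S.cmap_cinv[of _ c] S.cinv_cdom[of _ c] by (force simp: image_iff)
  moreover have "smooth_on (cmap c ` (cdom c \<inter> f -` cdom d)) (cmap d \<circ> f \<circ> cinv c)"
    using f_map c d by (simp add: smooth_map_def)
  ultimately show "smooth_on (cimage c \<inter> X c -` cdom d) (cmap d \<circ> X c)"
    using smooth_on_subset by (fastforce simp: o_def)
qed

lemma X_change:
  assumes c: "c \<in> atlas S" and c': "c' \<in> atlas S" and x: "x \<in> cimage c" "cinv c x \<in> cdom c'"
    and d: "d \<in> atlas M" "X c x \<in> cdom d"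
  defines "\<sigma> \<equiv> cmap c' \<circ> cinv c"
  shows "dd (cmap d \<circ> X c) x a = dd (cmap d \<circ> X c') (\<sigma> x) (dd \<sigma> x a)"
    and "hess M g d (X c) x a b = hess M g d (X c') (\<sigma> x) (dd \<sigma> x a) (dd \<sigma> x b)
      + dd (cmap d \<circ> X c') (\<sigma> x) (d2 \<sigma> x a b)"
proof -
  let ?W = "cimage c \<inter> cinv c -` cdom c'"
  note Pc = S.smooth_param_cinv[OF c]
  have W: "open ?W" "x \<in> ?W" using S.param_chart_open[OF Pc c'] x by auto
  have s: "smooth_on ?W \<sigma>" unfolding \<sigma>_def by (rule S.param_chart_smooth[OF Pc c'])
  have im: "\<sigma> y \<in> cimage c'" if "y \<in> ?W" for y using that S.cmap_cimage by (auto simp: \<sigma>_def)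
  have eq: "X c' (\<sigma> y) = X c y" if "y \<in> ?W" for y using that S.cinv_cmap[OF c'] by (auto simp: \<sigma>_def)
  have d': "X c' (\<sigma> x) \<in> cdom d" using d(2) eq[OF W(2)] by simp
  note P = smooth_param_compose[OF X_param[OF c'] W(1) s im]
  have 1: "dd (cmap d \<circ> (\<lambda>y. X c' (\<sigma> y))) x = dd (cmap d \<circ> X c) x"
    by (rule hess_cong(1)[OF P W(2) eq d(1) d'])
  have 2: "hess M g d (\<lambda>y. X c' (\<sigma> y)) x a b = hess M g d (X c) x a b"
    by (rule hess_cong(2)[OF P W(2) eq d(1) d'])
  show "dd (cmap d \<circ> X c) x a = dd (cmap d \<circ> X c') (\<sigma> x) (dd \<sigma> x a)"
    unfolding 1[symmetric] by (rule hess_compose(1)[OF X_param[OF c'] W(1) s im W(2) d(1) d'])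
  show "hess M g d (X c) x a b = hess M g d (X c') (\<sigma> x) (dd \<sigma> x a) (dd \<sigma> x b)
      + dd (cmap d \<circ> X c') (\<sigma> x) (d2 \<sigma> x a b)"
    unfolding 2[symmetric] by (rule hess_compose(2)[OF X_param[OF c'] W(1) s im W(2) d(1) d'])
qed

lemma differential_eq: "differential S M f q = dd (cmap (chart_at M (f q)) \<circ> X (chart_at S q)) (cmap (chart_at S q) q)"
  by (simp add: differential_def local_rep_def coords_def o_def)

lemma differential_linear: assumes q: "q \<in> carrier S" shows "linear (differential S M f q)"
proof -
  note c = S.chart_at[OF q] and d = chart_at[OF f_carrier[OF q]]
  have "cmap (chart_at S q) q \<in> cimage (chart_at S q) \<inter> X (chart_at S q) -` cdom (chart_at M (f q))"
    using S.cmap_cimage[OF c(2)] S.cinv_cmap[OF c] d(2) by simp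
  then show ?thesis unfolding differential_eq
    by (rule smooth_on_linear_dd[OF param_chart_smooth[OF X_param[OF c(1)] d(1)]])
qed

lemma h_inner: assumes q: "q \<in> carrier S" shows "inner_form (h q)"
  using inner_form_pullback[OF g_inner[OF f_carrier[OF q]] differential_linear[OF q] f_inj[OF q]]
  by (simp add: induced_metric_def[abs_def])

text \<open>\<open>h\<close> is defined through preferred charts on both manifolds; the chain rule
  removes the one on \<open>S\<close>, leaving the pullback along \<open>X c\<close>.\<close>

lemma local_metric_h:
  assumes c: "c \<in> atlas S" and x: "x \<in> cimage c"
  shows "local_metric S h c x a b = param_metric M g (X c) x a b"
proof -
  let ?q = "cinv c x"
  have q: "?q \<in> cdom c" "?q \<in> carrier S" using S.cinv_cdom[OF x] S.cdom_sub[OF c] by auto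
  note c' = S.chart_at[OF q(2)] and d = chart_at[OF f_carrier[OF q(2)]]
  show ?thesis
    unfolding local_metric_def Let_def induced_metric_def differential_eq param_metric_def
    using X_change(1)[OF c c'(1) x c'(2) d] by simp
qed

lemma h_riem: "riemannian_metric S h"
  unfolding riemannian_metric_def
proof (intro conjI ballI allI impI)
  fix q u v assume q: "q \<in> carrier S"
  show "bilinear (h q)" "h q u v = h q v u" "u \<noteq> 0 \<Longrightarrow> 0 < h q u u" using inner_formD(1-3)[OF h_inner[OF q]] by auto
next
  fix c and u v :: "real^'n" assume c: "c \<in> atlas S"
  show "smooth_on (cimage c) (\<lambda>x. local_metric S h c x u v)"
    by (rule smooth_on_cong[OF S.open_cimage[OF c] _ smooth_param_metric[OF X_param[OF c]]])
       (simp add: local_metric_h[OF c])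
qed

sublocale Sh: riem S h using h_riem by unfold_locales

text \<open>Minimality, expressed in an arbitrary chart of the submanifold: the tangential part that the chart
  change contributes does not matter.\<close>

lemma mean_curvature_chart:
  assumes mc: "mean_curvature S M g f (cinv c x) = 0" and c: "c \<in> atlas S" and x: "x \<in> cimage c"
  obtains Eb w d where "d \<in> atlas M" "X c x \<in> cdom d" "orthonormal_basis (local_metric S h c x) Eb"
    "(\<Sum>e\<in>Eb. hess M g d (X c) x e e) = dd (cmap d \<circ> X c) x w"
proof -
  let ?q = "cinv c x"
  let ?c = "chart_at S ?q" and ?d = "chart_at M (f ?q)"
  have q: "?q \<in> cdom c" "?q \<in> carrier S" using S.cinv_cdom[OF x] S.cdom_sub[OF c] by auto
  note c' = S.chart_at[OF q(2)] and d = chart_at[OF f_carrier[OF q(2)]]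
  define E0 where "E0 = (SOME E. orthonormal_basis (h ?q) E)"
  have E0: "orthonormal_basis (h ?q) E0"
    unfolding E0_def by (rule someI_ex[OF orthonormal_basis_ex[OF h_inner[OF q(2)]]])
  define df where "df = differential S M f ?q"
  have df: "linear df" "inj df" unfolding df_def by (rule differential_linear[OF q(2)], rule f_inj[OF q(2)])
  define H where "H e = hess M g ?d (X ?c) (cmap ?c ?q) e e" for e
  have lr: "local_rep S M f ?q = cmap ?d \<circ> X ?c" by (simp add: local_rep_def o_def)
  have sff: "second_fundamental_form S M g f ?q e e = normal_part (g (f ?q)) (range df) (H e)" for e
    unfolding second_fundamental_form_def Let_def df_def[symmetric] H_def hess_def lr coords_def christoffel_eq_chr
    by (simp add: df_def differential_eq S.cinv_cmap[OF c'])
  have "(\<Sum>e\<in>E0. second_fundamental_form S M g f ?q e e) = 0"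
    using mc unfolding mean_curvature_def E0_def .
  \<comment> \<open>The normal parts sum to zero, so the sum of the \<open>H e\<close> equals its
    own tangential part.\<close>
  then have "(\<Sum>e\<in>E0. H e) = (\<Sum>e\<in>E0. H e - normal_part (g (f ?q)) (range df) (H e))"
    by (simp add: sff sum_subtractf)
  also have "\<dots> \<in> range df"
    by (rule subspace_sum[OF linear_subspace_image[OF df(1) subspace_UNIV]])
       (rule normal_part_works[OF g_inner[OF f_carrier[OF q(2)]] df])
  finally obtain w0 where w0: "(\<Sum>e\<in>E0. H e) = df w0" by blast
  define \<sigma> where "\<sigma> = cmap ?c \<circ> cinv c"
  have \<sigma>x: "\<sigma> x = cmap ?c ?q" by (simp add: \<sigma>_def)
  have xq: "cmap c ?q = x" by (rule S.cmap_cinv[OF x])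
  define L where "L = dd \<sigma> x"
  have L: "linear L" "inj L" "surj L"
    using S.transition_linear[OF c c'(1) q(1) c'(2)] unfolding xq L_def \<sigma>_def .
  have bij: "bij L" using L by (simp add: bij_def)
  define Eb where "Eb = inv L ` E0"
  have Li: "L (inv L e) = e" for e using L(3) by (simp add: surj_f_inv_f)
  have hL: "local_metric S h c x = (\<lambda>u v. h ?q (L u) (L v))"
    by (simp add: fun_eq_iff local_metric_def Let_def L_def \<sigma>_def)
  have Eb: "orthonormal_basis (local_metric S h c x) Eb"
    unfolding hL Eb_def by (rule orthonormal_basis_pullback[OF L(1) bij E0])
  have ch: "dd (cmap ?d \<circ> X c) x a = df (L a)" "hess M g ?d (X c) x a a = hess M g ?d (X ?c) (\<sigma> x) (L a) (L a) + df (d2 \<sigma> x a a)" for a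
    using X_change(1)[OF c c'(1) x c'(2) d, where a = a] X_change(2)[OF c c'(1) x c'(2) d, where a = a and b = a] unfolding \<sigma>_def[symmetric] L_def[symmetric]
    by (simp_all add: df_def differential_eq \<sigma>x)
  have inj: "inj_on (inv L) E0" using inj_on_subset[OF bij_is_inj[OF bij_imp_bij_inv[OF bij]]] by blast
  have "(\<Sum>e\<in>Eb. hess M g ?d (X c) x e e) = (\<Sum>e\<in>E0. H e + df (d2 \<sigma> x (inv L e) (inv L e)))"
    unfolding Eb_def sum.reindex[OF inj] o_def by (intro sum.cong refl) (simp add: ch Li H_def \<sigma>x)
  also have "\<dots> = df (w0 + (\<Sum>e\<in>E0. d2 \<sigma> x (inv L e) (inv L e)))"
    by (simp add: sum.distrib w0 linear_add[OF df(1)] linear_sum[OF df(1)])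
  also have "\<dots> = dd (cmap ?d \<circ> X c) x (inv L (w0 + (\<Sum>e\<in>E0. d2 \<sigma> x (inv L e) (inv L e))))"
    by (simp add: ch Li)
  finally show ?thesis using that[OF d(1) _ Eb] d(2) by blast
qed

end

subsection \<open>The Laplacian of the squared distance on a minimal submanifold\<close>

lemma metric_on_subset: "metric_on U G \<Longrightarrow> open V \<Longrightarrow> V \<subseteq> U \<Longrightarrow> metric_on V G"
  unfolding metric_on_def using smooth_on_subset by blast

context normal_ball_le begin

lemma gauss_deriv: assumes x: "x \<in> B" shows "dd (\<lambda>z. N z x b) x a + N x a b = g p a b"
proof -
  have D: "((\<lambda>z. N z z b) has_derivative (\<lambda>a. dd (\<lambda>z. N z x b) x a + N x a b + N x x 0)) (at x)"
    by (rule has_derivative_bilinear[where F = "\<lambda>z. z" and A = "\<lambda>z. z" and B = "\<lambda>_. b", OF open_B N.smooth N.bil x]) auto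
  have lin: "linear (\<lambda>z. g p z b)" using inner_formD(1)[OF gp] by (simp add: bilinear_def)
  have D2: "((\<lambda>z. g p z b) has_derivative (\<lambda>z. g p z b)) (at x)"
    using lin by (simp add: linear_imp_has_derivative)
  have "dd (\<lambda>z. N z z b) x = dd (\<lambda>z. g p z b) x"
    by (rule dd_cong[OF open_B x gauss]) (use D in \<open>auto simp: differentiable_def\<close>)
  from fun_cong[OF this, of a] show ?thesis
    unfolding dd_eqI[OF D] dd_eqI[OF D2] using bilinear_rzero[OF N.bil[OF x]] by simp
qed

text \<open>The left side is the second coordinate derivative of half the squared radius minus its
  differential on the Christoffel term; the Gauss lemma writes that differential as
  \<open>N x x\<close>.\<close>

lemma Hs_chr: assumes x: "x \<in> B" shows "g p a a - N x x (chr N x a a) = Hs x a a"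
proof -
  have "N x x (chr N x a a) = koszul N x a a x"
    using N.sym[OF x, of x "chr N x a a"] N.chr_works[OF x, of a a x] by simp
  also have "\<dots> = dd (\<lambda>z. N z x a) x a - dd (\<lambda>z. N z a a) x x / 2"
    using N.dG_sym[OF x, of a x] by (simp add: koszul_def)
  finally show ?thesis using gauss_deriv[OF x, of a a] by (simp add: Hs_def)
qed

text \<open>Since \<open>N\<close> is the pullback of the metric, both sides have the same products
  with the image of the differential of \<open>E\<close>, which is the whole tangent space.\<close>

lemma hess_E:
  assumes z: "z \<in> B" and d: "d \<in> atlas M" "E z \<in> cdom d"
  shows "hess M g d E z a b = dd (cmap d \<circ> E) z (chr N z a b)"
proof -
  interpret m: metric_on "cimage d" "local_metric M g d" by (rule metric_on_chart[OF d(1)])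
  show ?thesis
  proof (rule inner_form_eqI[OF m.inner[OF cmap_cimage[OF d(2)]]])
    fix w
    obtain v where v: "w = dd (cmap d \<circ> E) z v" using dE_bij(3)[OF z d] by (metis surjD)
    show "local_metric M g d (cmap d (E z)) (hess M g d E z a b) w
      = local_metric M g d (cmap d (E z)) (dd (cmap d \<circ> E) z (chr N z a b)) w"
      unfolding v param_koszul[OF E_param z d, symmetric] N_chart[OF z d, symmetric] N.chr_works[OF z]
      by (simp add: N_def)
  qed
qed

end

locale min_sub = normal_ball_le M g p R \<delta> + submfd M g S f
  for M :: "('a::{t2_space, second_countable_topology}, real^'m) manifold" and g p R \<delta>
    and S :: "('b::{t2_space, second_countable_topology}, real^'n) manifold" and f +
  assumes minimal: "q \<in> carrier S \<Longrightarrow> mean_curvature S M g f q = 0"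
    and proper: "compact K \<Longrightarrow> K \<subseteq> carrier M \<Longrightarrow> compact {q \<in> carrier S. f q \<in> K}"
begin

definition V where "V c = cimage c \<inter> X c -` W"
definition \<Phi>c where "\<Phi>c c x = \<Phi> (X c x)"
text \<open>Half the squared distance to \<open>p\<close> is used because, unlike the distance, it
  is smooth where the submanifold passes through \<open>p\<close>.\<close>

definition uc where "uc c x = g p (\<Phi>c c x) (\<Phi>c c x) / 2"
definition \<rho> where "\<rho> q = rad (\<Phi> (f q))"

lemma V_open: assumes c: "c \<in> atlas S" shows "open (V c)"
proof -
  note P = X_param[OF c]
  have "openin (top_of_set (cimage c)) (cimage c \<inter> X c -` W)"
    using P openin_W' unfolding smooth_param_def
    by (intro continuous_openin_preimage[of _ _ "carrier M"]) auto
  then show ?thesis unfolding V_def using S.open_cimage[OF c] openin_open_trans by blast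
qed

lemma V_sub: "V c \<subseteq> cimage c" and V_W: "x \<in> V c \<Longrightarrow> X c x \<in> W" by (auto simp: V_def)

lemma XV_param: "c \<in> atlas S \<Longrightarrow> smooth_param M (V c) (X c)"
  by (rule smooth_param_subset[OF X_param V_open V_sub])

lemma \<Phi>c_smooth: "c \<in> atlas S \<Longrightarrow> smooth_on (V c) (\<Phi>c c)"
  unfolding \<Phi>c_def[abs_def] by (rule \<Phi>_smooth[OF XV_param V_W])

lemma \<Phi>c_B: "x \<in> V c \<Longrightarrow> \<Phi>c c x \<in> B" and E_\<Phi>c: "x \<in> V c \<Longrightarrow> E (\<Phi>c c x) = X c x"
  using V_W \<Phi>_B E_\<Phi> by (auto simp: \<Phi>c_def)

lemma X_normal:
  assumes c: "c \<in> atlas S" and x: "x \<in> V c" and d: "d \<in> atlas M" "X c x \<in> cdom d"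
  shows "dd (cmap d \<circ> X c) x a = dd (cmap d \<circ> E) (\<Phi>c c x) (dd (\<Phi>c c) x a)"
    and "hess M g d (X c) x a b = dd (cmap d \<circ> E) (\<Phi>c c x)
       (d2 (\<Phi>c c) x a b + chr N (\<Phi>c c x) (dd (\<Phi>c c) x a) (dd (\<Phi>c c) x b))"
proof -
  note s = \<Phi>c_smooth[OF c] and o = V_open[OF c]
  have d': "E (\<Phi>c c x) \<in> cdom d" using d(2) E_\<Phi>c[OF x] by simp
  note P = smooth_param_compose[OF E_param o s \<Phi>c_B]
  have 1: "dd (cmap d \<circ> (\<lambda>y. E (\<Phi>c c y))) x = dd (cmap d \<circ> X c) x"
    by (rule hess_cong(1)[OF P x E_\<Phi>c d(1) d'])
  have 2: "hess M g d (\<lambda>y. E (\<Phi>c c y)) x a b = hess M g d (X c) x a b"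
    by (rule hess_cong(2)[OF P x E_\<Phi>c d(1) d'])
  show "dd (cmap d \<circ> X c) x a = dd (cmap d \<circ> E) (\<Phi>c c x) (dd (\<Phi>c c) x a)"
    unfolding 1[symmetric] by (rule hess_compose(1)[OF E_param o s \<Phi>c_B x d(1) d'])
  show "hess M g d (X c) x a b = dd (cmap d \<circ> E) (\<Phi>c c x)
       (d2 (\<Phi>c c) x a b + chr N (\<Phi>c c x) (dd (\<Phi>c c) x a) (dd (\<Phi>c c) x b))"
  proof -
    have "hess M g d (\<lambda>y. E (\<Phi>c c y)) x a b = hess M g d E (\<Phi>c c x) (dd (\<Phi>c c) x a) (dd (\<Phi>c c) x b)
        + dd (cmap d \<circ> E) (\<Phi>c c x) (d2 (\<Phi>c c) x a b)"
      by (rule hess_compose(2)[OF E_param o s \<Phi>c_B x d(1) d'])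
    then show ?thesis
      unfolding 2 hess_E[OF \<Phi>c_B[OF x] d(1) d'] linear_add[OF dE_bij(1)[OF \<Phi>c_B[OF x] d(1) d']]
      by (simp only: add.commute)
  qed
qed

lemma h_normal:
  assumes c: "c \<in> atlas S" and x: "x \<in> V c"
  shows "local_metric S h c x a b = N (\<Phi>c c x) (dd (\<Phi>c c) x a) (dd (\<Phi>c c) x b)"
proof -
  note d = chart_at[OF param_carrier[OF XV_param[OF c] x]]
  have d': "E (\<Phi>c c x) \<in> cdom (chart_at M (X c x))" using d(2) E_\<Phi>c[OF x] by simp
  have "x \<in> cimage c" using x V_sub by blast
  then show ?thesis
    unfolding local_metric_h[OF c \<open>x \<in> cimage c\<close>] param_metric_chart[OF XV_param[OF c] x d]
      N_chart[OF \<Phi>c_B[OF x] d(1) d'] X_normal(1)[OF c x d] E_\<Phi>c[OF x] by simp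
qed

text \<open>The tangency found in a chart of \<open>M\<close> is pulled back through the
  differential of \<open>E\<close>, which is injective. The tangential vector \<open>w\<close>
  remains because the coordinates on \<open>S\<close> are arbitrary.\<close>

lemma minimal_normal:
  assumes c: "c \<in> atlas S" and x: "x \<in> V c"
  obtains Eb w where "orthonormal_basis (local_metric S h c x) Eb"
    "(\<Sum>e\<in>Eb. d2 (\<Phi>c c) x e e + chr N (\<Phi>c c x) (dd (\<Phi>c c) x e) (dd (\<Phi>c c) x e)) = dd (\<Phi>c c) x w"
proof -
  have xc: "x \<in> cimage c" using x V_sub by blast
  have "cinv c x \<in> carrier S" using S.cinv_cdom[OF xc] S.cdom_sub[OF c] by blast
  obtain Eb w d where d: "d \<in> atlas M" "X c x \<in> cdom d" and Eb: "orthonormal_basis (local_metric S h c x) Eb"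
    and w: "(\<Sum>e\<in>Eb. hess M g d (X c) x e e) = dd (cmap d \<circ> X c) x w"
    by (rule mean_curvature_chart[OF minimal[OF \<open>cinv c x \<in> carrier S\<close>] c xc])
  have d': "E (\<Phi>c c x) \<in> cdom d" using d(2) E_\<Phi>c[OF x] by simp
  note l = dE_bij[OF \<Phi>c_B[OF x] d(1) d']
  have "dd (cmap d \<circ> E) (\<Phi>c c x) (\<Sum>e\<in>Eb. d2 (\<Phi>c c) x e e + chr N (\<Phi>c c x) (dd (\<Phi>c c) x e) (dd (\<Phi>c c) x e))
    = dd (cmap d \<circ> E) (\<Phi>c c x) (dd (\<Phi>c c) x w)"
    using w unfolding X_normal[OF c x d] linear_sum[OF l(1)] .
  then show ?thesis using that[OF Eb] injD[OF l(2)] by blast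
qed

lemma uc_smooth: assumes c: "c \<in> atlas S" shows "smooth_on (V c) (uc c)"
proof -
  have "smooth_on (V c) (\<lambda>x. g p (\<Phi>c c x) (\<Phi>c c x))"
    by (rule smooth_on_bilinear[where V = UNIV and G = "\<lambda>_. g p" and F = "\<Phi>c c" and A = "\<Phi>c c" and B = "\<Phi>c c"])
       (use V_open[OF c] \<Phi>c_smooth[OF c] inner_formD(1)[OF gp] in auto)
  then show ?thesis unfolding uc_def[abs_def] using V_open[OF c] by (intro smooth_on_divide) auto
qed

lemma dd_gp:
  assumes "(P has_derivative P') (at x)" "(Q has_derivative Q') (at x)"
  shows "((\<lambda>x. g p (P x) (Q x)) has_derivative (\<lambda>v. g p (P' v) (Q x) + g p (P x) (Q' v))) (at x)"
proof -
  have "((\<lambda>x. g p (P x) (Q x)) has_derivative (\<lambda>v. dd (\<lambda>y. g p (P x) (Q x)) (P x) (P' v) + g p (P' v) (Q x) + g p (P x) (Q' v))) (at x)"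
    by (rule has_derivative_bilinear[where V = UNIV and G = "\<lambda>_. g p" and F = P and A = P and B = Q])
       (use assms inner_formD(1)[OF gp] in auto)
  then show ?thesis by simp
qed

lemma dd_uc:
  assumes c: "c \<in> atlas S" and x: "x \<in> V c"
  shows "dd (uc c) x z = g p (\<Phi>c c x) (dd (\<Phi>c c) x z)"
    and "d2 (uc c) x a b = g p (dd (\<Phi>c c) x a) (dd (\<Phi>c c) x b) + g p (\<Phi>c c x) (d2 (\<Phi>c c) x a b)"
proof -
  note s = \<Phi>c_smooth[OF c]
  have 1: "dd (uc c) y z = g p (\<Phi>c c y) (dd (\<Phi>c c) y z)" if "y \<in> V c" for y z
  proof -
    have "(uc c has_derivative (\<lambda>v. (g p (dd (\<Phi>c c) y v) (\<Phi>c c y) + g p (\<Phi>c c y) (dd (\<Phi>c c) y v)) / 2)) (at y)"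
      unfolding uc_def[abs_def] by (rule bounded_linear.has_derivative[OF bounded_linear_divide dd_gp[OF smooth_on_D[OF s that] smooth_on_D[OF s that]]])
    from dd_eqI[OF this] show ?thesis using inner_formD(2)[OF gp, of _ "\<Phi>c c y"] by simp
  qed
  show "dd (uc c) x z = g p (\<Phi>c c x) (dd (\<Phi>c c) x z)" by (rule 1[OF x])
  have "dd (\<lambda>y. dd (uc c) y b) x = dd (\<lambda>y. g p (\<Phi>c c y) (dd (\<Phi>c c) y b)) x"
    by (rule dd_cong_on[OF V_open[OF c] x 1 smooth_on_dd[OF uc_smooth[OF c]]])
  then show "d2 (uc c) x a b = g p (dd (\<Phi>c c) x a) (dd (\<Phi>c c) x b) + g p (\<Phi>c c x) (d2 (\<Phi>c c) x a b)"
    unfolding dd_eqI[OF dd_gp[OF smooth_on_D[OF s x] smooth_on_D[OF smooth_on_dd[OF s] x]]] by simp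
qed

definition grad where "grad c x = (THE w. \<forall>z. local_metric S h c x w z = dd (uc c) x z)"

lemma metric_V: "c \<in> atlas S \<Longrightarrow> metric_on (V c) (local_metric S h c)"
  by (rule metric_on_subset[OF Sh.metric_on_chart V_open V_sub])

lemma grad_works:
  assumes c: "c \<in> atlas S" and x: "x \<in> V c"
  shows "local_metric S h c x (grad c x) z = dd (uc c) x z"
  unfolding grad_def
  using theI'[OF riesz_form[OF metric_on.inner[OF metric_V[OF c] x] smooth_on_linear_dd[OF uc_smooth[OF c] x]]] by blast

lemma grad_smooth: assumes c: "c \<in> atlas S" shows "smooth_on (V c) (grad c)"
  by (rule metric_on.smooth_riesz[OF metric_V[OF c] smooth_on_dd[OF uc_smooth[OF c]] grad_works[OF c]])

text \<open>\<open>gsq\<close> is the squared length of the gradient of \<open>\<rho>\<close> on the submanifold, with junk value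
  \<open>0\<close> where \<open>\<rho> = 0\<close>.\<close>

definition gsq where "gsq c x = dd (uc c) x (grad c x) / (rad (\<Phi>c c x))\<^sup>2"

text \<open>The vectors \<open>dd (\<Phi>c c) x e\<close> are orthonormal for \<open>N\<close>, so
  Bessel's inequality for the radial vector bounds the gradient; the Gauss lemma turns these
  products into those of \<open>g p\<close>.\<close>

lemma gsq_bounds:
  assumes c: "c \<in> atlas S" and x: "x \<in> V c" and Eb: "orthonormal_basis (local_metric S h c x) Eb"
  shows "dd (uc c) x (grad c x) = (\<Sum>e\<in>Eb. (g p (\<Phi>c c x) (dd (\<Phi>c c) x e))\<^sup>2)" (is ?A)
    and "0 \<le> gsq c x" "gsq c x \<le> 1"
proof -
  interpret m: metric_on "V c" "local_metric S h c" by (rule metric_V[OF c])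
  have "dd (uc c) x (grad c x) = local_metric S h c x (grad c x) (grad c x)" using grad_works[OF c x] by simp
  also have "\<dots> = (\<Sum>e\<in>Eb. local_metric S h c x (grad c x) e * local_metric S h c x (grad c x) e)"
    by (rule orthonormal_parseval[OF m.inner[OF x] Eb])
  also have "\<dots> = (\<Sum>e\<in>Eb. (g p (\<Phi>c c x) (dd (\<Phi>c c) x e))\<^sup>2)"
    unfolding grad_works[OF c x] dd_uc(1)[OF c x] by (simp add: power2_eq_square)
  finally show A: ?A .
  have zB: "\<Phi>c c x \<in> B" by (rule \<Phi>c_B[OF x])
  have "(\<Sum>e\<in>Eb. (N (\<Phi>c c x) (\<Phi>c c x) (dd (\<Phi>c c) x e))\<^sup>2) \<le> N (\<Phi>c c x) (\<Phi>c c x) (\<Phi>c c x)"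
    by (rule orthonormal_bessel[OF N.inner[OF zB]])
       (use Eb in \<open>simp_all add: orthonormal_basis_def h_normal[OF c x, symmetric]\<close>)
  then have le: "dd (uc c) x (grad c x) \<le> (rad (\<Phi>c c x))\<^sup>2" unfolding A gauss[OF zB] rad_sq .
  show "0 \<le> gsq c x" unfolding gsq_def A by (intro divide_nonneg_nonneg sum_nonneg) auto
  show "gsq c x \<le> 1" unfolding gsq_def using le by (cases "rad (\<Phi>c c x) = 0") (auto simp: divide_le_eq_1)
qed

text \<open>The sum of the Koszul terms is the product of \<open>w\<close> with the gradient, hence
  the derivative of \<open>uc c\<close> along \<open>w\<close>, hence a radial product of the sum
  that minimality equates with the image of \<open>w\<close>. The second derivatives of
  \<open>\<Phi>c c\<close> cancel, leaving the trace of \<open>Hs\<close>, to which the comparison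
  applies in each basis direction.\<close>

lemma laplace_lower:
  assumes c: "c \<in> atlas S" and x: "x \<in> V c" and pi: "\<delta> > 0 \<Longrightarrow> rad (\<Phi>c c x) < pi / sqrt \<delta>"
  shows "(\<Sum>i\<in>UNIV. dd (\<lambda>y. dens S h c y *\<^sub>R grad c y) x (axis i 1) $ i)
     \<ge> dens S h c x * (kf \<delta> (rad (\<Phi>c c x)) * (real CARD('n) - gsq c x) + gsq c x)"
proof -
  interpret m: metric_on "V c" "local_metric S h c" by (rule metric_V[OF c])
  let ?z = "\<Phi>c c x" and ?D = "dd (\<Phi>c c) x"
  have zB: "?z \<in> B" by (rule \<Phi>c_B[OF x])
  note s = \<Phi>c_smooth[OF c] and Nb = bilinear_simps[OF N.bil[OF zB]]
  obtain Eb w where Eb: "orthonormal_basis (local_metric S h c x) Eb"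
    and w: "(\<Sum>e\<in>Eb. d2 (\<Phi>c c) x e e + chr N ?z (?D e) (?D e)) = ?D w" by (rule minimal_normal[OF c x])
  have Ef: "finite Eb" "card Eb = CARD('n)" using Eb by (auto simp: orthonormal_basis_def)
  have ko: "koszul (local_metric S h c) x e e (grad c x) = N ?z (d2 (\<Phi>c c) x e e + chr N ?z (?D e) (?D e)) (?D (grad c x))" for e
    by (rule N.koszul_pullback[OF V_open[OF c] x s \<Phi>c_B h_normal[OF c]])
  have "(\<Sum>e\<in>Eb. koszul (local_metric S h c) x e e (grad c x)) = N ?z (?D w) (?D (grad c x))"
    unfolding ko w[symmetric] by (rule bilinear_sumL[OF N.bil[OF zB], symmetric])
  also have "\<dots> = dd (uc c) x w"
    using grad_works[OF c x, of w] m.sym[OF x, of w "grad c x"] h_normal[OF c x] by simp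
  also have "\<dots> = N ?z ?z (\<Sum>e\<in>Eb. d2 (\<Phi>c c) x e e + chr N ?z (?D e) (?D e))"
    unfolding w dd_uc(1)[OF c x] gauss[OF zB] ..
  also have "\<dots> = (\<Sum>e\<in>Eb. g p ?z (d2 (\<Phi>c c) x e e) + N ?z ?z (chr N ?z (?D e) (?D e)))"
    by (simp add: bilinear_sumR[OF N.bil[OF zB]] Nb gauss[OF zB])
  finally have K: "(\<Sum>e\<in>Eb. koszul (local_metric S h c) x e e (grad c x))
     = (\<Sum>e\<in>Eb. g p ?z (d2 (\<Phi>c c) x e e) + N ?z ?z (chr N ?z (?D e) (?D e)))" .
  have "(\<Sum>e\<in>Eb. d2 (uc c) x e e - koszul (local_metric S h c) x e e (grad c x))
     = (\<Sum>e\<in>Eb. g p (?D e) (?D e) - N ?z ?z (chr N ?z (?D e) (?D e)))"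
    unfolding sum_subtractf K dd_uc(2)[OF c x] by (simp add: sum.distrib)
  also have "\<dots> = (\<Sum>e\<in>Eb. Hs ?z (?D e) (?D e))" unfolding Hs_chr[OF zB] ..
  finally have L: "(\<Sum>e\<in>Eb. d2 (uc c) x e e - koszul (local_metric S h c) x e e (grad c x)) = (\<Sum>e\<in>Eb. Hs ?z (?D e) (?D e))" .
  let ?k = "kf \<delta> (rad ?z)"
  have "(\<Sum>e\<in>Eb. Hs ?z (?D e) (?D e)) \<ge> (\<Sum>e\<in>Eb. ?k * 1 + (1 - ?k) * ((g p ?z (?D e))\<^sup>2 / (rad ?z)\<^sup>2))"
  proof (rule sum_mono)
    fix e assume "e \<in> Eb"
    then have "N ?z (?D e) (?D e) = 1" using Eb by (simp add: orthonormal_basis_def h_normal[OF c x, symmetric])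
    then show "?k * 1 + (1 - ?k) * ((g p ?z (?D e))\<^sup>2 / (rad ?z)\<^sup>2) \<le> Hs ?z (?D e) (?D e)"
      using hessian_comparison[OF zB pi, of "?D e"] by simp
  qed
  also have "(\<Sum>e\<in>Eb. ?k * 1 + (1 - ?k) * ((g p ?z (?D e))\<^sup>2 / (rad ?z)\<^sup>2)) = ?k * (real CARD('n) - gsq c x) + gsq c x"
  proof -
    have "(\<Sum>e\<in>Eb. ?k * 1 + (1 - ?k) * ((g p ?z (?D e))\<^sup>2 / (rad ?z)\<^sup>2))
       = ?k * real CARD('n) + (1 - ?k) * gsq c x"
      unfolding gsq_def gsq_bounds(1)[OF c x Eb] sum_divide_distrib sum_distrib_left sum.distrib
      by (simp add: Ef)
    then show ?thesis by (simp add: algebra_simps)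
  qed
  finally have low: "(\<Sum>e\<in>Eb. Hs ?z (?D e) (?D e)) \<ge> ?k * (real CARD('n) - gsq c x) + gsq c x" .
  have "x \<in> cimage c" using x V_sub by blast
  then have dp: "dens S h c x \<ge> 0" using Sh.dens_pos[OF c] by (simp add: less_imp_le)
  note eq = m.divergence_gradient[OF x Eb uc_smooth[OF c] grad_smooth[OF c] grad_works[OF c]]
  have "(\<Sum>i\<in>UNIV. dd (\<lambda>y. dens S h c y *\<^sub>R grad c y) x (axis i 1) $ i) =
      dens S h c x * (\<Sum>e\<in>Eb. d2 (uc c) x e e - koszul (local_metric S h c) x e e (grad c x))"
    unfolding dens_def[abs_def] by (rule eq)
  then show ?thesis unfolding L using mult_left_mono[OF low dp] by (simp only:)
qed

end

subsection \<open>Compactly supported functions\<close>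

text \<open>Translation invariance makes the integral of every difference quotient vanish.\<close>

lemma integral_dd_zero:
  fixes \<zeta> :: "'e::euclidean_space \<Rightarrow> real"
  assumes \<zeta>: "Ck (Suc 0) UNIV \<zeta>" and L: "compact L" "\<And>x. x \<notin> L \<Longrightarrow> \<zeta> x = 0"
  shows "integrable lborel (\<lambda>x. dd \<zeta> x e)" "(\<integral>x. dd \<zeta> x e \<partial>lborel) = 0"
proof -
  let ?D = "\<lambda>x. dd \<zeta> x e"
  have D: "(\<zeta> has_derivative dd \<zeta> x) (at x)" for x by (rule Ck_Suc_D[OF \<zeta>]) simp
  have cD: "continuous_on UNIV ?D" using Ck_imp_continuous_on[OF Ck_Suc_dd[OF \<zeta>]] .
  have c\<zeta>: "continuous_on UNIV \<zeta>" using Ck_imp_continuous_on[OF \<zeta>] .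
  have D0: "?D x = 0" if "x \<notin> L" for x
  proof -
    have "open (- L)" using L(1) by (simp add: compact_imp_closed open_Compl)
    then have "dd \<zeta> x = dd (\<lambda>_. 0) x"
      by (rule dd_cong) (use that L(2) D in \<open>auto simp: differentiable_def\<close>)
    then show ?thesis by simp
  qed
  obtain K where K: "\<And>x. x \<in> L \<Longrightarrow> norm (?D x) \<le> K" "K \<ge> 0"
  proof -
    have "bounded (?D ` L)" by (intro compact_imp_bounded compact_continuous_image continuous_on_subset[OF cD] L(1)) auto
    then obtain K where "\<And>x. x \<in> L \<Longrightarrow> norm (?D x) \<le> K" unfolding bounded_iff by auto
    then show ?thesis using that[of "max K 0"] by fastforce
  qed
  have K': "norm (?D x) \<le> K" for x using K D0 by (cases "x \<in> L") auto
  obtain a where a: "\<And>x. x \<in> L \<Longrightarrow> norm x \<le> a" using compact_imp_bounded[OF L(1)] unfolding bounded_iff by auto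
  let ?Q = "\<lambda>k x. (\<zeta> (x + (1 / real (Suc k)) *\<^sub>R e) - \<zeta> x) * real (Suc k)"
  \<comment> \<open>The translations are by vectors no longer than \<open>e\<close>, so the
    quotients vanish outside a ball enlarged by \<open>norm e\<close>; inside, the mean value
    theorem bounds them by \<open>K\<close>.\<close>
  let ?b = "\<lambda>x::'e. K * indicator (cball 0 (a + norm e)) x :: real"
  have lim: "(\<lambda>k. ?Q k x) \<longlonglongrightarrow> ?D x" for x
  proof -
    have "((\<lambda>s. \<zeta> (x + s *\<^sub>R e)) has_vector_derivative ?D x) (at 0)"
      using line_deriv[of \<zeta> x 0 e] D by (auto simp: differentiable_def)
    then have "((\<lambda>s. \<zeta> (x + s *\<^sub>R e)) has_real_derivative ?D x) (at 0)"
      by (simp add: has_real_derivative_iff_has_vector_derivative)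
    then have l: "((\<lambda>s. (\<zeta> (x + s *\<^sub>R e) - \<zeta> x) / s) \<longlongrightarrow> ?D x) (at 0)"
      by (simp add: DERIV_def)
    have "filterlim (\<lambda>k. 1 / real (Suc k)) (at 0) sequentially"
      unfolding filterlim_at using LIMSEQ_inverse_real_of_nat by (auto simp: inverse_eq_divide)
    from filterlim_compose[OF l this] show ?thesis by simp
  qed
  have bound: "norm (?Q k x) \<le> ?b x" for k x
  proof -
    let ?t = "1 / real (Suc k)"
    have t: "0 < ?t" "?t \<le> 1" by auto
    show ?thesis
    proof (cases "norm x \<le> a + norm e")
      case True
      have "\<exists>z. z > 0 \<and> z < ?t \<and> \<zeta> (x + ?t *\<^sub>R e) - \<zeta> (x + 0 *\<^sub>R e) = (?t - 0) * ?D (x + z *\<^sub>R e)"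
      proof (rule MVT2[OF t(1)])
        fix z
        show "((\<lambda>s. \<zeta> (x + s *\<^sub>R e)) has_real_derivative ?D (x + z *\<^sub>R e)) (at z)"
          using line_deriv[of \<zeta> x z e] D by (auto simp: differentiable_def has_real_derivative_iff_has_vector_derivative)
      qed
      then obtain z where "\<zeta> (x + ?t *\<^sub>R e) - \<zeta> x = ?t * ?D (x + z *\<^sub>R e)" by auto
      then have "?Q k x = ?D (x + z *\<^sub>R e)" by simp
      then show ?thesis using K'[of "x + z *\<^sub>R e"] True by (simp add: indicator_def)
    next
      case False
      then have "x \<notin> L" using a[of x] norm_ge_zero[of e] by linarith
      moreover have "x + ?t *\<^sub>R e \<notin> L"
      proof
        assume "x + ?t *\<^sub>R e \<in> L"
        then have "norm (x + ?t *\<^sub>R e) \<le> a" by (rule a)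
        moreover have "norm x \<le> norm (x + ?t *\<^sub>R e) + norm (?t *\<^sub>R e)"
          using norm_triangle_ineq4[of "x + ?t *\<^sub>R e" "?t *\<^sub>R e"] by simp
        moreover have "norm (?t *\<^sub>R e) \<le> norm e" using mult_right_mono[OF t(2) norm_ge_zero[of e]] by simp
        ultimately show False using False by linarith
      qed
      ultimately show ?thesis using L(2) K(2) by simp
    qed
  qed
  have mQ: "?Q k \<in> borel_measurable lborel" for k
    unfolding measurable_lborel2
    by (intro borel_measurable_continuous_onI continuous_intros continuous_on_compose2[OF c\<zeta>]) auto
  have mD: "?D \<in> borel_measurable lborel"
    using borel_measurable_continuous_onI[OF cD] by simp
  have ib: "integrable lborel ?b"
    by (intro integrable_mult_right integrable_real_indicator) (use emeasure_lborel_cball_finite[of "0::'e" "a + norm e"] in \<open>auto simp: infinity_ennreal_def\<close>)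
  show "integrable lborel ?D"
    by (rule integrable_dominated_convergence[where s = ?Q and w = ?b]) (use mQ mD ib lim bound in auto)
  have "(\<lambda>k. integral\<^sup>L lborel (?Q k)) \<longlonglongrightarrow> integral\<^sup>L lborel ?D"
    by (rule integral_dominated_convergence[where w = ?b]) (use mQ mD ib lim bound in auto)
  moreover have "integral\<^sup>L lborel (?Q k) = 0" for k
  proof -
    have i\<zeta>: "integrable lborel \<zeta>"
    proof -
      have "integrable lborel (\<lambda>x. indicator L x *\<^sub>R \<zeta> x)"
        by (rule borel_integrable_compact[OF L(1) continuous_on_subset[OF c\<zeta>]]) simp
      moreover have "(\<lambda>x. indicator L x *\<^sub>R \<zeta> x) = \<zeta>" using L(2) by (auto simp: indicator_def fun_eq_iff)
      ultimately show ?thesis by simp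
    qed
    let ?c = "(1 / real (Suc k)) *\<^sub>R e"
    have m: "(+) ?c \<in> measurable lborel borel" by simp
    have m\<zeta>: "\<zeta> \<in> borel_measurable borel" using c\<zeta> by (rule borel_measurable_continuous_onI)
    have "integrable (distr lborel borel ((+) ?c)) \<zeta>" unfolding lborel_distr_plus by (rule i\<zeta>)
    then have 1: "integrable lborel (\<lambda>x. \<zeta> (x + ?c))" unfolding integrable_distr_eq[OF m m\<zeta>] by (simp add: add.commute)
    have "integral\<^sup>L (distr lborel borel ((+) ?c)) \<zeta> = integral\<^sup>L lborel (\<lambda>x. \<zeta> (x + ?c))"
      unfolding integral_distr[OF m m\<zeta>] by (simp add: add.commute)
    then have "integral\<^sup>L lborel (\<lambda>x. \<zeta> (x + ?c)) = integral\<^sup>L lborel \<zeta>" unfolding lborel_distr_plus by simp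
    then show ?thesis using Bochner_Integration.integral_diff[OF 1 i\<zeta>] by simp
  qed
  ultimately show "integral\<^sup>L lborel ?D = 0" by (simp add: LIMSEQ_const_iff)
qed

section \<open>Functions of class C^1 on open subsets of a manifold\<close>

lemma continuous_on_openin_local:
  assumes "\<And>q. q \<in> A \<Longrightarrow> \<exists>U. openin (top_of_set A) U \<and> q \<in> U \<and> continuous_on U \<psi>"
  shows "continuous_on A \<psi>"
  unfolding continuous_on_def
proof
  fix q assume "q \<in> A"
  from assms[OF this] obtain T where T: "open T" "q \<in> A \<inter> T" "continuous_on (A \<inter> T) \<psi>"
    unfolding openin_open by blast
  have "at q within A = at q within (A \<inter> T)" by (rule at_within_nhd[of _ T]) (use T in auto)
  then show "(\<psi> \<longlongrightarrow> \<psi> q) (at q within A)"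
    using T(2,3) by (simp add: continuous_on_def)
qed

text \<open>C^1 rather than smooth, because the cut-offs and the radial test functions are only
  assured continuous first derivatives.\<close>

definition C1_fun :: "('a, 'e::euclidean_space) manifold \<Rightarrow> 'a set \<Rightarrow> ('a \<Rightarrow> real) \<Rightarrow> bool" where
  "C1_fun M A \<psi> \<longleftrightarrow> (\<forall>c\<in>atlas M. Ck (Suc 0) (cimage c \<inter> cinv c -` A) (\<lambda>x. \<psi> (cinv c x)))"

context mfd begin

lemma open_chart_part:
  assumes "c \<in> atlas M" "openin (top_of_set (carrier M)) A" shows "open (cimage c \<inter> cinv c -` A)"
proof -
  have "openin (top_of_set (cimage c)) (cimage c \<inter> cinv c -` A)"
    using continuous_cinv[OF assms(1)] cinv_cdom[of _ c] cdom_sub[OF assms(1)] assms(2)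
    by (intro continuous_openin_preimage[of _ _ "carrier M"]) auto
  then show ?thesis using open_cimage[OF assms(1)] openin_open_trans by blast
qed

lemma open_chart_back:
  assumes c: "c \<in> atlas M" and D: "open D" "D \<subseteq> cimage c"
  shows "openin (top_of_set (carrier M)) (cinv c ` D)"
proof -
  have "cinv c ` D = cdom c \<inter> cmap c -` D"
    using cinv_cmap[OF c] cmap_cinv[of _ c] cinv_cdom[of _ c] D(2) by (force simp: image_iff)
  moreover have "openin (top_of_set (cdom c)) (cdom c \<inter> cmap c -` D)"
    using continuous_cmap[OF c] D(1) by (simp add: continuous_openin_preimage_gen)
  ultimately show ?thesis using openin_cdom[OF c] openin_trans by metis
qed

text \<open>Differentiability is local on open sets; this glues a formula near the support of a
  function with zero elsewhere.\<close>

lemma C1_fun_Un: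
  assumes A: "openin (top_of_set (carrier M)) A" "openin (top_of_set (carrier M)) A'"
    and "C1_fun M A \<psi>" "C1_fun M A' \<psi>"
  shows "C1_fun M (A \<union> A') \<psi>"
  unfolding C1_fun_def
proof (intro ballI Ck_local)
  fix c x assume c: "c \<in> atlas M" and x: "x \<in> cimage c \<inter> cinv c -` (A \<union> A')"
  show "\<exists>V. open V \<and> x \<in> V \<and> Ck (Suc 0) V (\<lambda>x. \<psi> (cinv c x))"
  proof (cases "cinv c x \<in> A")
    case True
    then show ?thesis using open_chart_part[OF c A(1)] assms(3) c x unfolding C1_fun_def by blast
  next
    case False
    then show ?thesis using open_chart_part[OF c A(2)] assms(4) c x unfolding C1_fun_def by blast
  qed
qed (use open_chart_part[OF _ openin_Un[OF A]] in blast)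

text \<open>Differentiability in one chart passes to all others through the smooth transition
  maps.\<close>

lemma C1_fun_chart:
  assumes d: "d \<in> atlas M" and D: "open D" "D \<subseteq> cimage d" and F: "Ck (Suc 0) D F"
    and \<psi>: "\<And>x. x \<in> D \<Longrightarrow> \<psi> (cinv d x) = F x"
  shows "C1_fun M (cinv d ` D) \<psi>"
  unfolding C1_fun_def
proof
  fix c assume c: "c \<in> atlas M"
  let ?U = "cimage c \<inter> cinv c -` (cinv d ` D)"
  have o: "open ?U" by (rule open_chart_part[OF c open_chart_back[OF d D]])
  have s: "(cmap d \<circ> cinv c) x \<in> D" "\<psi> (cinv c x) = F ((cmap d \<circ> cinv c) x)" "x \<in> cmap c ` (cdom c \<inter> cdom d)"
    if "x \<in> ?U" for x
  proof -
    obtain y where y: "y \<in> D" "cinv c x = cinv d y" using \<open>x \<in> ?U\<close> by blast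
    then show "(cmap d \<circ> cinv c) x \<in> D" "\<psi> (cinv c x) = F ((cmap d \<circ> cinv c) x)"
      using cmap_cinv[of y d] D(2) \<psi>[OF y(1)] by auto
    have "cinv c x \<in> cdom c \<inter> cdom d" using y D(2) cinv_cdom[of y d] cinv_cdom[of x c] \<open>x \<in> ?U\<close> by auto
    moreover have "x = cmap c (cinv c x)" using cmap_cinv[of x c] \<open>x \<in> ?U\<close> by simp
    ultimately show "x \<in> cmap c ` (cdom c \<inter> cdom d)" by blast
  qed
  have "Ck (Suc 0) ?U (\<lambda>x. F ((cmap d \<circ> cinv c) x))"
    by (rule Ck_compose[OF o F Ck_subset[OF smooth_on_Ck[OF transition_smooth[OF c d]]]]) (use s in blast)+
  then show "Ck (Suc 0) ?U (\<lambda>x. \<psi> (cinv c x))"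
    by (rule Ck_cong[OF o, rotated]) (rule s(2)[symmetric])
qed

lemma C1_fun_cong:
  assumes "openin (top_of_set (carrier M)) A" "C1_fun M A \<psi>" "\<And>q. q \<in> A \<Longrightarrow> \<psi> q = \<psi>' q"
  shows "C1_fun M A \<psi>'"
  unfolding C1_fun_def
proof
  fix c assume c: "c \<in> atlas M"
  show "Ck (Suc 0) (cimage c \<inter> cinv c -` A) (\<lambda>x. \<psi>' (cinv c x))"
    by (rule Ck_cong[OF open_chart_part[OF c assms(1)], where F = "\<lambda>x. \<psi> (cinv c x)"])
       (use assms c in \<open>auto simp: C1_fun_def\<close>)
qed

lemma C1_fun_zero:
  assumes "openin (top_of_set (carrier M)) A" "\<And>q. q \<in> A \<Longrightarrow> \<psi> q = 0" shows "C1_fun M A \<psi>"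
  by (rule C1_fun_cong[OF assms(1), where \<psi> = "\<lambda>_. 0"]) (simp_all add: C1_fun_def assms(2))

lemma C1_fun_subset: "C1_fun M A \<psi> \<Longrightarrow> A' \<subseteq> A \<Longrightarrow> C1_fun M A' \<psi>"
  unfolding C1_fun_def
proof
  fix c assume "\<forall>c\<in>atlas M. Ck (Suc 0) (cimage c \<inter> cinv c -` A) (\<lambda>x. \<psi> (cinv c x))" "A' \<subseteq> A" "c \<in> atlas M"
  then show "Ck (Suc 0) (cimage c \<inter> cinv c -` A') (\<lambda>x. \<psi> (cinv c x))"
    by (intro Ck_subset[where U = "cimage c \<inter> cinv c -` A" and V = "cimage c \<inter> cinv c -` A'"]) auto
qed

lemma openin_diff_compact: "compact K \<Longrightarrow> openin (top_of_set (carrier M)) (carrier M - K)"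
  by (metis Diff_Diff_Int Diff_eq compact_imp_closed open_Compl openin_open_Int)

lemma C1_fun_continuous:
  assumes A: "openin (top_of_set (carrier M)) A" and \<psi>: "C1_fun M A \<psi>"
  shows "continuous_on A \<psi>"
proof (rule continuous_on_openin_local)
  fix q assume q: "q \<in> A"
    have "q \<in> carrier M" using q A openin_imp_subset by blast
    note c = chart_at[OF this]
    let ?c = "chart_at M q"
    have "continuous_on (A \<inter> cdom ?c) (\<lambda>q. \<psi> (cinv ?c (cmap ?c q)))"
    proof (rule continuous_on_compose2[of "cimage ?c \<inter> cinv ?c -` A" "\<lambda>x. \<psi> (cinv ?c x)" _ "cmap ?c"])
      show "continuous_on (cimage ?c \<inter> cinv ?c -` A) (\<lambda>x. \<psi> (cinv ?c x))"
        using \<psi> c(1) unfolding C1_fun_def using Ck_imp_continuous_on by blast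
      show "continuous_on (A \<inter> cdom ?c) (cmap ?c)" using continuous_cmap[OF c(1)] continuous_on_subset by blast
      show "cmap ?c ` (A \<inter> cdom ?c) \<subseteq> cimage ?c \<inter> cinv ?c -` A"
        using cmap_cimage cinv_cmap[OF c(1)] by auto
    qed
    then have "continuous_on (A \<inter> cdom ?c) \<psi>"
      by (rule continuous_on_eq) (use cinv_cmap[OF c(1)] in auto)
    moreover have "openin (top_of_set A) (A \<inter> cdom ?c)"
      using openin_subset_trans[OF openin_Int[OF A openin_cdom[OF c(1)]]] openin_imp_subset[OF A] by blast
    ultimately show "\<exists>U. openin (top_of_set A) U \<and> q \<in> U \<and> continuous_on U \<psi>" using q c(2) by blast
qed

end

subsection \<open>The gradient of the squared distance\<close>

lemma (in mfd) function_change: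
  assumes c: "c \<in> atlas M" "q \<in> cdom c" and d: "d \<in> atlas M" "q \<in> cdom d"
    and \<psi>: "(\<lambda>z. \<psi> (cinv d z)) differentiable (at (cmap d q))"
  shows "dd (\<lambda>z. \<psi> (cinv c z)) (cmap c q) v = dd (\<lambda>z. \<psi> (cinv d z)) (cmap d q) (dd (cmap d \<circ> cinv c) (cmap c q) v)"
proof -
  let ?U = "cimage c \<inter> cinv c -` cdom d" and ?\<tau> = "cmap d \<circ> cinv c"
  have o: "open ?U" by (rule open_chart_part[OF c(1) openin_cdom[OF d(1)]])
  have x: "cmap c q \<in> ?U" using c d cmap_cimage cinv_cmap by simp
  have U: "?U \<subseteq> cmap c ` (cdom c \<inter> cdom d)"
  proof
    fix z assume "z \<in> ?U"
    then show "z \<in> cmap c ` (cdom c \<inter> cdom d)"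
      using cmap_cinv[of z c] cinv_cdom[of z c] by (metis IntD1 IntD2 IntI image_eqI vimageD)
  qed
  have \<tau>: "(?\<tau> has_derivative dd ?\<tau> (cmap c q)) (at (cmap c q))"
    by (rule smooth_on_D[OF transition_smooth[OF c(1) d(1)]]) (use x U in blast)
  have \<tau>q: "?\<tau> (cmap c q) = cmap d q" using cinv_cmap[OF c] by simp
  have "((\<lambda>z. \<psi> (cinv d z)) has_derivative dd (\<lambda>z. \<psi> (cinv d z)) (cmap d q)) (at (?\<tau> (cmap c q)))"
    unfolding \<tau>q by (rule dd_works[OF \<psi>])
  from has_derivative_compose[OF \<tau> this]
  have D: "((\<lambda>z. \<psi> (cinv d (?\<tau> z))) has_derivative (\<lambda>v. dd (\<lambda>z. \<psi> (cinv d z)) (cmap d q) (dd ?\<tau> (cmap c q) v))) (at (cmap c q))" .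
  have "dd (\<lambda>z. \<psi> (cinv d (?\<tau> z))) (cmap c q) = dd (\<lambda>z. \<psi> (cinv c z)) (cmap c q)"
  proof (rule dd_cong[OF o x])
    fix y assume "y \<in> ?U"
    then show "\<psi> (cinv d (?\<tau> y)) = \<psi> (cinv c y)" using cinv_cmap[OF d(1)] by simp
  qed (use D in \<open>auto simp: differentiable_def\<close>)
  then show ?thesis unfolding dd_eqI[OF D] by (simp add: fun_eq_iff)
qed

context min_sub begin

definition SW where "SW = {q \<in> carrier S. f q \<in> W}"

lemma SW_open: "openin (top_of_set (carrier S)) SW"
proof -
  have "openin (top_of_set (carrier S)) (carrier S \<inter> f -` W)"
    using f_map openin_W' f_carrier unfolding smooth_map_def
    by (intro continuous_openin_preimage[of _ _ "carrier M"]) auto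
  moreover have "carrier S \<inter> f -` W = SW" by (auto simp: SW_def)
  ultimately show ?thesis by simp
qed

lemma V_SW: "c \<in> atlas S \<Longrightarrow> V c = cimage c \<inter> cinv c -` SW"
  unfolding V_def SW_def using S.cinv_cdom[of _ c] S.cdom_sub[of c] by auto

lemma V_cinv: "c \<in> atlas S \<Longrightarrow> x \<in> V c \<Longrightarrow> cinv c x \<in> SW \<and> cinv c x \<in> cdom c \<and> x \<in> cimage c"
  using V_SW S.cinv_cdom[of x c] by auto

lemma SW_V: "c \<in> atlas S \<Longrightarrow> q \<in> SW \<Longrightarrow> q \<in> cdom c \<Longrightarrow> cmap c q \<in> V c"
  using V_SW S.cinv_cmap[of c q] S.cmap_cimage[of q c] by auto

lemma SW_chart: "q \<in> SW \<Longrightarrow> chart_at S q \<in> atlas S \<and> q \<in> cdom (chart_at S q)"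
  using S.chart_at[of q] by (auto simp: SW_def)

definition half_sq where "half_sq q = g p (\<Phi> (f q)) (\<Phi> (f q)) / 2"

lemma uc_half_sq: "uc c = (\<lambda>x. half_sq (cinv c x))"
  by (simp add: uc_def half_sq_def \<Phi>c_def fun_eq_iff)

lemma \<rho>_half_sq: "\<rho> q = sqrt (2 * half_sq q)" by (simp add: \<rho>_def half_sq_def rad_def)

text \<open>Gradients in two charts represent the same differential, and metric and differential
  transform by the same linear map. Hence derivatives along the gradient do not depend on the
  chart.\<close>

lemma grad_change:
  assumes c: "c \<in> atlas S" "q \<in> cdom c" and d: "d \<in> atlas S" "q \<in> cdom d" and q: "q \<in> SW"
  shows "dd (cmap d \<circ> cinv c) (cmap c q) (grad c (cmap c q)) = grad d (cmap d q)"
proof (rule inner_form_eqI[OF metric_on.inner[OF metric_V[OF d(1)] SW_V[OF d(1) q d(2)]]])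
  fix w
  let ?D = "dd (cmap d \<circ> cinv c) (cmap c q)"
  note x = SW_V[OF c(1) q c(2)] and y = SW_V[OF d(1) q d(2)]
  obtain v where v: "w = ?D v" using S.transition_linear(3)[OF c(1) d(1) c(2) d(2)] by (metis surjD)
  have qx: "cinv c (cmap c q) = q" using S.cinv_cmap[OF c] .
  have "local_metric S h c (cmap c q) a b = local_metric S h d (cmap d q) (?D a) (?D b)" for a b
    using Sh.param_metric_chart[OF S.smooth_param_cinv[OF c(1)] S.cmap_cimage[OF c(2)] d(1)] d(2)
    unfolding local_metric_eq_param qx by simp
  then have "local_metric S h d (cmap d q) (?D (grad c (cmap c q))) w = dd (uc c) (cmap c q) v"
    unfolding v using grad_works[OF c(1) x] by simp
  also have "\<dots> = dd (uc d) (cmap d q) w"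
    unfolding v uc_half_sq
    by (rule S.function_change[OF c d smooth_on_differentiable[OF uc_smooth[OF d(1)] y, unfolded uc_half_sq]])
  finally show "local_metric S h d (cmap d q) (?D (grad c (cmap c q))) w = local_metric S h d (cmap d q) (grad d (cmap d q)) w"
    using grad_works[OF d(1) y] by simp
qed

text \<open>The derivative of \<open>\<psi>\<close> along the gradient of \<open>\<rho>\<^sup>2 / 2\<close>.\<close>

definition DY :: "('b \<Rightarrow> real) \<Rightarrow> 'b \<Rightarrow> real" where
  "DY \<psi> q = dd (\<lambda>x. \<psi> (cinv (chart_at S q) x)) (cmap (chart_at S q) q) (grad (chart_at S q) (cmap (chart_at S q) q))"

text \<open>Squared length of the gradient of \<rho>, from |grad (\<rho>^2/2)|^2 = \<rho>^2 |grad
  \<rho>|^2.\<close>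

definition \<sigma> where "\<sigma> q = DY half_sq q / (\<rho> q)\<^sup>2"

lemma C1_differentiable:
  assumes "C1_fun S A \<psi>" "c \<in> atlas S" "q \<in> cdom c" "q \<in> A"
  shows "(\<lambda>z. \<psi> (cinv c z)) differentiable (at (cmap c q))"
proof -
  have "cmap c q \<in> cimage c \<inter> cinv c -` A" using assms S.cmap_cimage S.cinv_cmap by simp
  then have "((\<lambda>z. \<psi> (cinv c z)) has_derivative dd (\<lambda>z. \<psi> (cinv c z)) (cmap c q)) (at (cmap c q))"
    using assms(1,2) unfolding C1_fun_def by (intro Ck_Suc_D[of 0 "cimage c \<inter> cinv c -` A"]) auto
  then show ?thesis by (auto simp: differentiable_def)
qed

lemma DY_chart:
  assumes \<psi>: "C1_fun S A \<psi>" and c: "c \<in> atlas S" "q \<in> cdom c" and q: "q \<in> A" "q \<in> SW"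
  shows "DY \<psi> q = dd (\<lambda>x. \<psi> (cinv c x)) (cmap c q) (grad c (cmap c q))"
proof -
  let ?d = "chart_at S q"
  have d: "?d \<in> atlas S" "q \<in> cdom ?d" using SW_chart[OF q(2)] by auto
  show ?thesis
    unfolding DY_def grad_change[OF c d q(2), symmetric]
    by (rule S.function_change[OF c d C1_differentiable[OF \<psi> d q(1)], symmetric])
qed

lemma C1_half_sq: "C1_fun S SW half_sq"
  unfolding C1_fun_def uc_half_sq[symmetric] using uc_smooth smooth_on_Ck V_SW by metis

lemma \<sigma>_chart: assumes c: "c \<in> atlas S" "q \<in> cdom c" and q: "q \<in> SW" shows "\<sigma> q = gsq c (cmap c q)"
  unfolding \<sigma>_def DY_chart[OF C1_half_sq c q q] gsq_def uc_half_sq[symmetric] \<rho>_def \<Phi>c_def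
  using S.cinv_cmap[OF c] by simp

lemma \<sigma>_bounds: assumes q: "q \<in> SW" shows "0 \<le> \<sigma> q" "\<sigma> q \<le> 1"
proof -
  let ?c = "chart_at S q"
  have c: "?c \<in> atlas S" "q \<in> cdom ?c" using SW_chart[OF q] by auto
  note x = SW_V[OF c(1) q c(2)]
  obtain Eb where "orthonormal_basis (local_metric S h ?c (cmap ?c q)) Eb"
    using orthonormal_basis_ex[OF metric_on.inner[OF metric_V[OF c(1)] x]] by blast
  from gsq_bounds(2,3)[OF c(1) x this] show "0 \<le> \<sigma> q" "\<sigma> q \<le> 1" unfolding \<sigma>_chart[OF c q] .
qed

lemma \<rho>_nonneg: "\<rho> q \<ge> 0" if "q \<in> SW" unfolding \<rho>_def by (rule rad_nonneg)

lemma \<rho>_chart: "\<rho> (cinv c x) = rad (\<Phi>c c x)" by (simp add: \<rho>_def \<Phi>c_def)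

lemma continuous_\<rho>: "continuous_on SW \<rho>"
  unfolding \<rho>_half_sq[abs_def]
  by (intro continuous_intros S.C1_fun_continuous[OF SW_open C1_half_sq])

text \<open>The preferred chart in \<open>DY\<close> jumps, so continuity is checked in one chart
  near each point. The derivative along the moving gradient is expanded over a basis, because
  \<open>Ck\<close> controls fixed directions.\<close>

lemma continuous_DY:
  assumes A: "openin (top_of_set (carrier S)) A" "A \<subseteq> SW" and \<psi>: "C1_fun S A \<psi>"
  shows "continuous_on A (DY \<psi>)"
proof (rule continuous_on_openin_local)
  fix q assume q: "q \<in> A"
  let ?c = "chart_at S q" and ?F = "\<lambda>c x. dd (\<lambda>x. \<psi> (cinv c x)) x (grad c x)"
  have c: "?c \<in> atlas S" "q \<in> cdom ?c" using SW_chart q A(2) by auto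
  let ?D = "cimage ?c \<inter> cinv ?c -` A"
  have D: "?D \<subseteq> V ?c" using V_SW[OF c(1)] A(2) by blast
  have "continuous_on ?D (?F ?c)"
  proof -
    have "continuous_on ?D (\<lambda>x. \<Sum>b\<in>Basis. (grad ?c x \<bullet> b) *\<^sub>R dd (\<lambda>x. \<psi> (cinv ?c x)) x b)"
    proof (intro continuous_intros)
      show "continuous_on ?D (grad ?c)"
        using continuous_on_subset[OF smooth_on_continuous[OF grad_smooth[OF c(1)]] D] .
      show "continuous_on ?D (\<lambda>x. dd (\<lambda>x. \<psi> (cinv ?c x)) x b)" for b
        by (rule Ck_imp_continuous_on[OF Ck_Suc_dd[of 0]]) (use \<psi> c(1) in \<open>simp only: C1_fun_def\<close>)
    qed
    moreover have "?F ?c x = (\<Sum>b\<in>Basis. (grad ?c x \<bullet> b) *\<^sub>R dd (\<lambda>x. \<psi> (cinv ?c x)) x b)" if "x \<in> ?D" for x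
    proof -
      have "((\<lambda>x. \<psi> (cinv ?c x)) has_derivative dd (\<lambda>x. \<psi> (cinv ?c x)) x) (at x)"
        using \<psi> c(1) that unfolding C1_fun_def by (intro Ck_Suc_D[of 0 ?D]) auto
      from linear_expand[OF has_derivative_linear[OF this]] show ?thesis .
    qed
    ultimately show ?thesis by (simp cong: continuous_on_cong_simp)
  qed
  then have "continuous_on (A \<inter> cdom ?c) (\<lambda>q. ?F ?c (cmap ?c q))"
    by (rule continuous_on_compose2[OF _ continuous_on_subset[OF S.continuous_cmap[OF c(1)]]])
       (use S.cmap_cimage S.cinv_cmap[OF c(1)] in auto)
  then have "continuous_on (A \<inter> cdom ?c) (DY \<psi>)"
    by (rule continuous_on_eq) (use DY_chart[OF \<psi> c(1)] A(2) in auto)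
  moreover have "openin (top_of_set A) (A \<inter> cdom ?c)"
    using openin_subset_trans[OF openin_Int[OF A(1) S.openin_cdom[OF c(1)]]] openin_imp_subset[OF A(1)] by blast
  ultimately show "\<exists>U. openin (top_of_set A) U \<and> q \<in> U \<and> continuous_on U (DY \<psi>)" using q c(2) by blast
qed

end

subsection \<open>The integrated Laplace inequality\<close>

text \<open>At 0 the quotient sn t / t tends to the derivative of \<open>sn \<delta>\<close> at 0,
  which is 1; elsewhere on the set \<open>sn \<delta>\<close> does not vanish.\<close>

lemma kf_continuous: "continuous_on {t. 0 \<le> t \<and> (\<delta> > 0 \<longrightarrow> t < pi / sqrt \<delta>)} (kf \<delta>)"
  unfolding continuous_on_eq_continuous_within
proof
  fix t assume t: "t \<in> {t. 0 \<le> t \<and> (\<delta> > 0 \<longrightarrow> t < pi / sqrt \<delta>)}"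
  have "isCont (kf \<delta>) t"
  proof (cases "t = 0")
    case True
    have "((\<lambda>t. sn \<delta> t / t) \<longlongrightarrow> 1) (at 0)"
      using sn_deriv[of \<delta> 0] by (simp add: DERIV_def)
    moreover have "(cs \<delta> \<longlongrightarrow> 1) (at 0)" using DERIV_isCont[OF cs_deriv[of \<delta> 0]] by (simp add: isCont_def)
    ultimately have "((\<lambda>t. cs \<delta> t / (sn \<delta> t / t)) \<longlongrightarrow> 1 / 1) (at 0)" by (intro tendsto_divide) auto
    moreover have "\<forall>\<^sub>F t in at 0. cs \<delta> t / (sn \<delta> t / t) = kf \<delta> t"
      by (auto simp: kf_def eventually_at_filter)
    ultimately have "(kf \<delta> \<longlongrightarrow> 1 / 1) (at 0)" by (rule Lim_transform_eventually)
    then show ?thesis using True by (simp add: isCont_def kf_def)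
  next
    case False
    then have "sn \<delta> t \<noteq> 0" using sn_pos[of t \<delta>] t by fastforce
    then have "isCont (\<lambda>t. t * cs \<delta> t / sn \<delta> t) t"
      by (intro continuous_intros DERIV_isCont[OF cs_deriv] DERIV_isCont[OF sn_deriv])
    moreover have "\<forall>\<^sub>F x in nhds t. x * cs \<delta> x / sn \<delta> x = kf \<delta> x"
      using t1_space_nhds[OF False] by eventually_elim (simp add: kf_def)
    ultimately show ?thesis using isCont_cong[of "\<lambda>t. t * cs \<delta> t / sn \<delta> t" "kf \<delta>" t] by simp
  qed
  then show "continuous (at t within {t. 0 \<le> t \<and> (\<delta> > 0 \<longrightarrow> t < pi / sqrt \<delta>)}) (kf \<delta>)"
    by (rule continuous_at_imp_continuous_at_within)
qed

lemma (in riem) Ck_dens: assumes c: "c \<in> atlas M" shows "Ck (Suc 0) (cimage c) (dens M g c)"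
proof -
  have s: "Ck (Suc 0) {0<..} sqrt"
  proof (rule Ck_SucI)
    show "(sqrt has_derivative (*) (inverse (sqrt x) / 2)) (at x)" if "x \<in> {0<..}" for x
      using DERIV_real_sqrt[of x] that unfolding has_field_derivative_def by simp
    show "Ck 0 {0<..} (\<lambda>x. inverse (sqrt x) / 2 * v)" for v :: real
      by (auto intro!: continuous_intros)
  qed simp
  show ?thesis unfolding dens_def[abs_def]
    by (rule Ck_compose[OF open_cimage[OF c] s smooth_on_Ck[OF smooth_gram_det[OF c]]]) (use gram_pos[OF c] in simp)
qed

context min_sub begin

lemma K_sub: "K \<subseteq> SW \<Longrightarrow> K \<subseteq> carrier S" by (auto simp: SW_def)

text \<open>For \<psi> \<ge> 0 this bounds the divergence of \<psi> grad (\<rho>^2/2) from below: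
  the first summand by the Laplace comparison, the second exactly.\<close>

definition wsum where "wsum \<psi> q = \<psi> q * (kf \<delta> (\<rho> q) * (real CARD('n) - \<sigma> q) + \<sigma> q) + DY \<psi> q"

lemma DY_zero:
  assumes A: "openin (top_of_set (carrier S)) A" "A \<subseteq> SW" "\<And>q. q \<in> A \<Longrightarrow> \<psi> q = 0" and q: "q \<in> A"
  shows "DY \<psi> q = 0"
proof -
  have c: "chart_at S q \<in> atlas S" "q \<in> cdom (chart_at S q)" using SW_chart A(2) q by auto
  have D: "DY \<psi> q = dd (\<lambda>x. \<psi> (cinv (chart_at S q) x)) (cmap (chart_at S q) q) (grad (chart_at S q) (cmap (chart_at S q) q))"
    by (rule DY_chart[OF S.C1_fun_zero[OF A(1,3)] c q]) (use A(2) q in auto)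
  have "dd (\<lambda>_. 0::real) (cmap (chart_at S q) q) = dd (\<lambda>x. \<psi> (cinv (chart_at S q) x)) (cmap (chart_at S q) q)"
    by (rule dd_cong[OF S.open_chart_part[OF c(1) A(1)]])
       (use A(3) q c S.cmap_cimage S.cinv_cmap in auto)
  then show ?thesis unfolding D by (metis has_derivative_const dd_eqI)
qed

lemma measurable_on_compact:
  fixes F :: "'b \<Rightarrow> real"
  assumes "compact K" "K \<subseteq> SW" "continuous_on K F"
  shows "(\<lambda>q. indicator K q * F q) \<in> borel_measurable S.borel_M"
proof -
  have K: "K \<in> sets borel" by (rule borel_closed[OF compact_imp_closed[OF assms(1)]])
  have "F \<in> borel_measurable (restrict_space borel K)" by (rule borel_measurable_continuous_on_restrict[OF assms(3)])
  then have "(\<lambda>q. indicator K q *\<^sub>R F q) \<in> borel_measurable borel"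
    using K by (subst (asm) borel_measurable_restrict_space_iff) auto
  then show ?thesis by (intro measurable_restrict_space1) simp
qed

text \<open>\<sigma> may jump where \<rho> = 0. It is a quotient of functions continuous on
  \<open>K\<close>, hence measurable under the convention that division by 0 gives 0.\<close>

lemma \<sigma>_measurable:
  assumes K: "compact K" "K \<subseteq> SW" shows "(\<lambda>q. indicator K q * \<sigma> q) \<in> borel_measurable S.borel_M"
proof -
  have "continuous_on K (DY half_sq)" using continuous_DY[OF SW_open order_refl C1_half_sq] K(2) by (rule continuous_on_subset)
  moreover have "continuous_on K \<rho>" using continuous_\<rho> K(2) by (rule continuous_on_subset)
  ultimately have "(\<lambda>q. (indicator K q * DY half_sq q) / (indicator K q * (\<rho> q)\<^sup>2)) \<in> borel_measurable S.borel_M"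
    by (intro borel_measurable_divide measurable_on_compact[OF K] continuous_intros)
  moreover have "(\<lambda>q. (indicator K q * DY half_sq q) / (indicator K q * (\<rho> q)\<^sup>2)) = (\<lambda>q. indicator K q * \<sigma> q)"
    by (auto simp: \<sigma>_def indicator_def fun_eq_iff)
  ultimately show ?thesis by simp
qed

context
  fixes K assumes K: "compact K" "K \<subseteq> SW" "\<And>q. q \<in> K \<Longrightarrow> \<delta> > 0 \<Longrightarrow> \<rho> q < pi / sqrt \<delta>"
begin

lemma wsum_integrable:
  assumes \<psi>: "C1_fun S SW \<psi>"
  shows "(\<lambda>q. indicator K q * wsum \<psi> q) \<in> borel_measurable S.borel_M" (is ?m)
    and "integrable Sh.vol (\<lambda>q. indicator K q * wsum \<psi> q)"
proof -
  have c1: "continuous_on K \<psi>" using S.C1_fun_continuous[OF SW_open \<psi>] K(2) by (rule continuous_on_subset)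
  have c2: "continuous_on K (DY \<psi>)" using continuous_DY[OF SW_open order_refl \<psi>] K(2) by (rule continuous_on_subset)
  have c4: "continuous_on K \<rho>" using continuous_\<rho> K(2) by (rule continuous_on_subset)
  have c5: "continuous_on K (\<lambda>q. kf \<delta> (\<rho> q))"
    by (rule continuous_on_compose2[OF kf_continuous[of \<delta>] c4]) (use K \<rho>_nonneg in auto)
  have m\<sigma>: "(\<lambda>q. indicator K q * \<sigma> q) \<in> borel_measurable S.borel_M" by (rule \<sigma>_measurable[OF K(1,2)])
  have eq: "indicator K q * wsum \<psi> q = (indicator K q * \<psi> q) * ((indicator K q * kf \<delta> (\<rho> q)) * (real CARD('n) - indicator K q * \<sigma> q) + indicator K q * \<sigma> q) + indicator K q * DY \<psi> q" for q
    by (simp add: wsum_def indicator_def)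
  show m: ?m unfolding eq
    by (intro borel_measurable_add borel_measurable_times borel_measurable_diff borel_measurable_const
        measurable_on_compact[OF K(1,2)] m\<sigma> c1 c2 c5)
  obtain b1 where b1: "\<And>q. q \<in> K \<Longrightarrow> \<bar>\<psi> q\<bar> \<le> b1"
    using compact_imp_bounded[OF compact_continuous_image[OF c1 K(1)]] unfolding bounded_iff by auto
  obtain b2 where b2: "\<And>q. q \<in> K \<Longrightarrow> \<bar>DY \<psi> q\<bar> \<le> b2"
    using compact_imp_bounded[OF compact_continuous_image[OF c2 K(1)]] unfolding bounded_iff by auto
  obtain b3 where b3: "\<And>q. q \<in> K \<Longrightarrow> \<bar>kf \<delta> (\<rho> q)\<bar> \<le> b3"
    using compact_imp_bounded[OF compact_continuous_image[OF c5 K(1)]] unfolding bounded_iff by auto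
  let ?b = "b1 * (b3 * (real CARD('n) + 1) + 1) + b2"
  have b: "\<bar>wsum \<psi> q\<bar> \<le> ?b" if q: "q \<in> K" for q
  proof -
    have s: "0 \<le> \<sigma> q" "\<sigma> q \<le> 1" using \<sigma>_bounds K(2) q by auto
    have "\<bar>kf \<delta> (\<rho> q) * (real CARD('n) - \<sigma> q) + \<sigma> q\<bar> \<le> b3 * (real CARD('n) + 1) + 1"
    proof -
      have "\<bar>kf \<delta> (\<rho> q) * (real CARD('n) - \<sigma> q)\<bar> \<le> b3 * (real CARD('n) + 1)"
        unfolding abs_mult by (rule mult_mono[OF b3[OF q]]) (use s b3[OF q] in auto)
      then show ?thesis using s by linarith
    qed
    then have "\<bar>\<psi> q * (kf \<delta> (\<rho> q) * (real CARD('n) - \<sigma> q) + \<sigma> q)\<bar> \<le> b1 * (b3 * (real CARD('n) + 1) + 1)"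
      unfolding abs_mult[of "\<psi> q"] by (intro mult_mono[OF b1[OF q]]) (use b1[OF q] in auto)
    then show ?thesis unfolding wsum_def using b2[OF q] by linarith
  qed
  have Kv: "K \<in> sets Sh.vol" "emeasure Sh.vol K < \<infinity>"
    using Sh.vol_compact_finite[OF K(1) K_sub[OF K(2)]] borel_closed[OF compact_imp_closed[OF K(1)]] K_sub[OF K(2)]
    by (auto simp: sets_restrict_space intro!: image_eqI[of _ _ K])
  show "integrable Sh.vol (\<lambda>q. indicator K q * wsum \<psi> q)"
  proof (rule Bochner_Integration.integrable_bound)
    show "integrable Sh.vol (\<lambda>q. ?b * indicator K q)"
      by (intro integrable_mult_right integrable_real_indicator Kv)
    show "(\<lambda>q. indicator K q * wsum \<psi> q) \<in> borel_measurable Sh.vol" using m by (simp cong: measurable_cong_sets)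
    show "AE q in Sh.vol. norm (indicator K q * wsum \<psi> q) \<le> norm (?b * indicator K q)"
      using order_trans[OF b abs_ge_self] by (intro AE_I2) (auto simp: indicator_def)
  qed
qed

text \<open>The components of \<psi> times density times gradient have compact support
  \<open>L\<close> in the chart, so their derivatives integrate to 0. The sum \<open>G\<close> of
  these derivatives dominates the integrand by \<open>laplace_lower\<close>, which applies on
  \<open>K\<close>.\<close>

lemma chart_inequality:
  assumes c: "c \<in> atlas S" and L: "compact L" "L \<subseteq> V c"
    and \<psi>: "C1_fun S SW \<psi>" "\<And>q. q \<in> SW \<Longrightarrow> \<psi> q \<ge> 0"
    and zero: "\<And>q. q \<in> SW - K \<Longrightarrow> \<psi> q = 0" "\<And>q. q \<in> SW - cinv c ` L \<Longrightarrow> \<psi> q = 0"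
  shows "(\<integral>q. indicator K q * wsum \<psi> q \<partial>Sh.vol) \<le> 0"
proof -
  let ?\<psi> = "\<lambda>x. \<psi> (cinv c x)" and ?d = "dens S h c"
  let ?Y = "\<lambda>y. ?d y *\<^sub>R grad c y"
  have Vo: "open (V c)" by (rule V_open[OF c])
  have C\<psi>: "Ck (Suc 0) (V c) ?\<psi>" using \<psi>(1) c V_SW[OF c] by (simp only: C1_fun_def)
  have CY: "Ck (Suc 0) (V c) ?Y"
    by (intro Ck_scaleR[OF Vo] Ck_subset[OF Sh.Ck_dens[OF c] V_sub] smooth_on_Ck[OF grad_smooth[OF c]])
  define Z where "Z i x = (if x \<in> V c then ?\<psi> x * ?Y x $ i else 0)" for i x
  have ZV: "Ck (Suc 0) (V c) (\<lambda>x. ?\<psi> x * ?Y x $ i)" for i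
    by (intro Ck_mult[OF Vo C\<psi>] Ck_linear_comp[OF Vo bounded_linear_vec_nth CY])
  have Lo: "open (- L)" using L(1) by (simp add: compact_imp_closed open_Compl)
  have Z0: "Z i x = 0" if "x \<notin> L" for i x
  proof (cases "x \<in> V c")
    case True
    have "cinv c x \<notin> cinv c ` L"
    proof
      assume "cinv c x \<in> cinv c ` L"
      then obtain y where "y \<in> L" "cinv c x = cinv c y" by blast
      moreover have "x \<in> cimage c" "y \<in> cimage c" using True \<open>y \<in> L\<close> L(2) V_sub by blast+
      ultimately show False using S.cmap_cinv that by metis
    qed
    then have "?\<psi> x = 0" using zero(2)[of "cinv c x"] V_cinv[OF c True] by simp
    then show ?thesis by (simp add: Z_def)
  qed (simp add: Z_def)
  have CZ: "Ck (Suc 0) UNIV (Z i)" for i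
  proof (rule Ck_local)
    fix x :: "real^'n"
    show "\<exists>U. open U \<and> x \<in> U \<and> Ck (Suc 0) U (Z i)"
    proof (cases "x \<in> V c")
      case True
      have "Ck (Suc 0) (V c) (Z i)" by (rule Ck_cong[OF Vo _ ZV[of i]]) (simp add: Z_def)
      then show ?thesis using True Vo by blast
    next
      case False
      have "Ck (Suc 0) (- L) (Z i)" by (rule Ck_cong[OF Lo _ Ck_const[of _ _ 0]]) (simp add: Z0)
      then show ?thesis using False Lo L(2) by blast
    qed
  qed simp
  note int = integral_dd_zero[OF CZ L(1) Z0]
  define G where "G x = (\<Sum>i\<in>UNIV. dd (Z i) x (axis i 1))" for x
  have G: "integrable lborel G" "integral\<^sup>L lborel G = 0"
    unfolding G_def[abs_def] using int by (auto simp: Bochner_Integration.integral_sum)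
  have GV: "G x = ?\<psi> x * (\<Sum>i\<in>UNIV. dd ?Y x (axis i 1) $ i) + ?d x * DY \<psi> (cinv c x)" if x: "x \<in> V c" for x
  proof -
    have D\<psi>: "(?\<psi> has_derivative dd ?\<psi> x) (at x)" by (rule Ck_Suc_D[OF C\<psi> x])
    have DYx: "(?Y has_derivative dd ?Y x) (at x)" by (rule Ck_Suc_D[OF CY x])
    have lin: "linear (dd ?\<psi> x)" using D\<psi> by (rule has_derivative_linear)
    have "dd (Z i) x v = ?\<psi> x * dd ?Y x v $ i + dd ?\<psi> x v * ?Y x $ i" for i v
    proof -
      have "((\<lambda>x. ?\<psi> x * ?Y x $ i) has_derivative (\<lambda>v. ?\<psi> x * dd ?Y x v $ i + dd ?\<psi> x v * ?Y x $ i)) (at x)"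
        by (rule has_derivative_mult[OF D\<psi> bounded_linear.has_derivative[OF bounded_linear_vec_nth DYx]])
      moreover have "dd (Z i) x = dd (\<lambda>x. ?\<psi> x * ?Y x $ i) x"
        by (rule dd_cong[OF Vo x]) (use Ck_Suc_D[OF CZ, of x i] in \<open>auto simp: Z_def differentiable_def\<close>)
      ultimately show ?thesis by (simp only: dd_eqI)
    qed
    then have "G x = ?\<psi> x * (\<Sum>i\<in>UNIV. dd ?Y x (axis i 1) $ i) + (\<Sum>i\<in>UNIV. ?Y x $ i * dd ?\<psi> x (axis i 1))"
      by (simp add: G_def sum.distrib sum_distrib_left mult.commute)
    also have "(\<Sum>i\<in>UNIV. ?Y x $ i * dd ?\<psi> x (axis i 1)) = dd ?\<psi> x (?Y x)"
    proof -
      have "dd ?\<psi> x (?Y x) = dd ?\<psi> x (\<Sum>i\<in>UNIV. (?Y x $ i) *\<^sub>R axis i 1)"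
        using basis_expansion[of "?Y x"] by (simp add: scalar_mult_eq_scaleR)
      then show ?thesis unfolding linear_sum[OF lin] linear_cmul[OF lin] by simp
    qed
    also have "\<dots> = ?d x * DY \<psi> (cinv c x)"
      using DY_chart[OF \<psi>(1) c, of "cinv c x"] V_cinv[OF c x] S.cmap_cinv[of x c] linear_cmul[OF lin] by simp
    finally show ?thesis .
  qed
  have G0: "G x = 0" if "x \<notin> V c" for x
  proof -
    have "dd (Z i) x = dd (\<lambda>_. 0) x" for i
      by (rule dd_cong[OF Lo]) (use that L(2) Z0 Ck_Suc_D[OF CZ, of x i] in \<open>auto simp: differentiable_def\<close>)
    then show ?thesis by (simp add: G_def)
  qed
  have DY0: "DY \<psi> q = 0" if "q \<in> SW - C" "compact C" "\<And>q. q \<in> SW - C \<Longrightarrow> \<psi> q = 0" for q C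
  proof -
    have "SW - C = SW \<inter> (carrier S - C)" by (auto simp: SW_def)
    then have "openin (top_of_set (carrier S)) (SW - C)"
      using openin_Int[OF SW_open S.openin_diff_compact[OF that(2)]] by simp
    then show ?thesis by (rule DY_zero) (use that in auto)
  qed
  have "L \<subseteq> cimage c" using L(2) V_sub by blast
  then have cL: "compact (cinv c ` L)"
    by (intro compact_continuous_image L(1) continuous_on_subset[OF S.continuous_cinv[OF c]])
  let ?F = "\<lambda>q. indicator K q * wsum \<psi> q"
  have F0: "?F q = 0" if "q \<in> carrier S - cdom c" for q
  proof (cases "q \<in> K")
    case True
    have "q \<in> SW - cinv c ` L" using True K(2) that S.cinv_cdom[of _ c] \<open>L \<subseteq> cimage c\<close> by auto
    then show ?thesis using zero(2) DY0[OF _ cL zero(2)] by (simp add: wsum_def)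
  qed simp
  have le: "indicator (cimage c) x * (?d x * ?F (cinv c x)) \<le> G x" for x
  proof (cases "x \<in> V c")
    case True
    note q = V_cinv[OF c True]
    show ?thesis
    proof (cases "cinv c x \<in> K")
      case inK: True
      have low: "?d x * (kf \<delta> (\<rho> (cinv c x)) * (real CARD('n) - \<sigma> (cinv c x)) + \<sigma> (cinv c x)) \<le> (\<Sum>i\<in>UNIV. dd ?Y x (axis i 1) $ i)"
        using laplace_lower[OF c True] K(3)[OF inK] \<sigma>_chart[OF c, of "cinv c x"] q S.cmap_cinv[of x c] by (simp add: \<rho>_chart)
      have "?\<psi> x * (?d x * (kf \<delta> (\<rho> (cinv c x)) * (real CARD('n) - \<sigma> (cinv c x)) + \<sigma> (cinv c x))) + ?d x * DY \<psi> (cinv c x) \<le> G x"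
        unfolding GV[OF True] using mult_left_mono[OF low \<psi>(2)[of "cinv c x"]] q by simp
      then show ?thesis using inK q by (simp add: wsum_def algebra_simps)
    next
      case False
      then have "?\<psi> x = 0" "DY \<psi> (cinv c x) = 0" using zero(1) DY0[OF _ K(1) zero(1)] q by auto
      then show ?thesis using GV[OF True] False by simp
    qed
  next
    case False
    then have "x \<in> cimage c \<Longrightarrow> cinv c x \<notin> K" using V_SW[OF c] K(2) by auto
    then show ?thesis using G0[OF False] by (auto simp: indicator_def)
  qed
  have meas: "?F \<in> borel_measurable S.borel_M" and "integrable Sh.vol ?F" using wsum_integrable[OF \<psi>(1)] .
  note ic = Sh.integral_chart[OF c meas F0]
  have "(\<integral>q. ?F q \<partial>Sh.vol) = (\<integral>x. indicator (cimage c) x * (?d x * ?F (cinv c x)) \<partial>lborel)" by (rule ic(2))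
  also have "\<dots> \<le> integral\<^sup>L lborel G"
    by (rule integral_mono[OF _ G(1) le]) (use ic(1) \<open>integrable Sh.vol ?F\<close> in simp)
  finally show ?thesis unfolding G(2) .
qed

end

end

section \<open>Cut-off functions and summation over charts\<close>

lemma Ck_pos_part_sq: "Ck (Suc 0) UNIV (\<lambda>t::real. (max 0 t)\<^sup>2)"
proof (rule Ck_SucI)
  fix t :: real
  have "((\<lambda>t::real. (max 0 t)\<^sup>2) has_real_derivative 2 * max 0 t) (at t)"
  proof (cases "t = 0")
    case True
    have "((\<lambda>h::real. (max 0 h)\<^sup>2 / h) \<longlongrightarrow> 0) (at 0)"
    proof (rule Lim_null_comparison)
      show "\<forall>\<^sub>F h::real in at 0. norm ((max 0 h)\<^sup>2 / h) \<le> norm h"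
        by (intro always_eventually allI) (auto simp: max_def power2_eq_square)
      show "((\<lambda>h::real. norm h) \<longlongrightarrow> 0) (at 0)" by (intro tendsto_eq_intros) auto
    qed
    then show ?thesis using True by (simp add: DERIV_def)
  next
    case False
    then consider "t > 0" | "t < 0" by linarith
    then show ?thesis
    proof cases
      case 1
      have "((\<lambda>t::real. t\<^sup>2) has_real_derivative 2 * max 0 t) (at t)" using 1 by (auto intro!: derivative_eq_intros)
      then show ?thesis by (rule has_field_derivative_transform_within_open[of _ _ _ "{0<..}"]) (use 1 in auto)
    next
      case 2
      have "((\<lambda>t::real. 0) has_real_derivative 2 * max 0 t) (at t)" using 2 by (auto intro!: derivative_eq_intros)
      then show ?thesis by (rule has_field_derivative_transform_within_open[of _ _ _ "{..<0}"]) (use 2 in auto)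
    qed
  qed
  then show "((\<lambda>t::real. (max 0 t)\<^sup>2) has_derivative (*) (2 * max 0 t)) (at t)"
    unfolding has_field_derivative_def .
qed (auto intro!: continuous_intros)

context min_sub begin

text \<open>In coordinates the cut-off is the squared positive part of r^2 - |x - x0|^2, which is
  C^1 and positive exactly inside the ball; it is extended by zero beyond the chart.\<close>

lemma bump_ex:
  assumes q: "q \<in> SW"
  obtains c L b T where "c \<in> atlas S" "compact L" "L \<subseteq> V c" "C1_fun S (carrier S) b" "\<And>q. b q \<ge> 0"
    "\<And>q. q \<in> carrier S - cinv c ` L \<Longrightarrow> b q = 0" "open T" "q \<in> T" "\<And>q. q \<in> T \<inter> carrier S \<Longrightarrow> b q > 0"
proof -
  let ?c = "chart_at S q"
  have c: "?c \<in> atlas S" "q \<in> cdom ?c" using SW_chart q by auto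
  define x0 where "x0 = cmap ?c q"
  obtain r where r: "r > 0" "cball x0 r \<subseteq> V ?c"
    using V_open[OF c(1)] SW_V[OF c(1) q c(2)] unfolding open_contains_cball x0_def by blast
  have sub: "cball x0 r \<subseteq> cimage ?c" using r(2) V_sub by blast
  have cL: "compact (cinv ?c ` cball x0 r)"
    by (intro compact_continuous_image compact_cball continuous_on_subset[OF S.continuous_cinv[OF c(1)] sub])
  let ?F = "\<lambda>x. (max 0 (r\<^sup>2 - (x - x0) \<bullet> (x - x0)))\<^sup>2"
  have F: "?F x = 0" if "x \<notin> cball x0 r" for x
  proof -
    have "r < norm (x - x0)" using that by (simp add: dist_norm norm_minus_commute)
    then have "r\<^sup>2 < (norm (x - x0))\<^sup>2" using r(1) by (simp add: power_strict_mono)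
    then show ?thesis by (simp add: power2_norm_eq_inner)
  qed
  define b where "b q = (if q \<in> cdom ?c then ?F (cmap ?c q) else 0)" for q
  have b0: "b q = 0" if "q \<in> carrier S - cinv ?c ` cball x0 r" for q
  proof (cases "q \<in> cdom ?c")
    case True
    then have "cmap ?c q \<notin> cball x0 r" using that S.cinv_cmap[OF c(1) True] by force
    then show ?thesis using F by (simp add: b_def)
  qed (simp add: b_def)
  note o = S.open_cimage[OF c(1)]
  have "Ck (Suc 0) (cimage ?c) ?F"
    by (rule Ck_compose[OF o Ck_pos_part_sq Ck_diff[OF o Ck_const Ck_inner[OF o Ck_diff[OF o Ck_ident Ck_const] Ck_diff[OF o Ck_ident Ck_const]]]]) simp
  then have b1: "C1_fun S (cinv ?c ` cimage ?c) b"
    by (rule S.C1_fun_chart[OF c(1) o order_refl]) (simp add: b_def S.cinv_cdom S.cmap_cinv)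
  have b2: "C1_fun S (carrier S - cinv ?c ` cball x0 r) b"
    by (rule S.C1_fun_zero[OF S.openin_diff_compact[OF cL] b0])
  have "C1_fun S (cinv ?c ` cimage ?c \<union> (carrier S - cinv ?c ` cball x0 r)) b"
    by (rule S.C1_fun_Un[OF S.open_chart_back[OF c(1) o order_refl] S.openin_diff_compact[OF cL] b1 b2])
  moreover have "carrier S \<subseteq> cinv ?c ` cimage ?c \<union> (carrier S - cinv ?c ` cball x0 r)" using sub by blast
  ultimately have b: "C1_fun S (carrier S) b" by (rule S.C1_fun_subset)
  have "openin (top_of_set (carrier S)) (cinv ?c ` ball x0 r)"
    by (rule S.open_chart_back[OF c(1) open_ball]) (use sub ball_subset_cball in blast)
  then obtain T where T: "open T" "cinv ?c ` ball x0 r = carrier S \<inter> T" unfolding openin_open by blast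
  have "q \<in> cinv ?c ` ball x0 r" using S.cinv_cmap[OF c] r(1) unfolding x0_def by (metis centre_in_ball image_eqI)
  then have qT: "q \<in> T" using T by blast
  have pos: "b q' > 0" if "q' \<in> T \<inter> carrier S" for q'
  proof -
    have "q' \<in> cinv ?c ` ball x0 r" unfolding T(2) using that by blast
    then obtain y where y: "y \<in> ball x0 r" "q' = cinv ?c y" by (rule imageE)
    then have yc: "y \<in> cimage ?c" using sub ball_subset_cball by blast
    have "norm (y - x0) < r" using y(1) by (simp add: dist_norm norm_minus_commute)
    then have "(norm (y - x0))\<^sup>2 < r\<^sup>2" by (simp add: power_strict_mono)
    then show ?thesis using y(2) S.cinv_cdom[OF yc] S.cmap_cinv[OF yc] by (simp add: b_def power2_norm_eq_inner)
  qed
  have bnn: "b q \<ge> 0" for q by (simp add: b_def)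
  show ?thesis
    using c(1) compact_cball r(2) b bnn b0 T(1) qT pos by (rule that[of ?c "cball x0 r" b T])
qed

lemma DY_sum:
  assumes I: "finite I" "\<And>i. i \<in> I \<Longrightarrow> C1_fun S SW (\<eta> i)" and \<psi>: "C1_fun S SW \<psi>" "\<And>q. q \<in> SW \<Longrightarrow> \<psi> q = (\<Sum>i\<in>I. \<eta> i q)"
    and q: "q \<in> SW"
  shows "DY \<psi> q = (\<Sum>i\<in>I. DY (\<eta> i) q)"
proof -
  let ?c = "chart_at S q"
  have c: "?c \<in> atlas S" "q \<in> cdom ?c" using SW_chart q by auto
  have D: "((\<lambda>x. \<eta> i (cinv ?c x)) has_derivative dd (\<lambda>x. \<eta> i (cinv ?c x)) (cmap ?c q)) (at (cmap ?c q))" if "i \<in> I" for i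
    by (rule dd_works[OF C1_differentiable[OF I(2)[OF that] c q]])
  have "dd (\<lambda>x. \<psi> (cinv ?c x)) (cmap ?c q) = dd (\<lambda>x. \<Sum>i\<in>I. \<eta> i (cinv ?c x)) (cmap ?c q)"
    by (rule dd_cong[OF V_open[OF c(1)] SW_V[OF c(1) q c(2)] _ C1_differentiable[OF \<psi>(1) c q]])
       (use V_cinv[OF c(1)] \<psi>(2) in blast)
  moreover have "((\<lambda>x. \<Sum>i\<in>I. \<eta> i (cinv ?c x)) has_derivative (\<lambda>v. \<Sum>i\<in>I. dd (\<lambda>x. \<eta> i (cinv ?c x)) (cmap ?c q) v)) (at (cmap ?c q))"
    by (rule has_derivative_sum) (rule D)
  ultimately have "dd (\<lambda>x. \<psi> (cinv ?c x)) (cmap ?c q) = (\<lambda>v. \<Sum>i\<in>I. dd (\<lambda>x. \<eta> i (cinv ?c x)) (cmap ?c q) v)"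
    by (simp only: dd_eqI)
  then show ?thesis
    unfolding DY_chart[OF \<psi>(1) c q q] using DY_chart[OF I(2) c q q] by simp
qed

text \<open>The cut-offs are divided by their sum \<beta> where it is positive, which includes
  \<open>K\<close>; as \<psi> vanishes off \<open>K\<close>, every \<open>\<eta> i\<close> is C^1 on
  all of \<open>SW\<close>. Since \<open>wsum\<close> is linear in \<psi>, the chart inequalities
  add up.\<close>

lemma partition_inequality:
  assumes K: "compact K" "K \<subseteq> SW" "\<And>q. q \<in> K \<Longrightarrow> \<delta> > 0 \<Longrightarrow> \<rho> q < pi / sqrt \<delta>"
    and \<psi>: "C1_fun S SW \<psi>" "\<And>q. q \<in> SW \<Longrightarrow> \<psi> q \<ge> 0" "\<And>q. q \<in> SW - K \<Longrightarrow> \<psi> q = 0"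
  shows "(\<integral>q. indicator K q * wsum \<psi> q \<partial>Sh.vol) \<le> 0"
proof -
  have "\<forall>q\<in>K. \<exists>c L b T. c \<in> atlas S \<and> compact L \<and> L \<subseteq> V c \<and> C1_fun S (carrier S) b \<and> (\<forall>q. b q \<ge> 0) \<and>
    (\<forall>q\<in>carrier S - cinv c ` L. b q = 0) \<and> open T \<and> q \<in> T \<and> (\<forall>q\<in>T \<inter> carrier S. b q > 0)"
  proof
    fix q assume "q \<in> K"
    then have "q \<in> SW" using K(2) by blast
    from bump_ex[OF this] show "\<exists>c L b T. c \<in> atlas S \<and> compact L \<and> L \<subseteq> V c \<and> C1_fun S (carrier S) b \<and> (\<forall>q. b q \<ge> 0) \<and>
      (\<forall>q\<in>carrier S - cinv c ` L. b q = 0) \<and> open T \<and> q \<in> T \<and> (\<forall>q\<in>T \<inter> carrier S. b q > 0)"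
      by metis
  qed
  then obtain c L b T where A: "\<And>q. q \<in> K \<Longrightarrow> c q \<in> atlas S \<and> compact (L q) \<and> L q \<subseteq> V (c q) \<and> C1_fun S (carrier S) (b q)
    \<and> (\<forall>z. b q z \<ge> 0) \<and> (\<forall>z\<in>carrier S - cinv (c q) ` L q. b q z = 0) \<and> open (T q) \<and> q \<in> T q \<and> (\<forall>z\<in>T q \<inter> carrier S. b q z > 0)"
    unfolding bchoice_iff by - (elim exE, rule that, erule bspec)
  obtain I where I: "I \<subseteq> K" "finite I" "K \<subseteq> (\<Union>i\<in>I. T i)"
    by (rule compactE_image[OF K(1), of K T]) (use A in blast)+
  note A' = A[OF subsetD[OF I(1)]]
  define \<beta> where "\<beta> z = (\<Sum>i\<in>I. b i z)" for z
  have b0: "b i z \<ge> 0" if "i \<in> I" for i z using A'[OF that] by blast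
  have Sub: "SW \<subseteq> carrier S" by (auto simp: SW_def)
  have b1: "C1_fun S SW (b i)" if "i \<in> I" for i
    by (rule S.C1_fun_subset[OF _ Sub]) (use A'[OF that] in blast)
  have \<beta>1: "C1_fun S SW \<beta>"
    unfolding C1_fun_def
  proof
    fix d assume d: "d \<in> atlas S"
    show "Ck (Suc 0) (cimage d \<inter> cinv d -` SW) (\<lambda>x. \<beta> (cinv d x))"
      unfolding \<beta>_def by (rule Ck_sum[OF S.open_chart_part[OF d SW_open]]) (use b1 d in \<open>simp only: C1_fun_def\<close>)
  qed
  have \<beta>pos: "\<beta> z > 0" if z: "z \<in> K" for z
  proof -
    obtain i where i: "i \<in> I" "z \<in> T i" using I(3) z by blast
    then have "b i z > 0" using A'[OF i(1)] K(2) Sub z by blast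
    then show ?thesis unfolding \<beta>_def by (intro sum_pos2[OF I(2) i(1)]) (use b0 in auto)
  qed
  define P where "P = {z \<in> SW. \<beta> z > 0}"
  have P: "openin (top_of_set (carrier S)) P"
  proof -
    have "openin (top_of_set SW) (SW \<inter> \<beta> -` {0<..})"
      by (rule continuous_openin_preimage_gen[OF S.C1_fun_continuous[OF SW_open \<beta>1]]) simp
    moreover have "SW \<inter> \<beta> -` {0<..} = P" by (auto simp: P_def)
    ultimately show ?thesis using openin_trans SW_open by metis
  qed
  have SK: "openin (top_of_set (carrier S)) (SW - K)"
  proof -
    have "SW - K = SW \<inter> (carrier S - K)" using Sub by blast
    then show ?thesis using openin_Int[OF SW_open S.openin_diff_compact[OF K(1)]] by simp
  qed
  define \<eta> where "\<eta> i z = (if \<beta> z > 0 then \<psi> z * b i z / \<beta> z else 0)" for i z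
  have \<eta>1: "C1_fun S SW (\<eta> i)" if i: "i \<in> I" for i
  proof -
    have "C1_fun S P (\<lambda>z. \<psi> z * b i z / \<beta> z)"
      unfolding C1_fun_def
    proof
      fix d assume d: "d \<in> atlas S"
      have o: "open (cimage d \<inter> cinv d -` P)" by (rule S.open_chart_part[OF d P])
      have *: "Ck (Suc 0) (cimage d \<inter> cinv d -` P) (\<lambda>x. F (cinv d x))" if "C1_fun S SW F" for F
        using S.C1_fun_subset[OF that, of P] d unfolding C1_fun_def P_def by blast
      show "Ck (Suc 0) (cimage d \<inter> cinv d -` P) (\<lambda>x. \<psi> (cinv d x) * b i (cinv d x) / \<beta> (cinv d x))"
        by (intro Ck_divide[OF o] Ck_mult[OF o] *[OF \<psi>(1)] *[OF b1[OF i]] *[OF \<beta>1]) (auto simp: P_def)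
    qed
    then have "C1_fun S P (\<eta> i)" by (rule S.C1_fun_cong[OF P]) (simp add: \<eta>_def P_def)
    moreover have "C1_fun S (SW - K) (\<eta> i)" by (rule S.C1_fun_zero[OF SK]) (simp add: \<eta>_def \<psi>(3))
    ultimately have "C1_fun S (P \<union> (SW - K)) (\<eta> i)" by (rule S.C1_fun_Un[OF P SK])
    moreover have "P \<union> (SW - K) = SW" using \<beta>pos by (auto simp: P_def)
    ultimately show ?thesis by simp
  qed
  have \<psi>sum: "\<psi> z = (\<Sum>i\<in>I. \<eta> i z)" if z: "z \<in> SW" for z
  proof (cases "\<beta> z > 0")
    case True
    have "(\<Sum>i\<in>I. \<eta> i z) = \<psi> z * \<beta> z / \<beta> z"
      using True unfolding \<eta>_def by (simp add: \<beta>_def sum_distrib_left sum_divide_distrib)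
    then show ?thesis using True by simp
  next
    case False
    then have "z \<notin> K" using \<beta>pos by blast
    then show ?thesis using False z \<psi>(3) by (simp add: \<eta>_def)
  qed
  have each: "(\<integral>q. indicator K q * wsum (\<eta> i) q \<partial>Sh.vol) \<le> 0" if i: "i \<in> I" for i
  proof (rule chart_inequality[OF K _ _ _ \<eta>1[OF i]])
    show "c i \<in> atlas S" "compact (L i)" "L i \<subseteq> V (c i)" using A'[OF i] by blast+
    show "\<eta> i q \<ge> 0" if "q \<in> SW" for q using \<psi>(2)[OF that] b0[OF i, of q] by (simp add: \<eta>_def)
    show "\<eta> i q = 0" if "q \<in> SW - K" for q using that \<psi>(3) by (simp add: \<eta>_def)
    show "\<eta> i q = 0" if "q \<in> SW - cinv (c i) ` L i" for q
    proof -
      have "b i q = 0" using A'[OF i] that Sub by blast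
      then show ?thesis by (simp add: \<eta>_def)
    qed
  qed
  have "indicator K q * wsum \<psi> q = (\<Sum>i\<in>I. indicator K q * wsum (\<eta> i) q)" for q
  proof (cases "q \<in> K")
    case True
    then have q: "q \<in> SW" using K(2) by blast
    have dy: "DY \<psi> q = (\<Sum>i\<in>I. DY (\<eta> i) q)" by (rule DY_sum[OF I(2) \<eta>1 \<psi>(1) \<psi>sum q])
    show ?thesis
      unfolding wsum_def dy \<psi>sum[OF q]
      by (simp only: sum_distrib_left[symmetric] sum.distrib sum_distrib_right[symmetric])
  qed simp
  then have "(\<integral>q. indicator K q * wsum \<psi> q \<partial>Sh.vol) = (\<Sum>i\<in>I. \<integral>q. indicator K q * wsum (\<eta> i) q \<partial>Sh.vol)"
    using wsum_integrable(2)[OF K \<eta>1] by (simp add: Bochner_Integration.integral_sum)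
  also have "\<dots> \<le> 0" by (rule sum_nonpos) (rule each)
  finally show ?thesis .
qed

section \<open>Sublevel sets and radial functions on the submanifold\<close>

definition KS where "KS s = {q \<in> SW. \<rho> q \<le> s}"

text \<open>It is the preimage under the proper map \<open>f\<close> of the compact image of a
  closed ball in normal coordinates.\<close>

lemma KS_compact: assumes "s < R" shows "compact (KS s)"
proof -
  have "E ` {v. rad v \<le> s} \<subseteq> W" using assms by (auto simp: E_W B_iff)
  then have "compact {q \<in> carrier S. f q \<in> E ` {v. rad v \<le> s}}"
    using W_sub by (intro proper compact_E_ball assms) blast
  moreover have "{q \<in> carrier S. f q \<in> E ` {v. rad v \<le> s}} = KS s"
  proof safe
    fix q v assume "q \<in> carrier S" "f q = E v" "rad v \<le> s"
    moreover then have "v \<in> B" using assms by (simp add: B_iff)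
    ultimately show "q \<in> KS s" by (simp add: KS_def SW_def \<rho>_def \<Phi>_E E_W)
  next
    fix q assume "q \<in> KS s"
    then have "q \<in> carrier S" "f q \<in> W" "rad (\<Phi> (f q)) \<le> s" by (auto simp: KS_def SW_def \<rho>_def)
    then show "q \<in> carrier S" "f q \<in> E ` {v. rad v \<le> s}" using E_\<Phi>[of "f q"] by (auto intro!: image_eqI[of _ _ "\<Phi> (f q)"])
  qed
  ultimately show ?thesis by simp
qed

text \<open>As a function of u = \<rho>^2/2, a radial function that is constant for \<rho> <
  \<epsilon> is C^1 also at the centre. Its derivative along grad u is \<phi>'(\<rho>) \<rho>
  \<sigma>.\<close>

lemma radial_inequality:
  assumes s: "s < R" "\<delta> > 0 \<Longrightarrow> s < pi / sqrt \<delta>"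
    and \<phi>: "\<And>t. (\<phi> has_real_derivative \<phi>' t) (at t)" "continuous_on UNIV \<phi>'" "\<And>t. \<phi> t \<ge> 0"
    and \<epsilon>: "0 < \<epsilon>" "\<And>t. t < \<epsilon> \<Longrightarrow> \<phi> t = a" "\<And>t. t \<le> \<epsilon> \<Longrightarrow> \<phi>' t = 0" and zero: "\<And>t. t \<ge> s \<Longrightarrow> \<phi> t = 0"
  shows "(\<integral>q. indicator (KS s) q * (\<phi> (\<rho> q) * (kf \<delta> (\<rho> q) * (real CARD('n) - \<sigma> q) + \<sigma> q) + \<phi>' (\<rho> q) * \<rho> q * \<sigma> q) \<partial>Sh.vol) \<le> 0"
proof -
  define \<Theta> where "\<Theta> u = \<phi> (sqrt (2 * u))" for u
  define \<Theta>' where "\<Theta>' u = \<phi>' (sqrt (2 * u)) / sqrt (2 * u)" for u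
  have e2: "\<epsilon>\<^sup>2 / 2 > 0" using \<epsilon>(1) by simp
  \<comment> \<open>\<open>sqrt\<close> of a negative real is negative, so negative \<open>u\<close>
    are covered as well.\<close>
  have small: "sqrt (2 * u) < \<epsilon>" if "u < \<epsilon>\<^sup>2 / 2" for u
    using that \<epsilon>(1) by (auto intro!: real_less_lsqrt simp: real_sqrt_less_iff)
  have D\<Theta>: "(\<Theta> has_real_derivative \<Theta>' u) (at u)" for u
  proof (cases "u > 0")
    case True
    then have "((\<lambda>u. sqrt (2 * u)) has_real_derivative 1 / sqrt (2 * u)) (at u)"
      by (auto intro!: derivative_eq_intros simp: field_simps)
    from DERIV_chain2[OF \<phi>(1) this] show ?thesis unfolding \<Theta>_def[abs_def] \<Theta>'_def by simp
  next
    case False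
    then have u: "u < \<epsilon>\<^sup>2 / 2" using e2 by linarith
    have "((\<lambda>_. a) has_real_derivative \<Theta>' u) (at u)"
      using \<epsilon>(3) small[OF u] by (simp add: \<Theta>'_def)
    then show ?thesis
      by (rule has_field_derivative_transform_within_open[of _ _ _ "{..<\<epsilon>\<^sup>2 / 2}"])
         (use u small \<epsilon>(2) in \<open>auto simp: \<Theta>_def\<close>)
  qed
  have c1: "continuous_on {0<..} \<Theta>'"
    unfolding \<Theta>'_def[abs_def] by (intro continuous_intros continuous_on_compose2[OF \<phi>(2)]) auto
  have c2: "continuous_on {..<\<epsilon>\<^sup>2 / 2} \<Theta>'"
    by (rule continuous_on_eq[of _ "\<lambda>_. 0"]) (use small \<epsilon>(3) in \<open>auto simp: \<Theta>'_def less_imp_le\<close>)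
  have "continuous_on ({0<..} \<union> {..<\<epsilon>\<^sup>2 / 2}) \<Theta>'" by (rule continuous_on_open_Un[OF _ _ c1 c2]) auto
  moreover have "{0<..} \<union> {..<\<epsilon>\<^sup>2 / 2} = UNIV"
  proof -
    have "u \<in> {0<..} \<union> {..<\<epsilon>\<^sup>2 / 2}" for u unfolding Un_iff greaterThan_iff lessThan_iff using e2 by linarith
    then show ?thesis by blast
  qed
  ultimately have c\<Theta>: "continuous_on UNIV \<Theta>'" by simp
  have C\<Theta>: "Ck (Suc 0) UNIV \<Theta>"
  proof (rule Ck_SucI)
    show "(\<Theta> has_derivative (*) (\<Theta>' u)) (at u)" for u using D\<Theta> unfolding has_field_derivative_def .
    show "Ck 0 UNIV (\<lambda>u. \<Theta>' u * v)" for v using c\<Theta> by (auto intro!: continuous_intros)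
  qed simp
  define \<psi> where "\<psi> q = \<Theta> (half_sq q)" for q
  have \<psi>\<rho>: "\<psi> q = \<phi> (\<rho> q)" for q by (simp add: \<psi>_def \<Theta>_def \<rho>_half_sq)
  have C\<psi>: "C1_fun S SW \<psi>"
    unfolding C1_fun_def
  proof
    fix c assume c: "c \<in> atlas S"
    have "Ck (Suc 0) (V c) (\<lambda>x. \<Theta> (uc c x))"
      by (rule Ck_compose[OF V_open[OF c] C\<Theta> smooth_on_Ck[OF uc_smooth[OF c]]]) simp
    then show "Ck (Suc 0) (cimage c \<inter> cinv c -` SW) (\<lambda>x. \<psi> (cinv c x))"
      unfolding \<psi>_def uc_half_sq V_SW[OF c] .
  qed
  have DY\<psi>: "DY \<psi> q = \<phi>' (\<rho> q) * \<rho> q * \<sigma> q" if q: "q \<in> SW" for q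
  proof -
    let ?c = "chart_at S q"
    have c: "?c \<in> atlas S" "q \<in> cdom ?c" using SW_chart q by auto
    have uq: "uc ?c (cmap ?c q) = half_sq q" unfolding uc_half_sq S.cinv_cmap[OF c] ..
    have "(\<Theta> has_derivative (*) (\<Theta>' (half_sq q))) (at (uc ?c (cmap ?c q)))"
      unfolding uq using D\<Theta> unfolding has_field_derivative_def .
    from has_derivative_compose[OF smooth_on_D[OF uc_smooth[OF c(1)] SW_V[OF c(1) q c(2)]] this]
    have "((\<lambda>x. \<psi> (cinv ?c x)) has_derivative (\<lambda>v. \<Theta>' (half_sq q) * dd (uc ?c) (cmap ?c q) v)) (at (cmap ?c q))"
      unfolding \<psi>_def uc_half_sq .
    then have "DY \<psi> q = \<Theta>' (half_sq q) * DY half_sq q"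
      unfolding DY_chart[OF C\<psi> c q q] DY_chart[OF C1_half_sq c q q] uc_half_sq[symmetric] by (simp add: dd_eqI)
    also have "\<dots> = \<phi>' (\<rho> q) / \<rho> q * DY half_sq q" by (simp add: \<Theta>'_def \<rho>_half_sq)
    also have "\<dots> = \<phi>' (\<rho> q) * \<rho> q * \<sigma> q" by (simp add: \<sigma>_def power2_eq_square)
    finally show ?thesis .
  qed
  have "(\<integral>q. indicator (KS s) q * wsum \<psi> q \<partial>Sh.vol) \<le> 0"
  proof (rule partition_inequality[OF KS_compact[OF s(1)] _ _ C\<psi>])
    show "\<rho> q < pi / sqrt \<delta>" if "q \<in> KS s" "\<delta> > 0" for q using that s(2) by (auto simp: KS_def)
    show "\<psi> q = 0" if "q \<in> SW - KS s" for q using that zero by (auto simp: KS_def \<psi>\<rho>)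
  qed (auto simp: KS_def \<psi>\<rho> \<phi>(3))
  moreover have "indicator (KS s) q * wsum \<psi> q = indicator (KS s) q * (\<phi> (\<rho> q) * (kf \<delta> (\<rho> q) * (real CARD('n) - \<sigma> q) + \<sigma> q) + \<phi>' (\<rho> q) * \<rho> q * \<sigma> q)" for q
    using DY\<psi>[of q] by (auto simp: wsum_def \<psi>\<rho> indicator_def KS_def)
  ultimately show ?thesis by (simp only:)
qed

end

subsection \<open>Radial test functions\<close>

text \<open>The integral from 0 has the required derivative at \<open>t\<close>, seen on an interval
  that contains 0 and has \<open>t\<close> in its interior.\<close>

lemma antiderivative_ex:
  fixes F :: "real \<Rightarrow> real"
  assumes "continuous_on UNIV F"
  obtains P where "\<And>t. (P has_real_derivative F t) (at t)"
proof
  fix t :: real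
  have c: "continuous_on {- \<bar>t\<bar> - 1..\<bar>t\<bar> + 1} F" by (rule continuous_on_subset[OF assms]) simp
  have "((\<lambda>u. LBINT y=0..u. F y) has_vector_derivative F t) (at t within {- \<bar>t\<bar> - 1..\<bar>t\<bar> + 1})"
    using interval_integral_FTC2[of "- \<bar>t\<bar> - 1" 0 "\<bar>t\<bar> + 1" F t] c by (simp add: zero_ereal_def[symmetric])
  moreover have "at t within {- \<bar>t\<bar> - 1..\<bar>t\<bar> + 1} = at t" by (rule at_within_interior) (simp add: abs_if)
  ultimately show "((\<lambda>u. LBINT y=0..u. F y) has_real_derivative F t) (at t)"
    by (simp add: has_real_derivative_iff_has_vector_derivative)
qed

text \<open>All geometry is condensed into a finite measure, the two functions \<rho> and \<sigma>,
  and the inequality \<open>base\<close>; what follows is analysis in one real variable.\<close>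

locale radial_ineq =
  fixes \<mu> :: "'b measure" and \<rho> \<sigma> :: "'b \<Rightarrow> real" and \<delta> s :: real and n :: nat
  assumes fin: "finite_measure \<mu>"
    and meas [measurable]: "\<rho> \<in> borel_measurable \<mu>" "\<sigma> \<in> borel_measurable \<mu>"
    and \<rho>: "\<And>q. q \<in> space \<mu> \<Longrightarrow> 0 \<le> \<rho> q \<and> \<rho> q \<le> s"
    and \<sigma>: "\<And>q. q \<in> space \<mu> \<Longrightarrow> 0 \<le> \<sigma> q \<and> \<sigma> q \<le> 1"
    and s: "0 < s" "\<delta> > 0 \<Longrightarrow> s < pi / sqrt \<delta>"
    and n: "n \<ge> 1"
    and base: "\<And>\<phi> \<phi>' a \<epsilon>. (\<And>t. (\<phi> has_real_derivative \<phi>' t) (at t)) \<Longrightarrow> continuous_on UNIV \<phi>' \<Longrightarrow> (\<And>t. \<phi> t \<ge> 0) \<Longrightarrow>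
       0 < \<epsilon> \<Longrightarrow> (\<And>t. t < \<epsilon> \<Longrightarrow> \<phi> t = a) \<Longrightarrow> (\<And>t. t \<le> \<epsilon> \<Longrightarrow> \<phi>' t = 0) \<Longrightarrow> (\<And>t. t \<ge> s \<Longrightarrow> \<phi> t = 0) \<Longrightarrow>
       (\<integral>q. \<phi> (\<rho> q) * (kf \<delta> (\<rho> q) * (real n - \<sigma> q) + \<sigma> q) + \<phi>' (\<rho> q) * \<rho> q * \<sigma> q \<partial>\<mu>) \<le> 0"
begin

lemma kf_cont: "continuous_on {0..s} (kf \<delta>)"
  by (rule continuous_on_subset[OF kf_continuous]) (use s in auto)

lemma kf_meas [measurable]: "(\<lambda>q. kf \<delta> (\<rho> q)) \<in> borel_measurable \<mu>"
proof -
  have "kf \<delta> \<in> borel_measurable (restrict_space borel {0..s})"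
    by (rule borel_measurable_continuous_on_restrict[OF kf_cont])
  moreover have "\<rho> \<in> measurable \<mu> (restrict_space borel {0..s})"
    by (rule measurable_restrict_space2) (use \<rho> in auto)
  ultimately show ?thesis by (rule measurable_compose[rotated])
qed

text \<open>Approximation by the Steklov averages \<open>k \<integral> \<phi>\<close> over \<open>[t, t + 1/k]\<close>, whose derivatives are the difference
  quotients of \<open>\<phi>\<close>; hence only right derivatives are required.\<close>

lemma lipschitz_inequality:
  assumes L: "\<And>x y. \<bar>\<phi> x - \<phi> y\<bar> \<le> L * \<bar>x - y\<bar>" and pos: "\<And>t. \<phi> t \<ge> 0"
    and \<epsilon>: "0 < \<epsilon>" "\<And>t. t < \<epsilon> \<Longrightarrow> \<phi> t = a" and zero: "\<And>t. t \<ge> s \<Longrightarrow> \<phi> t = 0"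
    and \<xi>: "\<And>t. 0 \<le> t \<Longrightarrow> t \<le> s \<Longrightarrow> ((\<lambda>u. (\<phi> (t + u) - \<phi> t) / u) \<longlongrightarrow> \<xi> t) (at_right 0)"
  shows "integrable \<mu> (\<lambda>q. \<phi> (\<rho> q) * (kf \<delta> (\<rho> q) * (real n - \<sigma> q) + \<sigma> q) + \<xi> (\<rho> q) * \<rho> q * \<sigma> q)"
    and "(\<integral>q. \<phi> (\<rho> q) * (kf \<delta> (\<rho> q) * (real n - \<sigma> q) + \<sigma> q) + \<xi> (\<rho> q) * \<rho> q * \<sigma> q \<partial>\<mu>) \<le> 0"
proof -
  interpret finite_measure \<mu> by (rule fin)
  have "L * \<bar>0 - 1\<bar> \<ge> 0" using L[of 0 1] by linarith
  then have L0: "L \<ge> 0" by simp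
  have c\<phi>: "continuous_on UNIV \<phi>"
  proof (rule lipschitz_on_continuous_on)
    show "L-lipschitz_on UNIV \<phi>" by (rule lipschitz_onI) (use L L0 in \<open>auto simp: dist_real_def\<close>)
  qed
  obtain P where P: "\<And>t. (P has_real_derivative \<phi> t) (at t)" using antiderivative_ex[OF c\<phi>] by blast
  \<comment> \<open>From this index on the averages run over intervals shorter than \<epsilon>/2, so
    they are still constant below \<epsilon>/2.\<close>
  obtain K where K: "real K > 2 / \<epsilon>" "K > 0" using reals_Archimedean2 \<epsilon>(1)
    by (metis divide_pos_pos of_nat_0_less_iff order.strict_trans zero_less_numeral)
  define m where "m i = real (K + i)" for i :: nat
  have m: "m i > 0" "m i > 2 / \<epsilon>" for i using K by (auto simp: m_def)
  have m1: "1 / m i < \<epsilon> / 2" for i using m[of i] \<epsilon>(1) by (simp add: field_simps)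
  have m2: "1 / m i \<le> 1" for i using K(2) by (simp add: m_def)
  define \<phi>k where "\<phi>k i t = m i * (P (t + 1 / m i) - P t)" for i t
  define \<xi>k where "\<xi>k i t = m i * (\<phi> (t + 1 / m i) - \<phi> t)" for i t
  have D: "(\<phi>k i has_real_derivative \<xi>k i t) (at t)" for i t
  proof -
    have "((\<lambda>t. P (t + 1 / m i)) has_real_derivative \<phi> (t + 1 / m i)) (at t)"
      using DERIV_shift[of P "\<phi> (t + 1 / m i)" t "1 / m i"] P by simp
    then show ?thesis unfolding \<phi>k_def[abs_def] \<xi>k_def by (intro DERIV_cmult DERIV_diff P)
  qed
  have mv: "\<exists>z. t < z \<and> z < t + 1 / m i \<and> \<phi>k i t = \<phi> z" for i t
  proof -
    have "t < t + 1 / m i" using m(1)[of i] by simp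
    from MVT2[OF this P] obtain z where "t < z" "z < t + 1 / m i" "P (t + 1 / m i) - P t = (t + 1 / m i - t) * \<phi> z"
      by blast
    then show ?thesis using m(1)[of i] by (auto simp: \<phi>k_def)
  qed
  have near: "\<bar>\<phi>k i t - \<phi> t\<bar> \<le> L / m i" for i t
  proof -
    obtain z where z: "t < z" "z < t + 1 / m i" "\<phi>k i t = \<phi> z" using mv by blast
    have "\<bar>\<phi> z - \<phi> t\<bar> \<le> L * \<bar>z - t\<bar>" by (rule L)
    also have "\<dots> \<le> L * (1 / m i)" by (rule mult_left_mono[OF _ L0]) (use z in linarith)
    finally show ?thesis using z by simp
  qed
  have \<xi>kb: "\<bar>\<xi>k i t\<bar> \<le> L" for i t
  proof -
    have "\<bar>\<xi>k i t\<bar> = m i * \<bar>\<phi> (t + 1 / m i) - \<phi> t\<bar>" using m(1)[of i] by (simp add: \<xi>k_def abs_mult)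
    also have "\<dots> \<le> m i * (L * (1 / m i))" by (rule mult_left_mono) (use L[of "t + 1 / m i" t] m(1)[of i] in simp_all)
    finally show ?thesis using m(1)[of i] by simp
  qed
  let ?f = "\<lambda>i q. \<phi>k i (\<rho> q) * (kf \<delta> (\<rho> q) * (real n - \<sigma> q) + \<sigma> q) + \<xi>k i (\<rho> q) * \<rho> q * \<sigma> q"
  let ?g = "\<lambda>q. \<phi> (\<rho> q) * (kf \<delta> (\<rho> q) * (real n - \<sigma> q) + \<sigma> q) + \<xi> (\<rho> q) * \<rho> q * \<sigma> q"
  have neg: "integral\<^sup>L \<mu> (?f i) \<le> 0" for i
  proof (rule base[OF D, of _ "\<epsilon> / 2" a])
    show "continuous_on UNIV (\<xi>k i)" unfolding \<xi>k_def[abs_def]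
      by (intro continuous_intros continuous_on_compose2[OF c\<phi>]) auto
    show "\<phi>k i t \<ge> 0" for t using mv[of t i] pos by metis
    show "\<phi>k i t = a" if "t < \<epsilon> / 2" for t
    proof -
      obtain z where "z < t + 1 / m i" "\<phi>k i t = \<phi> z" using mv[of t i] by blast
      then show ?thesis using that m1[of i] \<epsilon>(2)[of z] by linarith
    qed
    show "\<xi>k i t = 0" if "t \<le> \<epsilon> / 2" for t
      using that m1[of i] \<epsilon>(2)[of t] \<epsilon>(2)[of "t + 1 / m i"] \<epsilon>(1) by (simp add: \<xi>k_def)
    show "\<phi>k i t = 0" if "t \<ge> s" for t
    proof -
      obtain z where "t < z" "\<phi>k i t = \<phi> z" using mv[of t i] by blast
      then show ?thesis using that zero[of z] by linarith
    qed
  qed (use \<epsilon>(1) in simp)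
  obtain b3 where "\<forall>x\<in>kf \<delta> ` {0..s}. norm x \<le> b3"
    using compact_imp_bounded[OF compact_continuous_image[OF kf_cont compact_Icc]] unfolding bounded_iff by blast
  then have b3: "\<bar>kf \<delta> t\<bar> \<le> b3" if "t \<in> {0..s}" for t using that by simp
  \<comment> \<open>\<phi> is at most L s because it vanishes at \<open>s\<close>, averaging costs
    at most L, and the difference quotients are bounded by L.\<close>
  let ?b = "(L * s + L) * (b3 * (real n + 1) + 1) + L * s * 1"
  have bound: "norm (?f i q) \<le> ?b" if q: "q \<in> space \<mu>" for i q
  proof -
    have r: "0 \<le> \<rho> q" "\<rho> q \<le> s" "0 \<le> \<sigma> q" "\<sigma> q \<le> 1" using \<rho>[OF q] \<sigma>[OF q] by auto
    have k: "\<bar>kf \<delta> (\<rho> q)\<bar> \<le> b3" using b3 r by simp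
    have "\<bar>kf \<delta> (\<rho> q) * (real n - \<sigma> q)\<bar> \<le> b3 * (real n + 1)"
      unfolding abs_mult by (rule mult_mono[OF k]) (use r k in auto)
    then have 1: "\<bar>kf \<delta> (\<rho> q) * (real n - \<sigma> q) + \<sigma> q\<bar> \<le> b3 * (real n + 1) + 1" using r by linarith
    have "\<bar>\<phi> (\<rho> q) - \<phi> s\<bar> \<le> L * \<bar>\<rho> q - s\<bar>" by (rule L)
    also have "\<dots> \<le> L * s" by (rule mult_left_mono[OF _ L0]) (use r in linarith)
    finally have "\<bar>\<phi> (\<rho> q)\<bar> \<le> L * s" using zero[of s] by simp
    moreover have "L * (1 / m i) \<le> L * 1" by (rule mult_left_mono[OF m2 L0])
    ultimately have 2: "\<bar>\<phi>k i (\<rho> q)\<bar> \<le> L * s + L" using near[of i "\<rho> q"] by simp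
    have "\<bar>\<phi>k i (\<rho> q) * (kf \<delta> (\<rho> q) * (real n - \<sigma> q) + \<sigma> q)\<bar> \<le> (L * s + L) * (b3 * (real n + 1) + 1)"
      unfolding abs_mult[of "\<phi>k i (\<rho> q)"] by (rule mult_mono[OF 2 1]) (use L0 s in auto)
    moreover have "\<bar>\<xi>k i (\<rho> q) * \<rho> q * \<sigma> q\<bar> \<le> L * s * 1"
      unfolding abs_mult by (intro mult_mono \<xi>kb) (use r L0 s in auto)
    ultimately show ?thesis by simp
  qed
  have m_lim: "filterlim (\<lambda>i. 1 / m i) (at_right 0) sequentially"
  proof -
    have "(\<lambda>i. 1 / m i) \<longlonglongrightarrow> 0" unfolding m_def
      using LIMSEQ_ignore_initial_segment[OF lim_inverse_n', of K] by (simp add: add.commute)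
    then show ?thesis unfolding filterlim_at using m(1) by (auto simp: order.strict_implies_not_eq[THEN not_sym])
  qed
  have lim: "(\<lambda>i. ?f i q) \<longlonglongrightarrow> ?g q" if q: "q \<in> space \<mu>" for q
  proof -
    have "(\<lambda>i. (\<phi> (\<rho> q + 1 / m i) - \<phi> (\<rho> q)) / (1 / m i)) \<longlonglongrightarrow> \<xi> (\<rho> q)"
      using filterlim_compose[OF \<xi> m_lim] \<rho>[OF q] by blast
    then have 1: "(\<lambda>i. \<xi>k i (\<rho> q)) \<longlonglongrightarrow> \<xi> (\<rho> q)" by (simp add: \<xi>k_def mult.commute)
    have "(\<lambda>i. \<phi>k i (\<rho> q) - \<phi> (\<rho> q)) \<longlonglongrightarrow> 0"
    proof (rule Lim_null_comparison)
      show "\<forall>\<^sub>F i in sequentially. norm (\<phi>k i (\<rho> q) - \<phi> (\<rho> q)) \<le> L * (1 / m i)"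
        using near by (intro always_eventually) simp
      have "(\<lambda>i. 1 / m i) \<longlonglongrightarrow> 0" using m_lim unfolding filterlim_at by blast
      then show "(\<lambda>i. L * (1 / m i)) \<longlonglongrightarrow> 0" by (rule tendsto_mult_right_zero)
    qed
    then have 2: "(\<lambda>i. \<phi>k i (\<rho> q)) \<longlonglongrightarrow> \<phi> (\<rho> q)" by (simp add: LIM_zero_iff)
    show ?thesis by (intro tendsto_intros 1 2)
  qed
  have mk: "?f i \<in> borel_measurable \<mu>" for i
  proof -
    have "continuous_on UNIV (\<phi>k i)" using D by (intro continuous_at_imp_continuous_on ballI DERIV_isCont) blast
    then have [measurable]: "\<phi>k i \<in> borel_measurable borel" by (rule borel_measurable_continuous_onI)
    have "continuous_on UNIV (\<xi>k i)" unfolding \<xi>k_def[abs_def]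
      by (intro continuous_intros continuous_on_compose2[OF c\<phi>]) auto
    then have [measurable]: "\<xi>k i \<in> borel_measurable borel" by (rule borel_measurable_continuous_onI)
    show ?thesis by measurable
  qed
  have mg: "?g \<in> borel_measurable \<mu>" by (rule borel_measurable_LIMSEQ_real[OF lim mk])
  have dc: "AE q in \<mu>. (\<lambda>i. ?f i q) \<longlonglongrightarrow> ?g q" "\<And>i. AE q in \<mu>. norm (?f i q) \<le> ?b"
    using lim bound by (auto intro!: AE_I2)
  have ib: "integrable \<mu> (\<lambda>q. ?b)" by simp
  show "integrable \<mu> ?g" by (rule integrable_dominated_convergence[OF mg mk ib dc])
  have "(\<lambda>i. integral\<^sup>L \<mu> (?f i)) \<longlonglongrightarrow> integral\<^sup>L \<mu> ?g" by (rule integral_dominated_convergence[OF mg mk ib dc])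
  then show "integral\<^sup>L \<mu> ?g \<le> 0" by (rule LIMSEQ_le_const2) (use neg in auto)
qed

end

lemma C1_lipschitz:
  fixes F :: "real \<Rightarrow> real"
  assumes "\<And>t. a \<le> t \<Longrightarrow> t \<le> b \<Longrightarrow> (F has_real_derivative F' t) (at t)" "continuous_on {a..b} F'"
  obtains L where "L \<ge> 0" "\<And>x y. x \<in> {a..b} \<Longrightarrow> y \<in> {a..b} \<Longrightarrow> \<bar>F x - F y\<bar> \<le> L * \<bar>x - y\<bar>"
proof -
  obtain L where L: "\<forall>x\<in>F' ` {a..b}. norm x \<le> L"
    using compact_imp_bounded[OF compact_continuous_image[OF assms(2) compact_Icc]] unfolding bounded_iff by blast
  show ?thesis
  proof (rule that[of "max L 0"])
    fix x y assume xy: "x \<in> {a..b}" "y \<in> {a..b}"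
    have "norm (F x - F y) \<le> max L 0 * norm (x - y)"
      by (rule field_differentiable_bound[of "{a..b}" F F'])
         (use assms(1) L xy in \<open>auto intro: has_field_derivative_at_within simp: le_max_iff_disj\<close>)
    then show "\<bar>F x - F y\<bar> \<le> max L 0 * \<bar>x - y\<bar>" by simp
  qed simp
qed

lemma right_difference_quotient:
  fixes F :: "real \<Rightarrow> real"
  assumes "(F has_real_derivative D) (at t)" "t < b" "\<And>x. t \<le> x \<Longrightarrow> x < b \<Longrightarrow> \<phi> x = F x"
  shows "((\<lambda>u. (\<phi> (t + u) - \<phi> t) / u) \<longlongrightarrow> D) (at_right 0)"
proof (rule Lim_transform_eventually)
  show "((\<lambda>u. (F (t + u) - F t) / u) \<longlongrightarrow> D) (at_right 0)"
    using assms(1) unfolding DERIV_def by (rule tendsto_within_subset) simp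
  show "\<forall>\<^sub>F u in at_right 0. (F (t + u) - F t) / u = (\<phi> (t + u) - \<phi> t) / u"
    unfolding eventually_at_right_field using assms(2,3) by (intro exI[of _ "b - t"]) auto
qed

context radial_ineq begin

definition G where "G t = measure \<mu> {q \<in> space \<mu>. \<rho> q < t}"

text \<open>Below \<epsilon> the function \<kappa> sn/t is frozen, as a test function must be
  constant near 0. For \<kappa>' \<le> 0, replacing \<sigma> by 1 only lowers the integrand, which
  \<open>b0\<close>, \<open>b1\<close> and \<open>b2\<close> then bound below by D on \<rho> < r and
  by - d on r \<le> \<rho> < s; its integral is nonpositive.\<close>

lemma piecewise_inequality:
  assumes e: "0 < \<epsilon>" "\<epsilon> < r" "r < s"
    and 1: "\<And>t. \<epsilon> \<le> t \<Longrightarrow> t \<le> r \<Longrightarrow> (\<kappa>\<^sub>1 has_real_derivative \<kappa>\<^sub>1' t) (at t)" "continuous_on {\<epsilon>..r} \<kappa>\<^sub>1'"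
      "\<And>t. \<epsilon> \<le> t \<Longrightarrow> t \<le> r \<Longrightarrow> \<kappa>\<^sub>1 t \<ge> 0" "\<And>t. \<epsilon> \<le> t \<Longrightarrow> t \<le> r \<Longrightarrow> \<kappa>\<^sub>1' t \<le> 0"
    and 2: "\<And>t. r \<le> t \<Longrightarrow> t \<le> s \<Longrightarrow> (\<kappa>\<^sub>2 has_real_derivative \<kappa>\<^sub>2' t) (at t)" "continuous_on {r..s} \<kappa>\<^sub>2'"
      "\<And>t. r \<le> t \<Longrightarrow> t \<le> s \<Longrightarrow> \<kappa>\<^sub>2 t \<ge> 0" "\<And>t. r \<le> t \<Longrightarrow> t \<le> s \<Longrightarrow> \<kappa>\<^sub>2' t \<le> 0"
    and glue: "\<kappa>\<^sub>1 r = \<kappa>\<^sub>2 r" "\<kappa>\<^sub>2 s = 0"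
    and b0: "\<And>t x. 0 \<le> t \<Longrightarrow> t < \<epsilon> \<Longrightarrow> 0 \<le> x \<Longrightarrow> x \<le> 1 \<Longrightarrow> D \<le> \<kappa>\<^sub>1 \<epsilon> * sn \<delta> \<epsilon> / \<epsilon> * (kf \<delta> t * (real n - x) + x)"
    and b1: "\<And>t. \<epsilon> \<le> t \<Longrightarrow> t < r \<Longrightarrow> D \<le> real n * \<kappa>\<^sub>1 t * cs \<delta> t + \<kappa>\<^sub>1' t * sn \<delta> t"
    and b2: "\<And>t. r \<le> t \<Longrightarrow> t < s \<Longrightarrow> - d \<le> real n * \<kappa>\<^sub>2 t * cs \<delta> t + \<kappa>\<^sub>2' t * sn \<delta> t"
  shows "D * G r \<le> d * (G s - G r)"
proof -
  interpret finite_measure \<mu> by (rule fin)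
  define F where "F \<kappa> t = \<kappa> t * sn \<delta> t / t" for \<kappa> :: "real \<Rightarrow> real" and t
  define F' where "F' \<kappa> \<kappa>' t = \<kappa>' t * sn \<delta> t / t + \<kappa> t * (cs \<delta> t / t - sn \<delta> t / t\<^sup>2)" for \<kappa> \<kappa>' :: "real \<Rightarrow> real" and t
  have DF: "(F \<kappa> has_real_derivative F' \<kappa> \<kappa>' t) (at t)" if "(\<kappa> has_real_derivative \<kappa>' t) (at t)" "t > 0" for \<kappa> \<kappa>' t
    unfolding F_def[abs_def] F'_def using that sn_deriv[of \<delta> t]
    by (auto intro!: derivative_eq_intros simp: field_simps power2_eq_square)
  have snp: "sn \<delta> t > 0" if "0 < t" "t \<le> s" for t using sn_pos[OF that(1)] that s(2) by fastforce
  have key: "F \<kappa> t * (kf \<delta> t * (real n - x) + x) + F' \<kappa> \<kappa>' t * t * x = real n * \<kappa> t * cs \<delta> t + \<kappa>' t * sn \<delta> t * x"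
    if "0 < t" "t \<le> s" for \<kappa> \<kappa>' t x
    using snp[OF that] that by (simp add: F_def F'_def kf_def field_simps power2_eq_square)
  have key': "real n * \<kappa> t * cs \<delta> t + \<kappa>' t * sn \<delta> t \<le> F \<kappa> t * (kf \<delta> t * (real n - x) + x) + F' \<kappa> \<kappa>' t * t * x"
    if "0 < t" "t \<le> s" "\<kappa>' t \<le> 0" "0 \<le> x" "x \<le> 1" for \<kappa> \<kappa>' t x
  proof -
    have "\<kappa>' t * sn \<delta> t \<le> 0" using that snp[of t] by (simp add: mult_nonpos_nonneg)
    then have "\<kappa>' t * sn \<delta> t * 1 \<le> \<kappa>' t * sn \<delta> t * x" by (rule mult_left_mono_neg[OF that(5)])
    then show ?thesis unfolding key[OF that(1,2)] by simp
  qed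
  have cF': "continuous_on {a..b} (F' \<kappa> \<kappa>')"
    if "\<And>t. a \<le> t \<Longrightarrow> t \<le> b \<Longrightarrow> (\<kappa> has_real_derivative \<kappa>' t) (at t)" "continuous_on {a..b} \<kappa>'" "a > 0" for a b \<kappa> \<kappa>'
  proof -
    have "continuous_on {a..b} \<kappa>" using that(1) by (intro continuous_at_imp_continuous_on ballI DERIV_isCont) auto
    moreover have "continuous_on {a..b} (sn \<delta>)" "continuous_on {a..b} (cs \<delta>)"
      using sn_deriv cs_deriv by (auto intro!: continuous_at_imp_continuous_on DERIV_isCont)
    ultimately show ?thesis unfolding F'_def[abs_def] using that(2,3) by (intro continuous_intros) auto
  qed
  have d1: "(F \<kappa>\<^sub>1 has_real_derivative F' \<kappa>\<^sub>1 \<kappa>\<^sub>1' t) (at t)" if "\<epsilon> \<le> t" "t \<le> r" for t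
    using DF[where \<kappa> = \<kappa>\<^sub>1 and \<kappa>' = \<kappa>\<^sub>1' and t = t] 1(1)[OF that] that e by simp
  have d2: "(F \<kappa>\<^sub>2 has_real_derivative F' \<kappa>\<^sub>2 \<kappa>\<^sub>2' t) (at t)" if "r \<le> t" "t \<le> s" for t
    using DF[where \<kappa> = \<kappa>\<^sub>2 and \<kappa>' = \<kappa>\<^sub>2' and t = t] 2(1)[OF that] that e by simp
  obtain L\<^sub>1 where L1: "L\<^sub>1 \<ge> 0" "\<And>x y. x \<in> {\<epsilon>..r} \<Longrightarrow> y \<in> {\<epsilon>..r} \<Longrightarrow> \<bar>F \<kappa>\<^sub>1 x - F \<kappa>\<^sub>1 y\<bar> \<le> L\<^sub>1 * \<bar>x - y\<bar>"
    using C1_lipschitz[OF d1 cF'[where \<kappa> = \<kappa>\<^sub>1 and \<kappa>' = \<kappa>\<^sub>1', OF 1(1,2) e(1)]] by blast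
  obtain L\<^sub>2 where L2: "L\<^sub>2 \<ge> 0" "\<And>x y. x \<in> {r..s} \<Longrightarrow> y \<in> {r..s} \<Longrightarrow> \<bar>F \<kappa>\<^sub>2 x - F \<kappa>\<^sub>2 y\<bar> \<le> L\<^sub>2 * \<bar>x - y\<bar>"
    using C1_lipschitz[OF d2 cF'[where \<kappa> = \<kappa>\<^sub>2 and \<kappa>' = \<kappa>\<^sub>2', OF 2(1,2) less_trans[OF e(1,2)]]] by blast
  define \<phi> where "\<phi> t = (if t \<le> r then F \<kappa>\<^sub>1 (max t \<epsilon>) else F \<kappa>\<^sub>2 (min t s))" for t
  define \<xi> where "\<xi> t = (if t < \<epsilon> then 0 else if t < r then F' \<kappa>\<^sub>1 \<kappa>\<^sub>1' t else if t < s then F' \<kappa>\<^sub>2 \<kappa>\<^sub>2' t else 0)" for t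
  have Fr: "F \<kappa>\<^sub>1 r = F \<kappa>\<^sub>2 r" "F \<kappa>\<^sub>2 s = 0" using glue by (simp_all add: F_def)
  have Lle: "\<bar>\<phi> x - \<phi> y\<bar> \<le> (L\<^sub>1 + L\<^sub>2) * \<bar>x - y\<bar>" if xy: "x \<le> y" for x y
  proof -
    define u v where "u = L\<^sub>1 * \<bar>x - y\<bar>" and "v = L\<^sub>2 * \<bar>x - y\<bar>"
    have uv: "u \<ge> 0" "v \<ge> 0" using L1(1) L2(1) by (auto simp: u_def v_def)
    have m1: "L\<^sub>1 * a \<le> u" if "a \<le> \<bar>x - y\<bar>" for a using mult_left_mono[OF that L1(1)] by (simp add: u_def)
    have m2: "L\<^sub>2 * a \<le> v" if "a \<le> \<bar>x - y\<bar>" for a using mult_left_mono[OF that L2(1)] by (simp add: v_def)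
    consider "y \<le> r" | "r < x" | "x \<le> r" "r < y" by linarith
    then have "\<bar>\<phi> x - \<phi> y\<bar> \<le> u + v"
    proof cases
      case a: 1
      have "\<bar>\<phi> x - \<phi> y\<bar> \<le> L\<^sub>1 * \<bar>max x \<epsilon> - max y \<epsilon>\<bar>"
        using L1(2)[of "max x \<epsilon>" "max y \<epsilon>"] a xy e by (simp add: \<phi>_def)
      also have "\<dots> \<le> u" by (rule m1) linarith
      finally show ?thesis using uv by linarith
    next
      case a: 2
      have "\<bar>\<phi> x - \<phi> y\<bar> \<le> L\<^sub>2 * \<bar>min x s - min y s\<bar>"
        using L2(2)[of "min x s" "min y s"] a xy e by (simp add: \<phi>_def)
      also have "\<dots> \<le> v" by (rule m2) linarith
      finally show ?thesis using uv by linarith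
    next
      case a: 3
      have "\<bar>\<phi> x - F \<kappa>\<^sub>1 r\<bar> \<le> L\<^sub>1 * \<bar>max x \<epsilon> - r\<bar>" using L1(2)[of "max x \<epsilon>" r] a e by (simp add: \<phi>_def)
      also have "\<dots> \<le> u" by (rule m1) (use a e in linarith)
      finally have i: "\<bar>\<phi> x - F \<kappa>\<^sub>1 r\<bar> \<le> u" .
      have "\<bar>F \<kappa>\<^sub>2 r - \<phi> y\<bar> \<le> L\<^sub>2 * \<bar>r - min y s\<bar>" using L2(2)[of r "min y s"] a e by (simp add: \<phi>_def)
      also have "\<dots> \<le> v" by (rule m2) (use a e in linarith)
      finally show ?thesis using i Fr(1) by linarith
    qed
    then show ?thesis by (simp add: u_def v_def distrib_right)
  qed
  have Lip: "\<bar>\<phi> x - \<phi> y\<bar> \<le> (L\<^sub>1 + L\<^sub>2) * \<bar>x - y\<bar>" for x y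
    using Lle[of x y] Lle[of y x] by (cases "x \<le> y") (simp_all add: abs_minus_commute)
  have Fp: "F \<kappa> x \<ge> 0" if "0 < x" "x \<le> s" "\<kappa> x \<ge> 0" for \<kappa> x
    using snp[OF that(1,2)] that unfolding F_def by (intro divide_nonneg_nonneg mult_nonneg_nonneg) auto
  have pos: "\<phi> t \<ge> 0" for t
  proof (cases "t \<le> r")
    case True
    then show ?thesis using Fp[of "max t \<epsilon>" \<kappa>\<^sub>1] 1(3)[of "max t \<epsilon>"] e by (simp add: \<phi>_def)
  next
    case False
    then show ?thesis using Fp[of "min t s" \<kappa>\<^sub>2] 2(3)[of "min t s"] e by (simp add: \<phi>_def)
  qed
  have lim: "((\<lambda>u. (\<phi> (t + u) - \<phi> t) / u) \<longlongrightarrow> \<xi> t) (at_right 0)" if t: "0 \<le> t" "t \<le> s" for t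
  proof -
    consider "t < \<epsilon>" | "\<epsilon> \<le> t" "t < r" | "r \<le> t" "t < s" | "t = s" using t by linarith
    then show ?thesis
    proof cases
      case a: 1
      have "((\<lambda>u. (\<phi> (t + u) - \<phi> t) / u) \<longlongrightarrow> 0) (at_right 0)"
        by (rule right_difference_quotient[where F = "\<lambda>_. F \<kappa>\<^sub>1 \<epsilon>" and b = \<epsilon>]) (use a e in \<open>auto simp: \<phi>_def\<close>)
      then show ?thesis using a by (simp add: \<xi>_def)
    next
      case a: 2
      have "((\<lambda>u. (\<phi> (t + u) - \<phi> t) / u) \<longlongrightarrow> F' \<kappa>\<^sub>1 \<kappa>\<^sub>1' t) (at_right 0)"
        by (rule right_difference_quotient[where F = "F \<kappa>\<^sub>1" and b = r]) (use a e d1 in \<open>auto simp: \<phi>_def max_absorb1\<close>)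
      then show ?thesis using a by (simp add: \<xi>_def)
    next
      case a: 3
      have "((\<lambda>u. (\<phi> (t + u) - \<phi> t) / u) \<longlongrightarrow> F' \<kappa>\<^sub>2 \<kappa>\<^sub>2' t) (at_right 0)"
      proof (rule right_difference_quotient[where F = "F \<kappa>\<^sub>2" and b = s])
        show "\<phi> x = F \<kappa>\<^sub>2 x" if "t \<le> x" "x < s" for x
          using that a e Fr(1) by (cases "x = r") (auto simp: \<phi>_def)
      qed (use a d2 in auto)
      then show ?thesis using a e by (simp add: \<xi>_def)
    next
      case a: 4
      have "((\<lambda>u. (\<phi> (t + u) - \<phi> t) / u) \<longlongrightarrow> 0) (at_right 0)"
        by (rule right_difference_quotient[where F = "\<lambda>_. 0" and b = "s + 1"]) (use a e Fr in \<open>auto simp: \<phi>_def\<close>)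
      then show ?thesis using a e by (simp add: \<xi>_def)
    qed
  qed
  have \<phi>s: "\<phi> t = 0" if "t \<ge> s" for t using that e Fr(2) by (simp add: \<phi>_def)
  have \<phi>e: "\<phi> t = F \<kappa>\<^sub>1 \<epsilon>" if "t < \<epsilon>" for t using that e by (simp add: \<phi>_def)
  let ?g = "\<lambda>q. \<phi> (\<rho> q) * (kf \<delta> (\<rho> q) * (real n - \<sigma> q) + \<sigma> q) + \<xi> (\<rho> q) * \<rho> q * \<sigma> q"
  note g = lipschitz_inequality[OF Lip pos e(1) \<phi>e \<phi>s lim]
  let ?A = "\<lambda>t. {q \<in> space \<mu>. \<rho> q < t}"
  have As: "?A t \<in> sets \<mu>" for t by measurable
  \<comment> \<open>The step function with value D on \<rho> < r, - d on r \<le> \<rho> < s and 0 at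
    \<rho> = s.\<close>
  let ?w = "\<lambda>q. (D + d) * indicator (?A r) q - d * indicator (?A s) q :: real"
  have w: "integrable \<mu> ?w" by (intro Bochner_Integration.integrable_diff integrable_mult_right integrable_real_indicator As) (auto simp: emeasure_eq_measure)
  have "?w q \<le> ?g q" if q: "q \<in> space \<mu>" for q
  proof -
    let ?t = "\<rho> q" and ?x = "\<sigma> q"
    have r: "0 \<le> ?t" "?t \<le> s" "0 \<le> ?x" "?x \<le> 1" using \<rho>[OF q] \<sigma>[OF q] by auto
    consider "?t < \<epsilon>" | "\<epsilon> \<le> ?t" "?t < r" | "r \<le> ?t" "?t < s" | "?t = s" using r by linarith
    then show ?thesis
    proof cases
      case a: 1
      then show ?thesis using b0[OF r(1) a r(3,4)] e q \<phi>e[OF a] by (simp add: \<xi>_def F_def)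
    next
      case a: 2
      have t0: "0 < ?t" using a e by linarith
      have "D \<le> F \<kappa>\<^sub>1 ?t * (kf \<delta> ?t * (real n - ?x) + ?x) + F' \<kappa>\<^sub>1 \<kappa>\<^sub>1' ?t * ?t * ?x"
        using b1[OF a] key'[where \<kappa> = \<kappa>\<^sub>1 and \<kappa>' = \<kappa>\<^sub>1', OF t0 r(2) 1(4) r(3,4)] a by simp
      then show ?thesis using a e q by (simp add: \<phi>_def \<xi>_def max_def)
    next
      case a: 3
      have t0: "0 < ?t" using a e by linarith
      have "- d \<le> F \<kappa>\<^sub>2 ?t * (kf \<delta> ?t * (real n - ?x) + ?x) + F' \<kappa>\<^sub>2 \<kappa>\<^sub>2' ?t * ?t * ?x"
        using b2[OF a] key'[where \<kappa> = \<kappa>\<^sub>2 and \<kappa>' = \<kappa>\<^sub>2', OF t0 r(2) 2(4) r(3,4)] a by simp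
      moreover have "\<phi> ?t = F \<kappa>\<^sub>2 ?t" using a e Fr(1) by (cases "?t = r") (auto simp: \<phi>_def)
      ultimately show ?thesis using a e q by (simp add: \<xi>_def)
    next
      case a: 4
      then show ?thesis using \<phi>s[of s] e by (simp add: \<xi>_def)
    qed
  qed
  then have "integral\<^sup>L \<mu> ?w \<le> integral\<^sup>L \<mu> ?g" by (intro integral_mono[OF w g(1)])
  moreover have "integral\<^sup>L \<mu> ?w = (D + d) * G r - d * G s"
    using As by (simp add: G_def Bochner_Integration.integral_diff emeasure_eq_measure)
  ultimately show ?thesis using g(2) by (simp add: algebra_simps)
qed

end

subsection \<open>Monotonicity\<close>

context radial_ineq begin

lemma sn_pos': "0 < t \<Longrightarrow> t \<le> s \<Longrightarrow> sn \<delta> t > 0"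
  using sn_pos[of t \<delta>] s(2) by fastforce

lemma sn_nonneg: "0 \<le> t \<Longrightarrow> t \<le> s \<Longrightarrow> sn \<delta> t \<ge> 0"
  using sn_pos'[of t] by (cases "t = 0") auto

lemma continuous_sn: "continuous_on A (sn \<delta>)" and continuous_cs: "continuous_on A (cs \<delta>)"
  using sn_deriv cs_deriv by (auto intro!: continuous_at_imp_continuous_on DERIV_isCont)

text \<open>\<open>V\<close> is the model volume without its constant factor, as an antiderivative
  on the whole line, so that its derivative at 0 is two-sided.\<close>

lemma volume_function:
  obtains V where "\<And>t. (V has_real_derivative sn \<delta> t ^ (n - 1)) (at t)" "V 0 = 0"
    "\<And>t. 0 \<le> t \<Longrightarrow> integral {0..t} (\<lambda>t. sn \<delta> t ^ (n - 1)) = V t"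
proof -
  obtain P where P: "\<And>t. (P has_real_derivative sn \<delta> t ^ (n - 1)) (at t)"
    by (rule antiderivative_ex[of "\<lambda>t. sn \<delta> t ^ (n - 1)"]) (auto intro!: continuous_intros continuous_sn)
  show ?thesis
  proof (rule that[of "\<lambda>t. P t - P 0"])
    show "((\<lambda>t. P t - P 0) has_real_derivative sn \<delta> t ^ (n - 1)) (at t)" for t
      using P by (auto intro!: derivative_eq_intros)
    show "integral {0..t} (\<lambda>t. sn \<delta> t ^ (n - 1)) = P t - P 0" if "0 \<le> t" for t
      using fundamental_theorem_of_calculus[OF that, of P "\<lambda>t. sn \<delta> t ^ (n - 1)"] P
      by (intro integral_unique) (simp add: has_real_derivative_iff_has_vector_derivative has_vector_derivative_at_within)
  qed simp
qed

context
  fixes V assumes V: "\<And>t. (V has_real_derivative sn \<delta> t ^ (n - 1)) (at t)" "V 0 = 0"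
begin

lemma V_mono: assumes "0 \<le> a" "a < b" "b \<le> s" shows "V a < V b"
proof (rule DERIV_pos_imp_increasing_open[OF assms(2)])
  show "\<exists>y. (V has_real_derivative y) (at t) \<and> 0 < y" if "a < t" "t < b" for t
    using V(1)[of t] sn_pos'[of t] that assms by (intro exI[of _ "sn \<delta> t ^ (n - 1)"]) auto
  show "continuous_on {a..b} V" using V(1) by (auto intro!: continuous_at_imp_continuous_on DERIV_isCont)
qed

definition quot where "quot \<beta> t = \<beta> t / sn \<delta> t ^ n" for \<beta> :: "real \<Rightarrow> real"
text \<open>The quotient rule for \<open>quot \<beta>\<close> when \<beta> has derivative c
  sn^(n-1), so that the prescribed density of \<beta> is the constant c.\<close>

definition quot' where "quot' \<beta> c t = (c * sn \<delta> t ^ n - real n * \<beta> t * cs \<delta> t) * sn \<delta> t ^ (n - 1) / (sn \<delta> t ^ n * sn \<delta> t ^ n)"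
  for \<beta> :: "real \<Rightarrow> real"

lemma quot_deriv:
  assumes "(\<beta> has_real_derivative c * sn \<delta> t ^ (n - 1)) (at t)" "0 < t" "t \<le> s"
  shows "(quot \<beta> has_real_derivative quot' \<beta> c t) (at t)"
proof -
  have "sn \<delta> t ^ n \<noteq> 0" using sn_pos'[OF assms(2,3)] by simp
  moreover have "((\<lambda>t. sn \<delta> t ^ n) has_real_derivative real n * cs \<delta> t * sn \<delta> t ^ (n - 1)) (at t)"
    using sn_deriv[of \<delta> t] by (auto intro!: derivative_eq_intros)
  ultimately have "(quot \<beta> has_real_derivative ((c * sn \<delta> t ^ (n - 1)) * sn \<delta> t ^ n - \<beta> t * (real n * cs \<delta> t * sn \<delta> t ^ (n - 1))) / (sn \<delta> t ^ n * sn \<delta> t ^ n)) (at t)"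
    unfolding quot_def[abs_def] using assms(1) by (intro DERIV_divide)
  moreover have "((c * sn \<delta> t ^ (n - 1)) * sn \<delta> t ^ n - \<beta> t * (real n * cs \<delta> t * sn \<delta> t ^ (n - 1))) / (sn \<delta> t ^ n * sn \<delta> t ^ n) = quot' \<beta> c t"
    by (simp add: quot'_def algebra_simps)
  ultimately show ?thesis by simp
qed

lemma quot'_continuous:
  assumes "\<And>t. (\<beta> has_real_derivative c * sn \<delta> t ^ (n - 1)) (at t)" "0 < a" "b \<le> s"
  shows "continuous_on {a..b} (quot' \<beta> c)"
proof -
  have "continuous_on {a..b} \<beta>" using assms(1) by (auto intro!: continuous_at_imp_continuous_on DERIV_isCont)
  moreover have "sn \<delta> t \<noteq> 0" if "t \<in> {a..b}" for t using sn_pos'[of t] assms that by auto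
  ultimately show ?thesis unfolding quot'_def[abs_def] by (intro continuous_intros continuous_sn continuous_cs) auto
qed

lemma quot'_nonpos:
  assumes "c * sn \<delta> t ^ n \<le> real n * \<beta> t * cs \<delta> t" "0 \<le> t" "t \<le> s" shows "quot' \<beta> c t \<le> 0"
  unfolding quot'_def using assms sn_nonneg[OF assms(2,3)]
  by (intro divide_nonpos_nonneg mult_nonpos_nonneg) auto

text \<open>The left side is (\<kappa> sn^n)' / sn^(n-1) for \<kappa> = \<beta> / sn^n, and the
  derivative prescribed for \<beta> is c sn^(n-1).\<close>

lemma quot_identity:
  assumes "0 < t" "t \<le> s" shows "real n * quot \<beta> t * cs \<delta> t + quot' \<beta> c t * sn \<delta> t = c"
proof -
  obtain m where m: "n = Suc m" using n by (cases n) auto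
  have "sn \<delta> t > 0" using sn_pos'[OF assms] .
  then show ?thesis unfolding quot_def quot'_def unfolding m by (simp add: field_simps)
qed

text \<open>\<open>snV\<close> makes V/sn^n non-increasing, and \<open>kf1\<close> bounds the
  integrand near the centre. Freezing at \<epsilon> leaves C / cs \<epsilon> instead of C as the
  lower bound there; then \<epsilon> tends to 0.\<close>

lemma monotone_nonpos:
  assumes \<delta>: "\<delta> \<le> 0" and r: "0 < r" "r < s"
  shows "G r / V r \<le> G s / V s"
proof -
  have cs1: "cs \<delta> t \<ge> 1" for t using \<delta> by (simp add: cs_def cosh_real_ge_1)
  have Vp: "V t > 0" if "0 < t" "t \<le> s" for t using V_mono[of 0 t] that V(2) by simp
  \<comment> \<open>The difference of the two sides starts at 0 and has derivative - \<delta> n V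
    sn, which is nonnegative for this sign of \<delta>.\<close>
  have snV: "sn \<delta> t ^ n \<le> real n * V t * cs \<delta> t" if t: "0 \<le> t" "t \<le> s" for t
  proof -
    have "real n * V 0 * cs \<delta> 0 - sn \<delta> 0 ^ n \<le> real n * V t * cs \<delta> t - sn \<delta> t ^ n"
    proof (rule DERIV_nonneg_imp_nondecreasing[OF t(1)])
      fix u assume u: "0 \<le> u" "u \<le> t"
      have "((\<lambda>t. real n * V t * cs \<delta> t - sn \<delta> t ^ n) has_real_derivative real n * V u * (- \<delta> * sn \<delta> u)) (at u)"
        using V(1)[of u] sn_deriv[of \<delta> u] cs_deriv[of \<delta> u] by (auto intro!: derivative_eq_intros)
      moreover have "V u \<ge> 0" using Vp[of u] u t V(2) by (cases "u = 0") auto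
      then have "real n * V u * (- \<delta> * sn \<delta> u) \<ge> 0"
        using \<delta> sn_nonneg[of u] u t by (intro mult_nonneg_nonneg) auto
      ultimately show "\<exists>y. ((\<lambda>t. real n * V t * cs \<delta> t - sn \<delta> t ^ n) has_real_derivative y) (at u) \<and> 0 \<le> y" by blast
    qed
    then show ?thesis using V(2) n by (simp add: power_0_left)
  qed
  have snt: "sn \<delta> t \<ge> t" if t: "0 \<le> t" for t
  proof -
    have "sn \<delta> 0 - 0 \<le> sn \<delta> t - t"
      by (rule DERIV_nonneg_imp_nondecreasing[OF t])
         (use cs1 sn_deriv in \<open>auto intro!: derivative_eq_intros exI[of _ "cs \<delta> _ - 1"]\<close>)
    then show ?thesis by simp
  qed
  have kf1: "kf \<delta> t \<ge> 1" if t: "0 \<le> t" "t \<le> s" for t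
  proof (cases "t = 0")
    case False
    have "0 * cs \<delta> 0 - sn \<delta> 0 \<le> t * cs \<delta> t - sn \<delta> t"
    proof (rule DERIV_nonneg_imp_nondecreasing[OF t(1)])
      fix u assume u: "0 \<le> u" "u \<le> t"
      have "((\<lambda>t. t * cs \<delta> t - sn \<delta> t) has_real_derivative u * (- \<delta> * sn \<delta> u)) (at u)"
        using sn_deriv[of \<delta> u] cs_deriv[of \<delta> u] by (auto intro!: derivative_eq_intros)
      moreover have "u * (- \<delta> * sn \<delta> u) \<ge> 0" using \<delta> sn_nonneg[of u] u t by (intro mult_nonneg_nonneg) auto
      ultimately show "\<exists>y. ((\<lambda>t. t * cs \<delta> t - sn \<delta> t) has_real_derivative y) (at u) \<and> 0 \<le> y" by blast
    qed
    then show ?thesis using False t sn_pos'[of t] by (simp add: kf_def field_simps)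
  qed (simp add: kf_def)
  \<comment> \<open>With this constant \<open>\<beta>\<^sub>1\<close> and
    \<open>\<beta>\<^sub>2\<close> agree at \<open>r\<close>, both being 1 - V r / V s.\<close>
  define C where "C = 1 / V r - 1 / V s"
  have Vrs: "V r > 0" "V r < V s" using Vp[of r] V_mono[of r s] r by auto
  have C: "C \<ge> 0" using Vrs by (simp add: C_def frac_le)
  define \<beta>\<^sub>1 where "\<beta>\<^sub>1 t = C * V t" for t
  define \<beta>\<^sub>2 where "\<beta>\<^sub>2 t = 1 - V t / V s" for t
  have d1: "(\<beta>\<^sub>1 has_real_derivative C * sn \<delta> t ^ (n - 1)) (at t)" for t
    unfolding \<beta>\<^sub>1_def[abs_def] using V(1)[of t] by (auto intro!: derivative_eq_intros)
  have d2: "(\<beta>\<^sub>2 has_real_derivative (- 1 / V s) * sn \<delta> t ^ (n - 1)) (at t)" for t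
    unfolding \<beta>\<^sub>2_def[abs_def] using V(1)[of t] Vrs by (auto intro!: derivative_eq_intros)
  have \<beta>2: "\<beta>\<^sub>2 t \<ge> 0" if "0 \<le> t" "t \<le> s" for t
    using V_mono[of t s] that Vp[of s] r unfolding \<beta>\<^sub>2_def by (cases "t = s") auto
  have ineq: "C / cs \<delta> \<epsilon> * G r \<le> 1 / V s * (G s - G r)" if \<epsilon>: "0 < \<epsilon>" "\<epsilon> < r" for \<epsilon>
  proof (rule piecewise_inequality[OF \<epsilon> r(2), where \<kappa>\<^sub>1 = "quot \<beta>\<^sub>1" and \<kappa>\<^sub>1' = "quot' \<beta>\<^sub>1 C" and \<kappa>\<^sub>2 = "quot \<beta>\<^sub>2" and \<kappa>\<^sub>2' = "quot' \<beta>\<^sub>2 (- 1 / V s)"])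
    show "(quot \<beta>\<^sub>1 has_real_derivative quot' \<beta>\<^sub>1 C t) (at t)" if "\<epsilon> \<le> t" "t \<le> r" for t
      by (rule quot_deriv[OF d1]) (use that \<epsilon> r in auto)
    show "(quot \<beta>\<^sub>2 has_real_derivative quot' \<beta>\<^sub>2 (- 1 / V s) t) (at t)" if "r \<le> t" "t \<le> s" for t
      by (rule quot_deriv[OF d2]) (use that \<epsilon> r in auto)
    show "continuous_on {\<epsilon>..r} (quot' \<beta>\<^sub>1 C)" by (rule quot'_continuous[OF d1]) (use \<epsilon> r in auto)
    show "continuous_on {r..s} (quot' \<beta>\<^sub>2 (- 1 / V s))" by (rule quot'_continuous[OF d2]) (use \<epsilon> r in auto)
    show "quot \<beta>\<^sub>1 t \<ge> 0" if "\<epsilon> \<le> t" "t \<le> r" for t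
      using C Vp[of t] sn_pos'[of t] that \<epsilon> r by (simp add: quot_def \<beta>\<^sub>1_def)
    show "quot \<beta>\<^sub>2 t \<ge> 0" if "r \<le> t" "t \<le> s" for t
      using \<beta>2[of t] sn_pos'[of t] that \<epsilon> r by (simp add: quot_def)
    show "quot' \<beta>\<^sub>1 C t \<le> 0" if "\<epsilon> \<le> t" "t \<le> r" for t
    proof (rule quot'_nonpos)
      show "C * sn \<delta> t ^ n \<le> real n * \<beta>\<^sub>1 t * cs \<delta> t"
        using mult_left_mono[OF snV[of t] C] that \<epsilon> r by (simp add: \<beta>\<^sub>1_def algebra_simps)
    qed (use that \<epsilon> r in auto)
    show "quot' \<beta>\<^sub>2 (- 1 / V s) t \<le> 0" if "r \<le> t" "t \<le> s" for t
    proof (rule quot'_nonpos)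
      have "- 1 / V s * sn \<delta> t ^ n \<le> 0" using Vrs sn_nonneg[of t] that r by (simp add: divide_nonpos_nonneg mult_nonpos_nonneg)
      also have "0 \<le> real n * \<beta>\<^sub>2 t * cs \<delta> t" using \<beta>2[of t] that r cs1[of t] by simp
      finally show "- 1 / V s * sn \<delta> t ^ n \<le> real n * \<beta>\<^sub>2 t * cs \<delta> t" .
    qed (use that \<epsilon> r in auto)
    have "\<beta>\<^sub>1 r = \<beta>\<^sub>2 r" using Vrs by (simp add: \<beta>\<^sub>1_def \<beta>\<^sub>2_def C_def left_diff_distrib)
    then show "quot \<beta>\<^sub>1 r = quot \<beta>\<^sub>2 r" by (simp add: quot_def)
    show "quot \<beta>\<^sub>2 s = 0" using Vrs by (simp add: quot_def \<beta>\<^sub>2_def)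
    show "C / cs \<delta> \<epsilon> \<le> real n * quot \<beta>\<^sub>1 t * cs \<delta> t + quot' \<beta>\<^sub>1 C t * sn \<delta> t" if "\<epsilon> \<le> t" "t < r" for t
    proof -
      have "C / cs \<delta> \<epsilon> \<le> C" using cs1[of \<epsilon>] C by (simp add: divide_le_eq mult_le_cancel_left1)
      then show ?thesis using quot_identity[of t \<beta>\<^sub>1 C] that \<epsilon> r by simp
    qed
    show "- (1 / V s) \<le> real n * quot \<beta>\<^sub>2 t * cs \<delta> t + quot' \<beta>\<^sub>2 (- 1 / V s) t * sn \<delta> t" if "r \<le> t" "t < s" for t
      using quot_identity[of t \<beta>\<^sub>2 "- 1 / V s"] that r by simp
    show "C / cs \<delta> \<epsilon> \<le> quot \<beta>\<^sub>1 \<epsilon> * sn \<delta> \<epsilon> / \<epsilon> * (kf \<delta> t * (real n - x) + x)"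
      if "0 \<le> t" "t < \<epsilon>" "0 \<le> x" "x \<le> 1" for t x
    proof -
      have q0: "quot \<beta>\<^sub>1 \<epsilon> \<ge> 0" using C Vp[of \<epsilon>] sn_pos'[of \<epsilon>] \<epsilon> r by (simp add: quot_def \<beta>\<^sub>1_def)
      have "1 * (real n - x) \<le> kf \<delta> t * (real n - x)" by (rule mult_right_mono) (use kf1[of t] that \<epsilon> r n in auto)
      then have k: "real n \<le> kf \<delta> t * (real n - x) + x" by simp
      have "C / cs \<delta> \<epsilon> \<le> real n * quot \<beta>\<^sub>1 \<epsilon>"
      proof -
        have "C * sn \<delta> \<epsilon> ^ n \<le> C * (real n * V \<epsilon> * cs \<delta> \<epsilon>)" by (rule mult_left_mono[OF snV C]) (use \<epsilon> r in auto)
        moreover have "cs \<delta> \<epsilon> > 0" using cs1[of \<epsilon>] by linarith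
        ultimately show ?thesis using sn_pos'[of \<epsilon>] \<epsilon> r by (simp add: quot_def \<beta>\<^sub>1_def field_simps)
      qed
      also have "\<dots> \<le> real n * (quot \<beta>\<^sub>1 \<epsilon> * sn \<delta> \<epsilon> / \<epsilon>)"
      proof (rule mult_left_mono)
        have "quot \<beta>\<^sub>1 \<epsilon> * 1 \<le> quot \<beta>\<^sub>1 \<epsilon> * (sn \<delta> \<epsilon> / \<epsilon>)"
          by (rule mult_left_mono[OF _ q0]) (use snt[of \<epsilon>] \<epsilon> in simp)
        then show "quot \<beta>\<^sub>1 \<epsilon> \<le> quot \<beta>\<^sub>1 \<epsilon> * sn \<delta> \<epsilon> / \<epsilon>" by simp
      qed simp
      also have "\<dots> = quot \<beta>\<^sub>1 \<epsilon> * sn \<delta> \<epsilon> / \<epsilon> * real n" by simp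
      also have "\<dots> \<le> quot \<beta>\<^sub>1 \<epsilon> * sn \<delta> \<epsilon> / \<epsilon> * (kf \<delta> t * (real n - x) + x)"
        by (rule mult_left_mono[OF k]) (use q0 sn_nonneg[of \<epsilon>] \<epsilon> r in auto)
      finally show ?thesis .
    qed
  qed
  have "C * G r \<le> 1 / V s * (G s - G r)"
  proof (rule tendsto_upperbound)
    have "(cs \<delta> \<longlongrightarrow> 1) (at_right 0)"
      using DERIV_isCont[OF cs_deriv[of \<delta> 0]] by (simp add: isCont_def filterlim_at_split)
    then have "((\<lambda>\<epsilon>. C / cs \<delta> \<epsilon> * G r) \<longlongrightarrow> C / 1 * G r) (at_right 0)" by (intro tendsto_intros) auto
    then show "((\<lambda>\<epsilon>. C / cs \<delta> \<epsilon> * G r) \<longlongrightarrow> C * G r) (at_right 0)" by simp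
    show "\<forall>\<^sub>F \<epsilon> in at_right 0. C / cs \<delta> \<epsilon> * G r \<le> 1 / V s * (G s - G r)"
      unfolding eventually_at_right_field using ineq r by blast
  qed simp
  then show ?thesis unfolding C_def by (simp add: left_diff_distrib right_diff_distrib)
qed

text \<open>For constant k the integrand bound below \<open>r\<close> is n k cs t, at least D = n k
  cs r because cs decreases. This gives D G(r) \<le> G(s) - G(r), and \<open>snV\<close> at
  \<open>r\<close> bounds 1 + D below by the ratio of the powers sn^n.\<close>

lemma monotone_pos:
  assumes \<delta>: "\<delta> > 0" and r: "0 < r" "r < s"
  shows "G r / sn \<delta> r ^ n \<le> G s / sn \<delta> s ^ n"
proof -
  have cs_mono: "cs \<delta> b \<le> cs \<delta> a" if ab: "0 \<le> a" "a \<le> b" "b \<le> s" for a b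
  proof (rule DERIV_nonpos_imp_nonincreasing[OF ab(2)])
    fix u assume "a \<le> u" "u \<le> b"
    then show "\<exists>y. (cs \<delta> has_real_derivative y) (at u) \<and> y \<le> 0"
      using cs_deriv[of \<delta> u] \<delta> sn_nonneg[of u] ab by (intro exI[of _ "- \<delta> * sn \<delta> u"]) auto
  qed
  \<comment> \<open>The derivative of sn^n is n cs V', and cs decreases, so beyond \<open>t\<close>
    the growth of sn^n is at most n cs t times that of V.\<close>
  have snV: "sn \<delta> s ^ n - sn \<delta> t ^ n \<le> real n * cs \<delta> t * (V s - V t)" if t: "0 \<le> t" "t \<le> s" for t
  proof -
    have "real n * cs \<delta> t * V t - sn \<delta> t ^ n \<le> real n * cs \<delta> t * V s - sn \<delta> s ^ n"
    proof (rule DERIV_nonneg_imp_nondecreasing[OF t(2)])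
      fix u assume u: "t \<le> u" "u \<le> s"
      have "((\<lambda>u. real n * cs \<delta> t * V u - sn \<delta> u ^ n) has_real_derivative real n * sn \<delta> u ^ (n - 1) * (cs \<delta> t - cs \<delta> u)) (at u)"
        using V(1)[of u] sn_deriv[of \<delta> u] by (auto intro!: derivative_eq_intros simp: algebra_simps)
      moreover have "real n * sn \<delta> u ^ (n - 1) * (cs \<delta> t - cs \<delta> u) \<ge> 0"
        using cs_mono[of t u] sn_nonneg[of u] u t by (intro mult_nonneg_nonneg) auto
      ultimately show "\<exists>y. ((\<lambda>u. real n * cs \<delta> t * V u - sn \<delta> u ^ n) has_real_derivative y) (at u) \<and> 0 \<le> y" by blast
    qed
    then show ?thesis by (simp add: algebra_simps)
  qed
  have kf1: "t * cs \<delta> t \<le> sn \<delta> t" if t: "0 \<le> t" "t \<le> s" for t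
  proof -
    have "sn \<delta> 0 - 0 * cs \<delta> 0 \<le> sn \<delta> t - t * cs \<delta> t"
    proof (rule DERIV_nonneg_imp_nondecreasing[OF t(1)])
      fix u assume u: "0 \<le> u" "u \<le> t"
      have "((\<lambda>t. sn \<delta> t - t * cs \<delta> t) has_real_derivative u * (\<delta> * sn \<delta> u)) (at u)"
        using sn_deriv[of \<delta> u] cs_deriv[of \<delta> u] by (auto intro!: derivative_eq_intros)
      moreover have "u * (\<delta> * sn \<delta> u) \<ge> 0" using \<delta> sn_nonneg[of u] u t by (intro mult_nonneg_nonneg) auto
      ultimately show "\<exists>y. ((\<lambda>t. sn \<delta> t - t * cs \<delta> t) has_real_derivative y) (at u) \<and> 0 \<le> y" by blast
    qed
    then show ?thesis by simp
  qed
  have snt: "sn \<delta> t \<le> t" if t: "0 \<le> t" "t \<le> s" for t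
  proof -
    have "0 - sn \<delta> 0 \<le> t - sn \<delta> t"
    proof (rule DERIV_nonneg_imp_nondecreasing[OF t(1)])
      fix u assume u: "0 \<le> u" "u \<le> t"
      have "((\<lambda>t. t - sn \<delta> t) has_real_derivative 1 - cs \<delta> u) (at u)"
        using sn_deriv[of \<delta> u] by (auto intro!: derivative_eq_intros)
      then show "\<exists>y. ((\<lambda>t. t - sn \<delta> t) has_real_derivative y) (at u) \<and> 0 \<le> y"
        using cs_mono[of 0 u] u t by (intro exI[of _ "1 - cs \<delta> u"]) simp
    qed
    then show ?thesis by simp
  qed
  have rs: "sn \<delta> r > 0" "sn \<delta> s > 0" "V r < V s" using sn_pos' V_mono[of r s] r by auto
  \<comment> \<open>The value of (V s - V t) / sn t ^ n at t = r, so that the constant piece joins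
    the outer one continuously.\<close>
  define k where "k = (V s - V r) / sn \<delta> r ^ n"
  define D where "D = real n * k * cs \<delta> r"
  have k: "k \<ge> 0" using rs by (simp add: k_def)
  define \<beta> where "\<beta> t = V s - V t" for t
  have d2: "(\<beta> has_real_derivative (- 1) * sn \<delta> t ^ (n - 1)) (at t)" for t
    unfolding \<beta>_def[abs_def] using V(1)[of t] by (auto intro!: derivative_eq_intros)
  have \<beta>: "\<beta> t \<ge> 0" if "0 \<le> t" "t \<le> s" for t
    using V_mono[of t s] that unfolding \<beta>_def by (cases "t = s") auto
  have ineq: "min D (sn \<delta> \<epsilon> / \<epsilon> * D) * G r \<le> 1 * (G s - G r)" if \<epsilon>: "0 < \<epsilon>" "\<epsilon> < r" "cs \<delta> \<epsilon> \<ge> 0" for \<epsilon>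
  proof (rule piecewise_inequality[OF \<epsilon>(1,2) r(2), where \<kappa>\<^sub>1 = "\<lambda>_. k" and \<kappa>\<^sub>1' = "\<lambda>_. 0" and \<kappa>\<^sub>2 = "quot \<beta>" and \<kappa>\<^sub>2' = "quot' \<beta> (- 1)"])
    show "(quot \<beta> has_real_derivative quot' \<beta> (- 1) t) (at t)" if "r \<le> t" "t \<le> s" for t
      by (rule quot_deriv[OF d2]) (use that \<epsilon> r in auto)
    show "continuous_on {r..s} (quot' \<beta> (- 1))" by (rule quot'_continuous[OF d2]) (use \<epsilon> r in auto)
    show "quot \<beta> t \<ge> 0" if "r \<le> t" "t \<le> s" for t
      using \<beta>[of t] sn_pos'[of t] that \<epsilon> r by (simp add: quot_def)
    show "quot' \<beta> (- 1) t \<le> 0" if t: "r \<le> t" "t \<le> s" for t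
    proof (rule quot'_nonpos)
      show "- 1 * sn \<delta> t ^ n \<le> real n * \<beta> t * cs \<delta> t"
        using snV[of t] t r zero_less_power[OF rs(2), of n] by (simp add: \<beta>_def mult.commute mult.left_commute)
    qed (use t r in auto)
    show "k = quot \<beta> r" by (simp add: quot_def \<beta>_def k_def)
    show "quot \<beta> s = 0" by (simp add: quot_def \<beta>_def)
    show "min D (sn \<delta> \<epsilon> / \<epsilon> * D) \<le> real n * k * cs \<delta> t + 0 * sn \<delta> t" if "\<epsilon> \<le> t" "t < r" for t
    proof -
      have "D \<le> real n * k * cs \<delta> t" unfolding D_def
        by (rule mult_left_mono[OF cs_mono]) (use that \<epsilon> r k in auto)
      then show ?thesis by simp
    qed
    show "- 1 \<le> real n * quot \<beta> t * cs \<delta> t + quot' \<beta> (- 1) t * sn \<delta> t" if "r \<le> t" "t < s" for t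
      using quot_identity[of t \<beta> "- 1"] that r by simp
    show "min D (sn \<delta> \<epsilon> / \<epsilon> * D) \<le> k * sn \<delta> \<epsilon> / \<epsilon> * (kf \<delta> t * (real n - x) + x)"
      if t: "0 \<le> t" "t < \<epsilon>" and x: "0 \<le> x" "x \<le> 1" for t x
    proof -
      have cst: "cs \<delta> t \<ge> 0" "cs \<delta> t \<ge> cs \<delta> r" using cs_mono[of t \<epsilon>] cs_mono[of t r] t \<epsilon> r by auto
      have kft: "kf \<delta> t \<ge> cs \<delta> t" "kf \<delta> t \<le> 1"
      proof -
        have "kf \<delta> t \<ge> cs \<delta> t \<and> kf \<delta> t \<le> 1"
        proof (cases "t = 0")
          case False
          then have p: "sn \<delta> t > 0" using sn_pos'[of t] t \<epsilon> r by simp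
          have "sn \<delta> t * cs \<delta> t \<le> t * cs \<delta> t" by (rule mult_right_mono) (use snt[of t] t \<epsilon> r cst in auto)
          then show ?thesis using p False kf1[of t] t \<epsilon> r by (simp add: kf_def field_simps)
        qed (simp add: kf_def)
        then show "kf \<delta> t \<ge> cs \<delta> t" "kf \<delta> t \<le> 1" by auto
      qed
      have "real n * cs \<delta> t \<le> real n * kf \<delta> t" by (rule mult_left_mono[OF kft(1)]) simp
      also have "\<dots> \<le> kf \<delta> t * (real n - x) + x"
        using mult_left_mono[OF kft(2) x(1)] by (simp add: algebra_simps)
      finally have lo: "real n * cs \<delta> t \<le> kf \<delta> t * (real n - x) + x" .
      have \<theta>: "k * (sn \<delta> \<epsilon> / \<epsilon>) \<ge> 0" using k sn_nonneg[of \<epsilon>] \<epsilon> r by simp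
      show ?thesis
      proof (cases "cs \<delta> r \<ge> 0")
        case True
        have "sn \<delta> \<epsilon> / \<epsilon> * D = k * (sn \<delta> \<epsilon> / \<epsilon>) * (real n * cs \<delta> r)" by (simp add: D_def)
        also have "\<dots> \<le> k * (sn \<delta> \<epsilon> / \<epsilon>) * (kf \<delta> t * (real n - x) + x)"
          by (rule mult_left_mono[OF order_trans[OF _ lo] \<theta>]) (use cst in \<open>simp add: mult_left_mono\<close>)
        finally show ?thesis by simp
      next
        case False
        have "D \<le> 0" unfolding D_def using False k by (simp add: mult_nonneg_nonpos)
        also have "0 \<le> k * (sn \<delta> \<epsilon> / \<epsilon>) * (kf \<delta> t * (real n - x) + x)"
          by (rule mult_nonneg_nonneg[OF \<theta> order_trans[OF _ lo]]) (use cst in simp)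
        finally show ?thesis by simp
      qed
    qed
  qed (use k in auto)
  have "D * G r \<le> 1 * (G s - G r)"
  proof (rule tendsto_upperbound)
    have "((\<lambda>\<epsilon>. sn \<delta> \<epsilon> / \<epsilon>) \<longlongrightarrow> 1) (at_right 0)"
      using sn_deriv[of \<delta> 0] by (simp add: DERIV_def filterlim_at_split)
    then have "((\<lambda>\<epsilon>. min D (sn \<delta> \<epsilon> / \<epsilon> * D) * G r) \<longlongrightarrow> min D (1 * D) * G r) (at_right 0)" by (intro tendsto_intros)
    then show "((\<lambda>\<epsilon>. min D (sn \<delta> \<epsilon> / \<epsilon> * D) * G r) \<longlongrightarrow> D * G r) (at_right 0)" by simp
    have "(cs \<delta> \<longlongrightarrow> 1) (at_right 0)"
      using DERIV_isCont[OF cs_deriv[of \<delta> 0]] by (simp add: isCont_def filterlim_at_split)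
    then have "\<forall>\<^sub>F \<epsilon> in at_right 0. cs \<delta> \<epsilon> > 0" by (rule order_tendstoD) simp
    moreover have "\<forall>\<^sub>F \<epsilon> in at_right 0. 0 < \<epsilon> \<and> \<epsilon> < r"
      unfolding eventually_at_right_field using r by blast
    ultimately show "\<forall>\<^sub>F \<epsilon> in at_right 0. min D (sn \<delta> \<epsilon> / \<epsilon> * D) * G r \<le> 1 * (G s - G r)"
      by eventually_elim (rule ineq, auto)
  qed simp
  moreover have "sn \<delta> s ^ n / sn \<delta> r ^ n * G r \<le> (1 + D) * G r"
  proof (rule mult_right_mono)
    have "(sn \<delta> s ^ n - sn \<delta> r ^ n) / sn \<delta> r ^ n \<le> real n * cs \<delta> r * (V s - V r) / sn \<delta> r ^ n"
      by (rule divide_right_mono[OF snV]) (use r rs in auto)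
    also have "\<dots> = D" by (simp add: D_def k_def)
    finally show "sn \<delta> s ^ n / sn \<delta> r ^ n \<le> 1 + D" using rs by (simp add: diff_divide_distrib)
  qed (simp add: G_def)
  ultimately have "sn \<delta> s ^ n / sn \<delta> r ^ n * G r \<le> G s" by (simp add: algebra_simps)
  then show ?thesis using rs by (simp add: field_simps)
qed

end

end

section \<open>Volumes of balls in the submanifold and conclusion\<close>

context min_sub begin

lemma KS_sets: assumes "s < R" shows "KS s \<in> sets S.borel_M" "emeasure Sh.vol (KS s) < \<infinity>"
proof -
  note K = KS_compact[OF assms]
  have sub: "KS s \<subseteq> carrier S" by (auto simp: KS_def SW_def)
  show "KS s \<in> sets S.borel_M"
    using borel_closed[OF compact_imp_closed[OF K]] sub by (auto simp: sets_restrict_space intro!: image_eqI[of _ _ "KS s"])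
  show "emeasure Sh.vol (KS s) < \<infinity>" by (rule Sh.vol_compact_finite[OF K sub])
qed

text \<open>On the compact set \<rho> \<le> s the volume is finite and the comparison radius is
  respected, so the restricted measure meets the one-variable hypotheses.\<close>

lemma radial:
  assumes s: "0 < s" "s < R" "\<delta> > 0 \<Longrightarrow> s < pi / sqrt \<delta>"
  shows "radial_ineq (restrict_space Sh.vol (KS s)) \<rho> \<sigma> \<delta> s CARD('n)"
proof (rule radial_ineq.intro)
  let ?K = "KS s" and ?\<mu> = "restrict_space Sh.vol (KS s)"
  note K = KS_compact[OF s(2)] and Ks = KS_sets[OF s(2)]
  have KSW: "?K \<subseteq> SW" by (auto simp: KS_def)
  have sp: "space ?\<mu> = ?K" using KSW by (auto simp: space_restrict_space SW_def)
  show "finite_measure ?\<mu>"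
  proof (rule finite_measureI)
    show "emeasure ?\<mu> (space ?\<mu>) \<noteq> \<infinity>"
      unfolding sp using Ks(2) emeasure_restrict_space[of ?K Sh.vol ?K] Ks(1) sp by (simp add: space_restrict_space Int_absorb2)
  qed
  have m: "F \<in> borel_measurable ?\<mu>" if "(\<lambda>q. indicator ?K q * F q) \<in> borel_measurable S.borel_M" for F :: "'b \<Rightarrow> real"
  proof -
    have "(\<lambda>q. indicator ?K q * F q) \<in> borel_measurable Sh.vol" using that by (simp cong: measurable_cong_sets)
    then have "(\<lambda>q. indicator ?K q * F q) \<in> borel_measurable ?\<mu>" by (rule measurable_restrict_space1)
    then show ?thesis by (subst (asm) measurable_cong[of _ _ F]) (auto simp: sp)
  qed
  show "\<rho> \<in> borel_measurable ?\<mu>"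
    by (rule m[OF measurable_on_compact[OF K KSW continuous_on_subset[OF continuous_\<rho> KSW]]])
  show "\<sigma> \<in> borel_measurable ?\<mu>" by (rule m[OF \<sigma>_measurable[OF K KSW]])
  show "0 \<le> \<rho> q \<and> \<rho> q \<le> s" "0 \<le> \<sigma> q \<and> \<sigma> q \<le> 1" if "q \<in> space ?\<mu>" for q
    using that \<rho>_nonneg \<sigma>_bounds unfolding sp by (auto simp: KS_def)
  fix \<phi> \<phi>' :: "real \<Rightarrow> real" and a \<epsilon> :: real
  assume A: "\<And>t. (\<phi> has_real_derivative \<phi>' t) (at t)" "continuous_on UNIV \<phi>'" "\<And>t. 0 \<le> \<phi> t" "0 < \<epsilon>"
    "\<And>t. t < \<epsilon> \<Longrightarrow> \<phi> t = a" "\<And>t. t \<le> \<epsilon> \<Longrightarrow> \<phi>' t = 0" "\<And>t. s \<le> t \<Longrightarrow> \<phi> t = 0"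
  have "KS s \<inter> space Sh.vol \<in> sets Sh.vol" using Ks(1) KSW by (simp add: Int_absorb2 KS_def SW_def)
  then show "(\<integral>q. \<phi> (\<rho> q) * (kf \<delta> (\<rho> q) * (real CARD('n) - \<sigma> q) + \<sigma> q) + \<phi>' (\<rho> q) * \<rho> q * \<sigma> q \<partial>?\<mu>) \<le> 0"
    using radial_inequality[OF s(2,3) A] by (simp add: integral_restrict_space)
qed (use s in \<open>auto simp: Suc_le_eq\<close>)

lemma ball_volume:
  assumes t: "0 < t" "t \<le> s" "s < R" and pi: "\<delta> > 0 \<Longrightarrow> s < pi / sqrt \<delta>"
  shows "emeasure Sh.vol {q \<in> carrier S. f q \<in> geodesic_ball M g p t}
    = ennreal (radial_ineq.G (restrict_space Sh.vol (KS s)) \<rho> t)"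
proof -
  let ?K = "KS s" and ?\<mu> = "restrict_space Sh.vol (KS s)"
  interpret r: radial_ineq ?\<mu> \<rho> \<sigma> \<delta> s "CARD('n)" by (rule radial[OF less_le_trans[OF t(1,2)] t(3) pi])
  have sub: "KS s \<subseteq> space Sh.vol" by (auto simp: KS_def SW_def)
  have Ks: "KS s \<inter> space Sh.vol \<in> sets Sh.vol" "emeasure Sh.vol (KS s) < \<infinity>"
    using KS_sets[OF t(3)] sub by (simp_all add: Int_absorb2)
  have sp: "space ?\<mu> = ?K" using sub by (auto simp: space_restrict_space)
  have eq: "{q \<in> carrier S. f q \<in> geodesic_ball M g p t} = {q \<in> space ?\<mu>. \<rho> q < t}"
  proof -
    have "t < R" using t by simp
    then show ?thesis unfolding geodesic_ball_eq[OF t(1) \<open>t < R\<close>] sp using t(2) by (auto simp: KS_def SW_def \<rho>_def)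
  qed
  have "emeasure Sh.vol {q \<in> space ?\<mu>. \<rho> q < t} = emeasure ?\<mu> {q \<in> space ?\<mu>. \<rho> q < t}"
    by (rule emeasure_restrict_space[OF Ks(1), symmetric]) (use sp in auto)
  also have "\<dots> = ennreal (measure ?\<mu> {q \<in> space ?\<mu>. \<rho> q < t})"
  proof (rule emeasure_eq_ennreal_measure)
    have "emeasure ?\<mu> {q \<in> space ?\<mu>. \<rho> q < t} \<le> emeasure ?\<mu> (space ?\<mu>)" by (rule emeasure_space)
    also have "\<dots> = emeasure Sh.vol (KS s)" unfolding sp by (rule emeasure_restrict_space[OF Ks(1)]) simp
    finally show "emeasure ?\<mu> {q \<in> space ?\<mu>. \<rho> q < t} \<noteq> top" using Ks(2) by (auto simp: top_unique)
  qed
  finally show ?thesis unfolding eq r.G_def .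
qed

end

text \<open>Some member of the set whose supremum is the injectivity radius exceeds
  \<open>s\<close>. The strict gap is what later makes the sublevel set \<rho> \<le> s
  compact.\<close>

lemma injectivity_radius_less:
  assumes "ereal s < injectivity_radius M g p"
  obtains R where "s < R" "0 < R" "openin (top_of_set (carrier M)) (exp_map M g p ` {v. sqrt (g p v v) < R})"
    "diffeomorphism (euclidean_manifold {v. sqrt (g p v v) < R})
       (open_submanifold M (exp_map M g p ` {v. sqrt (g p v v) < R})) (exp_map M g p)"
  using assms unfolding injectivity_radius_def less_Sup_iff Let_def by auto

text \<open>Both model functions are a positive constant times \<open>V\<close> or a power of
  \<open>sn \<delta>\<close>, and the constant cancels. All volumes involved are finite, so the
  inequality in \<open>ennreal\<close> reduces to one between reals.\<close>

lemma volume_ratio_mono: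
  fixes M :: "('a::{t2_space, second_countable_topology}, real^'m) manifold"
    and S :: "('b::{t2_space, second_countable_topology}, real^'n) manifold"
  assumes "smooth_manifold M" "riemannian_metric M g" "complete_metric M g" "sectional_curvature_le M g \<delta>"
    and "smooth_manifold S" "proper_immersion S M f" "minimal_immersion S M g f" "p \<in> carrier M"
    and r: "0 < r" "r \<le> s" and s: "ereal s < injectivity_radius M g p" "\<delta> > 0 \<Longrightarrow> s < pi / sqrt \<delta>"
  defines "vol t \<equiv> emeasure (riemannian_measure S (induced_metric S M g f)) {q \<in> carrier S. f q \<in> geodesic_ball M g p t}"
  shows "\<delta> \<le> 0 \<Longrightarrow> vol r / ennreal (V_model CARD('n) \<delta> r) \<le> vol s / ennreal (V_model CARD('n) \<delta> s)"
    and "\<delta> > 0 \<Longrightarrow> vol r / ennreal (A_model CARD('n) \<delta> r) \<le> vol s / ennreal (A_model CARD('n) \<delta> s)"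
proof -
  obtain R where R': "s < R" "0 < R" "openin (top_of_set (carrier M)) (exp_map M g p ` {v. sqrt (g p v v) < R})"
    "diffeomorphism (euclidean_manifold {v. sqrt (g p v v) < R})
       (open_submanifold M (exp_map M g p ` {v. sqrt (g p v v) < R})) (exp_map M g p)"
    by (rule injectivity_radius_less[OF s(1)])
  interpret min_sub M g p R \<delta> S f
    by unfold_locales (use assms(1-8) R' in \<open>auto simp: proper_immersion_def minimal_immersion_def\<close>)
  have s0: "0 < s" using r by simp
  interpret radial_ineq "restrict_space Sh.vol (KS s)" \<rho> \<sigma> \<delta> s "CARD('n)" by (rule radial[OF s0 R'(1) s(2)])
  have vol: "vol t = ennreal (G t)" if "0 < t" "t \<le> s" for t unfolding vol_def by (rule ball_volume[OF that R'(1) s(2)])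
  have G: "G t \<ge> 0" for t by (simp add: G_def)
  obtain V where V: "\<And>t. (V has_real_derivative sn \<delta> t ^ (CARD('n) - 1)) (at t)" "V 0 = 0"
    "\<And>t. 0 \<le> t \<Longrightarrow> integral {0..t} (\<lambda>t. sn \<delta> t ^ (CARD('n) - 1)) = V t"
    by (rule volume_function) blast
  have div: "vol t / ennreal (c * x) = ennreal (G t / x / c)" if "0 < t" "t \<le> s" "x > 0" "c > 0" for t x c :: real
    unfolding vol[OF that(1,2)] using that G[of t] by (simp add: divide_ennreal field_simps)
  have le: "vol r / ennreal (c * F r) \<le> vol s / ennreal (c * F s)"
    if "r < s \<Longrightarrow> G r / F r \<le> G s / F s" "c > 0" "\<And>t. 0 < t \<Longrightarrow> t \<le> s \<Longrightarrow> F t > 0" for c and F :: "real \<Rightarrow> real"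
  proof (cases "r = s")
    case False
    then have "G r / F r / c \<le> G s / F s / c" using that(1,2) r by (intro divide_right_mono) auto
    then show ?thesis using div[OF r that(3)[OF r] that(2)] div[OF s0 order_refl that(3)[OF s0 order_refl] that(2)]
      by (simp add: ennreal_leI)
  qed simp
  show "vol r / ennreal (V_model CARD('n) \<delta> r) \<le> vol s / ennreal (V_model CARD('n) \<delta> s)" if "\<delta> \<le> 0"
  proof -
    have Vm: "V_model CARD('n) \<delta> t = real CARD('n) * unit_ball_vol (real CARD('n)) * V t" if "0 \<le> t" for t
      unfolding V_model_def V(3)[OF that] ..
    show ?thesis unfolding Vm[OF less_imp_le[OF r(1)]] Vm[OF less_imp_le[OF s0]]
    proof (rule le)
      show "G r / V r \<le> G s / V s" if "r < s" by (rule monotone_nonpos[OF V(1,2) \<open>\<delta> \<le> 0\<close> r(1) that])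
      show "V t > 0" if "0 < t" "t \<le> s" for t using V_mono[OF V(1,2), of 0 t] that V(2) by simp
    qed simp
  qed
  show "vol r / ennreal (A_model CARD('n) \<delta> r) \<le> vol s / ennreal (A_model CARD('n) \<delta> s)" if "\<delta> > 0"
    unfolding A_model_def
  proof (rule le)
    show "G r / sn \<delta> r ^ CARD('n) \<le> G s / sn \<delta> s ^ CARD('n)" if "r < s"
      by (rule monotone_pos[OF V(1,2) \<open>\<delta> > 0\<close> r(1) that])
    show "sn \<delta> t ^ CARD('n) > 0" if "0 < t" "t \<le> s" for t using sn_pos'[OF that] by simp
  qed simp
qed

theorem proposition2p3:
  fixes M :: "('a::{t2_space, second_countable_topology}, real^'m) manifold"
    and g :: "'a \<Rightarrow> real^'m \<Rightarrow> real^'m \<Rightarrow> real"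
    and S :: "('b::{t2_space, second_countable_topology}, real^'n) manifold"
    and f :: "'b \<Rightarrow> 'a"
    and \<delta> :: real
    and p :: 'a
  assumes "smooth_manifold M" and "riemannian_metric M g" and "complete_metric M g"
    and "sectional_curvature_le M g \<delta>"
    and "smooth_manifold S" and "proper_immersion S M f" and "minimal_immersion S M g f"
    and "p \<in> carrier M"
  shows "(\<delta> \<le> 0 \<longrightarrow>
            mono_on {r. 0 < r \<and> ereal r < injectivity_radius M g p}
              (\<lambda>r. emeasure (riemannian_measure S (induced_metric S M g f))
                     {q \<in> carrier S. f q \<in> geodesic_ball M g p r}
                   / ennreal (V_model CARD('n) \<delta> r))) \<and>
         (\<delta> > 0 \<longrightarrow>
            mono_on {r. 0 < r \<and> ereal r < min (injectivity_radius M g p) (ereal (pi / sqrt \<delta>))}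
              (\<lambda>r. emeasure (riemannian_measure S (induced_metric S M g f))
                     {q \<in> carrier S. f q \<in> geodesic_ball M g p r}
                   / ennreal (A_model CARD('n) \<delta> r)))"
  by (intro conjI impI mono_onI volume_ratio_mono[OF assms]) auto

end
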